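(* Let $\kappa\in\{1,-1\}$. The space $N(\kappa)$ is isometric to the extrinsic symmetric space $$M:=\{(p,q_1q_2,q)\mid p=(p_1,p_2),\ q=(q_1,q_2)\in\mathbb R^2\}\subset\mathbb R^2\oplus\mathbb R\oplus\mathbb R^2=\mathbb R^5,$$ where the scalar product $\langle\cdot,\cdot\rangle$ on $\mathbb R^5$ with coordinates $p_1,p_2,x,q_1,q_2$ is given by $-2(dp_1dq_1+dp_2dq_2)-\kappa\,dx^2$. The extrinsic transvection group of $M$ is the subgroup of the group of affine isometries of $(\mathbb R^5,\langle\cdot,\cdot\rangle)$ consisting of the matrices $$\left(\begin{array}{ccc|c} I & \kappa X & -\frac\kappa2XX^\top+Y & Z \\ 0 & 1 & -X^\top & x_1x_2 \\ 0 & 0 & I & \bar X \end{array}\right),$$ where $X,Z\in\mathbb R^2$, $X=\begin{pmatrix} x_1 \\ x_2 \end{pmatrix}$, $\bar X=\begin{pmatrix} -x_2 \\ -x_1 \end{pmatrix}$, $Y=\begin{pmatrix} 0 & -y \\ y & 0 \end{pmatrix}$, $y\in\mathbb R$. It is isomorphic to the (ordinary) transvection group $\hat G$ of $N(\kappa)$. The group of all extrinsic isometries of $M$ is equal to $\hat G\rtimes(\mathrm O(1,1)\times\mathbb Z_2)$, where $\mathrm O(1,1)$ is understood as $\{\mathrm{diag}((S^{-1})^\top,1,S)\mid S\in\mathrm O(1,1)\}\subset\mathrm{SO}(\mathbb R^2\oplus\mathbb R\oplus\mathbb R^2,\langle\cdot,\cdot\rangle)$, and $\mathbb Z_2$ is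 generated by $\mathrm{diag}(1,-1,-1,1,-1)\in\mathrm O(\mathbb R^5)$.
   Context: Here $\mathrm O(1,1)$ denotes the group of linear maps $S$ of $\mathbb R^2$ preserving the quadratic form $q\mapsto q_1q_2$ (which, up to a factor and a change of basis, is the standard Lorentz form on $\mathbb R^2$), and $\hat G$ is regarded as the extrinsic transvection group when describing the extrinsic isometries. $N(\kappa)$ is the simply-connected pseudo-Riemannian symmetric space $\tilde G/\tilde G_+$ defined by: the Lie algebra $\hat{\mathfrak g}$ with basis $\sigma^1,\sigma^2,a_0,e_1,e_2$ and non-vanishing brackets $[e_1,e_2]=a_0$, $[e_1,a_0]=-\kappa\sigma^2$, $[e_2,a_0]=\kappa\sigma^1$ (up to antisymmetry); the inner product with $\langle\sigma^i,e_j\rangle=\delta_{ij}$, $\langle a_0,a_0\rangle=\kappa$, all other products of basis vectors zero; the involution $\theta$ that is $-1$ on $\sigma^i,e_i$ and $+1$ on $a_0$; $\tilde G$ the simply-connected Lie group with Lie algebra $\hat{\mathfrak g}$, $\tilde G_+$ the connected subgroup with Lie algebra $\mathbb Ra_0$, and the $\tilde G$-invariant metric given at the base point by the restriction of $\langle\cdot,\cdot\rangle$ to the $(-1)$-eigenspace of $\theta$. The (ordinary) transvection group of a symmetric space is the subgroup of its isometry group generated by all compositions of two point symmetries. Extrinsic symmetric: Let $(V,\langle\cdot,\cdot\rangle)$ be a pseudo-Euclidean vector space and $M\hookrightarrow V$ a submanifold such that $\langle\cdot,\cdot\rangle$ is non-degenerate on each tangent space $T_xM\subset V$. For $x\in M$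 let $\mathcal N_xM\subset V$ be the affine normal space at $x$ and $s_x:V\to V$ the affine map with $ds_x|_{T_xM}=-\mathrm{id}$, $s_x|_{\mathcal N_xM}=\mathrm{id}$. $M$ is extrinsic symmetric if $s_x(M)=M$ for all $x\in M$; it carries the induced metric. Its extrinsic transvection group is the group generated by all compositions $s_x\circ s_y$, $x,y\in M$. An extrinsic isometry of $M$ is an affine isometry of $V$ that maps $M$ to itself. An augmented matrix $(A\,|\,b)$ denotes the affine map $w\mapsto Aw+b$, in block form with respect to $\mathbb R^2\oplus\mathbb R\oplus\mathbb R^2$.
   Formalization: The direct product O(1,1) × Z_2 is replaced by an internal semidirect product of the same two subgroups, with O(1,1) normal, because diag(1,-1,-1,1,-1) does not commute with the coordinate swap in O(1,1), so the direct product claim is false as stated. *)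

theory Defs
  imports "HOL-Analysis.Analysis" "HOL-Algebra.Bij" "HOL-Algebra.Generated_Groups"
begin

section \<open>Smooth manifolds embedded in Euclidean spaces\<close>

text \<open>Manifolds are taken as embedded submanifolds of an arbitrary Euclidean space; by Whitney's
  theorem this is no restriction (Hausdorff, second countable).\<close>

text \<open>On open sets \<open>U\<close>, and for Euclidean domain, \<open>Ck_on k f U\<close> is \<open>C\<^sup>k\<close>: the directional
  derivatives determine the Frechet derivative.\<close>

primrec Ck_on :: "nat \<Rightarrow> ('a::real_normed_vector \<Rightarrow> 'b::real_normed_vector) \<Rightarrow> 'a set \<Rightarrow> bool" where
  "Ck_on 0 f U \<longleftrightarrow> continuous_on U f"
| "Ck_on (Suc k) f U \<longleftrightarrow> (\<forall>x\<in>U. f differentiable (at x)) \<and>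
     (\<forall>v. Ck_on k (\<lambda>x. frechet_derivative f (at x) v) U)"

definition Cinf_on :: "('a::real_normed_vector \<Rightarrow> 'b::real_normed_vector) \<Rightarrow> 'a set \<Rightarrow> bool" where
  "Cinf_on f U \<longleftrightarrow> (\<forall>k. Ck_on k f U)"

definition smooth_on :: "'a::real_normed_vector set \<Rightarrow> ('a \<Rightarrow> 'b::real_normed_vector) \<Rightarrow> bool" where
  "smooth_on S f \<longleftrightarrow>
     (\<forall>x\<in>S. \<exists>U h. open U \<and> x \<in> U \<and> Cinf_on h U \<and> (\<forall>y\<in>U \<inter> S. f y = h y))"

definition submanifold :: "nat \<Rightarrow> 'a::euclidean_space set \<Rightarrow> bool" where
  "submanifold k S \<longleftrightarrow>
     (\<forall>x\<in>S. \<exists>U V \<phi> \<psi> L. open U \<and> x \<in> U \<and> open V \<and> homeomorphism U V \<phi> \<psi> \<and>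
        Cinf_on \<phi> U \<and> Cinf_on \<psi> V \<and> subspace (L :: 'a set) \<and> dim L = k \<and> \<phi> ` (U \<inter> S) = V \<inter> L)"

definition tangent_space :: "'a::real_normed_vector set \<Rightarrow> 'a \<Rightarrow> 'a set" where
  "tangent_space S x = {v. \<exists>c e. 0 < e \<and> Cinf_on c {-e<..<e} \<and> c ` {-e<..<e} \<subseteq> S \<and> c 0 = x \<and>
     (c has_vector_derivative v) (at (0::real))}"

text \<open>The derivative within \<open>S\<close> picks some linear map on the ambient space, but for smooth \<open>f\<close> its
  values on vectors of \<^term>\<open>tangent_space S x\<close> are uniquely determined. It is only ever
  evaluated on such vectors.\<close>

abbreviation differential ::
    "'a::real_normed_vector set \<Rightarrow> ('a \<Rightarrow> 'b::real_normed_vector) \<Rightarrow> 'a \<Rightarrow> 'a \<Rightarrow> 'b" where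
  "differential S f x \<equiv> frechet_derivative f (at x within S)"


section \<open>Lie groups and homogeneous spaces\<close>

definition lie_group :: "'a::euclidean_space monoid \<Rightarrow> bool" where
  "lie_group G \<longleftrightarrow> group G \<and> (\<exists>k. submanifold k (carrier G)) \<and>
     smooth_on (carrier G \<times> carrier G) (\<lambda>(a, b). a \<otimes>\<^bsub>G\<^esub> b) \<and> smooth_on (carrier G) (m_inv G)"

definition left_invariant_field :: "'a::euclidean_space monoid \<Rightarrow> 'a \<Rightarrow> 'a \<Rightarrow> 'a" where
  "left_invariant_field G v a = differential (carrier G) (\<lambda>b. a \<otimes>\<^bsub>G\<^esub> b) \<one>\<^bsub>G\<^esub> v"

definition field_bracket ::
    "'a::real_normed_vector set \<Rightarrow> ('a \<Rightarrow> 'a) \<Rightarrow> ('a \<Rightarrow> 'a) \<Rightarrow> 'a \<Rightarrow> 'a" where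
  "field_bracket S X Y x = differential S Y x (X x) - differential S X x (Y x)"

definition lie_bracket :: "'a::euclidean_space monoid \<Rightarrow> 'a \<Rightarrow> 'a \<Rightarrow> 'a" where
  "lie_bracket G v w =
     field_bracket (carrier G) (left_invariant_field G v) (left_invariant_field G w) \<one>\<^bsub>G\<^esub>"

definition connected_lie_subgroup :: "'a::euclidean_space set \<Rightarrow> 'a monoid \<Rightarrow> 'a set \<Rightarrow> bool" where
  "connected_lie_subgroup H G \<h> \<longleftrightarrow> subgroup H G \<and> (\<exists>k. submanifold k H) \<and> connected H \<and>
     tangent_space H \<one>\<^bsub>G\<^esub> = \<h>"

text \<open>\<open>N\<close> is the quotient manifold \<open>G/H\<close> of left cosets, with projection \<open>\<pi>\<close>: a surjective submersion
  whose fibres are the cosets determines the manifold structure of the quotient.\<close>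

definition homogeneous_space ::
    "'a::euclidean_space monoid \<Rightarrow> 'a set \<Rightarrow> 'n::euclidean_space set \<Rightarrow> ('a \<Rightarrow> 'n) \<Rightarrow> bool" where
  "homogeneous_space G H N \<pi> \<longleftrightarrow> (\<exists>k. submanifold k N) \<and>
     smooth_on (carrier G) \<pi> \<and> \<pi> ` carrier G = N \<and>
     (\<forall>a\<in>carrier G. \<forall>b\<in>carrier G. \<pi> a = \<pi> b \<longleftrightarrow> a <#\<^bsub>G\<^esub> H = b <#\<^bsub>G\<^esub> H) \<and>
     (\<forall>a\<in>carrier G.
        differential (carrier G) \<pi> a ` tangent_space (carrier G) a = tangent_space N (\<pi> a))"

definition translation :: "'a monoid \<Rightarrow> ('a \<Rightarrow> 'n) \<Rightarrow> 'a \<Rightarrow> 'n \<Rightarrow> 'n" where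
  "translation G \<pi> a x = \<pi> (a \<otimes>\<^bsub>G\<^esub> inv_into (carrier G) \<pi> x)"


section \<open>Pseudo-Riemannian manifolds and transvections\<close>

definition nondegenerate_on :: "'a::real_vector set \<Rightarrow> ('a \<Rightarrow> 'a \<Rightarrow> real) \<Rightarrow> bool" where
  "nondegenerate_on T \<beta> \<longleftrightarrow> (\<forall>u\<in>T. (\<forall>v\<in>T. \<beta> u v = 0) \<longrightarrow> u = 0)"

definition scalar_product_on :: "'a::real_vector set \<Rightarrow> ('a \<Rightarrow> 'a \<Rightarrow> real) \<Rightarrow> bool" where
  "scalar_product_on T \<beta> \<longleftrightarrow>
     (\<forall>u\<in>T. \<forall>v\<in>T. \<beta> u v = \<beta> v u) \<and>
     (\<forall>u\<in>T. \<forall>v\<in>T. \<forall>w\<in>T. \<beta> (u + v) w = \<beta> u w + \<beta> v w) \<and>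
     (\<forall>c. \<forall>u\<in>T. \<forall>v\<in>T. \<beta> (c *\<^sub>R u) v = c * \<beta> u v) \<and>
     nondegenerate_on T \<beta>"

definition pseudo_riemannian_metric ::
    "'n::euclidean_space set \<Rightarrow> ('n \<Rightarrow> 'n \<Rightarrow> 'n \<Rightarrow> real) \<Rightarrow> bool" where
  "pseudo_riemannian_metric N g \<longleftrightarrow>
     (\<forall>x\<in>N. scalar_product_on (tangent_space N x) (g x)) \<and>
     (\<forall>X Y. smooth_on N X \<and> smooth_on N Y \<and>
        (\<forall>x\<in>N. X x \<in> tangent_space N x \<and> Y x \<in> tangent_space N x) \<longrightarrow>
        smooth_on N (\<lambda>x. g x (X x) (Y x)))"

definition isometry ::
    "'n::euclidean_space set \<Rightarrow> ('n \<Rightarrow> 'n \<Rightarrow> 'n \<Rightarrow> real) \<Rightarrow>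
     'm::euclidean_space set \<Rightarrow> ('m \<Rightarrow> 'm \<Rightarrow> 'm \<Rightarrow> real) \<Rightarrow> ('n \<Rightarrow> 'm) \<Rightarrow> bool" where
  "isometry N g M h f \<longleftrightarrow>
     bij_betw f N M \<and> smooth_on N f \<and> smooth_on M (inv_into N f) \<and>
     (\<forall>x\<in>N. \<forall>u\<in>tangent_space N x. \<forall>v\<in>tangent_space N x.
        h (f x) (differential N f x u) (differential N f x v) = g x u v)"

definition isometry_group ::
    "'n::euclidean_space set \<Rightarrow> ('n \<Rightarrow> 'n \<Rightarrow> 'n \<Rightarrow> real) \<Rightarrow> ('n \<Rightarrow> 'n) monoid" where
  "isometry_group N g = BijGroup N \<lparr>carrier := {f \<in> extensional N. isometry N g N g f}\<rparr>"

definition point_symmetry ::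
    "'n::euclidean_space set \<Rightarrow> ('n \<Rightarrow> 'n \<Rightarrow> 'n \<Rightarrow> real) \<Rightarrow> 'n \<Rightarrow> ('n \<Rightarrow> 'n) \<Rightarrow> bool" where
  "point_symmetry N g x s \<longleftrightarrow> s \<in> carrier (isometry_group N g) \<and> s x = x \<and>
     (\<forall>v\<in>tangent_space N x. differential N s x v = - v)"

definition transvection_group ::
    "'n::euclidean_space set \<Rightarrow> ('n \<Rightarrow> 'n \<Rightarrow> 'n \<Rightarrow> real) \<Rightarrow> ('n \<Rightarrow> 'n) monoid" where
  "transvection_group N g = isometry_group N g \<lparr>carrier := generate (isometry_group N g)
     {s \<otimes>\<^bsub>isometry_group N g\<^esub> t | s t. (\<exists>x\<in>N. point_symmetry N g x s) \<and>
                                     (\<exists>y\<in>N. point_symmetry N g y t)}\<rparr>"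

text \<open>For transformation groups, carrying the topology of pointwise convergence (the product topology
  on functions). Between Lie groups, topological and smooth isomorphisms coincide.\<close>

definition topological_group_isomorphic ::
    "'a::topological_space monoid \<Rightarrow> 'b::topological_space monoid \<Rightarrow> bool" where
  "topological_group_isomorphic A B \<longleftrightarrow>
     (\<exists>h k. h \<in> iso A B \<and> homeomorphism (carrier A) (carrier B) h k)"


section \<open>Extrinsic symmetric spaces\<close>

definition normal_space :: "('v::real_normed_vector \<Rightarrow> 'v \<Rightarrow> real) \<Rightarrow> 'v set \<Rightarrow> 'v \<Rightarrow> 'v set" where
  "normal_space \<beta> M x = {x + n | n. \<forall>v\<in>tangent_space M x. \<beta> n v = 0}"

definition extrinsic_reflection ::
    "('v::real_normed_vector \<Rightarrow> 'v \<Rightarrow> real) \<Rightarrow> 'v set \<Rightarrow> 'v \<Rightarrow> 'v \<Rightarrow> 'v" where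
  "extrinsic_reflection \<beta> M x =
     (THE s. (\<exists>A b. linear A \<and> s = (\<lambda>w. A w + b) \<and> (\<forall>v\<in>tangent_space M x. A v = - v)) \<and>
             (\<forall>w\<in>normal_space \<beta> M x. s w = w))"

definition extrinsic_symmetric :: "('v::euclidean_space \<Rightarrow> 'v \<Rightarrow> real) \<Rightarrow> 'v set \<Rightarrow> bool" where
  "extrinsic_symmetric \<beta> M \<longleftrightarrow>
     scalar_product_on UNIV \<beta> \<and> (\<exists>k. submanifold k M) \<and>
     (\<forall>x\<in>M. nondegenerate_on (tangent_space M x) \<beta>) \<and>
     (\<forall>x\<in>M. extrinsic_reflection \<beta> M x ` M = M)"

definition linear_isometries :: "('v::real_vector \<Rightarrow> 'v \<Rightarrow> real) \<Rightarrow> ('v \<Rightarrow> 'v) set" where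
  "linear_isometries \<beta> = {A. linear A \<and> bij A \<and> (\<forall>u v. \<beta> (A u) (A v) = \<beta> u v)}"

definition affine_isometry_group :: "('v::real_vector \<Rightarrow> 'v \<Rightarrow> real) \<Rightarrow> ('v \<Rightarrow> 'v) monoid" where
  "affine_isometry_group \<beta> =
     BijGroup UNIV \<lparr>carrier := {(\<lambda>w. A w + b) | A b. A \<in> linear_isometries \<beta>}\<rparr>"

definition extrinsic_transvection_group ::
    "('v::euclidean_space \<Rightarrow> 'v \<Rightarrow> real) \<Rightarrow> 'v set \<Rightarrow> ('v \<Rightarrow> 'v) monoid" where
  "extrinsic_transvection_group \<beta> M = BijGroup UNIV \<lparr>carrier := generate (BijGroup UNIV)
     {extrinsic_reflection \<beta> M x \<circ> extrinsic_reflection \<beta> M y | x y. x \<in> M \<and> y \<in> M}\<rparr>"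

definition extrinsic_isometry_group ::
    "('v::euclidean_space \<Rightarrow> 'v \<Rightarrow> real) \<Rightarrow> 'v set \<Rightarrow> ('v \<Rightarrow> 'v) monoid" where
  "extrinsic_isometry_group \<beta> M =
     BijGroup UNIV \<lparr>carrier := {F \<in> carrier (affine_isometry_group \<beta>). F ` M = M}\<rparr>"

definition internal_semidirect :: "'a monoid \<Rightarrow> 'a set \<Rightarrow> 'a set \<Rightarrow> bool" where
  "internal_semidirect E A K \<longleftrightarrow>
     A \<lhd> E \<and> subgroup K E \<and> A \<inter> K = {\<one>\<^bsub>E\<^esub>} \<and> A <#>\<^bsub>E\<^esub> K = carrier E"


section \<open>The symmetric space \<open>N(\<kappa>)\<close>\<close>

text \<open>The triple \<open>(s, a, e)\<close> stands for
  \<open>s\<^sub>1 \<sigma>\<^sup>1 + s\<^sub>2 \<sigma>\<^sup>2 + a a\<^sub>0 + e\<^sub>1 e\<^sub>1 + e\<^sub>2 e\<^sub>2\<close>.\<close>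

type_synonym ghat = "(real^2) \<times> real \<times> (real^2)"

definition ghat_bracket :: "real \<Rightarrow> ghat \<Rightarrow> ghat \<Rightarrow> ghat" where
  "ghat_bracket \<kappa> = (\<lambda>(s, a, e) (s', a', e').
     (vector [\<kappa> * (e$2 * a' - a * e'$2), - \<kappa> * (e$1 * a' - a * e'$1)],
      e$1 * e'$2 - e$2 * e'$1,
      0))"

definition ghat_inner :: "real \<Rightarrow> ghat \<Rightarrow> ghat \<Rightarrow> real" where
  "ghat_inner \<kappa> = (\<lambda>(s, a, e) (s', a', e'). s \<bullet> e' + e \<bullet> s' + \<kappa> * a * a')"

definition theta :: "ghat \<Rightarrow> ghat" where
  "theta = (\<lambda>(s, a, e). (- s, a, - e))"

text \<open>\<open>\<psi>\<close> identifies \<open>\<gg>\<close> with the Lie algebra of \<open>G\<close>, \<open>N\<close> with projection \<open>\<pi>\<close> is the quotient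
  \<open>G/H\<close>. The simply connected Lie group with given Lie algebra is only determined up to isomorphism,
  hence a predicate, satisfied by all realisations.\<close>

definition N_space ::
    "real \<Rightarrow> 'a::euclidean_space monoid \<Rightarrow> (ghat \<Rightarrow> 'a) \<Rightarrow> 'a set \<Rightarrow>
     'n::euclidean_space set \<Rightarrow> ('a \<Rightarrow> 'n) \<Rightarrow> ('n \<Rightarrow> 'n \<Rightarrow> 'n \<Rightarrow> real) \<Rightarrow> bool" where
  "N_space \<kappa> G \<psi> H N \<pi> g \<longleftrightarrow>
     lie_group G \<and> simply_connected (carrier G) \<and>
     linear \<psi> \<and> bij_betw \<psi> UNIV (tangent_space (carrier G) \<one>\<^bsub>G\<^esub>) \<and>
     (\<forall>\<xi> \<eta>. lie_bracket G (\<psi> \<xi>) (\<psi> \<eta>) = \<psi> (ghat_bracket \<kappa> \<xi> \<eta>)) \<and>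
     connected_lie_subgroup H G (\<psi> ` {(0, a, 0) | a. True}) \<and>
     homogeneous_space G H N \<pi> \<and>
     pseudo_riemannian_metric N g \<and>
     (\<forall>a\<in>carrier G. isometry N g N g (translation G \<pi> a)) \<and>
     (\<forall>\<xi> \<eta>. theta \<xi> = - \<xi> \<and> theta \<eta> = - \<eta> \<longrightarrow>
        g (\<pi> \<one>\<^bsub>G\<^esub>) (differential (carrier G) \<pi> \<one>\<^bsub>G\<^esub> (\<psi> \<xi>)) (differential (carrier G) \<pi> \<one>\<^bsub>G\<^esub> (\<psi> \<eta>))
          = ghat_inner \<kappa> \<xi> \<eta>)"


section \<open>The submanifold \<open>M\<close> and its extrinsic isometries\<close>

text \<open>\<open>\<real>\<^sup>5 = \<real>\<^sup>2 \<oplus> \<real> \<oplus> \<real>\<^sup>2\<close> with elements \<open>(p, x, q)\<close>.\<close>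

type_synonym R5 = "(real^2) \<times> real \<times> (real^2)"

text \<open>The polarisation of the quadratic form \<open>- 2 (p\<^sub>1 q\<^sub>1 + p\<^sub>2 q\<^sub>2) - \<kappa> x\<^sup>2\<close>.\<close>

definition form5 :: "real \<Rightarrow> R5 \<Rightarrow> R5 \<Rightarrow> real" where
  "form5 \<kappa> = (\<lambda>(p, x, q) (p', x', q'). - (p \<bullet> q' + q \<bullet> p') - \<kappa> * x * x')"

definition M5 :: "R5 set" where
  "M5 = {(p, q$1 * q$2, q) | p q. True}"

definition transvection5 :: "real \<Rightarrow> real^2 \<Rightarrow> real^2 \<Rightarrow> real \<Rightarrow> R5 \<Rightarrow> R5" where
  "transvection5 \<kappa> X Z y =
     (let XXt = (\<chi> i j. X$i * X$j) :: real^2^2;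
          Y = vector [vector [0, - y], vector [y, 0]] :: real^2^2;
          Xbar = vector [- X$2, - X$1] :: real^2
      in (\<lambda>(p, x, q).
           (p + x *\<^sub>R (\<kappa> *\<^sub>R X) + ((- \<kappa> / 2) *\<^sub>R XXt + Y) *v q + Z,
            x + (- X) \<bullet> q + X$1 * X$2,
            q + Xbar)))"

definition O11 :: "(real^2^2) set" where
  "O11 = {S. \<forall>q. (S *v q)$1 * (S *v q)$2 = q$1 * q$2}"

definition O11_diag :: "real^2^2 \<Rightarrow> R5 \<Rightarrow> R5" where
  "O11_diag S = (\<lambda>(p, x, q). (transpose (matrix_inv S) *v p, x, S *v q))"

definition Z2_gen :: "R5 \<Rightarrow> R5" where
  "Z2_gen = (\<lambda>(p, x, q). (vector [p$1, - p$2], - x, vector [q$1, - q$2]))"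

definition coords5 :: "R5 \<Rightarrow> real^5" where
  "coords5 = (\<lambda>(p, x, q). vector [p$1, p$2, x, q$1, q$2])"

definition SO5 :: "real \<Rightarrow> (R5 \<Rightarrow> R5) set" where
  "SO5 \<kappa> = {A \<in> linear_isometries (form5 \<kappa>).
     det (matrix (coords5 \<circ> A \<circ> inv_into UNIV coords5)) = 1}"


section \<open>Realisations of \<open>N(\<kappa>)\<close> exist\<close>

text \<open>The model group is \<open>\<real>\<^sup>5\<close> with coordinates \<open>(Z, y, X)\<close> and the composition law of the maps
  \<open>transvection5 \<kappa> X Z y\<close>, see \<open>transvection5_comp\<close>; the quotient is \<open>\<real>\<^sup>4\<close> with coordinates \<open>(Z, X)\<close>.\<close>

lemma Ck_on_cong:
  assumes "open U" "\<And>x. x \<in> U \<Longrightarrow> f x = h x" "Ck_on k f U"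
  shows "Ck_on k h U"
  using assms(2,3)
proof (induction k arbitrary: f h)
  case 0 then show ?case by (simp cong: continuous_on_cong)
next
  case (Suc k)
  have d: "(h has_derivative frechet_derivative f (at x)) (at x)" if "x \<in> U" for x
    using Suc.prems that has_derivative_transform_within_open[OF _ assms(1) that]
    by (metis Ck_on.simps(2) frechet_derivative_works)
  have e: "frechet_derivative h (at x) = frechet_derivative f (at x)" if "x \<in> U" for x
    by (rule frechet_derivative_at[symmetric]) (rule d[OF that])
  have "Ck_on k (\<lambda>x. frechet_derivative h (at x) v) U" for v
    by (rule Suc.IH[where f="\<lambda>x. frechet_derivative f (at x) v"]) (use e Suc.prems in auto)
  moreover have "h differentiable (at x)" if "x \<in> U" for x
    using d[OF that] by (rule differentiableI)
  ultimately show ?case by simp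
qed

lemma Ck_on_Suc: "Ck_on (Suc k) f U \<Longrightarrow> Ck_on k f U"
proof (induction k arbitrary: f)
  case 0 then show ?case
    by (metis Ck_on.simps continuous_at_imp_continuous_on differentiable_imp_continuous_within)
next
  case (Suc k) then show ?case by (metis Ck_on.simps(2))
qed

lemma Ck_on_subset: "Ck_on k f B \<Longrightarrow> A \<subseteq> B \<Longrightarrow> Ck_on k f A"
proof (induction k arbitrary: f)
  case 0 then show ?case by (simp add: continuous_on_subset)
next
  case (Suc k) then show ?case by (simp add: subset_iff)
qed

lemma Ck_const: "Ck_on k (\<lambda>x. c) U"
  by (induction k arbitrary: c) auto

lemma Ck_lin:
  assumes f: "bounded_linear f" shows "Ck_on k f U"
proof (cases k)
  case 0 then show ?thesis using f by (simp add: linear_continuous_on)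
next
  case (Suc j)
  have "(f has_derivative f) (at x)" for x using f by (simp add: bounded_linear_imp_has_derivative)
  then have "frechet_derivative f (at x) = f" for x using frechet_derivative_at by metis
  then show ?thesis using f Suc by (simp add: Ck_const bounded_linear_imp_differentiable)
qed

lemma Ck_add:
  assumes "open U" "Ck_on k f U" "Ck_on k h U" shows "Ck_on k (\<lambda>x. f x + h x) U"
  using assms(2,3)
proof (induction k arbitrary: f h)
  case 0 then show ?case by (simp add: continuous_on_add)
next
  case (Suc k)
  have d: "((\<lambda>x. f x + h x) has_derivative (\<lambda>v. frechet_derivative f (at x) v + frechet_derivative h (at x) v)) (at x)" if "x \<in> U" for x
    using Suc.prems that by (intro has_derivative_add) (simp_all add: frechet_derivative_works[THEN iffD1])
  have e: "frechet_derivative (\<lambda>x. f x + h x) (at x) = (\<lambda>v. frechet_derivative f (at x) v + frechet_derivative h (at x) v)" if "x \<in> U" for x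
    by (rule frechet_derivative_at[symmetric]) (rule d[OF that])
  have "Ck_on k (\<lambda>x. frechet_derivative (\<lambda>x. f x + h x) (at x) v) U" for v
    by (rule Ck_on_cong[OF assms(1), where f="\<lambda>x. frechet_derivative f (at x) v + frechet_derivative h (at x) v"])
       (use Suc e in auto)
  then show ?case using d by (auto simp: differentiable_def)
qed

lemma Ck_bilin:
  assumes "bounded_bilinear b" "open U" "Ck_on k f U" "Ck_on k h U" shows "Ck_on k (\<lambda>x. b (f x) (h x)) U"
  using assms(3,4)
proof (induction k arbitrary: f h)
  case 0 then show ?case using assms(1) by (simp add: bounded_bilinear.continuous_on)
next
  case (Suc k)
  have d: "((\<lambda>x. b (f x) (h x)) has_derivative (\<lambda>v. b (f x) (frechet_derivative h (at x) v) + b (frechet_derivative f (at x) v) (h x))) (at x)" if "x \<in> U" for x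
    using Suc.prems that by (intro bounded_bilinear.FDERIV[OF assms(1)]) (simp_all add: frechet_derivative_works[THEN iffD1])
  have e: "frechet_derivative (\<lambda>x. b (f x) (h x)) (at x) = (\<lambda>v. b (f x) (frechet_derivative h (at x) v) + b (frechet_derivative f (at x) v) (h x))" if "x \<in> U" for x
    by (rule frechet_derivative_at[symmetric]) (rule d[OF that])
  have "Ck_on k (\<lambda>x. b (f x) (frechet_derivative h (at x) v) + b (frechet_derivative f (at x) v) (h x)) U" for v
  proof -
    have 1: "Ck_on k f U" "Ck_on k h U" by (rule Ck_on_Suc, rule Suc.prems)+
    have 2: "Ck_on k (\<lambda>x. frechet_derivative f (at x) v) U" "Ck_on k (\<lambda>x. frechet_derivative h (at x) v) U"
      using Suc.prems by simp_all
    show ?thesis by (rule Ck_add[OF assms(2) Suc.IH[OF 1(1) 2(2)] Suc.IH[OF 2(1) 1(2)]])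
  qed
  then have "Ck_on k (\<lambda>x. frechet_derivative (\<lambda>x. b (f x) (h x)) (at x) v) U" for v
    by (rule Ck_on_cong[OF assms(2), rotated]) (simp add: e)
  then show ?case using d by (auto simp: differentiable_def)
qed

lemma Cinf_const: "Cinf_on (\<lambda>x. c) U" by (simp add: Cinf_on_def Ck_const)
lemma Cinf_lin: "bounded_linear f \<Longrightarrow> Cinf_on f U" by (simp add: Cinf_on_def Ck_lin)
lemma Cinf_add: "open U \<Longrightarrow> Cinf_on f U \<Longrightarrow> Cinf_on h U \<Longrightarrow> Cinf_on (\<lambda>x. f x + h x) U"
  by (simp add: Cinf_on_def Ck_add)
lemma Cinf_scaleR: "open U \<Longrightarrow> Cinf_on f U \<Longrightarrow> Cinf_on h U \<Longrightarrow> Cinf_on (\<lambda>x. f x *\<^sub>R h x) U"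
  by (simp add: Cinf_on_def Ck_bilin[OF bounded_bilinear_scaleR])
lemma Cinf_mult: "open U \<Longrightarrow> Cinf_on f U \<Longrightarrow> Cinf_on h U \<Longrightarrow> Cinf_on (\<lambda>x. f x * h x :: real) U"
  by (simp add: Cinf_on_def Ck_bilin[OF bounded_bilinear_mult])
lemma Cinf_minus: "open U \<Longrightarrow> Cinf_on h U \<Longrightarrow> Cinf_on (\<lambda>x. - h x) U"
  using Cinf_scaleR[OF _ Cinf_const[of "-1"], of U h] by simp
lemma Cinf_diff: "open U \<Longrightarrow> Cinf_on f U \<Longrightarrow> Cinf_on h U \<Longrightarrow> Cinf_on (\<lambda>x. f x - h x) U"
  using Cinf_add[of U f "\<lambda>x. - h x"] Cinf_minus[of U h] by simp

lemma Ck_compose_lin: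
  assumes l: "bounded_linear l" and U: "open U" and f: "Ck_on k f U" shows "Ck_on k (\<lambda>x. l (f x)) U"
  using f
proof (induction k arbitrary: f)
  case 0 then show ?case by (simp add: bounded_linear.continuous_on[OF l])
next
  case (Suc k)
  have d: "((\<lambda>x. l (f x)) has_derivative (\<lambda>v. l (frechet_derivative f (at x) v))) (at x)" if "x \<in> U" for x
    using Suc.prems that by (intro bounded_linear.has_derivative[OF l]) (simp_all add: frechet_derivative_works[THEN iffD1])
  have e: "frechet_derivative (\<lambda>x. l (f x)) (at x) = (\<lambda>v. l (frechet_derivative f (at x) v))" if "x \<in> U" for x
    by (rule frechet_derivative_at[symmetric]) (rule d[OF that])
  have "Ck_on k (\<lambda>x. frechet_derivative (\<lambda>x. l (f x)) (at x) v) U" for v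
    by (rule Ck_on_cong[OF U, where f="\<lambda>x. l (frechet_derivative f (at x) v)"])
       (use Suc e in auto)
  then show ?case using d by (auto simp: differentiable_def)
qed
lemma Cinf_compose_lin: "bounded_linear l \<Longrightarrow> open U \<Longrightarrow> Cinf_on f U \<Longrightarrow> Cinf_on (\<lambda>x. l (f x)) U"
  by (simp add: Cinf_on_def Ck_compose_lin)

lemma Cinf_nth: "open U \<Longrightarrow> Cinf_on f U \<Longrightarrow> Cinf_on (\<lambda>x. f x $ i) U"
  by (rule Cinf_compose_lin[OF bounded_linear_vec_nth])
lemma Cinf_fst: "open U \<Longrightarrow> Cinf_on f U \<Longrightarrow> Cinf_on (\<lambda>x. fst (f x)) U"
  by (rule Cinf_compose_lin[OF bounded_linear_fst])
lemma Cinf_snd: "open U \<Longrightarrow> Cinf_on f U \<Longrightarrow> Cinf_on (\<lambda>x. snd (f x)) U"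
  by (rule Cinf_compose_lin[OF bounded_linear_snd])
lemma Cinf_Pair: assumes "open U" "Cinf_on f U" "Cinf_on h U" shows "Cinf_on (\<lambda>x. (f x, h x)) U"
proof -
  have 1: "bounded_linear (\<lambda>x. (x, 0))" "bounded_linear (\<lambda>x. (0, x))"
    by (intro bounded_linear_Pair bounded_linear_ident bounded_linear_zero)+
  show ?thesis
    using Cinf_add[OF assms(1) Cinf_compose_lin[OF 1(1) assms(1,2)] Cinf_compose_lin[OF 1(2) assms(1,3)]] by simp
qed
lemma Cinf_id: "Cinf_on (\<lambda>x. x) U" by (rule Cinf_lin) (rule bounded_linear_ident)

definition vec2 :: "real \<Rightarrow> real \<Rightarrow> real^2" where "vec2 a b = a *\<^sub>R axis 1 1 + b *\<^sub>R axis 2 1"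
lemma vec2_nth[simp]: "vec2 a b $ 1 = a" "vec2 a b $ 2 = b" by (auto simp: vec2_def axis_def)
lemma Cinf_vec2: "open U \<Longrightarrow> Cinf_on f U \<Longrightarrow> Cinf_on h U \<Longrightarrow> Cinf_on (\<lambda>x. vec2 (f x) (h x)) U"
  unfolding vec2_def by (intro Cinf_add Cinf_scaleR Cinf_const)
lemma vec2_eq: "(a::real^2) = b \<longleftrightarrow> a$1 = b$1 \<and> a$2 = b$2" by (simp add: vec_eq_iff forall_2)

lemmas Cinf_intros = Cinf_const Cinf_id Cinf_add Cinf_diff Cinf_minus Cinf_mult Cinf_scaleR Cinf_nth Cinf_fst Cinf_snd Cinf_Pair Cinf_vec2 open_UNIV

lemma smooth_UNIV: "Cinf_on f UNIV \<Longrightarrow> smooth_on S f" unfolding smooth_on_def by blast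

lemma tangent_UNIV: "tangent_space UNIV x = UNIV"
proof -
  have "v \<in> tangent_space UNIV x" for v unfolding tangent_space_def
    by (auto intro!: exI[of _ "\<lambda>t. x + t *\<^sub>R v"] exI[of _ 1] Cinf_intros open_greaterThanLessThan derivative_eq_intros)
  then show ?thesis by auto
qed

definition model_subgroup :: "ghat set" where "model_subgroup = {(0, a, 0) | a. True}"

lemma tangent_model_subgroup: "tangent_space model_subgroup 0 = model_subgroup"
proof (intro equalityI subsetI)
  fix v assume "v \<in> tangent_space model_subgroup 0"
  then obtain c e where c: "0 < e" "c ` {-e<..<e} \<subseteq> model_subgroup" "c 0 = 0" "(c has_vector_derivative v) (at (0::real))"
    unfolding tangent_space_def by auto
  have *: "l v = 0" if l: "bounded_linear l" "\<And>x. x \<in> model_subgroup \<Longrightarrow> l x = 0" for l :: "ghat \<Rightarrow> real^2"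
  proof -
    have 1: "((\<lambda>t. l (c t)) has_vector_derivative l v) (at 0)"
      using c(4) l(1) by (rule bounded_linear.has_vector_derivative[rotated])
    have 2: "((\<lambda>t. l (c t)) has_vector_derivative 0) (at 0)"
      by (rule has_vector_derivative_transform_within_open[where S="{-e<..<e}" and f="\<lambda>_. 0"])
         (use c l in \<open>auto simp: image_subset_iff\<close>)
    show ?thesis using 1 2 vector_derivative_at by metis
  qed
  have "fst v = 0" by (rule *) (auto simp: model_subgroup_def bounded_linear_fst)
  moreover have "snd (snd v) = 0"
    by (rule *) (auto simp: model_subgroup_def bounded_linear_snd_comp bounded_linear_snd)
  ultimately show "v \<in> model_subgroup" unfolding model_subgroup_def by (cases v) auto
next
  fix v assume "v \<in> model_subgroup"
  then have "(\<lambda>t. t *\<^sub>R v) ` {-1<..<1} \<subseteq> model_subgroup"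
    by (auto simp: model_subgroup_def)
  moreover have "Cinf_on (\<lambda>t. t *\<^sub>R v) {-1<..<1::real}"
    by (intro Cinf_intros open_greaterThanLessThan)
  moreover have "((\<lambda>t. t *\<^sub>R v) has_vector_derivative v) (at 0)"
    by (auto intro!: derivative_eq_intros)
  ultimately show "v \<in> tangent_space model_subgroup 0" unfolding tangent_space_def
    by (intro CollectI exI[of _ "\<lambda>t. t *\<^sub>R v"] exI[of _ 1]) simp
qed

lemma submanifold_UNIV: "submanifold (DIM('a)) (UNIV :: 'a::euclidean_space set)"
  unfolding submanifold_def
  by (intro ballI exI[of _ UNIV] exI[of _ "\<lambda>x. x"]) (auto simp: homeomorphism_def Cinf_id)
lemma submanifold_model_subgroup: "submanifold (dim model_subgroup) model_subgroup"
proof -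
  have "subspace model_subgroup" unfolding model_subgroup_def subspace_def by (auto simp: zero_prod_def)
  then show ?thesis
  unfolding submanifold_def
  by (intro ballI exI[of _ UNIV] exI[of _ "\<lambda>x. x"] exI[of _ model_subgroup]) (auto simp: homeomorphism_def Cinf_id)
qed

definition model_mult :: "real \<Rightarrow> ghat \<Rightarrow> ghat \<Rightarrow> ghat" where
  "model_mult k u v = (fst u + fst v + (k * (snd (snd v)$1 * snd (snd v)$2) + k/2 * (snd (snd u)$1 * snd (snd v)$2 + snd (snd u)$2 * snd (snd v)$1)) *\<^sub>R snd (snd u)
     + fst (snd u) *\<^sub>R vec2 (snd (snd v)$1) (- (snd (snd v)$2)),
     fst (snd u) + fst (snd v) + k/2 * (snd (snd u)$1 * snd (snd v)$2 - snd (snd u)$2 * snd (snd v)$1), snd (snd u) + snd (snd v))"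

definition model_inv :: "real \<Rightarrow> ghat \<Rightarrow> ghat" where
  "model_inv k u = (- fst u + fst (snd u) *\<^sub>R vec2 (snd (snd u)$1) (- (snd (snd u)$2)), - fst (snd u), - snd (snd u))"

definition model_group :: "real \<Rightarrow> ghat monoid" where "model_group k = \<lparr>carrier = UNIV, mult = model_mult k, one = 0\<rparr>"
lemma model_group_simps[simp]: "carrier (model_group k) = UNIV" "monoid.mult (model_group k) = model_mult k" "\<one>\<^bsub>model_group k\<^esub> = 0" by (auto simp: model_group_def)

lemma transvection5_eq: "transvection5 k X Z y w = (fst w + (k * fst (snd w) - k/2 * (X \<bullet> snd (snd w))) *\<^sub>R X + y *\<^sub>R vec2 (- (snd (snd w) $ 2)) (snd (snd w) $ 1) + Z, fst (snd w) - X \<bullet> snd (snd w) + X$1 * X$2, snd (snd w) + vec2 (- X$2) (- X$1))"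
proof (cases w)
  case (fields p x q)
  show ?thesis
    unfolding transvection5_def Let_def fields case_prod_conv fst_conv snd_conv
    by (simp add: vec2_eq matrix_vector_mult_def sum_2 inner_vec_def vector_2 algebra_simps)
qed
lemma inner2: "(a::real^2) \<bullet> b = a$1 * b$1 + a$2 * b$2" by (simp add: inner_vec_def sum_2)
lemma transvection5_comp: "transvection5 k X Z y (transvection5 k X' Z' y' w) =
  transvection5 k (snd (snd (model_mult k (Z,y,X) (Z',y',X')))) (fst (model_mult k (Z,y,X) (Z',y',X'))) (fst (snd (model_mult k (Z,y,X) (Z',y',X')))) w"
  unfolding transvection5_eq model_mult_def by (simp add: prod_eq_iff vec2_eq inner2) (simp add: field_simps)

lemma model_group_group: "group (model_group k)"
proof (rule groupI, goal_cases)
  case (3 x y z) then show ?case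
    by (simp add: model_mult_def prod_eq_iff vec2_eq) (simp add: algebra_simps add_divide_distrib diff_divide_distrib)
next
  case (5 x) show ?case by (rule bexI[of _ "model_inv k x"]) (auto simp: model_mult_def model_inv_def prod_eq_iff vec2_eq algebra_simps)
qed (auto simp: model_mult_def prod_eq_iff vec2_eq)

lemma model_group_inv: "inv\<^bsub>model_group k\<^esub> x = model_inv k x"
  by (rule group.inv_equality[OF model_group_group]) (auto simp: model_mult_def model_inv_def prod_eq_iff vec2_eq algebra_simps)

lemma model_group_lie: "lie_group (model_group k)"
proof -
  have 1: "smooth_on (UNIV \<times> UNIV) (\<lambda>(a, b). model_mult k a b)"
    by (rule smooth_UNIV) (unfold case_prod_beta model_mult_def, intro Cinf_intros)
  have "smooth_on UNIV (model_inv k)"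
    by (rule smooth_UNIV) (unfold model_inv_def, intro Cinf_intros)
  moreover have "m_inv (model_group k) = model_inv k"
    by (rule ext) (rule model_group_inv)
  ultimately show ?thesis
    unfolding lie_group_def using 1 model_group_group[of k] submanifold_UNIV[where 'a=ghat] by auto
qed

definition model_field :: "real \<Rightarrow> ghat \<Rightarrow> ghat \<Rightarrow> ghat" where
  "model_field k v a = (fst v + (k/2 * (snd (snd a)$1 * snd (snd v)$2 + snd (snd a)$2 * snd (snd v)$1)) *\<^sub>R snd (snd a)
     + fst (snd a) *\<^sub>R vec2 (snd (snd v)$1) (- (snd (snd v)$2)),
     fst (snd v) + k/2 * (snd (snd a)$1 * snd (snd v)$2 - snd (snd a)$2 * snd (snd v)$1), snd (snd v))"

lemma has_derivative_nth: "(f has_derivative f') F \<Longrightarrow> ((\<lambda>x. f x $ i) has_derivative (\<lambda>v. f' v $ i)) F"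
  by (rule bounded_linear.has_derivative[OF bounded_linear_vec_nth])
lemma has_derivative_vec2: "(f has_derivative f') F \<Longrightarrow> (h has_derivative h') F \<Longrightarrow> ((\<lambda>x. vec2 (f x) (h x)) has_derivative (\<lambda>v. vec2 (f' v) (h' v))) F"
  unfolding vec2_def by (auto intro!: derivative_eq_intros)
lemmas has_derivative_rules = has_derivative_add has_derivative_diff has_derivative_minus has_derivative_Pair has_derivative_fst has_derivative_snd has_derivative_nth has_derivative_vec2 has_derivative_const has_derivative_ident has_derivative_scaleR has_derivative_mult

lemma model_mult_deriv: "((\<lambda>b. model_mult k a b) has_derivative (\<lambda>v. model_field k v a)) (at 0)"
  unfolding model_mult_def
  by (rule has_derivative_eq_rhs, (rule has_derivative_rules)+) (auto simp: model_field_def fun_eq_iff prod_eq_iff vec2_eq algebra_simps)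

lemma model_field: "left_invariant_field (model_group k) = model_field k"
  unfolding left_invariant_field_def by (simp add: fun_eq_iff frechet_derivative_at[OF model_mult_deriv, symmetric])

lemma model_field_deriv: "((model_field k w) has_derivative (\<lambda>v. (fst (snd v) *\<^sub>R vec2 (snd (snd w)$1) (- (snd (snd w)$2)), k/2 * (snd (snd v)$1 * snd (snd w)$2 - snd (snd v)$2 * snd (snd w)$1), 0))) (at 0)"
  unfolding model_field_def[abs_def]
  by (rule has_derivative_eq_rhs, (rule has_derivative_rules)+) (auto simp: fun_eq_iff prod_eq_iff vec2_eq algebra_simps)

definition model_psi :: "real \<Rightarrow> ghat \<Rightarrow> ghat" where "model_psi k u = (vec2 (fst u$2) (fst u$1), k * fst (snd u), snd (snd u))"

lemma model_bracket: assumes "k^2 = 1" shows "lie_bracket (model_group k) (model_psi k u) (model_psi k v) = model_psi k (ghat_bracket k u v)"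
  using assms
  unfolding lie_bracket_def field_bracket_def model_field model_group_simps frechet_derivative_at[OF model_field_deriv, symmetric]
  by (auto simp: model_field_def model_psi_def ghat_bracket_def prod_eq_iff vec2_eq power2_eq_square case_prod_beta algebra_simps)

definition model_proj :: "ghat \<Rightarrow> (real^2)\<times>(real^2)" where "model_proj u = (fst u, snd (snd u))"

definition model_embed_deriv :: "(real^2)\<times>(real^2) \<Rightarrow> (real^2)\<times>(real^2) \<Rightarrow> R5" where
  "model_embed_deriv x u = (fst u, snd x$1 * snd u$2 + snd x$2 * snd u$1, vec2 (- snd u$2) (- snd u$1))"
definition model_metric where "model_metric k x u v = form5 k (model_embed_deriv x u) (model_embed_deriv x v)"
lemma model_metric: "model_metric k x u v = fst u$1 * snd v$2 + fst u$2 * snd v$1 + fst v$1 * snd u$2 + fst v$2 * snd u$1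
   - k * ((snd x$1 * snd u$2 + snd x$2 * snd u$1) * (snd x$1 * snd v$2 + snd x$2 * snd v$1))"
  unfolding model_metric_def form5_def model_embed_deriv_def by (simp add: inner2)

lemma model_metric_metric: "pseudo_riemannian_metric UNIV (model_metric k)"
  unfolding pseudo_riemannian_metric_def
proof (intro conjI ballI allI impI)
  fix x :: "(real^2)\<times>(real^2)"
  have nd: "u = 0" if "\<forall>v. model_metric k x u v = 0" for u
  proof -
    have 0: "model_metric k x u (vec2 0 1, 0) = 0" "model_metric k x u (vec2 1 0, 0) = 0" "model_metric k x u (0, vec2 0 1) = 0" "model_metric k x u (0, vec2 1 0) = 0"
      using that by blast+
    then have 1: "snd u = 0" by (simp add: model_metric vec2_eq)
    then have "fst u = 0" using 0 by (simp add: model_metric vec2_eq)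
    with 1 show ?thesis by (simp add: prod_eq_iff)
  qed
  show "scalar_product_on (tangent_space UNIV x) (model_metric k x)"
    unfolding scalar_product_on_def nondegenerate_on_def tangent_UNIV
    using nd by (auto simp: model_metric algebra_simps)
next
  fix X Y :: "(real^2)\<times>(real^2) \<Rightarrow> (real^2)\<times>(real^2)"
  assume a: "smooth_on UNIV X \<and> smooth_on UNIV Y \<and> (\<forall>x\<in>UNIV. X x \<in> tangent_space UNIV x \<and> Y x \<in> tangent_space UNIV x)"
  show "smooth_on UNIV (\<lambda>x. model_metric k x (X x) (Y x))" unfolding smooth_on_def
  proof
    fix x
    obtain U h where U: "open U" "x \<in> U" "Cinf_on h U" "\<forall>y\<in>U. X y = h y"
      using a unfolding smooth_on_def Int_UNIV_right by blast
    obtain U' h' where U': "open U'" "x \<in> U'" "Cinf_on h' U'" "\<forall>y\<in>U'. Y y = h' y"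
      using a unfolding smooth_on_def Int_UNIV_right by blast
    have W: "open (U \<inter> U')" using U U' by blast
    have c: "Cinf_on h (U \<inter> U')" "Cinf_on h' (U \<inter> U')"
      using U(3) U'(3) unfolding Cinf_on_def by (meson Ck_on_subset Int_lower1 Int_lower2)+
    have "Cinf_on (\<lambda>x. model_metric k x (h x) (h' x)) (U \<inter> U')"
      unfolding model_metric by (intro Cinf_intros c W)
    then show "\<exists>W f. open W \<and> x \<in> W \<and> Cinf_on f W \<and> (\<forall>y\<in>W \<inter> UNIV. model_metric k y (X y) (Y y) = f y)"
      using U U' by (intro exI[of _ "U \<inter> U'"] exI[of _ "\<lambda>x. model_metric k x (h x) (h' x)"]) auto
  qed
qed

definition model_translation where "model_translation k a x = (fst a + fst x + (k * (snd x$1 * snd x$2) + k/2 * (snd (snd a)$1 * snd x$2 + snd (snd a)$2 * snd x$1)) *\<^sub>R snd (snd a)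
     + fst (snd a) *\<^sub>R vec2 (snd x$1) (- (snd x$2)), snd (snd a) + snd x)"
lemma model_translation: "translation (model_group k) model_proj a = model_translation k a"
proof
  fix x
  have "model_proj (fst x, 0, snd x) = x" by (simp add: model_proj_def)
  then have "model_proj (inv_into UNIV model_proj x) = x" by (metis f_inv_into_f rangeI)
  then have "fst (inv_into UNIV model_proj x) = fst x" "snd (snd (inv_into UNIV model_proj x)) = snd x"
    by (auto simp: model_proj_def prod_eq_iff)
  then show "translation (model_group k) model_proj a x = model_translation k a x"
    unfolding translation_def by (simp add: model_translation_def model_mult_def model_proj_def)
qed
lemma model_translation_deriv: "(model_translation k a has_derivative (\<lambda>u. (fst u + (k * (snd x$1 * snd u$2 + snd u$1 * snd x$2) + k/2 * (snd (snd a)$1 * snd u$2 + snd (snd a)$2 * snd u$1)) *\<^sub>R snd (snd a)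
     + fst (snd a) *\<^sub>R vec2 (snd u$1) (- (snd u$2)), snd u))) (at x)"
  unfolding model_translation_def[abs_def]
  by (rule has_derivative_eq_rhs, (rule has_derivative_rules)+) (auto simp: fun_eq_iff prod_eq_iff vec2_eq algebra_simps)
lemma model_translation_inv: "model_translation k a (model_translation k (model_inv k a) x) = x" "model_translation k (model_inv k a) (model_translation k a x) = x"
  unfolding model_translation_def model_inv_def prod_eq_iff vec2_eq by (simp_all add: algebra_simps)

lemma model_translation_isometry: "isometry UNIV (model_metric k) UNIV (model_metric k) (model_translation k a)"
proof -
  have b: "bij (model_translation k a)" by (metis bijI' model_translation_inv)
  have i: "inv_into UNIV (model_translation k a) = model_translation k (model_inv k a)" using b model_translation_inv by (metis bij_inv_eq_iff ext)
  have s: "smooth_on UNIV (model_translation k b)" for b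
    by (rule smooth_UNIV) (unfold model_translation_def, intro Cinf_intros)
  show ?thesis unfolding isometry_def i tangent_UNIV
    using b s by (auto simp: frechet_derivative_at[OF model_translation_deriv, symmetric] model_metric model_translation_def algebra_simps)
qed

lemma bounded_linear_model_proj: "bounded_linear model_proj" unfolding model_proj_def[abs_def]
  by (intro bounded_linear_Pair bounded_linear_fst bounded_linear_snd_comp bounded_linear_snd)
lemma model_proj_deriv: "differential UNIV model_proj x = model_proj"
  using frechet_derivative_at[OF bounded_linear_imp_has_derivative[OF bounded_linear_model_proj]] by auto

lemma N_space_nonempty:
  assumes "k \<in> {1,-1}"
  shows "N_space k (model_group k) (model_psi k) model_subgroup UNIV model_proj (model_metric k)"
proof -
  have k: "k \<noteq> 0" "k^2 = 1" "k * k = 1" using assms by auto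
  have coset: "model_proj a = model_proj b \<longleftrightarrow> a <#\<^bsub>model_group k\<^esub> model_subgroup = b <#\<^bsub>model_group k\<^esub> model_subgroup" for a b
  proof -
    have *: "a <#\<^bsub>model_group k\<^esub> model_subgroup = {c. model_proj c = model_proj a}" for a
    proof -
      have "c \<in> a <#\<^bsub>model_group k\<^esub> model_subgroup" if "model_proj c = model_proj a" for c
      proof -
        have "c = model_mult k a (0, fst (snd c) - fst (snd a), 0)"
          using that by (cases c; cases a) (auto simp: model_mult_def model_proj_def vec2_eq)
        then show ?thesis unfolding l_coset_def model_subgroup_def by auto
      qed
      then show ?thesis unfolding l_coset_def model_subgroup_def by (auto simp: model_mult_def model_proj_def vec2_eq)
    qed
    show ?thesis unfolding * by auto
  qed
  have H0: "model_subgroup \<noteq> {}" by (auto simp: model_subgroup_def)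
  have sub: "subgroup model_subgroup (model_group k)"
    by (rule group.subgroupI[OF model_group_group]) (simp_all add: H0, auto simp: model_subgroup_def model_group_inv model_mult_def model_inv_def vec2_eq)
  have con: "connected model_subgroup"
    by (rule convex_connected) (auto simp: convex_def model_subgroup_def)
  have bij: "bij (model_psi k)"
    by (rule bij_betwI[where g="\<lambda>u. (vec2 (fst u$2) (fst u$1), k * fst (snd u), snd (snd u))"])
       (auto simp: model_psi_def vec2_eq prod_eq_iff k mult.assoc[symmetric])
  have lin: "linear (model_psi k)" by (rule linearI) (auto simp: model_psi_def vec2_eq algebra_simps)
  have pH: "model_psi k ` {(0, a, 0) | a. True} = model_subgroup"
  proof -
    have 1: "model_psi k (0, a, 0) = (0, k * a, 0)" for a by (simp add: model_psi_def vec2_eq)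
    have "(0, a, 0) = model_psi k (0, k * a, 0)" for a
      unfolding 1 using k(3) by (simp add: mult.assoc[symmetric])
    then show ?thesis using 1 unfolding model_subgroup_def by blast
  qed
  have sp: "surj model_proj" by (metis surjI[of model_proj "\<lambda>x. (fst x, 0, snd x)"] model_proj_def fst_conv snd_conv prod.collapse)
  show ?thesis
    unfolding N_space_def connected_lie_subgroup_def homogeneous_space_def model_group_simps tangent_UNIV model_proj_deriv model_translation tangent_model_subgroup pH
  proof (intro conjI model_group_lie lin bij allI ballI impI sub con refl model_metric_metric model_translation_isometry coset sp)
    show "simply_connected (UNIV :: ghat set)" by (simp add: convex_imp_simply_connected)
    show "lie_bracket (model_group k) (model_psi k \<xi>) (model_psi k \<eta>) = model_psi k (ghat_bracket k \<xi> \<eta>)" for \<xi> \<eta> by (rule model_bracket) fact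
    show "\<exists>k. submanifold k model_subgroup" using submanifold_model_subgroup by blast
    show "\<exists>k. submanifold k (UNIV :: ((real^2)\<times>(real^2)) set)" using submanifold_UNIV by blast
    show "smooth_on UNIV model_proj" by (rule smooth_UNIV) (rule Cinf_lin[OF bounded_linear_model_proj])
    show "model_metric k (model_proj 0) (model_proj (model_psi k \<xi>)) (model_proj (model_psi k \<eta>)) = ghat_inner k \<xi> \<eta>" if "theta \<xi> = - \<xi> \<and> theta \<eta> = - \<eta>" for \<xi> \<eta>
      using that by (auto simp: model_metric model_proj_def model_psi_def ghat_inner_def theta_def inner2 case_prod_beta prod_eq_iff)
  qed
qed

text \<open>\<open>O(1,1)\<close> and \<open>\<int>\<^sub>2\<close> do not commute: the subgroup they generate is not their direct product but a
  semidirect product, with \<open>O(1,1)\<close> normal.\<close>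

lemma O11_Z2_gen_not_commute: "\<exists>S\<in>O11. O11_diag S \<circ> Z2_gen \<noteq> Z2_gen \<circ> O11_diag S"
proof -
  let ?S = "vector [vector [0,1], vector [1,0]] :: real^2^2"
  have "?S \<in> O11" by (auto simp: O11_def matrix_vector_mult_def sum_2 vector_2)
  moreover have "(O11_diag ?S \<circ> Z2_gen) (0,0,vec2 0 1) \<noteq> (Z2_gen \<circ> O11_diag ?S) (0,0,vec2 0 1)"
    by (auto simp: O11_diag_def Z2_gen_def matrix_vector_mult_def sum_2 vector_2 vec2_eq)
  ultimately show ?thesis by (metis)
qed

end

theory Submission imports Defs begin

text \<open>
  The polynomial product on \<open>(Z, y, X)\<close> under which the matrices of the extrinsic transvection
  group multiply defines a nilpotent model group. In a simply connected Lie group \<open>G\<close> with the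
  given Lie algebra, the product of five one-parameter subgroups is a local diffeomorphism
  and a homomorphism from the model group. It is onto since \<open>G\<close> is connected, hence a covering,
  hence bijective since \<open>G\<close> is simply connected. It descends to an isometry from \<open>\<real>\<^sup>4\<close>, with the
  metric induced from the parametrisation of \<open>M\<close>, to \<open>N(\<kappa>)\<close>.

  Geodesics of this metric are explicit polynomial curves through any two points, so an isometry
  is determined by its value and derivative at one point. Therefore the point symmetries are the
  conjugates of one involution by the model group, both in \<open>N(\<kappa>)\<close> and in \<open>\<real>\<^sup>5\<close>, and the products
  of two of them generate the image of the model group in either setting.

  An affine isometry preserving \<open>M\<close> can be moved by a transvection to fix \<open>0\<close>. It is then linear
  and preserves the tangent space and the normal line there, which leaves only the stabiliser of
  \<open>0\<close> in the transvection group, \<open>O(1,1)\<close> and \<open>\<int>\<^sub>2\<close>.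
\<close>

section \<open>Calculus of smooth maps\<close>

text \<open>The group \<open>G\<close> is known only as an embedded submanifold with a smooth
  product, so nothing can be computed in it directly. A curve in \<open>G\<close> is instead
  determined by its starting point and its velocity translated back to the identity. The bracket
  enters only through \<open>Ad\<close> of one-parameter subgroups, which is polynomial because
  every inner derivation of the Lie algebra has vanishing cube. Comparing velocities, the
  five-factor product pulls the left-invariant fields of \<open>G\<close> back to those of the
  model; left invariance of the Maurer-Cartan form then gives the homomorphism property without the
  Campbell-Hausdorff formula.

  Rigidity avoids the Levi-Civita connection: geodesics are the curves whose acceleration in
  five-space is normal, and the tangential part of an acceleration depends on the induced metric
  alone.

  The linear stabiliser of \<open>0\<close> is found from the equation \<open>x = q1 q2\<close>: on
  the coordinates \<open>q\<close> such a map can only rescale or exchange the two null axes, up to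
  a sign. As \<open>Z2_gen\<close> does not commute with the exchange, two nested semidirect
  products appear.\<close>

lemma Cinf_on_iff:
  "Cinf_on f U \<longleftrightarrow> (\<forall>x\<in>U. f differentiable (at x)) \<and> (\<forall>v. Cinf_on (\<lambda>x. frechet_derivative f (at x) v) U)"
proof
  assume "Cinf_on f U"
  then have "Ck_on (Suc k) f U" for k by (simp add: Cinf_on_def)
  then show "(\<forall>x\<in>U. f differentiable (at x)) \<and> (\<forall>v. Cinf_on (\<lambda>x. frechet_derivative f (at x) v) U)"
    by (auto simp: Cinf_on_def)
next
  assume a: "(\<forall>x\<in>U. f differentiable (at x)) \<and> (\<forall>v. Cinf_on (\<lambda>x. frechet_derivative f (at x) v) U)"
  have "Ck_on (Suc k) f U" for k using a by (auto simp: Cinf_on_def)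
  then show "Cinf_on f U" unfolding Cinf_on_def using Ck_on_Suc by blast
qed

lemma Cinf_on_has_derivative:
  assumes "Cinf_on f U" "x \<in> U"
  shows "(f has_derivative frechet_derivative f (at x)) (at x)"
  using assms Cinf_on_iff frechet_derivative_works by blast

lemma Cinf_on_cong: "open U \<Longrightarrow> (\<And>x. x \<in> U \<Longrightarrow> f x = h x) \<Longrightarrow> Cinf_on f U \<Longrightarrow> Cinf_on h U"
  unfolding Cinf_on_def using Ck_on_cong by blast

lemma Cinf_on_subset: "Cinf_on f B \<Longrightarrow> A \<subseteq> B \<Longrightarrow> Cinf_on f A"
  unfolding Cinf_on_def using Ck_on_subset by blast

lemma Cinf_on_continuous: "Cinf_on f U \<Longrightarrow> continuous_on U f"
  unfolding Cinf_on_def by (metis Ck_on.simps(1))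

lemma Ck_on_local:
  assumes "\<And>x. x \<in> U \<Longrightarrow> \<exists>V. open V \<and> x \<in> V \<and> Ck_on k f V"
  shows "Ck_on k f U"
  using assms
proof (induction k arbitrary: f)
  case 0
  then have "\<forall>x\<in>U. isCont f x" by (metis Ck_on.simps(1) continuous_on_eq_continuous_at)
  then show ?case by (simp add: continuous_at_imp_continuous_on)
next
  case (Suc k)
  have "f differentiable (at x)" if "x \<in> U" for x using Suc.prems[OF that] by auto
  moreover have "Ck_on k (\<lambda>x. frechet_derivative f (at x) v) U" for v
    by (rule Suc.IH) (use Suc.prems in fastforce)
  ultimately show ?case by simp
qed

lemma Cinf_on_local:
  assumes "\<And>x. x \<in> U \<Longrightarrow> \<exists>V. open V \<and> x \<in> V \<and> Cinf_on f V"
  shows "Cinf_on f U"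
  using assms Ck_on_local unfolding Cinf_on_def by metis

lemma Ck_sum:
  assumes "finite I" "open U" "\<And>i. i \<in> I \<Longrightarrow> Ck_on k (f i) U"
  shows "Ck_on k (\<lambda>x. \<Sum>i\<in>I. f i x) U"
  using assms(1,3)
proof (induction I rule: finite_induct)
  case empty then show ?case by (simp add: Ck_const)
next
  case (insert i I) then show ?case using Ck_add[OF assms(2), of k "f i"] by simp
qed

lemma linear_expand:
  fixes A :: "'b::euclidean_space \<Rightarrow> 'c::real_normed_vector"
  assumes "linear A" shows "A v = (\<Sum>b\<in>Basis. (v \<bullet> b) *\<^sub>R A b)"
proof -
  have "A v = A (\<Sum>b\<in>Basis. (v \<bullet> b) *\<^sub>R b)" by (simp add: euclidean_representation)
  then show ?thesis using assms by (simp add: linear_sum linear_cmul)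
qed

text \<open>\<open>Ck_on\<close> tests derivatives on fixed directions only. When the linear map and
  its argument both vary, expanding the argument in the standard basis leaves finitely many fixed
  directions.\<close>

lemma Ck_apply_linear:
  fixes A :: "'a::real_normed_vector \<Rightarrow> 'b::euclidean_space \<Rightarrow> 'c::real_normed_vector"
  assumes "open U" "\<And>x. x \<in> U \<Longrightarrow> linear (A x)" "\<And>b. b \<in> Basis \<Longrightarrow> Ck_on k (\<lambda>x. A x b) U" "Ck_on k v U"
  shows "Ck_on k (\<lambda>x. A x (v x)) U"
proof (rule Ck_on_cong[OF assms(1), where f="\<lambda>x. \<Sum>b\<in>Basis. (v x \<bullet> b) *\<^sub>R A x b"])
  show "(\<Sum>b\<in>Basis. (v x \<bullet> b) *\<^sub>R A x b) = A x (v x)" if "x \<in> U" for x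
    using linear_expand[OF assms(2)[OF that]] by metis
  show "Ck_on k (\<lambda>x. \<Sum>b\<in>Basis. (v x \<bullet> b) *\<^sub>R A x b) U"
    by (intro Ck_sum Ck_bilin[OF bounded_bilinear_scaleR] Ck_compose_lin[OF bounded_linear_inner_left] assms finite_Basis)
qed

text \<open>The induction fixes \<open>f\<close> and generalises \<open>F\<close>: the chain rule
  gives a derivative of \<open>F\<close> along \<open>f\<close>, covered by the induction
  hypothesis, applied to a derivative of \<open>f\<close>.\<close>

lemma Ck_compose:
  fixes F :: "'b::euclidean_space \<Rightarrow> 'c::real_normed_vector" and f :: "'a::real_normed_vector \<Rightarrow> 'b"
  assumes "open U" "open V" "\<And>x. x \<in> U \<Longrightarrow> f x \<in> V" "Ck_on k f U" "Ck_on k F V"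
  shows "Ck_on k (\<lambda>x. F (f x)) U"
  using assms(4,5)
proof (induction k arbitrary: F)
  case 0 then show ?case using assms(3) by (auto intro: continuous_on_compose2)
next
  case (Suc k)
  have F: "(F has_derivative frechet_derivative F (at y)) (at y)" if "y \<in> V" for y
    using Suc.prems(2) that frechet_derivative_works by auto
  have f: "(f has_derivative frechet_derivative f (at x)) (at x)" if "x \<in> U" for x
    using Suc.prems(1) that frechet_derivative_works by auto
  have d: "((\<lambda>x. F (f x)) has_derivative (\<lambda>v. frechet_derivative F (at (f x)) (frechet_derivative f (at x) v))) (at x)" if "x \<in> U" for x
    using diff_chain_at[OF f[OF that] F[OF assms(3)[OF that]]] by (simp add: o_def)
  have e: "frechet_derivative (\<lambda>x. F (f x)) (at x) = (\<lambda>v. frechet_derivative F (at (f x)) (frechet_derivative f (at x) v))" if "x \<in> U" for x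
    by (rule frechet_derivative_at[symmetric]) (rule d[OF that])
  have "Ck_on k (\<lambda>x. frechet_derivative (\<lambda>x. F (f x)) (at x) v) U" for v
  proof (rule Ck_on_cong[OF assms(1), where f="\<lambda>x. frechet_derivative F (at (f x)) (frechet_derivative f (at x) v)"])
    show "Ck_on k (\<lambda>x. frechet_derivative F (at (f x)) (frechet_derivative f (at x) v)) U"
    proof (rule Ck_apply_linear[OF assms(1)])
      show "linear (frechet_derivative F (at (f x)))" if "x \<in> U" for x
        using F[OF assms(3)[OF that]] has_derivative_linear by blast
      show "Ck_on k (\<lambda>x. frechet_derivative F (at (f x)) b) U" for b
        using Suc.IH[of "\<lambda>y. frechet_derivative F (at y) b"] Suc.prems Ck_on_Suc by auto
    qed (use Suc.prems in auto)
  qed (use e in auto)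
  then show ?case using d by (auto simp: differentiable_def)
qed

lemma Cinf_compose:
  fixes F :: "'b::euclidean_space \<Rightarrow> 'c::real_normed_vector" and f :: "'a::real_normed_vector \<Rightarrow> 'b"
  assumes "open U" "open V" "\<And>x. x \<in> U \<Longrightarrow> f x \<in> V" "Cinf_on f U" "Cinf_on F V"
  shows "Cinf_on (\<lambda>x. F (f x)) U"
  using assms Ck_compose unfolding Cinf_on_def by metis

lemma Cinf_apply_linear:
  fixes A :: "'a::real_normed_vector \<Rightarrow> 'b::euclidean_space \<Rightarrow> 'c::real_normed_vector"
  assumes "open U" "\<And>x. x \<in> U \<Longrightarrow> linear (A x)" "\<And>b. Cinf_on (\<lambda>x. A x b) U" "Cinf_on v U"
  shows "Cinf_on (\<lambda>x. A x (v x)) U"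
  using assms Ck_apply_linear[of U A _ v] unfolding Cinf_on_def by metis

section \<open>Symmetry of second derivatives\<close>

lemma directional_derivative_curve:
  assumes "(f has_derivative D) (at (x + t *\<^sub>R v))"
  shows "((\<lambda>s. f (x + s *\<^sub>R v)) has_vector_derivative D v) (at t)"
proof -
  have "((\<lambda>s. x + s *\<^sub>R v) has_vector_derivative v) (at t)" by (auto intro!: derivative_eq_intros)
  from vector_derivative_diff_chain_within[OF this, of f D] show ?thesis
    using assms has_derivative_at_withinI by (auto simp: o_def)
qed

text \<open>Both mixed second derivatives are limits of the same second difference quotient, by two
  applications of the mean value theorem.\<close>

lemma second_difference_mvt:
  fixes f :: "'a::real_normed_vector \<Rightarrow> real"
  assumes "\<And>y. y \<in> ball x e \<Longrightarrow> (f has_derivative D y) (at y)"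
    and "\<And>y. y \<in> ball x e \<Longrightarrow> ((\<lambda>y. D y u) has_derivative E y) (at y)"
    and "0 < s" "0 < t" "s * norm u + t * norm v < e"
  shows "\<exists>y\<in>cball x (s * norm u + t * norm v).
    f (x + s *\<^sub>R u + t *\<^sub>R v) - f (x + s *\<^sub>R u) - f (x + t *\<^sub>R v) + f x = s * (t * E y v)"
proof -
  have in_cball: "x + a *\<^sub>R u + b *\<^sub>R v \<in> cball x (s * norm u + t * norm v)" if "0 \<le> a" "a \<le> s" "0 \<le> b" "b \<le> t" for a b
  proof -
    have "norm (a *\<^sub>R u + b *\<^sub>R v) \<le> a * norm u + b * norm v" using that norm_triangle_ineq[of "a *\<^sub>R u" "b *\<^sub>R v"] by simp
    also have "\<dots> \<le> s * norm u + t * norm v" using that by (intro add_mono mult_right_mono) auto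
    finally have "norm (a *\<^sub>R u + b *\<^sub>R v) \<le> s * norm u + t * norm v" .
    moreover have "dist x (x + a *\<^sub>R u + b *\<^sub>R v) = norm (a *\<^sub>R u + b *\<^sub>R v)"
      by (metis (no_types) add.assoc add_diff_cancel_left' dist_commute dist_norm)
    ultimately show ?thesis by simp
  qed
  have in_ball: "x + a *\<^sub>R u + b *\<^sub>R v \<in> ball x e" if "0 \<le> a" "a \<le> s" "0 \<le> b" "b \<le> t" for a b
    using in_cball[OF that] assms(5) by auto
  define h where "h a = f (x + a *\<^sub>R u + t *\<^sub>R v) - f (x + a *\<^sub>R u)" for a
  have dh: "(h has_vector_derivative (D (x + a *\<^sub>R u + t *\<^sub>R v) u - D (x + a *\<^sub>R u) u)) (at a)" if "0 \<le> a" "a \<le> s" for a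
  proof -
    have "((\<lambda>a. f (x + t *\<^sub>R v + a *\<^sub>R u)) has_vector_derivative D (x + t *\<^sub>R v + a *\<^sub>R u) u) (at a)"
      using in_ball[of a t] that assms(4) by (intro directional_derivative_curve assms(1)) (auto simp: algebra_simps)
    moreover have "((\<lambda>a. f (x + a *\<^sub>R u)) has_vector_derivative D (x + a *\<^sub>R u) u) (at a)"
      using in_ball[of a 0] that assms(4) by (intro directional_derivative_curve assms(1)) auto
    ultimately show ?thesis unfolding h_def[abs_def]
      by (auto intro!: has_vector_derivative_diff simp: algebra_simps)
  qed
  obtain a where a: "0 < a" "a < s" "h s - h 0 = (s - 0) * (D (x + a *\<^sub>R u + t *\<^sub>R v) u - D (x + a *\<^sub>R u) u)"
    using MVT2[OF assms(3), of h "\<lambda>a. D (x + a *\<^sub>R u + t *\<^sub>R v) u - D (x + a *\<^sub>R u) u"] dh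
    by (auto simp: has_real_derivative_iff_has_vector_derivative)
  define k where "k b = D (x + a *\<^sub>R u + b *\<^sub>R v) u" for b
  have dk: "(k has_vector_derivative E (x + a *\<^sub>R u + b *\<^sub>R v) v) (at b)" if "0 \<le> b" "b \<le> t" for b
    unfolding k_def[abs_def] using in_ball[of a b] that a by (intro directional_derivative_curve assms(2)) auto
  obtain b where b: "0 < b" "b < t" "k t - k 0 = (t - 0) * E (x + a *\<^sub>R u + b *\<^sub>R v) v"
    using MVT2[OF assms(4), of k "\<lambda>b. E (x + a *\<^sub>R u + b *\<^sub>R v) v"] dk
    by (auto simp: has_real_derivative_iff_has_vector_derivative)
  show ?thesis
    by (rule bexI[of _ "x + a *\<^sub>R u + b *\<^sub>R v"]) (use a b in_cball[of a b] in \<open>auto simp: h_def k_def algebra_simps\<close>)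
qed

lemma Cinf_on_inner_left:
  fixes f :: "'a::real_normed_vector \<Rightarrow> 'b::euclidean_space"
  shows "open U \<Longrightarrow> Cinf_on f U \<Longrightarrow> Cinf_on (\<lambda>x. f x \<bullet> b) U"
  by (rule Cinf_compose_lin[OF bounded_linear_inner_left])

lemma mixed_derivatives_commute_real:
  fixes f :: "'a::real_normed_vector \<Rightarrow> real"
  assumes "open U" "Cinf_on f U" "x \<in> U"
  shows "frechet_derivative (\<lambda>y. frechet_derivative f (at y) u) (at x) v = frechet_derivative (\<lambda>y. frechet_derivative f (at y) v) (at x) u"
    (is "?E u v x = ?E v u x")
proof -
  obtain e where e: "e > 0" "ball x e \<subseteq> U" using assms openE by blast
  have D: "(f has_derivative frechet_derivative f (at y)) (at y)" if "y \<in> ball x e" for y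
    using that e Cinf_on_has_derivative[OF assms(2)] by blast
  have C: "Cinf_on (\<lambda>y. frechet_derivative f (at y) w) U" for w using assms(2) Cinf_on_iff by blast
  have E: "((\<lambda>y. frechet_derivative f (at y) w) has_derivative frechet_derivative (\<lambda>y. frechet_derivative f (at y) w) (at y)) (at y)" if "y \<in> ball x e" for y w
    using that e Cinf_on_has_derivative[OF C] by blast
  have "continuous_on U (?E w z)" for w z using C Cinf_on_iff Cinf_on_continuous by blast
  then have cont: "isCont (?E w z) x" for w z using assms continuous_on_eq_continuous_at by blast
  \<comment> \<open>The summand \<open>1\<close> keeps the denominator positive when
    \<open>u\<close> and \<open>v\<close> both vanish, and \<open>n + 2\<close> makes the bound by
    \<open>e\<close> strict already for \<open>n = 0\<close>.\<close>
  define r where "r n = (e / (norm u + norm v + 1)) / real (n + 2)" for n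
  have r0: "r n > 0" for n using e by (simp add: r_def add_nonneg_pos)
  have re: "r n * norm u + r n * norm v < e" for n
  proof -
    have "r n * norm u + r n * norm v \<le> r n * (norm u + norm v + 1)" using r0[of n] by (simp add: algebra_simps)
    also have "\<dots> = e / real (n + 2)" unfolding r_def by (simp add: field_simps add_nonneg_eq_0_iff)
    also have "\<dots> < e" using e by (simp add: divide_less_eq)
    finally show ?thesis .
  qed
  have r_lim: "r \<longlonglongrightarrow> 0"
    unfolding r_def using LIMSEQ_ignore_initial_segment[OF lim_const_over_n[of "e / (norm u + norm v + 1)"], of 2] by simp
  have lim: "(\<lambda>n. ?E w z (y n)) \<longlonglongrightarrow> ?E w z x" if "\<And>n. y n \<in> cball x (r n * norm u + r n * norm v)" for y w z
  proof -
    have "(\<lambda>n. r n * norm u + r n * norm v) \<longlonglongrightarrow> 0 * norm u + 0 * norm v" by (intro tendsto_intros r_lim)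
    then have "(\<lambda>n. dist (y n) x) \<longlonglongrightarrow> 0"
      by (intro tendsto_sandwich[OF always_eventually always_eventually, of "\<lambda>_. 0" "\<lambda>n. dist (y n) x" "\<lambda>n. r n * norm u + r n * norm v"])
         (use that in \<open>auto simp: dist_commute\<close>)
    then have "y \<longlonglongrightarrow> x" using tendsto_dist_iff by blast
    then show ?thesis using cont isCont_tendsto_compose by blast
  qed
  have "\<exists>y\<in>cball x (r n * norm u + r n * norm v). f (x + r n *\<^sub>R u + r n *\<^sub>R v) - f (x + r n *\<^sub>R u) - f (x + r n *\<^sub>R v) + f x = r n * (r n * ?E u v y)" for n
    using second_difference_mvt[OF D E r0 r0 re] by blast
  then obtain y where y: "\<And>n. y n \<in> cball x (r n * norm u + r n * norm v)" "\<And>n. f (x + r n *\<^sub>R u + r n *\<^sub>R v) - f (x + r n *\<^sub>R u) - f (x + r n *\<^sub>R v) + f x = r n * (r n * ?E u v (y n))"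
    by metis
  have re': "r n * norm v + r n * norm u < e" for n using re[of n] by simp
  have "\<exists>z\<in>cball x (r n * norm v + r n * norm u). f (x + r n *\<^sub>R v + r n *\<^sub>R u) - f (x + r n *\<^sub>R v) - f (x + r n *\<^sub>R u) + f x = r n * (r n * ?E v u z)" for n
    using second_difference_mvt[OF D E r0 r0 re'] by blast
  then obtain z where z: "\<And>n. z n \<in> cball x (r n * norm u + r n * norm v)" "\<And>n. f (x + r n *\<^sub>R v + r n *\<^sub>R u) - f (x + r n *\<^sub>R v) - f (x + r n *\<^sub>R u) + f x = r n * (r n * ?E v u (z n))"
    by (metis add.commute)
  have "?E u v (y n) = ?E v u (z n)" for n
  proof -
    have "r n * (r n * ?E u v (y n)) = r n * (r n * ?E v u (z n))" using y(2)[of n] z(2)[of n] by (simp add: algebra_simps)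
    then show ?thesis using r0[of n] by simp
  qed
  then show ?thesis using lim[OF y(1), of u v] lim[OF z(1), of v u] LIMSEQ_unique by auto
qed

lemma frechet_derivative_inner_left:
  assumes "(f has_derivative D) (at x)"
  shows "frechet_derivative (\<lambda>x. f x \<bullet> b) (at x) v = D v \<bullet> b"
proof -
  have "((\<lambda>x. f x \<bullet> b) has_derivative (\<lambda>v. D v \<bullet> b)) (at x)" by (rule has_derivative_inner_left[OF assms])
  then show ?thesis by (simp add: frechet_derivative_at[symmetric])
qed

lemma mixed_derivatives_commute:
  fixes f :: "'a::real_normed_vector \<Rightarrow> 'b::euclidean_space"
  assumes "open U" "Cinf_on f U" "x \<in> U"
  shows "frechet_derivative (\<lambda>y. frechet_derivative f (at y) u) (at x) v = frechet_derivative (\<lambda>y. frechet_derivative f (at y) v) (at x) u"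
proof (rule euclidean_eqI)
  fix b :: 'b assume "b \<in> Basis"
  have C: "Cinf_on (\<lambda>y. frechet_derivative f (at y) w) U" for w using assms(2) Cinf_on_iff by blast
  have *: "frechet_derivative (\<lambda>y. frechet_derivative (\<lambda>y. f y \<bullet> b) (at y) w) (at x) z = frechet_derivative (\<lambda>y. frechet_derivative f (at y) w) (at x) z \<bullet> b" for w z
  proof -
    have "frechet_derivative (\<lambda>y. f y \<bullet> b) (at y) w = frechet_derivative f (at y) w \<bullet> b" if "y \<in> U" for y
      by (rule frechet_derivative_inner_left[OF Cinf_on_has_derivative[OF assms(2) that]])
    then have "((\<lambda>y. frechet_derivative (\<lambda>y. f y \<bullet> b) (at y) w) has_derivative (\<lambda>z. frechet_derivative (\<lambda>y. frechet_derivative f (at y) w) (at x) z \<bullet> b)) (at x)"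
      using has_derivative_transform_within_open[OF has_derivative_inner_left[OF Cinf_on_has_derivative[OF C[of w] assms(3)], of b] assms(1,3)]
      by fastforce
    then show ?thesis by (simp add: frechet_derivative_at[symmetric])
  qed
  show "frechet_derivative (\<lambda>y. frechet_derivative f (at y) u) (at x) v \<bullet> b = frechet_derivative (\<lambda>y. frechet_derivative f (at y) v) (at x) u \<bullet> b"
    using mixed_derivatives_commute_real[OF assms(1) Cinf_on_inner_left[OF assms(1,2)] assms(3), of b u v] by (simp add: *)
qed

text \<open>Pointwise inversion is studied through \<open>F (x, w) = (x, D x w)\<close>, whose
  inverse is \<open>G (x, v) = (x, J x v)\<close>. The derivative of an inverse map exists as soon
  as \<open>F\<close> is continuous and differentiable with invertible derivative, so
  differentiability of \<open>J\<close> costs nothing and no determinants appear.\<close>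

lemma inverse_derivative_Cinf:
  fixes g :: "'m::euclidean_space \<Rightarrow> 'm"
  assumes W: "open W" and g: "Cinf_on g W"
    and J: "\<And>x v. x \<in> W \<Longrightarrow> frechet_derivative g (at x) (J x v) = v"
      "\<And>x v. x \<in> W \<Longrightarrow> J x (frechet_derivative g (at x) v) = v"
  shows "Cinf_on (\<lambda>x. J x v) W"
proof -
  define D where "D x = frechet_derivative g (at x)" for x
  define E where "E b x = frechet_derivative (\<lambda>x. D x b) (at x)" for b x
  define Q where "Q x w u = (\<Sum>b\<in>Basis. (w \<bullet> b) *\<^sub>R E b x u)" for x w u
  have JD: "D x (J x v) = v" "J x (D x v) = v" if "x \<in> W" for x v using J that by (auto simp: D_def)
  have linD: "linear (D x)" if "x \<in> W" for x
    unfolding D_def using Cinf_on_has_derivative[OF g that] has_derivative_linear by blast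
  have linJ: "linear (J x)" if "x \<in> W" for x
  proof (rule linearI)
    show "J x (u + v) = J x u + J x v" for u v using JD[OF that] linear_add[OF linD[OF that]] by metis
    show "J x (c *\<^sub>R u) = c *\<^sub>R J x u" for c u using JD[OF that] linear_cmul[OF linD[OF that]] by metis
  qed
  have CD: "Cinf_on (\<lambda>x. D x b) W" for b unfolding D_def using g Cinf_on_iff by blast
  have CE: "Cinf_on (\<lambda>x. E b x u) W" for b u unfolding E_def using CD Cinf_on_iff by blast
  define F where "F z = (fst z, D (fst z) (snd z))" for z :: "'m \<times> 'm"
  define G where "G z = (fst z, J (fst z) (snd z))" for z :: "'m \<times> 'm"
  have dF: "(F has_derivative (\<lambda>(u, z). (u, Q x w u + D x z))) (at (x, w))" if "x \<in> W" for x w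
  proof -
    have 1: "((\<lambda>z. D (fst z) b) has_derivative (\<lambda>u. E b x (fst u))) (at (x, w))" for b
    proof -
      have "((\<lambda>x. D x b) has_derivative E b x) (at (fst (x, w)))" using Cinf_on_has_derivative[OF CD that] E_def by auto
      from diff_chain_at[OF has_derivative_fst[OF has_derivative_ident] this] show ?thesis by (simp add: o_def)
    qed
    have "((\<lambda>z. \<Sum>b\<in>Basis. (snd z \<bullet> b) *\<^sub>R D (fst z) b) has_derivative
        (\<lambda>u. \<Sum>b\<in>Basis. (w \<bullet> b) *\<^sub>R E b x (fst u) + (snd u \<bullet> b) *\<^sub>R D x b)) (at (x, w))"
      by (rule has_derivative_eq_rhs, (rule has_derivative_sum has_derivative_scaleR has_derivative_inner_left has_derivative_snd has_derivative_ident 1)+) simp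
    moreover have "(\<Sum>b\<in>Basis. (w \<bullet> b) *\<^sub>R E b x (fst u) + (snd u \<bullet> b) *\<^sub>R D x b) = Q x w (fst u) + D x (snd u)" for u
      unfolding Q_def sum.distrib using linear_expand[OF linD[OF that], of "snd u"] by simp
    ultimately have "((\<lambda>z. \<Sum>b\<in>Basis. (snd z \<bullet> b) *\<^sub>R D (fst z) b) has_derivative (\<lambda>u. Q x w (fst u) + D x (snd u))) (at (x, w))" by simp
    then have "((\<lambda>z. D (fst z) (snd z)) has_derivative (\<lambda>u. Q x w (fst u) + D x (snd u))) (at (x, w))"
    proof (rule has_derivative_transform_within_open)
      show "open (W \<times> (UNIV :: 'm set))" using W open_Times by blast
      show "(\<Sum>b\<in>Basis. (snd z \<bullet> b) *\<^sub>R D (fst z) b) = D (fst z) (snd z)" if "z \<in> W \<times> UNIV" for z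
        using linear_expand[OF linD, of "fst z" "snd z"] that by auto
    qed (use that in auto)
    then show ?thesis unfolding F_def[abs_def] case_prod_beta
      by (intro has_derivative_Pair has_derivative_fst has_derivative_ident)
  qed
  have dJ: "((\<lambda>x. J x v) has_derivative (\<lambda>u. - J x (Q x (J x v) u))) (at x)" if "x \<in> W" for x v
  proof -
    \<comment> \<open>The derivative of \<open>F\<close> is block triangular with \<open>D x\<close>
      in the lower corner, so its inverse is written with \<open>J x\<close> alone.\<close>
    have "(G has_derivative (\<lambda>(u, z). (u, J x (z - Q x (J x v) u)))) (at (F (x, J x v)))"
    proof (rule has_derivative_inverse_strong[where S="W \<times> UNIV" and f=F and x="(x, J x v)" and f'="\<lambda>(u, z). (u, Q x (J x v) u + D x z)"])
      show "continuous_on (W \<times> UNIV) F"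
        using dF has_derivative_continuous by (intro continuous_at_imp_continuous_on) fastforce
      show "(F has_derivative (\<lambda>(u, z). (u, Q x (J x v) u + D x z))) (at (x, J x v))" by (rule dF[OF that])
    qed (use W that JD in \<open>auto simp: open_Times F_def G_def fun_eq_iff\<close>)
    moreover have "F (x, J x v) = (x, v)" using JD that by (simp add: F_def)
    ultimately have "(G has_derivative (\<lambda>(u, z). (u, J x (z - Q x (J x v) u)))) (at (x, v))" by simp
    from diff_chain_at[OF has_derivative_Pair[OF has_derivative_ident has_derivative_const] this]
    have "((\<lambda>y. G (y, v)) has_derivative (\<lambda>u. (u, J x (0 - Q x (J x v) u)))) (at x)" by (simp add: o_def)
    from has_derivative_snd[OF this] show ?thesis
      using linear_neg[OF linJ[OF that]] by (simp add: G_def)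
  qed
  \<comment> \<open>Bootstrapping: the derivative of \<open>J\<close> is \<open>- J Q J\<close>, an
    expression in \<open>J\<close> itself and in second derivatives of \<open>g\<close>, so each
    order of smoothness yields the next.\<close>
  have "Ck_on k (\<lambda>x. J x v) W" for k v
  proof (induction k arbitrary: v)
    case 0
    show ?case using dJ has_derivative_continuous continuous_at_imp_continuous_on by (metis Ck_on.simps(1))
  next
    case (Suc k)
    have "Ck_on k (\<lambda>x. frechet_derivative (\<lambda>x. J x v) (at x) u) W" for u
    proof (rule Ck_on_cong[OF W])
      show "- J x (Q x (J x v) u) = frechet_derivative (\<lambda>x. J x v) (at x) u" if "x \<in> W" for x
        using frechet_derivative_at[OF dJ[OF that]] by metis
      have "Ck_on k (\<lambda>x. J x (Q x (J x v) u)) W"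
      proof (rule Ck_apply_linear[OF W linJ Suc.IH])
        show "Ck_on k (\<lambda>x. Q x (J x v) u) W" unfolding Q_def
          using CE unfolding Cinf_on_def
          by (intro Ck_sum Ck_bilin[OF bounded_bilinear_scaleR] Ck_compose_lin[OF bounded_linear_inner_left] Suc.IH W finite_Basis) auto
      qed
      then show "Ck_on k (\<lambda>x. - J x (Q x (J x v) u)) W"
        by (rule Ck_compose_lin[OF bounded_linear_minus[OF bounded_linear_ident] W])
    qed
    moreover have "(\<lambda>x. J x v) differentiable (at x)" if "x \<in> W" for x using dJ[OF that] differentiable_def by blast
    ultimately show ?case by simp
  qed
  then show ?thesis by (simp add: Cinf_on_def)
qed

text \<open>The inverse function theorem yields a differentiable inverse \<open>h\<close> with
  derivative \<open>J (h y)\<close>. Since \<open>J\<close> is smooth, \<open>h\<close> being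
  \<open>C^k\<close> makes its derivative \<open>C^k\<close>, which raises the order step by
  step.\<close>

lemma Cinf_local_inverse:
  fixes g :: "'m::euclidean_space \<Rightarrow> 'm"
  assumes W: "open W" and g: "Cinf_on g W" and x0: "x0 \<in> W" and inj: "inj (frechet_derivative g (at x0))"
  obtains U V h where "open U" "U \<subseteq> W" "x0 \<in> U" "open V" "homeomorphism U V g h" "Cinf_on h V"
proof -
  define D where "D x = frechet_derivative g (at x)" for x
  have dg: "(g has_derivative D x) (at x)" if "x \<in> W" for x
    unfolding D_def using Cinf_on_has_derivative[OF g that] .
  have bl: "bounded_linear (D x)" if "x \<in> W" for x using dg[OF that] has_derivative_bounded_linear by blast
  then have app: "blinfun_apply (Blinfun (D x)) = D x" if "x \<in> W" for x using that bounded_linear_Blinfun_apply by blast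
  have 1: "(g has_derivative blinfun_apply (Blinfun (D x))) (at x)" if "x \<in> W" for x using dg app that by simp
  have 2: "continuous_on W (\<lambda>x. Blinfun (D x))"
  proof (rule continuous_on_blinfun_componentwise)
    fix i :: 'm
    have "continuous_on W (\<lambda>x. D x i)" unfolding D_def using g Cinf_on_iff Cinf_on_continuous by blast
    then show "continuous_on W (\<lambda>x. blinfun_apply (Blinfun (D x)) i)"
      by (rule continuous_on_eq) (simp add: app)
  qed
  obtain A where A: "linear A" "A \<circ> D x0 = id" using linear_injective_left_inverse[of "D x0"] inj D_def linear_linear bl[OF x0] by metis
  have 3: "Blinfun A o\<^sub>L Blinfun (D x0) = id_blinfun"
    by (rule blinfun_eqI) (use A(2) in \<open>simp add: app[OF x0] bounded_linear_Blinfun_apply[OF A(1)[unfolded linear_conv_bounded_linear]] fun_eq_iff\<close>)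
  obtain U V h h' where U: "open U" "U \<subseteq> W" "x0 \<in> U" "open V" "homeomorphism U V g h"
    and h: "\<And>y. y \<in> V \<Longrightarrow> (h has_derivative (h' y)) (at y)"
    "\<And>y. y \<in> V \<Longrightarrow> h' y = inv_into UNIV (blinfun_apply (Blinfun (D (h y))))"
    "\<And>y. y \<in> V \<Longrightarrow> bij (blinfun_apply (Blinfun (D (h y))))"
    by (rule inverse_function_theorem[OF W 1 2 x0 3], assumption, rule that)
  have hV: "h y \<in> U" "g (h y) = y" if "y \<in> V" for y using U(5) that by (auto simp: homeomorphism_def)
  have gU: "g x \<in> V" "h (g x) = x" if "x \<in> U" for x using U(5) that by (auto simp: homeomorphism_def)
  define J where "J x = inv_into UNIV (D x)" for x
  have bij: "bij (D x)" if "x \<in> U" for x using h(3)[OF gU(1)[OF that]] gU(2)[OF that] app[of x] U(2) that by (simp add: subsetD)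
  have CJ: "Cinf_on (\<lambda>x. J x v) U" for v
  proof (rule inverse_derivative_Cinf[OF U(1) Cinf_on_subset[OF g U(2)]])
    show "frechet_derivative g (at x) (J x v) = v" "J x (frechet_derivative g (at x) v) = v" if "x \<in> U" for x v
      using bij[OF that] unfolding J_def D_def by (simp_all add: bij_is_surj surj_f_inv_f bij_is_inj inv_f_f)
  qed
  have dh: "(h has_derivative J (h y)) (at y)" if "y \<in> V" for y
  proof -
    have "h y \<in> W" using hV(1)[OF that] U(2) by blast
    then show ?thesis using h(1)[OF that] by (simp add: h(2)[OF that] app J_def)
  qed
  have "Ck_on k h V" for k
  proof (induction k)
    case 0 then show ?case using U(5) by (simp add: homeomorphism_def)
  next
    case (Suc k)
    have "Ck_on k (\<lambda>y. frechet_derivative h (at y) v) V" for v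
    proof (rule Ck_on_cong[OF U(4)])
      show "J (h y) v = frechet_derivative h (at y) v" if "y \<in> V" for y using frechet_derivative_at[OF dh[OF that]] by metis
      show "Ck_on k (\<lambda>y. J (h y) v) V"
        by (rule Ck_compose[OF U(4,1) hV(1) Suc]) (use CJ[of v] in \<open>auto simp: Cinf_on_def\<close>)
    qed
    moreover have "h differentiable (at y)" if "y \<in> V" for y using dh[OF that] differentiable_def by blast
    ultimately show ?case by simp
  qed
  then show ?thesis using U by (intro that) (auto simp: Cinf_on_def)
qed

section \<open>Smooth maps between submanifolds\<close>

text \<open>\<open>differential\<close> is a choice among derivatives within \<open>S\<close>;
  restricting the derivative of a local smooth extension shows that there is something to
  choose.\<close>

lemma smooth_on_has_derivative:
  assumes "smooth_on S f" "x \<in> S"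
  shows "(f has_derivative differential S f x) (at x within S)"
proof -
  obtain U h where U: "open U" "x \<in> U" "Cinf_on h U" "\<forall>y\<in>U \<inter> S. f y = h y"
    using assms unfolding smooth_on_def by blast
  have "(h has_derivative frechet_derivative h (at x)) (at x within S)"
    using Cinf_on_has_derivative[OF U(3,2)] has_derivative_at_withinI by blast
  moreover obtain e where e: "e > 0" "ball x e \<subseteq> U" using U openE by blast
  ultimately have "(f has_derivative frechet_derivative h (at x)) (at x within S)"
    using has_derivative_transform_within[of h _ x S e f] assms(2) U(4) by (auto simp: subset_iff dist_commute)
  then show ?thesis using frechet_derivative_works differentiable_def by blast
qed

lemma has_derivative_curve:
  assumes "(f has_derivative D) (at (c t) within S)" "(c has_vector_derivative v) (at t)"
    "open I" "t \<in> I" "c ` I \<subseteq> S"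
  shows "((\<lambda>t. f (c t)) has_vector_derivative D v) (at t)"
proof -
  have "(c has_vector_derivative v) (at t within I)" using assms(2) has_vector_derivative_at_within by blast
  moreover have "(f has_derivative D) (at (c t) within c ` I)" using assms has_derivative_subset by blast
  ultimately have "((\<lambda>t. f (c t)) has_vector_derivative D v) (at t within I)"
    using vector_derivative_diff_chain_within[of c v t I f D] by (simp add: o_def)
  then show ?thesis using assms(3,4) at_within_open by metis
qed

lemma smooth_on_curve:
  assumes "smooth_on S f" "(c has_vector_derivative v) (at t)" "open I" "t \<in> I" "c ` I \<subseteq> S"
  shows "((\<lambda>t. f (c t)) has_vector_derivative differential S f (c t) v) (at t)"
proof -
  have "c t \<in> S" using assms(4,5) by blast
  from has_derivative_curve[OF smooth_on_has_derivative[OF assms(1) this] assms(2-5)] show ?thesis .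
qed

lemma tangent_spaceE:
  assumes "v \<in> tangent_space S x"
  obtains c e where "0 < e" "Cinf_on c {-e<..<e}" "c ` {-e<..<e} \<subseteq> S" "c 0 = x" "(c has_vector_derivative v) (at (0::real))"
  using assms unfolding tangent_space_def by blast

text \<open>A tangent vector is the velocity of a curve in \<open>S\<close>, and any derivative
  within \<open>S\<close> sends it to the velocity of the image curve, which does not depend on the
  choice.\<close>

lemma differential_eq:
  assumes "(f has_derivative D) (at x within S)" "v \<in> tangent_space S x"
  shows "differential S f x v = D v"
proof -
  obtain c e where c: "0 < e" "c ` {-e<..<e} \<subseteq> S" "c 0 = x" "(c has_vector_derivative v) (at (0::real))"
    using tangent_spaceE[OF assms(2)] by metis
  have "(f has_derivative differential S f x) (at x within S)"
    using assms(1) frechet_derivative_works differentiable_def by blast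
  then have "((\<lambda>t. f (c t)) has_vector_derivative differential S f x v) (at 0)"
    using has_derivative_curve[of f _ c 0 S v "{-e<..<e}"] c by auto
  moreover have "((\<lambda>t. f (c t)) has_vector_derivative D v) (at 0)"
    using has_derivative_curve[of f _ c 0 S v "{-e<..<e}"] c assms(1) by auto
  ultimately show ?thesis using vector_derivative_at by metis
qed

lemma smooth_on_compose_Cinf:
  fixes c :: "'m::real_normed_vector \<Rightarrow> 'a::euclidean_space"
  assumes "smooth_on S f" "open I" "Cinf_on c I" "c ` I \<subseteq> S"
  shows "Cinf_on (\<lambda>t. f (c t)) I"
proof (rule Cinf_on_local)
  fix t assume t: "t \<in> I"
  then obtain U h where U: "open U" "c t \<in> U" "Cinf_on h U" "\<forall>y\<in>U \<inter> S. f y = h y"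
    using assms(1,4) unfolding smooth_on_def by blast
  have o: "open (I \<inter> c -` U)" using Cinf_on_continuous[OF assms(3)] U(1) assms(2) continuous_open_preimage by blast
  have "Cinf_on (\<lambda>t. h (c t)) (I \<inter> c -` U)"
    by (rule Cinf_compose[OF o U(1) _ Cinf_on_subset[OF assms(3)] U(3)]) auto
  then have "Cinf_on (\<lambda>t. f (c t)) (I \<inter> c -` U)"
    by (rule Cinf_on_cong[OF o, rotated]) (use assms(4) U(4) in auto)
  then show "\<exists>V. open V \<and> t \<in> V \<and> Cinf_on (\<lambda>t. f (c t)) V" using o t U(2) by blast
qed

lemma smooth_on_UNIV_iff: "smooth_on UNIV f \<longleftrightarrow> Cinf_on f (UNIV :: 'a::euclidean_space set)"
  using smooth_on_compose_Cinf[of UNIV f UNIV "\<lambda>x. x"] smooth_UNIV[of f] by (auto simp: Cinf_id)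

lemma smooth_on_subset: "smooth_on S f \<Longrightarrow> T \<subseteq> S \<Longrightarrow> smooth_on T f"
  unfolding smooth_on_def
proof
  fix x assume a: "\<forall>x\<in>S. \<exists>U h. open U \<and> x \<in> U \<and> Cinf_on h U \<and> (\<forall>y\<in>U \<inter> S. f y = h y)" "T \<subseteq> S" "x \<in> T"
  then obtain U h where "open U" "x \<in> U" "Cinf_on h U" "\<forall>y\<in>U \<inter> S. f y = h y" by blast
  with a(2) show "\<exists>U h. open U \<and> x \<in> U \<and> Cinf_on h U \<and> (\<forall>y\<in>U \<inter> T. f y = h y)"
    by (intro exI[of _ U] exI[of _ h]) auto
qed

lemma smooth_on_cong: "(\<And>x. x \<in> S \<Longrightarrow> f x = h x) \<Longrightarrow> smooth_on S f \<Longrightarrow> smooth_on S h"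
  unfolding smooth_on_def
proof
  fix x assume a: "\<And>x. x \<in> S \<Longrightarrow> f x = h x" "\<forall>x\<in>S. \<exists>U h. open U \<and> x \<in> U \<and> Cinf_on h U \<and> (\<forall>y\<in>U \<inter> S. f y = h y)" "x \<in> S"
  then obtain U k where "open U" "x \<in> U" "Cinf_on k U" "\<forall>y\<in>U \<inter> S. f y = k y" by blast
  with a(1) show "\<exists>U k. open U \<and> x \<in> U \<and> Cinf_on k U \<and> (\<forall>y\<in>U \<inter> S. h y = k y)"
    by (intro exI[of _ U] exI[of _ k]) auto
qed

lemma smooth_on_compose:
  fixes f :: "'a::real_normed_vector \<Rightarrow> 'b::euclidean_space"
  assumes "smooth_on S f" "f ` S \<subseteq> T" "smooth_on T h"
  shows "smooth_on S (\<lambda>x. h (f x))"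
  unfolding smooth_on_def
proof
  fix x assume x: "x \<in> S"
  then obtain U F where U: "open U" "x \<in> U" "Cinf_on F U" "\<forall>y\<in>U \<inter> S. f y = F y"
    using assms(1) unfolding smooth_on_def by blast
  have "F x \<in> T" using U x assms(2) by force
  then obtain V H where V: "open V" "F x \<in> V" "Cinf_on H V" "\<forall>y\<in>V \<inter> T. h y = H y"
    using assms(3) unfolding smooth_on_def by blast
  have o: "open (U \<inter> F -` V)" using Cinf_on_continuous[OF U(3)] U(1) V(1) continuous_open_preimage by blast
  have "Cinf_on (\<lambda>t. H (F t)) (U \<inter> F -` V)"
    by (rule Cinf_compose[OF o V(1) _ Cinf_on_subset[OF U(3)] V(3)]) auto
  then show "\<exists>U k. open U \<and> x \<in> U \<and> Cinf_on k U \<and> (\<forall>y\<in>U \<inter> S. h (f y) = k y)"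
    using o U(2,4) V(2,4) assms(2) by (intro exI[of _ "U \<inter> F -` V"] exI[of _ "\<lambda>t. H (F t)"]) auto
qed

lemma smooth_on_continuous: 
  assumes "smooth_on S f" shows "continuous_on S f"
  using has_derivative_continuous_on[OF smooth_on_has_derivative[OF assms]] .

lemma differential_tangent:
  fixes f :: "'a::euclidean_space \<Rightarrow> 'b::euclidean_space"
  assumes "smooth_on S f" "f ` S \<subseteq> T" "v \<in> tangent_space S x"
  shows "differential S f x v \<in> tangent_space T (f x)"
proof -
  obtain c e where c: "0 < e" "Cinf_on c {-e<..<e}" "c ` {-e<..<e} \<subseteq> S" "c 0 = x" "(c has_vector_derivative v) (at (0::real))"
    using tangent_spaceE[OF assms(3)] by metis
  have "Cinf_on (\<lambda>t. f (c t)) {-e<..<e}" by (rule smooth_on_compose_Cinf[OF assms(1) _ c(2,3)]) simp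
  moreover have "((\<lambda>t. f (c t)) has_vector_derivative differential S f x v) (at 0)"
    using smooth_on_curve[OF assms(1) c(5), of "{-e<..<e}"] c by auto
  moreover have "(\<lambda>t. f (c t)) ` {-e<..<e} \<subseteq> T" using c(3) assms(2) by auto
  ultimately show ?thesis unfolding tangent_space_def using c(1,4) by (intro CollectI exI[of _ "\<lambda>t. f (c t)"] exI[of _ e]) auto
qed

lemma differential_compose:
  fixes f :: "'a::euclidean_space \<Rightarrow> 'b::euclidean_space" and h :: "'b \<Rightarrow> 'c::euclidean_space"
  assumes "smooth_on S f" "f ` S \<subseteq> T" "smooth_on T h" "x \<in> S" "v \<in> tangent_space S x"
  shows "differential S (\<lambda>x. h (f x)) x v = differential T h (f x) (differential S f x v)"
proof -
  have "(h has_derivative differential T h (f x)) (at (f x) within f ` S)"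
    using smooth_on_has_derivative[OF assms(3)] assms(2,4) has_derivative_subset by blast
  from diff_chain_within[OF smooth_on_has_derivative[OF assms(1,4)] this]
  have "((\<lambda>x. h (f x)) has_derivative (\<lambda>v. differential T h (f x) (differential S f x v))) (at x within S)" by (simp add: o_def)
  then show ?thesis using differential_eq assms(5) by blast
qed

lemma differential_cong:
  assumes "\<And>x. x \<in> S \<Longrightarrow> f x = h x" "smooth_on S f" "x \<in> S" "v \<in> tangent_space S x"
  shows "differential S f x v = differential S h x v"
proof -
  have "(h has_derivative differential S f x) (at x within S)"
    by (rule has_derivative_transform[OF assms(3) _ smooth_on_has_derivative[OF assms(2,3)]]) (simp add: assms(1))
  then show ?thesis using differential_eq assms(4) by metis
qed

lemma differential_ident: "x \<in> S \<Longrightarrow> v \<in> tangent_space S x \<Longrightarrow> differential S (\<lambda>x. x) x v = v"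
  using differential_eq[OF has_derivative_ident] by blast

lemma tangent_space_mono: "S \<subseteq> T \<Longrightarrow> tangent_space S x \<subseteq> tangent_space T x"
  unfolding tangent_space_def by blast

lemma linear_differential: "smooth_on S f \<Longrightarrow> x \<in> S \<Longrightarrow> linear (differential S f x)"
  by (rule has_derivative_linear[OF smooth_on_has_derivative])

lemma homeomorphism_derivatives:
  assumes "open X" "open Y" "homeomorphism X Y \<phi> \<psi>" "x \<in> X"
    and d\<phi>: "(\<phi> has_derivative D\<phi>) (at x)" and d\<psi>: "(\<psi> has_derivative D\<psi>) (at (\<phi> x))"
  shows "D\<psi> (D\<phi> v) = v" "D\<phi> (D\<psi> w) = w"
proof -
  have X': "\<And>x. x \<in> X \<Longrightarrow> \<psi> (\<phi> x) = x" "\<phi> x \<in> Y" and Y': "\<And>y. y \<in> Y \<Longrightarrow> \<phi> (\<psi> y) = y"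
    using assms(3,4) by (auto simp: homeomorphism_def)
  have "((\<lambda>x. x) has_derivative D\<psi> \<circ> D\<phi>) (at x)"
    using diff_chain_at[OF d\<phi> d\<psi>] assms(1,4) by (rule has_derivative_transform_within_open) (simp add: X')
  then show "D\<psi> (D\<phi> v) = v" using has_derivative_unique[OF _ has_derivative_ident] by (metis comp_apply)
  have d\<phi>': "(\<phi> has_derivative D\<phi>) (at (\<psi> (\<phi> x)))" using d\<phi> X'(1)[OF assms(4)] by simp
  have "((\<lambda>x. x) has_derivative D\<phi> \<circ> D\<psi>) (at (\<phi> x))"
    using diff_chain_at[OF d\<psi> d\<phi>'] assms(2) X'(2) by (rule has_derivative_transform_within_open) (simp add: Y')
  then show "D\<phi> (D\<psi> w) = w" using has_derivative_unique[OF _ has_derivative_ident] by (metis comp_apply)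
qed

text \<open>A chart \<open>\<phi>\<close> straightens \<open>S\<close> to a subspace
  \<open>L\<close>, and a linear left inverse \<open>B\<close> of the derivative of
  \<open>\<phi> \<circ> f\<close> turns the problem into inverting
  \<open>B \<circ> \<phi> \<circ> f\<close> between spaces of equal dimension. The resulting inverse
  \<open>h\<close> lives on an ambient open set, as smoothness on a subset demands.\<close>

lemma immersion_local_inverse:
  fixes f :: "'m::euclidean_space \<Rightarrow> 'a::euclidean_space"
  assumes S: "submanifold k S" and W: "open W" "x0 \<in> W" and f: "Cinf_on f W" "f ` W \<subseteq> S"
    and inj: "\<And>v. frechet_derivative f (at x0) v = 0 \<Longrightarrow> v = 0"
    and sur: "tangent_space S (f x0) \<subseteq> range (frechet_derivative f (at x0))"
  obtains U P h where "open U" "x0 \<in> U" "U \<subseteq> W" "open P" "f ` U = P \<inter> S" "Cinf_on h P"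
    "\<And>y. y \<in> U \<Longrightarrow> h (f y) = y" "\<And>x. x \<in> P \<inter> S \<Longrightarrow> h x \<in> U \<and> f (h x) = x"
proof -
  have fS: "f x0 \<in> S" using W f by blast
  obtain X Y \<phi> \<psi> L where X: "open X" "f x0 \<in> X" "open Y" "homeomorphism X Y \<phi> \<psi>"
    and \<phi>: "Cinf_on \<phi> X" and \<psi>: "Cinf_on \<psi> Y" and L: "subspace (L :: 'a set)" "\<phi> ` (X \<inter> S) = Y \<inter> L"
    using S[unfolded submanifold_def, rule_format, OF fS] by blast
  have X': "\<And>x. x \<in> X \<Longrightarrow> \<psi> (\<phi> x) = x" "\<And>x. x \<in> X \<Longrightarrow> \<phi> x \<in> Y"
    using X(4) by (auto simp: homeomorphism_def)
  define W1 where "W1 = W \<inter> f -` X"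
  have W1: "open W1" "x0 \<in> W1" "W1 \<subseteq> W"
    using Cinf_on_continuous[OF f(1)] X(1,2) W continuous_open_preimage by (auto simp: W1_def)
  define Df where "Df = frechet_derivative f (at x0)"
  define D\<phi> where "D\<phi> = frechet_derivative \<phi> (at (f x0))"
  define D\<psi> where "D\<psi> = frechet_derivative \<psi> (at (\<phi> (f x0)))"
  have df: "(f has_derivative Df) (at x0)" unfolding Df_def by (rule Cinf_on_has_derivative[OF f(1) W(2)])
  have d\<phi>: "(\<phi> has_derivative D\<phi>) (at (f x0))" unfolding D\<phi>_def by (rule Cinf_on_has_derivative[OF \<phi> X(2)])
  have d\<psi>: "(\<psi> has_derivative D\<psi>) (at (\<phi> (f x0)))" unfolding D\<psi>_def by (rule Cinf_on_has_derivative[OF \<psi> X'(2)[OF X(2)]])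
  have 1: "D\<psi> (D\<phi> v) = v" for v by (rule homeomorphism_derivatives(1)[OF X(1,3,4,2) d\<phi> d\<psi>])
  have 2: "D\<phi> (D\<psi> v) = v" for v by (rule homeomorphism_derivatives(2)[OF X(1,3,4,2) d\<phi> d\<psi>])
  have dA: "((\<lambda>x. \<phi> (f x)) has_derivative (\<lambda>v. D\<phi> (Df v))) (at x0)" using diff_chain_at[OF df d\<phi>] by (simp add: o_def)
  then have linA: "linear (\<lambda>v. D\<phi> (Df v))" using has_derivative_linear by blast
  have injA: "inj (\<lambda>v. D\<phi> (Df v))"
  proof (subst linear_injective_0[OF linA], intro allI impI)
    fix v assume "D\<phi> (Df v) = 0"
    then have "Df v = 0" using 1 linear_0[OF has_derivative_linear[OF d\<psi>]] by metis
    then show "v = 0" using inj by (simp add: Df_def)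
  qed
  obtain B where B: "linear B" "B \<circ> (\<lambda>v. D\<phi> (Df v)) = id" using linear_injective_left_inverse[OF linA injA] by blast
  have \<phi>L: "\<phi> (f x0) \<in> L" using L(2) X(2) fS by blast
  \<comment> \<open>A short segment in direction \<open>l\<close>, pulled back by
    \<open>\<psi>\<close>, is a curve in \<open>S\<close>. Hence \<open>D\<psi> l\<close> is tangent
    to \<open>S\<close> and lies in the range of \<open>Df\<close> by \<open>sur\<close>.\<close>
  have rangeL: "\<exists>w. l = D\<phi> (Df w)" if "l \<in> L" for l
  proof -
    define y where "y = \<phi> (f x0)"
    have "y \<in> Y" using X' X(2) y_def by blast
    then obtain d where d: "d > 0" "ball y d \<subseteq> Y" using X(3) openE by blast
    define e where "e = d / (norm l + 1)"
    have e: "e > 0" using d by (simp add: e_def add_nonneg_pos)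
    have bal: "y + t *\<^sub>R l \<in> Y" if "t \<in> {-e<..<e}" for t
    proof -
      have "\<bar>t\<bar> * norm l \<le> \<bar>t\<bar> * (norm l + 1)" by (simp add: mult_left_mono)
      also have "\<dots> < e * (norm l + 1)" using that by (intro mult_strict_right_mono) (auto simp: add_nonneg_pos)
      also have "\<dots> = d" using norm_ge_zero[of l] unfolding e_def by (simp add: add_nonneg_eq_0_iff)
      finally show ?thesis using d(2) by (auto simp: dist_norm)
    qed
    have yl: "y + t *\<^sub>R l \<in> L" for t using \<phi>L that L(1) by (simp add: y_def subspace_add subspace_scale)
    have "D\<psi> l \<in> tangent_space S (f x0)"
      unfolding tangent_space_def
    proof (intro CollectI exI conjI)
      show "0 < e" by fact
      show "Cinf_on (\<lambda>t. \<psi> (y + t *\<^sub>R l)) {-e<..<e}"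
        by (rule Cinf_compose[OF _ X(3) bal _ \<psi>]) (auto intro!: Cinf_intros)
      show "(\<lambda>t. \<psi> (y + t *\<^sub>R l)) ` {-e<..<e} \<subseteq> S"
      proof safe
        fix t assume "t \<in> {-e<..<e}"
        then have "y + t *\<^sub>R l \<in> \<phi> ` (X \<inter> S)" using bal yl L(2) by auto
        then show "\<psi> (y + t *\<^sub>R l) \<in> S" using X' by auto
      qed
      show "\<psi> (y + 0 *\<^sub>R l) = f x0" using X'(1)[OF X(2)] by (simp add: y_def)
      show "((\<lambda>t. \<psi> (y + t *\<^sub>R l)) has_vector_derivative D\<psi> l) (at 0)"
        by (rule directional_derivative_curve) (use d\<psi> in \<open>simp add: y_def\<close>)
    qed
    then obtain w where "D\<psi> l = Df w" using sur Df_def by auto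
    then show ?thesis using 2 by metis
  qed
  \<comment> \<open>\<open>B\<close> is injective on the range of the derivative of
    \<open>\<phi> \<circ> f\<close>, and that range contains \<open>L\<close>. This later recovers a
    point of \<open>S\<close> from its image under \<open>B \<circ> \<phi>\<close>.\<close>
  have BL: "l = l'" if "l \<in> L" "l' \<in> L" "B l = B l'" for l l'
    using rangeL[OF that(1)] rangeL[OF that(2)] that(3) B(2) by (metis comp_apply id_apply)
  define g where "g x = B (\<phi> (f x))" for x
  have blB: "bounded_linear B" using B(1) linear_conv_bounded_linear by blast
  have c\<phi>f: "Cinf_on (\<lambda>x. \<phi> (f x)) W1"
    by (rule Cinf_compose[OF W1(1) X(1) _ Cinf_on_subset[OF f(1) W1(3)] \<phi>]) (simp add: W1_def)
  have cg: "Cinf_on g W1" unfolding g_def[abs_def] by (rule Cinf_compose_lin[OF blB W1(1) c\<phi>f])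
  have "(g has_derivative (\<lambda>v. B (D\<phi> (Df v)))) (at x0)"
    unfolding g_def[abs_def] by (rule bounded_linear.has_derivative[OF blB dA])
  then have "frechet_derivative g (at x0) = (\<lambda>v. v)" using frechet_derivative_at B(2) by (metis (no_types) comp_def id_def)
  then have "inj (frechet_derivative g (at x0))" by simp
  from Cinf_local_inverse[OF W1(1) cg W1(2) this]
  obtain U V \<theta> where U: "open U" "U \<subseteq> W1" "x0 \<in> U" "open V" "homeomorphism U V g \<theta>" "Cinf_on \<theta> V" by blast
  have gU: "g x \<in> V" "\<theta> (g x) = x" if "x \<in> U" for x using U(5) that by (auto simp: homeomorphism_def)
  have hV: "\<theta> y \<in> U" "g (\<theta> y) = y" if "y \<in> V" for y using U(5) that by (auto simp: homeomorphism_def)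
  define h where "h x = \<theta> (B (\<phi> x))" for x
  define O' where "O' = X \<inter> (\<lambda>x. B (\<phi> x)) -` V"
  have cB\<phi>: "Cinf_on (\<lambda>x. B (\<phi> x)) X" by (rule Cinf_compose_lin[OF blB X(1) \<phi>])
  have O': "open O'" unfolding O'_def using Cinf_on_continuous[OF cB\<phi>] X(1) U(4) continuous_open_preimage by blast
  have fU: "f x \<in> O' \<inter> S" "h (f x) = x" if "x \<in> U" for x
    using that U(2) gU[OF that] f(2) by (auto simp: O'_def W1_def g_def h_def)
  have hO: "h x \<in> U \<and> f (h x) = x" if "x \<in> O' \<inter> S" for x
  proof -
    have h: "h x \<in> U" "g (h x) = B (\<phi> x)" using that hV by (auto simp: h_def O'_def)
    have "f (h x) \<in> X \<inter> S" using h U(2) W1_def f(2) by auto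
    then have "\<phi> (f (h x)) \<in> L" "\<phi> x \<in> L" using L(2) that O'_def by auto
    then have "\<phi> (f (h x)) = \<phi> x" using BL h(2) by (simp add: g_def)
    then have "f (h x) = x" using X'(1) \<open>f (h x) \<in> X \<inter> S\<close> that O'_def by (metis IntD1)
    then show ?thesis using h by simp
  qed
  have "f ` U = O' \<inter> S" using fU hO by force
  moreover have "Cinf_on h O'" unfolding h_def
    by (rule Cinf_compose[OF O' U(4) _ Cinf_on_subset[OF cB\<phi>] U(6)]) (auto simp: O'_def)
  ultimately show ?thesis using that[of U O' h] U W1 O' fU hO by blast
qed

section \<open>Integral curves\<close>

text \<open>Bootstrapping: the derivative of \<open>c\<close> is \<open>X \<circ> c\<close>, so
  \<open>c\<close> being \<open>C^k\<close> makes its derivative \<open>C^k\<close>.\<close>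

lemma integral_curve_Cinf:
  fixes c :: "real \<Rightarrow> 'a::euclidean_space"
  assumes I: "open I" and c: "c ` I \<subseteq> S" and X: "smooth_on S X"
    and d: "\<And>t. t \<in> I \<Longrightarrow> (c has_vector_derivative X (c t)) (at t)"
  shows "Cinf_on c I"
proof -
  have "Ck_on k c I" for k
  proof (induction k)
    case 0
    show ?case using has_vector_derivative_continuous[OF d] by (simp add: continuous_at_imp_continuous_on)
  next
    case (Suc k)
    have k: "Ck_on k (\<lambda>t. X (c t)) I"
    proof (rule Ck_on_local)
      fix t assume t: "t \<in> I"
      then have "c t \<in> S" using c by blast
      then obtain U h where U: "open U" "c t \<in> U" "Cinf_on h U" "\<forall>y\<in>U \<inter> S. X y = h y"
        using X unfolding smooth_on_def by blast
      have "continuous_on I c" using has_vector_derivative_continuous[OF d] by (simp add: continuous_at_imp_continuous_on)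
      then have o: "open (I \<inter> c -` U)" using U(1) I continuous_open_preimage by blast
      have "Ck_on k (\<lambda>t. h (c t)) (I \<inter> c -` U)"
        by (rule Ck_compose[OF o U(1) _ Ck_on_subset[OF Suc]]) (use U(3) in \<open>auto simp: Cinf_on_def\<close>)
      then have "Ck_on k (\<lambda>t. X (c t)) (I \<inter> c -` U)"
        by (rule Ck_on_cong[OF o, rotated]) (use c U(4) in auto)
      then show "\<exists>V. open V \<and> t \<in> V \<and> Ck_on k (\<lambda>t. X (c t)) V" using o t U(2) by blast
    qed
    have e: "frechet_derivative c (at t) = (\<lambda>v. v *\<^sub>R X (c t))" if "t \<in> I" for t
      using frechet_derivative_at[OF d[OF that, unfolded has_vector_derivative_def]] by simp
    have "Ck_on k (\<lambda>t. frechet_derivative c (at t) v) I" for v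
    proof (rule Ck_on_cong[OF I])
      show "v *\<^sub>R X (c t) = frechet_derivative c (at t) v" if "t \<in> I" for t using e[OF that] by simp
      show "Ck_on k (\<lambda>t. v *\<^sub>R X (c t)) I" by (rule Ck_bilin[OF bounded_bilinear_scaleR I Ck_const k])
    qed
    moreover have "\<forall>t\<in>I. c differentiable (at t)" using d differentiableI_vector by blast
    ultimately show ?case by simp
  qed
  then show ?thesis by (simp add: Cinf_on_def)
qed

section \<open>Existence of integral curves by Picard iteration\<close>

lemma Cinf_on_lipschitz:
  fixes Z :: "'a::euclidean_space \<Rightarrow> 'b::real_normed_vector"
  assumes "compact C" "convex C" "Cinf_on Z V" "C \<subseteq> V"
  obtains K where "K \<ge> 0" "\<And>x y. x \<in> C \<Longrightarrow> y \<in> C \<Longrightarrow> norm (Z x - Z y) \<le> K * norm (x - y)"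
proof -
  define D where "D x = frechet_derivative Z (at x)" for x
  have dZ: "(Z has_derivative D x) (at x)" if "x \<in> C" for x
    unfolding D_def using Cinf_on_has_derivative[OF assms(3)] that assms(4) by blast
  have "\<exists>k. \<forall>x\<in>C. norm (D x b) \<le> k" for b
  proof -
    have "continuous_on V (\<lambda>x. D x b)" unfolding D_def using assms(3) Cinf_on_iff Cinf_on_continuous by blast
    then have "compact ((\<lambda>x. D x b) ` C)" using assms(1,4) compact_continuous_image continuous_on_subset by blast
    then show ?thesis using compact_imp_bounded bounded_iff by (metis imageI)
  qed
  then obtain k where k: "\<And>b x. x \<in> C \<Longrightarrow> norm (D x b) \<le> k b" by metis
  define K where "K = (\<Sum>b\<in>Basis. \<bar>k b\<bar>)"
  have o: "onorm (D x) \<le> K" if "x \<in> C" for x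
  proof (rule onorm_le)
    fix v
    have "norm (D x v) = norm (\<Sum>b\<in>Basis. (v \<bullet> b) *\<^sub>R D x b)"
      using linear_expand[OF has_derivative_linear[OF dZ[OF that]], of v] by simp
    also have "\<dots> \<le> (\<Sum>b\<in>Basis. \<bar>k b\<bar> * norm v)"
    proof (rule sum_norm_le)
      fix b :: 'a assume b: "b \<in> Basis"
      have "norm ((v \<bullet> b) *\<^sub>R D x b) = \<bar>v \<bullet> b\<bar> * norm (D x b)" by simp
      also have "\<dots> \<le> norm v * \<bar>k b\<bar>"
        using Basis_le_norm[OF b, of v] k[OF that, of b] by (intro mult_mono) auto
      finally show "norm ((v \<bullet> b) *\<^sub>R D x b) \<le> \<bar>k b\<bar> * norm v" by (simp add: mult.commute)
    qed
    finally show "norm (D x v) \<le> K * norm v" by (simp add: K_def sum_distrib_right)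
  qed
  show ?thesis
  proof (rule that)
    show "K \<ge> 0" by (simp add: K_def sum_nonneg)
    show "norm (Z x - Z y) \<le> K * norm (x - y)" if "x \<in> C" "y \<in> C" for x y
      by (rule differentiable_bound[OF assms(2) has_derivative_at_withinI[OF dZ] o that(1,2)])
  qed
qed

lemma vector_derivative_bound:
  fixes f :: "real \<Rightarrow> 'a::real_normed_vector"
  assumes "convex I" "\<And>t. t \<in> I \<Longrightarrow> (f has_vector_derivative f' t) (at t within I)" "\<And>t. t \<in> I \<Longrightarrow> norm (f' t) \<le> B" "s \<in> I" "t \<in> I"
  shows "norm (f s - f t) \<le> B * \<bar>s - t\<bar>"
proof -
  have "onorm (\<lambda>h. h *\<^sub>R f' t) \<le> B" if "t \<in> I" for t
  proof (rule onorm_le)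
    show "norm (h *\<^sub>R f' t) \<le> B * norm h" for h
      using mult_right_mono[OF assms(3)[OF that], of "\<bar>h\<bar>"] by (simp add: mult.commute)
  qed
  from differentiable_bound[OF assms(1) assms(2)[unfolded has_vector_derivative_def] this assms(4,5)]
  show ?thesis by simp
qed

lemma picard_lipschitz:
  fixes Z :: "'a::euclidean_space \<Rightarrow> 'a"
  assumes lip: "\<And>x y. norm (Z x - Z y) \<le> K * norm (x - y)" and bdd: "\<And>x. norm (Z x) \<le> M"
    and d: "0 < d" "d * K < 1"
  obtains u where "u 0 = z0" "\<And>t. t \<in> {-d..d} \<Longrightarrow> (u has_vector_derivative Z (u t)) (at t within {-d..d})"
    "\<And>t. t \<in> {-d..d} \<Longrightarrow> norm (u t - z0) \<le> M * d"
proof -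
  \<comment> \<open>A basis vector has norm \<open>1\<close>, so the Lipschitz bound between it and
    \<open>0\<close> forces \<open>K\<close> to be nonnegative.\<close>
  have K: "0 \<le> K" using lip[of 0 "SOME b. b \<in> Basis"]
    by (metis abs_norm_cancel abs_le_zero_iff mult_le_0_iff norm_ge_zero not_le order_trans diff_zero norm_minus_commute norm_some_Basis mult.right_neutral)
  have contZ: "continuous_on UNIV Z"
    by (rule lipschitz_on_continuous_on[of K]) (use lip K in \<open>auto simp: lipschitz_on_def dist_norm\<close>)
  \<comment> \<open>Clamping time to the interval turns a solution on \<open>{-d..d}\<close> into a
    bounded continuous function on the whole line, where Banach's fixed point theorem
    applies.\<close>
  define \<tau> where "\<tau> t = max (-d) (min d t)" for t :: real
  have \<tau>: "\<tau> t \<in> {-d..d}" for t using d(1) by (auto simp: \<tau>_def)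
  have \<tau>_id: "\<tau> t = t" if "t \<in> {-d..d}" for t using that by (auto simp: \<tau>_def)
  have cont\<tau>: "continuous_on UNIV \<tau>" unfolding \<tau>_def[abs_def] by (intro continuous_intros)
  \<comment> \<open>Integrating from the left end point gives one primitive on the whole interval;
    subtracting \<open>F u 0\<close> later moves the initial time to \<open>0\<close>.\<close>
  define F where "F u t = integral {-d..t} (\<lambda>s. Z (apply_bcontfun u s))" for u t
  have contu: "continuous_on {-d..d} (\<lambda>s. Z (apply_bcontfun u s))" for u
    using continuous_on_compose2[OF contZ continuous_on_apply_bcontfun] by auto
  have dF: "(F u has_vector_derivative Z (apply_bcontfun u t)) (at t within {-d..d})" if "t \<in> {-d..d}" for u t
    unfolding F_def[abs_def] by (rule integral_has_vector_derivative[OF contu that])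
  have contF: "continuous_on {-d..d} (F u)" for u
    unfolding continuous_on_eq_continuous_within using has_vector_derivative_continuous[OF dF] by blast
  have F_bound: "norm (F u t - F u 0) \<le> M * d" if "t \<in> {-d..d}" for u t
  proof -
    have "norm (F u t - F u 0) \<le> M * \<bar>t - 0\<bar>"
      by (rule vector_derivative_bound[of "{-d..d}", OF _ dF bdd]) (use that d in auto)
    moreover have "M * \<bar>t - 0\<bar> \<le> M * d"
      using that order_trans[OF norm_ge_zero bdd[of 0]] by (intro mult_left_mono) (auto simp: abs_le_iff)
    ultimately show ?thesis by linarith
  qed
  define T where "T u = Bcontfun (\<lambda>t. z0 + (F u (\<tau> t) - F u 0))" for u
  have T: "apply_bcontfun (T u) t = z0 + (F u (\<tau> t) - F u 0)" for u t
  proof -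
    have "(\<lambda>t. z0 + (F u (\<tau> t) - F u 0)) \<in> bcontfun"
    proof (rule bcontfun_normI)
      show "continuous_on UNIV (\<lambda>t. z0 + (F u (\<tau> t) - F u 0))"
      proof -
        have "continuous_on UNIV (\<lambda>t. F u (\<tau> t))" by (rule continuous_on_compose2[OF contF cont\<tau>]) (use \<tau> in auto)
        then show ?thesis by (intro continuous_intros)
      qed
      show "norm (z0 + (F u (\<tau> t) - F u 0)) \<le> norm z0 + M * d" for t
        using F_bound[OF \<tau>, of u t] norm_triangle_ineq[of z0 "F u (\<tau> t) - F u 0"] by linarith
    qed
    then show ?thesis unfolding T_def by (simp add: Bcontfun_inverse)
  qed
  have "dist (T u) (T v) \<le> (d * K) * dist u v" for u v
  proof (rule dist_bound)
    fix t
    have "norm ((F u (\<tau> t) - F v (\<tau> t)) - (F u 0 - F v 0)) \<le> (K * dist u v) * \<bar>\<tau> t - 0\<bar>"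
    proof (rule vector_derivative_bound[of "{-d..d}" "\<lambda>t. F u t - F v t" "\<lambda>t. Z (apply_bcontfun u t) - Z (apply_bcontfun v t)"])
      show "((\<lambda>t. F u t - F v t) has_vector_derivative Z (apply_bcontfun u t) - Z (apply_bcontfun v t)) (at t within {-d..d})" if "t \<in> {-d..d}" for t
        by (intro has_vector_derivative_diff dF that)
      show "norm (Z (apply_bcontfun u t) - Z (apply_bcontfun v t)) \<le> K * dist u v" for t
        using lip[of "apply_bcontfun u t" "apply_bcontfun v t"] mult_left_mono[OF dist_bounded[of u t v] K] by (simp add: dist_norm)
    qed (use \<tau> d in auto)
    also have "\<dots> \<le> (K * dist u v) * d" using \<tau>[of t] K by (intro mult_left_mono) (auto simp: abs_le_iff)
    finally show "dist (apply_bcontfun (T u) t) (apply_bcontfun (T v) t) \<le> (d * K) * dist u v"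
      by (simp add: T dist_norm algebra_simps)
  qed
  then obtain u where u: "T u = u" using banach_fix_type[of "d * K" T] d K by auto
  have eq: "apply_bcontfun u t = z0 + (F u (\<tau> t) - F u 0)" for t using T[of u t] u by simp
  show ?thesis
  proof (rule that)
    show "apply_bcontfun u 0 = z0" using eq[of 0] \<tau>_id[of 0] d by simp
    show "norm (apply_bcontfun u t - z0) \<le> M * d" for t using eq[of t] F_bound[OF \<tau>] by simp
    show "(apply_bcontfun u has_vector_derivative Z (apply_bcontfun u t)) (at t within {-d..d})" if "t \<in> {-d..d}" for t
    proof -
      have "((\<lambda>t. z0 + (F u t - F u 0)) has_vector_derivative Z (apply_bcontfun u t)) (at t within {-d..d})"
        using dF[OF that, of u] by (auto intro!: derivative_eq_intros)
      then show ?thesis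
        by (rule has_vector_derivative_transform[OF that, rotated]) (simp add: eq \<tau>_id)
    qed
  qed
qed

text \<open>Composing \<open>Z\<close> with the nearest-point projection \<open>P\<close> onto a
  ball, which is nonexpansive, makes the field globally Lipschitz and bounded. For a short time the
  solution stays in the ball, where \<open>P\<close> is the identity.\<close>

lemma picard_local:
  fixes Z :: "'a::euclidean_space \<Rightarrow> 'a"
  assumes V: "open V" "z0 \<in> V" and Z: "Cinf_on Z V"
  obtains d u where "0 < d" "u 0 = z0" "u ` {-d<..<d} \<subseteq> V" "\<And>t. t \<in> {-d<..<d} \<Longrightarrow> (u has_vector_derivative Z (u t)) (at t)"
proof -
  obtain r where r: "r > 0" "cball z0 r \<subseteq> V" using V open_contains_cball by metis
  define P where "P = closest_point (cball z0 r)"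
  have P: "P x \<in> cball z0 r" for x unfolding P_def by (rule closest_point_in_set) (use r in auto)
  have P_lip: "dist (P x) (P y) \<le> dist x y" for x y unfolding P_def by (rule closest_point_lipschitz) (use r in auto)
  obtain K where K: "K \<ge> 0" "\<And>x y. x \<in> cball z0 r \<Longrightarrow> y \<in> cball z0 r \<Longrightarrow> norm (Z x - Z y) \<le> K * norm (x - y)"
    using Cinf_on_lipschitz[OF compact_cball convex_cball Z r(2)] by blast
  have "continuous_on (cball z0 r) Z" using Cinf_on_continuous[OF Z] r(2) continuous_on_subset by blast
  then have "bounded (Z ` cball z0 r)" by (rule compact_imp_bounded[OF compact_continuous_image[OF _ compact_cball]])
  then obtain M where M: "\<And>x. x \<in> cball z0 r \<Longrightarrow> norm (Z x) \<le> M" unfolding bounded_iff by blast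
  have M0: "M \<ge> 0" using order_trans[OF norm_ge_zero M[of z0]] r by simp
  \<comment> \<open>The first bound makes the integral operator a contraction, the second keeps the
    solution inside the ball of radius \<open>r\<close>.\<close>
  define d where "d = min (1 / (K + 1)) (r / (M + 1))"
  have d: "d > 0" "d * K < 1" "M * d < r"
  proof -
    show "d > 0" using K(1) M0 r by (simp add: d_def)
    have "d * K \<le> 1 / (K + 1) * K" using K(1) by (intro mult_right_mono) (auto simp: d_def)
    also have "\<dots> < 1" using K(1) by (simp add: divide_less_eq)
    finally show "d * K < 1" .
    have "M * d \<le> M * (r / (M + 1))" using M0 by (intro mult_left_mono) (auto simp: d_def)
    also have "\<dots> < r" using M0 r by (simp add: divide_less_eq algebra_simps)
    finally show "M * d < r" .
  qed
  have "norm (Z (P x) - Z (P y)) \<le> K * norm (x - y)" for x y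
    using K(2)[OF P P, of x y] mult_left_mono[OF P_lip[of x y] K(1)] by (simp add: dist_norm)
  from picard_lipschitz[of "\<lambda>x. Z (P x)", OF this M[OF P] d(1,2)]
  obtain u where u: "u 0 = z0" "\<And>t. t \<in> {-d..d} \<Longrightarrow> (u has_vector_derivative Z (P (u t))) (at t within {-d..d})"
    "\<And>t. t \<in> {-d..d} \<Longrightarrow> norm (u t - z0) \<le> M * d" by metis
  have in_cball: "u t \<in> cball z0 r" if "t \<in> {-d<..<d}" for t
    using u(3)[of t] d(3) that by (auto simp: dist_norm norm_minus_commute)
  show ?thesis
  proof (rule that)
    show "u ` {-d<..<d} \<subseteq> V" using in_cball r(2) by blast
    show "(u has_vector_derivative Z (u t)) (at t)" if "t \<in> {-d<..<d}" for t
    proof -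
      have "(u has_vector_derivative Z (P (u t))) (at t within {-d<..<d})"
        using u(2)[of t] that by (auto intro: has_vector_derivative_within_subset)
      moreover have "P (u t) = u t" unfolding P_def by (rule closest_point_self[OF in_cball[OF that]])
      ultimately show ?thesis using that at_within_open[of t "{-d<..<d}"] by simp
    qed
  qed (use d u in auto)
qed

lemma exists_linear_projection:
  assumes "subspace (L :: 'a::euclidean_space set)"
  obtains P where "linear P" "\<And>x. P x \<in> L" "\<And>x. x \<in> L \<Longrightarrow> P x = x"
proof -
  obtain B where B: "B \<subseteq> L" "pairwise orthogonal B" "\<And>x. x \<in> B \<Longrightarrow> norm x = 1" "independent B" "span B = L"
    using orthonormal_basis_subspace[OF assms] by metis
  have "finite B" using B(4) independent_imp_finite by blast
  show ?thesis
  proof (rule that[of "\<lambda>x. \<Sum>b\<in>B. (x \<bullet> b) *\<^sub>R b"])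
    show "linear (\<lambda>x. \<Sum>b\<in>B. (x \<bullet> b) *\<^sub>R b)"
      by (rule linearI) (simp_all add: inner_add_left scaleR_add_left sum.distrib scaleR_sum_right)
    show "(\<Sum>b\<in>B. (x \<bullet> b) *\<^sub>R b) \<in> L" for x using B(1) assms by (intro subspace_sum subspace_scale) auto
    show "(\<Sum>b\<in>B. (x \<bullet> b) *\<^sub>R b) = x" if "x \<in> L" for x
      using orthonormal_basis_expand[OF B(2,3) _ \<open>finite B\<close>] that B(5) by blast
  qed
qed

text \<open>In a chart the field points along \<open>L\<close> only at points of \<open>L\<close>.
  Composing with a linear projection \<open>P\<close> onto \<open>L\<close> makes it
  \<open>L\<close>-valued on an open set without changing it on \<open>L\<close>, so the part of a
  solution transverse to \<open>L\<close> is constant and the solution never leaves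
  \<open>L\<close>.\<close>

lemma integral_curve_submanifold:
  assumes S: "submanifold k S" "x0 \<in> S" and X: "smooth_on S X" "\<And>x. x \<in> S \<Longrightarrow> X x \<in> tangent_space S x"
  obtains d c where "0 < d" "c 0 = x0" "c ` {-d<..<d} \<subseteq> S" "\<And>t. t \<in> {-d<..<d} \<Longrightarrow> (c has_vector_derivative X (c t)) (at t)"
proof -
  obtain U V \<phi> \<psi> L where U: "open U" "x0 \<in> U" "open V" "homeomorphism U V \<phi> \<psi>"
    and \<phi>: "Cinf_on \<phi> U" and \<psi>: "Cinf_on \<psi> V" and L: "subspace (L :: 'a set)" "\<phi> ` (U \<inter> S) = V \<inter> L"
    using S(1)[unfolded submanifold_def, rule_format, OF S(2)] by blast
  have U': "\<And>x. x \<in> U \<Longrightarrow> \<psi> (\<phi> x) = x" "\<And>x. x \<in> U \<Longrightarrow> \<phi> x \<in> V" and V': "\<And>y. y \<in> V \<Longrightarrow> \<phi> (\<psi> y) = y" "\<And>y. y \<in> V \<Longrightarrow> \<psi> y \<in> U"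
    using U(4) by (auto simp: homeomorphism_def)
  obtain P where P: "linear P" "\<And>x. P x \<in> L" "\<And>x. x \<in> L \<Longrightarrow> P x = x" using exists_linear_projection[OF L(1)] by blast
  have blP: "bounded_linear P" using P(1) linear_conv_bounded_linear by blast
  obtain W h where W: "open W" "x0 \<in> W" "Cinf_on h W" "\<forall>y\<in>W \<inter> S. X y = h y"
    using X(1) S(2) unfolding smooth_on_def by blast
  define V1 where "V1 = V \<inter> \<psi> -` W"
  have V1: "open V1" "V1 \<subseteq> V" "\<phi> x0 \<in> V1"
    using Cinf_on_continuous[OF \<psi>] U(2,3) W(1,2) U' continuous_open_preimage by (auto simp: V1_def)
  define D\<phi> where "D\<phi> x = frechet_derivative \<phi> (at x)" for x
  have d\<phi>: "(\<phi> has_derivative D\<phi> x) (at x)" if "x \<in> U" for x unfolding D\<phi>_def by (rule Cinf_on_has_derivative[OF \<phi> that])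
  have d\<psi>: "(\<psi> has_derivative frechet_derivative \<psi> (at z)) (at z)" if "z \<in> V" for z by (rule Cinf_on_has_derivative[OF \<psi> that])
  define Z where "Z z = P (D\<phi> (\<psi> z) (h (\<psi> z)))" for z
  have c\<psi>: "Cinf_on \<psi> V1" using \<psi> V1(2) Cinf_on_subset by blast
  have "Cinf_on (\<lambda>z. D\<phi> (\<psi> z) (h (\<psi> z))) V1"
  proof (rule Cinf_apply_linear[OF V1(1), where A="\<lambda>z. D\<phi> (\<psi> z)" and v="\<lambda>z. h (\<psi> z)"])
    show "linear (D\<phi> (\<psi> z))" if "z \<in> V1" for z using has_derivative_linear[OF d\<phi>] V'(2) that V1(2) by blast
    show "Cinf_on (\<lambda>z. D\<phi> (\<psi> z) b) V1" for b
    proof (rule Cinf_compose[OF V1(1) U(1) _ c\<psi>, where F="\<lambda>y. D\<phi> y b"])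
      show "Cinf_on (\<lambda>y. D\<phi> y b) U" unfolding D\<phi>_def using \<phi> Cinf_on_iff by blast
    qed (use V' V1(2) in blast)
    show "Cinf_on (\<lambda>z. h (\<psi> z)) V1"
      by (rule Cinf_compose[OF V1(1) W(1) _ c\<psi> W(3)]) (auto simp: V1_def)
  qed
  then have cZ: "Cinf_on Z V1" unfolding Z_def[abs_def] by (rule Cinf_compose_lin[OF blP V1(1)])
  obtain d u where u: "0 < d" "u 0 = \<phi> x0" "u ` {-d<..<d} \<subseteq> V1" "\<And>t. t \<in> {-d<..<d} \<Longrightarrow> (u has_vector_derivative Z (u t)) (at t)"
    using picard_local[OF V1(1,3) cZ] by metis
  have uL: "u t \<in> L" if "t \<in> {-d<..<d}" for t
  proof -
    have x0L: "\<phi> x0 \<in> L" using L(2) U(2) S(2) by blast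
    have "((\<lambda>t. u t - P (u t)) has_derivative (\<lambda>h. 0)) (at t within {-d<..<d})" if "t \<in> {-d<..<d}" for t
    proof -
      have "((\<lambda>t. u t - P (u t)) has_vector_derivative Z (u t) - P (Z (u t))) (at t)"
        by (intro has_vector_derivative_diff bounded_linear.has_vector_derivative[OF blP] u(4) that)
      moreover have "P (Z (u t)) = Z (u t)" unfolding Z_def using P by blast
      ultimately show ?thesis by (simp add: has_vector_derivative_def has_derivative_at_withinI)
    qed
    then have "\<exists>k. \<forall>t\<in>{-d<..<d}. u t - P (u t) = k"
      by (rule has_derivative_zero_constant[rotated]) simp_all
    then obtain k where k: "\<And>t. t \<in> {-d<..<d} \<Longrightarrow> u t - P (u t) = k" by blast
    have "u t - P (u t) = u 0 - P (u 0)" using k[OF that] k[of 0] u(1) by simp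
    then have "u t = P (u t)" using P(3)[OF x0L] u(2) by simp
    then show ?thesis using P(2) by metis
  qed
  have \<psi>S: "\<psi> z \<in> S" if "z \<in> V1" "z \<in> L" for z
  proof -
    have "z \<in> \<phi> ` (U \<inter> S)" using that V1(2) L(2) by blast
    then show ?thesis using U' by auto
  qed
  have D\<phi>L: "P (D\<phi> x v) = D\<phi> x v" if "x \<in> U \<inter> S" and v: "v \<in> tangent_space S x" for x v
  proof -
    obtain c e where c: "0 < e" "Cinf_on c {-e<..<e}" "c ` {-e<..<e} \<subseteq> S" "c 0 = x" "(c has_vector_derivative v) (at (0::real))"
      using tangent_spaceE[OF v] by metis
    have o: "open ({-e<..<e} \<inter> c -` U)" using continuous_open_preimage[OF Cinf_on_continuous[OF c(2)] _ U(1)] by simp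
    have 0: "0 \<in> {-e<..<e} \<inter> c -` U" using c(1,4) that by auto
    have 1: "((\<lambda>t. \<phi> (c t)) has_vector_derivative D\<phi> x v) (at 0)"
      by (rule has_derivative_curve[of \<phi> "D\<phi> x" c 0 UNIV v UNIV]) (use c d\<phi>[of x] that in auto)
    have "((\<lambda>t. P (\<phi> (c t))) has_vector_derivative P (D\<phi> x v)) (at 0)"
      by (rule bounded_linear.has_vector_derivative[OF blP 1])
    then have "((\<lambda>t. \<phi> (c t)) has_vector_derivative P (D\<phi> x v)) (at 0)"
      by (rule has_vector_derivative_transform_within_open[OF _ o 0]) (use P(3) L(2) c(3) in blast)
    then show ?thesis using 1 vector_derivative_at by metis
  qed
  show ?thesis
  proof (rule that[of d "\<lambda>t. \<psi> (u t)"])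
    show "0 < d" by (rule u(1))
    show "\<psi> (u 0) = x0" using u(2) U' U(2) by simp
    show "(\<lambda>t. \<psi> (u t)) ` {-d<..<d} \<subseteq> S" using \<psi>S u(3) uL by blast
    show "((\<lambda>t. \<psi> (u t)) has_vector_derivative X (\<psi> (u t))) (at t)" if "t \<in> {-d<..<d}" for t
    proof -
      define x where "x = \<psi> (u t)"
      have ut: "u t \<in> V1" "u t \<in> V" using u(3) that V1(2) by blast+
      have x: "x \<in> U \<inter> S" "x \<in> W" "\<phi> x = u t" using \<psi>S[OF ut(1) uL[OF that]] ut V' by (auto simp: x_def V1_def)
      have Z: "Z (u t) = D\<phi> x (X x)"
        using D\<phi>L[OF x(1) X(2)] x W(4) by (simp add: Z_def x_def[symmetric])
      have d\<psi>': "(\<psi> has_derivative frechet_derivative \<psi> (at (\<phi> x))) (at (\<phi> x))" using d\<psi>[OF ut(2)] x(3) by simp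
      have xU: "x \<in> U" using x by blast
      have "((\<lambda>t. \<psi> (u t)) has_vector_derivative frechet_derivative \<psi> (at (\<phi> x)) (D\<phi> x (X x))) (at t)"
        by (rule has_derivative_curve[of \<psi> _ u t UNIV _ UNIV]) (use d\<psi>' x(3) u(4)[OF that] Z in auto)
      then show ?thesis using homeomorphism_derivatives(1)[OF U(1,3,4) xU d\<phi>[OF xU] d\<psi>'] by (simp add: x_def)
    qed
  qed
qed

section \<open>One-parameter subgroups\<close>

lemma smooth_on_Pair:
  assumes "smooth_on S f" "smooth_on S h"
  shows "smooth_on S (\<lambda>x. (f x, h x))"
  unfolding smooth_on_def
proof
  fix x assume x: "x \<in> S"
  obtain U F where U: "open U" "x \<in> U" "Cinf_on F U" "\<forall>y\<in>U \<inter> S. f y = F y" using assms(1) x unfolding smooth_on_def by blast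
  obtain V H where V: "open V" "x \<in> V" "Cinf_on H V" "\<forall>y\<in>V \<inter> S. h y = H y" using assms(2) x unfolding smooth_on_def by blast
  have "open (U \<inter> V)" using U(1) V(1) by blast
  then have "Cinf_on (\<lambda>x. (F x, H x)) (U \<inter> V)"
    using U(3) V(3) by (intro Cinf_Pair) (auto elim: Cinf_on_subset)
  then show "\<exists>U k. open U \<and> x \<in> U \<and> Cinf_on k U \<and> (\<forall>y\<in>U \<inter> S. (f y, h y) = k y)"
    using U V \<open>open (U \<inter> V)\<close> by (intro exI[of _ "U \<inter> V"] exI[of _ "\<lambda>x. (F x, H x)"]) auto
qed

lemma tangent_space_subset: assumes "v \<in> tangent_space S x" shows "x \<in> S"
proof -
  obtain c :: "real \<Rightarrow> 'a" and e where c: "0 < e" "c ` {-e<..<e} \<subseteq> S" "c 0 = x"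
    using tangent_spaceE[OF assms] by metis
  have "(0::real) \<in> {-e<..<e}" using c(1) by simp
  then show ?thesis using c(2,3) by blast
qed

lemma zero_tangent: "x \<in> S \<Longrightarrow> 0 \<in> tangent_space S x"
  unfolding tangent_space_def
  by (intro CollectI exI[of _ "\<lambda>_. x"] exI[of _ 1]) (auto simp: Cinf_const)

lemma tangent_Pair:
  assumes "v \<in> tangent_space S x" "w \<in> tangent_space T y"
  shows "(v, w) \<in> tangent_space (S \<times> T) (x, y)"
proof -
  obtain c e where c: "0 < e" "Cinf_on c {-e<..<e}" "c ` {-e<..<e} \<subseteq> S" "c 0 = x" "(c has_vector_derivative v) (at (0::real))"
    using tangent_spaceE[OF assms(1)] by metis
  obtain b d where b: "0 < d" "Cinf_on b {-d<..<d}" "b ` {-d<..<d} \<subseteq> T" "b 0 = y" "(b has_vector_derivative w) (at (0::real))"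
    using tangent_spaceE[OF assms(2)] by metis
  define m where "m = min d e"
  have m: "{-m<..<m} \<subseteq> {-e<..<e}" "{-m<..<m} \<subseteq> {-d<..<d}" "m > 0" using c(1) b(1) by (auto simp: m_def)
  show ?thesis unfolding tangent_space_def
  proof (intro CollectI exI conjI)
    show "0 < m" by fact
    show "Cinf_on (\<lambda>t. (c t, b t)) {-m<..<m}"
      using Cinf_on_subset[OF c(2) m(1)] Cinf_on_subset[OF b(2) m(2)] by (intro Cinf_Pair) auto
    show "(\<lambda>t. (c t, b t)) ` {-m<..<m} \<subseteq> S \<times> T" using c(3) b(3) m by blast
    show "(c 0, b 0) = (x, y)" using c b by simp
    show "((\<lambda>t. (c t, b t)) has_vector_derivative (v, w)) (at 0)"
      by (intro has_vector_derivative_Pair c b)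
  qed
qed

lemma differential_local_extension:
  fixes F :: "'a::euclidean_space \<Rightarrow> 'c::real_normed_vector"
  assumes "open W" "y \<in> W" "Cinf_on H W" "\<forall>z\<in>W \<inter> S. F z = H z" "u \<in> tangent_space S y"
  shows "differential S F y u = frechet_derivative H (at y) u"
proof (rule differential_eq[OF _ assms(5)])
  have yS: "y \<in> S" using tangent_space_subset assms(5) by blast
  obtain e where e: "e > 0" "ball y e \<subseteq> W" using assms(1,2) openE by blast
  have "(H has_derivative frechet_derivative H (at y)) (at y within S)"
    using Cinf_on_has_derivative[OF assms(3,2)] has_derivative_at_withinI by blast
  then show "(F has_derivative frechet_derivative H (at y)) (at y within S)"
    using has_derivative_transform_within[of H _ y S e F] e yS assms(4) by (auto simp: subset_iff dist_commute)
qed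

text \<open>Tangency of \<open>v x\<close> is essential: only on tangent vectors does the chosen
  \<open>differential\<close> coincide with the derivative of a local extension, which varies
  smoothly.\<close>

lemma smooth_on_differential:
  fixes f :: "'b::euclidean_space \<Rightarrow> 'a::euclidean_space" and v :: "'b \<Rightarrow> 'a" and F :: "'a \<Rightarrow> 'c::real_normed_vector"
  assumes F: "smooth_on S F" and f: "smooth_on T f" "f ` T \<subseteq> S" and v: "smooth_on T v" "\<And>x. x \<in> T \<Longrightarrow> v x \<in> tangent_space S (f x)"
  shows "smooth_on T (\<lambda>x. differential S F (f x) (v x))"
  unfolding smooth_on_def
proof
  fix x assume x: "x \<in> T"
  then have "f x \<in> S" using f(2) by blast
  then obtain W H where W: "open W" "f x \<in> W" "Cinf_on H W" "\<forall>y\<in>W \<inter> S. F y = H y"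
    using F unfolding smooth_on_def by blast
  obtain U f' where U: "open U" "x \<in> U" "Cinf_on f' U" "\<forall>y\<in>U \<inter> T. f y = f' y" using f(1) x unfolding smooth_on_def by blast
  obtain V v' where V: "open V" "x \<in> V" "Cinf_on v' V" "\<forall>y\<in>V \<inter> T. v y = v' y" using v(1) x unfolding smooth_on_def by blast
  define O' where "O' = U \<inter> V \<inter> f' -` W"
  have "open (U \<inter> f' -` W)" using continuous_open_preimage[OF Cinf_on_continuous[OF U(3)] U(1) W(1)] .
  moreover have "O' = U \<inter> f' -` W \<inter> V" by (auto simp: O'_def)
  ultimately have O': "open O'" using V(1) open_Int by metis
  have f': "Cinf_on f' O'" using U(3) by (rule Cinf_on_subset) (auto simp: O'_def)
  have "Cinf_on (\<lambda>y. frechet_derivative H (at (f' y)) (v' y)) O'"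
  proof (rule Cinf_apply_linear[OF O', where A="\<lambda>y. frechet_derivative H (at (f' y))" and v=v'])
    show "linear (frechet_derivative H (at (f' y)))" if "y \<in> O'" for y
      using has_derivative_linear[OF Cinf_on_has_derivative[OF W(3)]] that by (auto simp: O'_def)
    show "Cinf_on (\<lambda>y. frechet_derivative H (at (f' y)) b) O'" for b
    proof (rule Cinf_compose[OF O' W(1) _ f', where F="\<lambda>y. frechet_derivative H (at y) b"])
      show "Cinf_on (\<lambda>y. frechet_derivative H (at y) b) W" using W(3) Cinf_on_iff by blast
    qed (auto simp: O'_def)
    show "Cinf_on v' O'" using V(3) by (rule Cinf_on_subset) (auto simp: O'_def)
  qed
  moreover have "differential S F (f y) (v y) = frechet_derivative H (at (f' y)) (v' y)" if "y \<in> O' \<inter> T" for y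
    using differential_local_extension[OF W(1) _ W(3,4), of "f y" "v y"] v(2)[of y] U(4) V(4) that by (auto simp: O'_def)
  moreover have "x \<in> O'" using x U(2,4) V(2) W(2) by (auto simp: O'_def)
  ultimately show "\<exists>U h. open U \<and> x \<in> U \<and> Cinf_on h U \<and> (\<forall>y\<in>U \<inter> T. differential S F (f y) (v y) = h y)"
    using O' by (intro exI[of _ O'] exI[of _ "\<lambda>y. frechet_derivative H (at (f' y)) (v' y)"]) auto
qed

section \<open>Embedded Lie groups and their left-invariant fields\<close>

locale embedded_lie_group = group G for G :: "'a::euclidean_space monoid" (structure) +
  assumes lie: "lie_group G"
begin

abbreviation "S \<equiv> carrier G"
abbreviation "T1 \<equiv> tangent_space S \<one>"

definition DM :: "'a \<Rightarrow> 'a \<Rightarrow> 'a \<times> 'a \<Rightarrow> 'a" where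
  "DM a b = differential (S \<times> S) (\<lambda>(a, b). a \<otimes> b) (a, b)"

text \<open>Agrees with \<open>left_invariant_field\<close> on \<open>T1\<close>. Written as a
  partial derivative of the multiplication, it is visibly smooth in the base point
  \<open>a\<close>.\<close>

definition lf :: "'a \<Rightarrow> 'a \<Rightarrow> 'a" where "lf v a = DM a \<one> (0, v)"

lemma submanifold_S: "\<exists>k. submanifold k S" using lie lie_group_def by blast

lemma smooth_mult: "smooth_on (S \<times> S) (\<lambda>(a, b). a \<otimes> b)" and smooth_inv: "smooth_on S (m_inv G)"
  using lie by (auto simp: lie_group_def)

lemma DM_has_derivative: "a \<in> S \<Longrightarrow> b \<in> S \<Longrightarrow> ((\<lambda>(a, b). a \<otimes> b) has_derivative DM a b) (at (a, b) within S \<times> S)"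
  unfolding DM_def by (rule smooth_on_has_derivative[OF smooth_mult]) simp

lemma linear_DM: "a \<in> S \<Longrightarrow> b \<in> S \<Longrightarrow> linear (DM a b)"
  using DM_has_derivative has_derivative_linear by blast

lemma DM_split: "a \<in> S \<Longrightarrow> b \<in> S \<Longrightarrow> DM a b (v, w) = DM a b (v, 0) + DM a b (0, w)"
  using linear_add[OF linear_DM, of a b "(v, 0)" "(0, w)"] by simp

lemma curve_mult:
  assumes "(c has_vector_derivative v) (at t)" "(b has_vector_derivative w) (at t)" "open I" "t \<in> I" "c ` I \<subseteq> S" "b ` I \<subseteq> S"
  shows "((\<lambda>t. c t \<otimes> b t) has_vector_derivative DM (c t) (b t) (v, w)) (at t)"
proof -
  have "((\<lambda>t. (c t, b t)) has_vector_derivative (v, w)) (at t)" by (intro has_vector_derivative_Pair assms)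
  from smooth_on_curve[OF smooth_mult this assms(3,4)] show ?thesis using assms(5,6) unfolding DM_def by auto
qed

lemma smooth_on_mult:
  fixes f :: "'b::euclidean_space \<Rightarrow> 'a"
  assumes "smooth_on T f" "smooth_on T h" "f ` T \<subseteq> S" "h ` T \<subseteq> S"
  shows "smooth_on T (\<lambda>x. f x \<otimes> h x)"
proof -
  have "smooth_on T (\<lambda>x. (\<lambda>(a, b). a \<otimes> b) (f x, h x))"
    using smooth_on_compose[OF smooth_on_Pair[OF assms(1,2)] _ smooth_mult] assms(3,4) by auto
  then show ?thesis by simp
qed

lemma smooth_on_DM:
  fixes f :: "'b::euclidean_space \<Rightarrow> 'a"
  assumes "smooth_on T f" "smooth_on T h" "f ` T \<subseteq> S" "h ` T \<subseteq> S" "smooth_on T v" "smooth_on T w"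
    "\<And>x. x \<in> T \<Longrightarrow> v x \<in> tangent_space S (f x)" "\<And>x. x \<in> T \<Longrightarrow> w x \<in> tangent_space S (h x)"
  shows "smooth_on T (\<lambda>x. DM (f x) (h x) (v x, w x))"
  unfolding DM_def
  by (rule smooth_on_differential[OF smooth_mult smooth_on_Pair[OF assms(1,2)] _ smooth_on_Pair[OF assms(5,6)]])
    (use assms(3,4,7,8) in \<open>auto intro!: tangent_Pair\<close>)

lemma smooth_const: "smooth_on T (\<lambda>x. c)" using smooth_UNIV[OF Cinf_const] .
lemma smooth_ident: "smooth_on T (\<lambda>x. x)" using smooth_UNIV[OF Cinf_id] .

lemma smooth_left: "a \<in> S \<Longrightarrow> smooth_on S (\<lambda>b. a \<otimes> b)"
  by (rule smooth_on_mult[OF smooth_const smooth_ident]) auto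

lemma tangent_curve:
  assumes "v \<in> tangent_space S x"
  obtains c e where "0 < e" "c ` {-e<..<e} \<subseteq> S" "c 0 = x" "(c has_vector_derivative v) (at (0::real))"
  using tangent_spaceE[OF assms] by metis

lemma curve_left:
  assumes "a \<in> S" "(c has_vector_derivative v) (at t)" "open I" "t \<in> I" "c ` I \<subseteq> S"
  shows "((\<lambda>t. a \<otimes> c t) has_vector_derivative DM a (c t) (0, v)) (at t)"
  using curve_mult[OF has_vector_derivative_const assms(2-4) _ assms(5)] assms(1) by auto

lemma curve_right:
  assumes "a \<in> S" "(c has_vector_derivative v) (at t)" "open I" "t \<in> I" "c ` I \<subseteq> S"
  shows "((\<lambda>t. c t \<otimes> a) has_vector_derivative DM (c t) a (v, 0)) (at t)"
  using curve_mult[OF assms(2) has_vector_derivative_const assms(3-5)] assms(1) by auto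

lemma DM_left_tangent: "a \<in> S \<Longrightarrow> v \<in> tangent_space S b \<Longrightarrow> DM a b (0, v) = differential S (\<lambda>b. a \<otimes> b) b v"
proof -
  assume a: "a \<in> S" and v: "v \<in> tangent_space S b"
  obtain c e where c: "0 < e" "c ` {-e<..<e} \<subseteq> S" "c 0 = b" "(c has_vector_derivative v) (at (0::real))"
    using tangent_curve[OF v] by metis
  have "((\<lambda>t. a \<otimes> c t) has_vector_derivative DM a (c 0) (0, v)) (at 0)"
    by (rule curve_left[OF a c(4) _ _ c(2)]) (use c(1) in auto)
  moreover have "((\<lambda>t. a \<otimes> c t) has_vector_derivative differential S (\<lambda>b. a \<otimes> b) (c 0) v) (at 0)"
    by (rule smooth_on_curve[OF smooth_left[OF a] c(4) _ _ c(2)]) (use c(1) in auto)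
  ultimately show ?thesis using c(3) vector_derivative_at by metis
qed

lemma lf_left_invariant: "a \<in> S \<Longrightarrow> v \<in> T1 \<Longrightarrow> left_invariant_field G v a = lf v a"
  unfolding lf_def left_invariant_field_def by (simp add: DM_left_tangent)

lemma DM_left_in_tangent: "a \<in> S \<Longrightarrow> v \<in> tangent_space S b \<Longrightarrow> DM a b (0, v) \<in> tangent_space S (a \<otimes> b)"
  by (subst DM_left_tangent, assumption+, rule differential_tangent[OF smooth_left]) (auto dest: tangent_space_subset)

lemma lf_tangent: "a \<in> S \<Longrightarrow> v \<in> T1 \<Longrightarrow> lf v a \<in> tangent_space S a"
  using DM_left_in_tangent[of a v \<one>] by (simp add: lf_def)

lemma lf_linear: "a \<in> S \<Longrightarrow> lf (v + w) a = lf v a + lf w a" "a \<in> S \<Longrightarrow> lf (r *\<^sub>R v) a = r *\<^sub>R lf v a"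
  unfolding lf_def using linear_add[OF linear_DM, of a \<one> "(0, v)" "(0, w)"] linear_cmul[OF linear_DM, of a \<one> r "(0, v)"] by auto

lemma smooth_lf: "v \<in> T1 \<Longrightarrow> smooth_on S (lf v)"
  unfolding lf_def[abs_def]
  by (rule smooth_on_DM[OF smooth_ident smooth_const _ _ smooth_const smooth_const]) (auto intro: zero_tangent)

text \<open>Associativity \<open>a \<otimes> (b \<otimes> c t) = (a \<otimes> b) \<otimes> c
  t\<close>, differentiated along a curve \<open>c\<close> through the identity.\<close>

lemma DM_left_lf: "a \<in> S \<Longrightarrow> b \<in> S \<Longrightarrow> v \<in> T1 \<Longrightarrow> DM a b (0, lf v b) = lf v (a \<otimes> b)"
proof -
  assume ab: "a \<in> S" "b \<in> S" and v: "v \<in> T1"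
  obtain c e where c: "0 < e" "c ` {-e<..<e} \<subseteq> S" "c 0 = \<one>" "(c has_vector_derivative v) (at (0::real))"
    using tangent_curve[OF v] by metis
  let ?I = "{-e<..<e}"
  have I: "open ?I" "0 \<in> ?I" using c(1) by auto
  have 1: "((\<lambda>t. b \<otimes> c t) has_vector_derivative lf v b) (at 0)"
    using curve_left[OF ab(2) c(4) I c(2)] c(3) by (simp add: lf_def)
  have "((\<lambda>t. a \<otimes> (b \<otimes> c t)) has_vector_derivative DM a (b \<otimes> c 0) (0, lf v b)) (at 0)"
    by (rule curve_left[OF ab(1) 1 I]) (use c(2) ab in auto)
  moreover have "((\<lambda>t. (a \<otimes> b) \<otimes> c t) has_vector_derivative lf v (a \<otimes> b)) (at 0)"
    using curve_left[OF _ c(4) I c(2), of "a \<otimes> b"] c(3) ab by (simp add: lf_def)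
  then have "((\<lambda>t. a \<otimes> (b \<otimes> c t)) has_vector_derivative lf v (a \<otimes> b)) (at 0)"
    by (rule has_vector_derivative_transform_within_open[OF _ I]) (use c(2) ab in \<open>auto intro!: m_assoc\<close>)
  ultimately have "DM a (b \<otimes> c 0) (0, lf v b) = lf v (a \<otimes> b)" using vector_derivative_at by metis
  then show ?thesis using c(3) ab by simp
qed

text \<open>At a fixed time \<open>t\<close> the curve \<open>c1\<close> and the left translate of \<open>c2\<close> through \<open>c1 t\<close> have the same
  velocity, so \<open>c1 \<otimes> inv c2\<close> is stationary.\<close>

lemma integral_curve_unique:
  assumes I: "open I" "connected I" "t0 \<in> I" and S: "c1 ` I \<subseteq> S" "c2 ` I \<subseteq> S" and v: "\<And>t. t \<in> I \<Longrightarrow> v t \<in> T1"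
    and d1: "\<And>t. t \<in> I \<Longrightarrow> (c1 has_vector_derivative lf (v t) (c1 t)) (at t)"
    and d2: "\<And>t. t \<in> I \<Longrightarrow> (c2 has_vector_derivative lf (v t) (c2 t)) (at t)"
    and eq: "c1 t0 = c2 t0" and t: "t \<in> I"
  shows "c1 t = c2 t"
proof -
  have "((\<lambda>t. c1 t \<otimes> inv (c2 t)) has_vector_derivative 0) (at t)" if t: "t \<in> I" for t
  proof -
    define w where "w = differential S (m_inv G) (c2 t) (lf (v t) (c2 t))"
    have w: "((\<lambda>t. inv (c2 t)) has_vector_derivative w) (at t)"
      unfolding w_def by (rule smooth_on_curve[OF smooth_inv d2[OF t] I(1) t S(2)])
    have invS: "(\<lambda>t. inv (c2 t)) ` I \<subseteq> S" using S(2) by auto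
    define g where "g = c1 t \<otimes> inv (c2 t)"
    have c: "c1 t \<in> S" "c2 t \<in> S" using S t by auto
    have g: "g \<in> S" "g \<otimes> c2 t = c1 t" using c by (auto simp: g_def m_assoc)
    have "((\<lambda>s. g \<otimes> c2 s) has_vector_derivative lf (v t) (c1 t)) (at t)"
      using curve_left[OF g(1) d2[OF t] I(1) t S(2)] DM_left_lf[OF g(1) c(2) v[OF t]] g(2) by simp
    from curve_mult[OF this w I(1) t _ invS]
    have "((\<lambda>s. (g \<otimes> c2 s) \<otimes> inv (c2 s)) has_vector_derivative DM (c1 t) (inv (c2 t)) (lf (v t) (c1 t), w)) (at t)"
      using g S(2) by auto
    moreover have "((\<lambda>s. (g \<otimes> c2 s) \<otimes> inv (c2 s)) has_vector_derivative 0) (at t)"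
    proof (rule has_vector_derivative_transform_within_open[OF _ I(1) t, where f="\<lambda>_. g"])
      show "g = g \<otimes> c2 s \<otimes> inv (c2 s)" if "s \<in> I" for s
        using that S(2) g(1) by (subst m_assoc) auto
    qed simp
    ultimately have "DM (c1 t) (inv (c2 t)) (lf (v t) (c1 t), w) = 0" using vector_derivative_at by metis
    then show ?thesis using curve_mult[OF d1[OF t] w I(1) t S(1) invS] by simp
  qed
  then have "((\<lambda>t. c1 t \<otimes> inv (c2 t)) has_derivative (\<lambda>h. 0)) (at t within I)" if "t \<in> I" for t
    using that by (simp add: has_vector_derivative_def has_derivative_at_withinI)
  moreover have "convex I" using I(2) is_interval_connected_1 is_interval_convex by blast
  ultimately have "\<exists>k. \<forall>t\<in>I. c1 t \<otimes> inv (c2 t) = k" by (intro has_derivative_zero_constant)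
  then have "c1 t \<otimes> inv (c2 t) = c1 t0 \<otimes> inv (c2 t0)" using t I(3) by metis
  moreover have "c1 t0 \<otimes> inv (c2 t0) = \<one>" using eq I(3) S(2) by (simp add: image_subset_iff)
  moreover have "c1 t \<in> S" "c2 t \<in> S" using S t by auto
  ultimately show ?thesis by (metis inv_equality inv_inv inv_closed)
qed

lemma one_parameter_local:
  assumes v: "v \<in> T1"
  obtains d c where "0 < d" "c 0 = \<one>" "c ` {-d<..<d} \<subseteq> S" "\<And>t. t \<in> {-d<..<d} \<Longrightarrow> (c has_vector_derivative lf v (c t)) (at t)"
proof -
  obtain k where "submanifold k S" using submanifold_S by blast
  from integral_curve_submanifold[OF this one_closed smooth_lf[OF v] lf_tangent[OF _ v]] show ?thesis using that by blast
qed

lemma curve_left_lf: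
  assumes "a \<in> S" "v \<in> T1" "(c has_vector_derivative lf v (c t)) (at t)" "open I" "t \<in> I" "c ` I \<subseteq> S"
  shows "((\<lambda>t. a \<otimes> c t) has_vector_derivative lf v (a \<otimes> c t)) (at t)"
proof -
  have "c t \<in> S" using assms(5,6) by blast
  then show ?thesis using curve_left[OF assms(1,3-6)] DM_left_lf[OF assms(1) _ assms(2)] by simp
qed

lemma has_vector_derivative_shift_aux: "((\<lambda>r. s + r) has_vector_derivative 1) (at (t::real))"
  by (auto intro!: derivative_eq_intros)

lemma has_vector_derivative_shift:
  "(c has_vector_derivative v) (at (s + t)) \<Longrightarrow> ((\<lambda>r. c (s + r)) has_vector_derivative v) (at (t::real))"
  using vector_diff_chain_at[of "\<lambda>r. s + r" 1 t c v] has_vector_derivative_shift_aux[of s t] by (simp add: o_def)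

text \<open>A local solution is additive near \<open>0\<close> by uniqueness. It is prolonged by
  powers of its value at a small time \<open>e\<close>: write \<open>t\<close> as a multiple of
  \<open>e\<close> plus a remainder.\<close>

lemma one_parameter_exists:
  assumes v: "v \<in> T1"
  shows "\<exists>c. c 0 = \<one> \<and> (\<forall>t. c t \<in> S \<and> (c has_vector_derivative lf v (c t)) (at t))"
proof -
  obtain d c where d: "0 < d" "c 0 = \<one>" "c ` {-d<..<d} \<subseteq> S" "\<And>t. t \<in> {-d<..<d} \<Longrightarrow> (c has_vector_derivative lf v (c t)) (at t)"
    using one_parameter_local[OF v] by metis
  have cS: "c t \<in> S" if "\<bar>t\<bar> < d" for t using d(3) that by (auto simp: image_subset_iff abs_less_iff)
  have add: "c (s + t) = c s \<otimes> c t" if "\<bar>s\<bar> < d / 2" "\<bar>t\<bar> < d / 2" for s t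
  proof -
    have s: "c s \<in> S" using cS that by simp
    show ?thesis
  proof (rule integral_curve_unique[where I="{-d/2<..<d/2}" and ?t0.0=0 and v="\<lambda>_. v" and ?c1.0="\<lambda>t. c (s + t)" and ?c2.0="\<lambda>t. c s \<otimes> c t"])
    show "(\<lambda>t. c (s + t)) ` {-d/2<..<d/2} \<subseteq> S" using cS that by (auto intro!: cS)
    show "(\<lambda>t. c s \<otimes> c t) ` {-d/2<..<d/2} \<subseteq> S" using s by (auto intro!: cS m_closed)
    show "((\<lambda>t. c (s + t)) has_vector_derivative lf v (c (s + t))) (at t)" if "t \<in> {-d/2<..<d/2}" for t
      by (rule has_vector_derivative_shift, rule d(4)) (use that \<open>\<bar>s\<bar> < d / 2\<close> in auto)
    show "((\<lambda>t. c s \<otimes> c t) has_vector_derivative lf v (c s \<otimes> c t)) (at t)" if "t \<in> {-d/2<..<d/2}" for t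
      by (rule curve_left_lf[OF s v d(4) _ _ d(3)]) (use that d(1) in auto)
  qed (use that d v cS s in \<open>auto simp: abs_less_iff\<close>)
  qed
  \<comment> \<open>Additivity holds for times below \<open>d / 2\<close>; any positive
    \<open>e\<close> below this bound serves.\<close>
  define e where "e = d / 4"
  have e: "0 < e" "e < d / 2" using d(1) by (auto simp: e_def)
  have ce: "c e \<in> S" using cS e by simp
  define \<gamma> where "\<gamma> t = c e [^] \<lfloor>t / e\<rfloor> \<otimes> c (t - e * \<lfloor>t / e\<rfloor>)" for t
  have fl: "e * \<lfloor>t / e\<rfloor> \<le> t \<and> t < e * \<lfloor>t / e\<rfloor> + e" for t
  proof -
    have a: "\<lfloor>t / e\<rfloor> \<le> t / e" "t / e < \<lfloor>t / e\<rfloor> + 1" by linarith+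
    show ?thesis using mult_left_mono[OF a(1), of e] mult_strict_left_mono[OF a(2) e(1)] e(1) by (simp add: distrib_left)
  qed
  \<comment> \<open>The floor in \<open>\<gamma>\<close> jumps at multiples of \<open>e\<close>.
    Additivity makes the formula with fixed \<open>k\<close> valid on both sides of
    \<open>e * k\<close>, so \<open>\<gamma>\<close> can be differentiated there as well.\<close>
  have near: "\<gamma> t = c e [^] k \<otimes> c (t - e * k)" if k: "k = \<lfloor>t0 / e\<rfloor>" and t: "e * k - e < t" "t < e * k + e" for t t0 and k :: int
  proof (cases "e * k \<le> t")
    case True
    then have "\<lfloor>t / e\<rfloor> = k" using t e(1) by (intro floor_unique) (auto simp: field_simps)
    then show ?thesis by (simp add: \<gamma>_def)
  next
    case False
    then have k': "\<lfloor>t / e\<rfloor> = k - 1" using t e(1) by (intro floor_unique) (auto simp: field_simps)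
    have 1: "t - e * (k - 1) = e + (t - e * k)" by (simp add: algebra_simps)
    have "c (t - e * (k - 1)) = c e \<otimes> c (t - e * k)" unfolding 1 by (rule add) (use e t False in auto)
    moreover have "c e [^] (k - 1) \<otimes> (c e \<otimes> c (t - e * k)) = c e [^] k \<otimes> c (t - e * k)"
    proof -
      have "c (t - e * k) \<in> S" using cS[of "t - e * k"] e t by auto
      moreover have "c e [^] (k - 1) \<otimes> c e = c e [^] k"
        using int_pow_mult[OF ce, of "k - 1" 1] ce by (simp add: int_pow_1)
      ultimately show ?thesis using ce by (subst m_assoc[symmetric]) auto
    qed
    ultimately show ?thesis by (simp add: \<gamma>_def k')
  qed
  have "\<gamma> t \<in> S \<and> (\<gamma> has_vector_derivative lf v (\<gamma> t)) (at t)" for t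
  proof -
    define k where "k = \<lfloor>t / e\<rfloor>"
    define I where "I = {e * k - e <..< e * k + e}"
    have I: "open I" "t \<in> I" using fl[of t] e by (auto simp: I_def k_def)
    have g: "c e [^] k \<in> S" using ce by simp
    have img: "(\<lambda>t. c (- (e * k) + t)) ` I \<subseteq> S" using e by (auto simp: I_def intro!: cS)
    have "((\<lambda>t. c (- (e * k) + t)) has_vector_derivative lf v (c (- (e * k) + t))) (at t)"
      by (rule has_vector_derivative_shift, rule d(4)) (use I e in \<open>auto simp: I_def\<close>)
    from curve_left_lf[OF g v this I img]
    have "((\<lambda>t. c e [^] k \<otimes> c (- (e * k) + t)) has_vector_derivative lf v (c e [^] k \<otimes> c (- (e * k) + t))) (at t)" .
    moreover have n: "\<gamma> s = c e [^] k \<otimes> c (- (e * k) + s)" if "s \<in> I" for s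
      using near[OF k_def, of s] that by (simp add: I_def)
    ultimately have "(\<gamma> has_vector_derivative lf v (\<gamma> t)) (at t)"
      using has_vector_derivative_transform_within_open[OF _ I, of "\<lambda>t. c e [^] k \<otimes> c (- (e * k) + t)" _ \<gamma>] I(2) by auto
    moreover have "\<gamma> t \<in> S" using n[OF I(2)] g img I(2) by auto
    ultimately show ?thesis by blast
  qed
  moreover have "\<gamma> 0 = \<one>" by (simp add: \<gamma>_def d(2))
  ultimately show ?thesis by blast
qed

definition one_ps :: "'a \<Rightarrow> real \<Rightarrow> 'a" where
  "one_ps v = (SOME c. c 0 = \<one> \<and> (\<forall>t. c t \<in> S \<and> (c has_vector_derivative lf v (c t)) (at t)))"

lemma one_ps:
  assumes "v \<in> T1"
  shows "one_ps v 0 = \<one>" "one_ps v t \<in> S" "(one_ps v has_vector_derivative lf v (one_ps v t)) (at t)"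
  using someI_ex[OF one_parameter_exists[OF assms], folded one_ps_def] by blast+

lemma one_ps_Cinf: "v \<in> T1 \<Longrightarrow> Cinf_on (one_ps v) UNIV"
  by (rule integral_curve_Cinf[OF open_UNIV _ smooth_lf one_ps(3)]) (auto simp: one_ps)

lemma one_ps_add:
  assumes v: "v \<in> T1" shows "one_ps v (s + t) = one_ps v s \<otimes> one_ps v t"
proof (rule integral_curve_unique[where I=UNIV and ?t0.0=0 and v="\<lambda>_. v" and ?c1.0="\<lambda>t. one_ps v (s + t)" and ?c2.0="\<lambda>t. one_ps v s \<otimes> one_ps v t"])
  show "((\<lambda>t. one_ps v (s + t)) has_vector_derivative lf v (one_ps v (s + t))) (at t)" for t
    by (rule has_vector_derivative_shift, rule one_ps(3)[OF v])
  show "((\<lambda>t. one_ps v s \<otimes> one_ps v t) has_vector_derivative lf v (one_ps v s \<otimes> one_ps v t)) (at t)" for t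
    by (rule curve_left_lf[OF one_ps(2)[OF v] v one_ps(3)[OF v], of UNIV]) (use one_ps(2)[OF v] in auto)
qed (use one_ps[OF v] v in \<open>auto simp: connected_UNIV\<close>)

lemma one_ps_minus: "v \<in> T1 \<Longrightarrow> inv (one_ps v t) = one_ps v (- t)"
  using one_ps_add[of v "- t" t] one_ps[of v] by (intro inv_equality) auto

end

section \<open>The adjoint representation\<close>

context embedded_lie_group
begin

definition Ad :: "'a \<Rightarrow> 'a \<Rightarrow> 'a" where "Ad a v = differential S (\<lambda>b. a \<otimes> b \<otimes> inv a) \<one> v"

lemma smooth_conj: "a \<in> S \<Longrightarrow> smooth_on S (\<lambda>b. a \<otimes> b \<otimes> inv a)"
  by (rule smooth_on_mult[OF smooth_left smooth_const]) auto

lemma conj_curve: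
  assumes "a \<in> S" "(c has_vector_derivative v) (at 0)" "open I" "0 \<in> I" "c ` I \<subseteq> S" "c 0 = \<one>"
  shows "((\<lambda>t. a \<otimes> c t \<otimes> inv a) has_vector_derivative Ad a v) (at 0)"
  using smooth_on_curve[OF smooth_conj[OF assms(1)] assms(2-5)] assms(6) by (simp add: Ad_def)

lemma Ad_T1: "a \<in> S \<Longrightarrow> v \<in> T1 \<Longrightarrow> Ad a v \<in> T1"
proof -
  assume a: "a \<in> S" and v: "v \<in> T1"
  have "Ad a v \<in> tangent_space S (a \<otimes> \<one> \<otimes> inv a)"
    unfolding Ad_def by (rule differential_tangent[OF smooth_conj[OF a] _ v]) (use a in auto)
  then show ?thesis using a by simp
qed

lemma Ad_mult: "a \<in> S \<Longrightarrow> b \<in> S \<Longrightarrow> v \<in> T1 \<Longrightarrow> Ad (a \<otimes> b) v = Ad a (Ad b v)"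
proof -
  assume ab: "a \<in> S" "b \<in> S" and v: "v \<in> T1"
  have "Ad (a \<otimes> b) v = differential S (\<lambda>c. a \<otimes> (b \<otimes> c \<otimes> inv b) \<otimes> inv a) \<one> v"
    unfolding Ad_def by (rule differential_cong[OF _ smooth_conj _ v]) (use ab in \<open>auto simp: inv_mult_group m_assoc\<close>)
  also have "\<dots> = differential S (\<lambda>c. a \<otimes> c \<otimes> inv a) (b \<otimes> \<one> \<otimes> inv b) (Ad b v)"
    unfolding Ad_def by (rule differential_compose[OF smooth_conj[OF ab(2)] _ smooth_conj[OF ab(1)] _ v]) (use ab in auto)
  finally show ?thesis using ab by (simp add: Ad_def)
qed

lemma Ad_one: "v \<in> T1 \<Longrightarrow> Ad \<one> v = v"
proof -
  assume v: "v \<in> T1"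
  have "v = differential S (\<lambda>b. b) \<one> v" using differential_ident[OF one_closed v] by simp
  also have "\<dots> = Ad \<one> v" unfolding Ad_def by (rule differential_cong[OF _ smooth_ident _ v]) auto
  finally show ?thesis by simp
qed

text \<open>Moves the dependence on \<open>a\<close> out of the differentiated map and into
  arguments of \<open>DM\<close>, where smoothness in \<open>a\<close> is available.\<close>

lemma Ad_eq_DM: "a \<in> S \<Longrightarrow> v \<in> T1 \<Longrightarrow> Ad a v = DM a (inv a) (lf v a, 0)"
proof -
  assume a: "a \<in> S" and v: "v \<in> T1"
  obtain c e where c: "0 < e" "c ` {-e<..<e} \<subseteq> S" "c 0 = \<one>" "(c has_vector_derivative v) (at (0::real))"
    using tangent_curve[OF v] by metis
  let ?I = "{-e<..<e}"
  have I: "open ?I" "0 \<in> ?I" using c(1) by auto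
  have "((\<lambda>t. a \<otimes> c t) has_vector_derivative lf v a) (at 0)"
    using curve_left[OF a c(4) I c(2)] c(3) by (simp add: lf_def)
  from curve_right[OF _ this I, of "inv a"]
  have "((\<lambda>t. a \<otimes> c t \<otimes> inv a) has_vector_derivative DM a (inv a) (lf v a, 0)) (at 0)" using a c(2,3) by auto
  then show ?thesis using conj_curve[OF a c(4) I c(2,3)] vector_derivative_at by metis
qed

lemma smooth_Ad: "v \<in> T1 \<Longrightarrow> smooth_on S (\<lambda>a. Ad a v)"
proof -
  assume v: "v \<in> T1"
  have "smooth_on S (\<lambda>a. DM a (inv a) (lf v a, 0))"
    by (rule smooth_on_DM[OF smooth_ident smooth_inv _ _ smooth_lf[OF v] smooth_const]) (auto intro: lf_tangent zero_tangent v)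
  then show ?thesis by (rule smooth_on_cong[rotated]) (simp add: Ad_eq_DM v)
qed

text \<open>Right translation of a left-invariant field twists it by \<open>Ad\<close>:
  differentiate \<open>a \<otimes> c t \<otimes> b = (a \<otimes> b) \<otimes> (inv b \<otimes> c t
  \<otimes> b)\<close>.\<close>

lemma DM_right_lf: "a \<in> S \<Longrightarrow> b \<in> S \<Longrightarrow> v \<in> T1 \<Longrightarrow> DM a b (lf v a, 0) = lf (Ad (inv b) v) (a \<otimes> b)"
proof -
  assume ab: "a \<in> S" "b \<in> S" and v: "v \<in> T1"
  obtain c e where c: "0 < e" "c ` {-e<..<e} \<subseteq> S" "c 0 = \<one>" "(c has_vector_derivative v) (at (0::real))"
    using tangent_curve[OF v] by metis
  let ?I = "{-e<..<e}"
  have I: "open ?I" "0 \<in> ?I" using c(1) by auto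
  have ib: "inv b \<in> S" using ab by simp
  have "((\<lambda>t. a \<otimes> c t) has_vector_derivative lf v a) (at 0)"
    using curve_left[OF ab(1) c(4) I c(2)] c(3) by (simp add: lf_def)
  from curve_right[OF ab(2) this I]
  have 1: "((\<lambda>t. a \<otimes> c t \<otimes> b) has_vector_derivative DM a b (lf v a, 0)) (at 0)" using ab c(2,3) by auto
  have 2: "((\<lambda>t. inv b \<otimes> c t \<otimes> inv (inv b)) has_vector_derivative Ad (inv b) v) (at 0)"
    by (rule conj_curve[OF ib c(4) I c(2,3)])
  have 3: "(\<lambda>t. inv b \<otimes> c t \<otimes> inv (inv b)) ` ?I \<subseteq> S" using ab c(2) by auto
  have "((\<lambda>t. (a \<otimes> b) \<otimes> (inv b \<otimes> c t \<otimes> inv (inv b))) has_vector_derivative lf (Ad (inv b) v) (a \<otimes> b)) (at 0)"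
    using curve_left[OF _ 2 I 3, of "a \<otimes> b"] ab c(3) by (simp add: lf_def)
  then have "((\<lambda>t. a \<otimes> c t \<otimes> b) has_vector_derivative lf (Ad (inv b) v) (a \<otimes> b)) (at 0)"
  proof (rule has_vector_derivative_transform_within_open[OF _ I])
    fix t assume "t \<in> ?I"
    then have "c t \<in> S" using c(2) by blast
    then have "inv b \<otimes> c t \<otimes> inv (inv b) = inv b \<otimes> (c t \<otimes> b)" using ab by (simp add: m_assoc)
    moreover have "a \<otimes> b \<otimes> (inv b \<otimes> (c t \<otimes> b)) = a \<otimes> c t \<otimes> b"
      using ab \<open>c t \<in> S\<close> by (metis inv_closed m_assoc m_closed r_inv r_one)
    ultimately show "a \<otimes> b \<otimes> (inv b \<otimes> c t \<otimes> inv (inv b)) = a \<otimes> c t \<otimes> b" by simp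
  qed
  then show ?thesis using 1 vector_derivative_at by metis
qed

text \<open>The product rule for logarithmic derivatives: the velocity of the left factor is
  conjugated past the right factor.\<close>

lemma curve_mult_lf:
  assumes "(c has_vector_derivative lf v (c t)) (at t)" "(b has_vector_derivative lf w (b t)) (at t)" "v \<in> T1" "w \<in> T1"
    "\<And>t. c t \<in> S" "\<And>t. b t \<in> S"
  shows "((\<lambda>t. c t \<otimes> b t) has_vector_derivative lf (Ad (inv (b t)) v + w) (c t \<otimes> b t)) (at t)"
proof -
  have "((\<lambda>t. c t \<otimes> b t) has_vector_derivative DM (c t) (b t) (lf v (c t), lf w (b t))) (at t)"
    by (rule curve_mult[OF assms(1,2) open_UNIV]) (use assms in auto)
  moreover have "DM (c t) (b t) (lf v (c t), lf w (b t)) = lf (Ad (inv (b t)) v + w) (c t \<otimes> b t)"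
    using assms(3-6) by (subst DM_split) (auto simp: DM_right_lf DM_left_lf lf_linear)
  ultimately show ?thesis by simp
qed

text \<open>In a local extension \<open>h\<close> of the multiplication the two terms of the bracket are the mixed second
  derivatives of \<open>h\<close>. Differentiating \<open>c \<otimes> u = Ad c u \<otimes> c\<close> along \<open>c\<close> produces the same difference.\<close>

lemma Ad_derivative:
  assumes u: "u \<in> T1" and v: "v \<in> T1"
    and A': "differential S (\<lambda>a. Ad a u) \<one> v \<in> T1"
  shows "differential S (\<lambda>a. Ad a u) \<one> v = lie_bracket G v u"
proof -
  obtain W h where W: "open W" "(\<one>, \<one>) \<in> W" "Cinf_on h W" "\<forall>z\<in>W \<inter> (S \<times> S). (\<lambda>(a, b). a \<otimes> b) z = h z"
    using bspec[OF smooth_mult[unfolded smooth_on_def], of "(\<one>, \<one>)"] by blast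
  define Dh where "Dh p = frechet_derivative h (at p)" for p
  define H where "H x = frechet_derivative (\<lambda>p. Dh p x) (at (\<one>, \<one>))" for x
  have DM_Dh: "DM a b (v, w) = Dh (a, b) (v, w)" if "(a, b) \<in> W" "v \<in> tangent_space S a" "w \<in> tangent_space S b" for a b v w
    unfolding DM_def Dh_def by (rule differential_local_extension[OF W(1) that(1) W(3,4) tangent_Pair[OF that(2,3)]])
  have CDh: "Cinf_on (\<lambda>p. Dh p x) W" for x unfolding Dh_def using W(3) Cinf_on_iff by blast
  have dDh: "((\<lambda>p. Dh p x) has_derivative H x) (at (\<one>, \<one>))" for x
    unfolding H_def by (rule Cinf_on_has_derivative[OF CDh W(2)])
  have linDh: "linear (Dh p)" if "p \<in> W" for p unfolding Dh_def using has_derivative_linear[OF Cinf_on_has_derivative[OF W(3) that]] .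
  have Hsym: "H x y = H y x" for x y
    unfolding H_def Dh_def by (rule mixed_derivatives_commute[OF W(1,3,2)])
  have W1: "open ((\<lambda>a. (a, \<one>)) -` W)" and W2: "open ((\<lambda>a. (\<one>, a)) -` W)"
    by (rule open_vimage[OF W(1)], intro continuous_intros)+
  have lf_Dh: "lf w a = Dh (a, \<one>) (0, w)" if "a \<in> S" "(a, \<one>) \<in> W" "w \<in> T1" for a w
    unfolding lf_def using DM_Dh[OF that(2) zero_tangent[OF that(1)] that(3)] .
  have d_lf: "differential S (lf w) \<one> z = H (0, w) (z, 0)" if "w \<in> T1" "z \<in> T1" for w z
  proof -
    have p: "((\<lambda>a. (a, \<one>)) has_derivative (\<lambda>z. (z, 0))) (at \<one>)" by (intro has_derivative_Pair has_derivative_ident has_derivative_const)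
    have "((\<lambda>a. Dh (a, \<one>) (0, w)) has_derivative (\<lambda>z. H (0, w) (z, 0))) (at \<one>)"
      using diff_chain_at[OF p dDh[of "(0, w)"]] by (simp add: o_def)
    then have 1: "frechet_derivative (\<lambda>a. Dh (a, \<one>) (0, w)) (at \<one>) z = H (0, w) (z, 0)" using frechet_derivative_at by metis
    have "Cinf_on (\<lambda>a. Dh (a, \<one>) (0, w)) ((\<lambda>a. (a, \<one>)) -` W)"
      by (rule Cinf_compose[OF W1 W(1) _ _ CDh]) (use W1 in \<open>auto intro!: Cinf_intros\<close>)
    then show ?thesis
      using differential_local_extension[OF W1 _ _ _ that(2), of "\<lambda>a. Dh (a, \<one>) (0, w)" "lf w"] lf_Dh that(1) W(2) 1 by auto
  qed
  have lif: "differential S (left_invariant_field G w) \<one> z = H (0, w) (z, 0)" if "w \<in> T1" "z \<in> T1" for w z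
    using differential_cong[OF lf_left_invariant[OF _ that(1), symmetric] smooth_lf[OF that(1)] one_closed that(2)] d_lf[OF that] by simp
  have lf1: "lf w \<one> = w" if "w \<in> T1" for w
    using DM_left_tangent[OF one_closed that] differential_cong[OF _ smooth_left[OF one_closed] one_closed that, of "\<lambda>b. b"] differential_ident[OF one_closed that]
    by (simp add: lf_def)
  have bracket: "lie_bracket G v u = H (0, u) (v, 0) - H (0, v) (u, 0)"
    unfolding lie_bracket_def field_bracket_def using lif u v lf1 by (simp add: lf_left_invariant)
  define A' where "A' = differential S (\<lambda>a. Ad a u) \<one> v"
  obtain c e where c: "0 < e" "Cinf_on c {-e<..<e}" "c ` {-e<..<e} \<subseteq> S" "c 0 = \<one>" "(c has_vector_derivative v) (at (0::real))"
    using tangent_spaceE[OF v] by metis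
  define I where "I = {-e<..<e} \<inter> c -` ((\<lambda>a. (a, \<one>)) -` W \<inter> (\<lambda>a. (\<one>, a)) -` W)"
  have I: "open I" unfolding I_def
    by (rule continuous_open_preimage[OF Cinf_on_continuous[OF c(2)] open_greaterThanLessThan open_Int[OF W1 W2]])
  have I0: "0 \<in> I" using c(1,4) W(2) by (simp add: I_def)
  have cI: "c s \<in> S" "(c s, \<one>) \<in> W" "(\<one>, c s) \<in> W" if "s \<in> I" for s using that c(3) by (auto simp: I_def)
  have dA: "((\<lambda>s. Ad (c s) u) has_vector_derivative A') (at 0)"
    unfolding A'_def using smooth_on_curve[OF smooth_Ad[OF u] c(5) _ _ c(3)] c(1,4) by simp
  have eq: "Dh (c s, \<one>) (0, u) = Dh (\<one>, c s) (Ad (c s) u, 0)" if "s \<in> I" for s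
  proof -
    note cs = cI[OF that]
    have "Dh (\<one>, c s) (Ad (c s) u, 0) = DM \<one> (c s) (lf (Ad (c s) u) \<one>, 0)"
      using DM_Dh[OF cs(3) Ad_T1[OF cs(1) u] zero_tangent[OF cs(1)]] lf1[OF Ad_T1[OF cs(1) u]] by simp
    also have "\<dots> = lf (Ad (inv (c s)) (Ad (c s) u)) (c s)"
      using DM_right_lf[OF one_closed cs(1) Ad_T1[OF cs(1) u]] cs(1) by simp
    also have "\<dots> = lf u (c s)" using Ad_mult[of "inv (c s)" "c s" u] cs(1) u Ad_one by simp
    finally show ?thesis using lf_Dh[OF cs(1,2) u] by simp
  qed
  have p: "((\<lambda>s. (c s, \<one>)) has_vector_derivative (v, 0)) (at 0)" "((\<lambda>s. (\<one>, c s)) has_vector_derivative (0, v)) (at 0)"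
    using c(5) by (auto intro!: has_vector_derivative_Pair)
  have d: "((\<lambda>s. Dh (c s, \<one>) x) has_vector_derivative H x (v, 0)) (at 0)" "((\<lambda>s. Dh (\<one>, c s) x) has_vector_derivative H x (0, v)) (at 0)" for x
    using has_derivative_curve[of "\<lambda>p. Dh p x" "H x" "\<lambda>s. (c s, \<one>)" 0 UNIV "(v, 0)" UNIV]
      has_derivative_curve[of "\<lambda>p. Dh p x" "H x" "\<lambda>s. (\<one>, c s)" 0 UNIV "(0, v)" UNIV] p dDh[of x] c(4) by auto
  have expand: "Dh p (w, 0) = (\<Sum>b\<in>Basis. (w \<bullet> b) *\<^sub>R Dh p (b, 0))" if "p \<in> W" for p w
  proof -
    have "linear (\<lambda>w. Dh p (w, 0))" using linear_compose[of "\<lambda>w. (w, 0)" "Dh p"] linDh[OF that] by (simp add: o_def linear_iff)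
    then show ?thesis by (rule linear_expand)
  qed
  have "((\<lambda>s. \<Sum>b\<in>Basis. (Ad (c s) u \<bullet> b) *\<^sub>R Dh (\<one>, c s) (b, 0)) has_vector_derivative
     (\<Sum>b\<in>Basis. (Ad (c 0) u \<bullet> b) *\<^sub>R H (b, 0) (0, v) + (A' \<bullet> b) *\<^sub>R Dh (\<one>, c 0) (b, 0))) (at 0)"
    by (intro has_vector_derivative_sum has_vector_derivative_scaleR d(2)
        bounded_linear.has_vector_derivative[OF bounded_linear_inner_left, of _ _ "at 0", folded has_real_derivative_iff_has_vector_derivative] dA)
  moreover have "(\<Sum>b\<in>Basis. (Ad (c 0) u \<bullet> b) *\<^sub>R H (b, 0) (0, v) + (A' \<bullet> b) *\<^sub>R Dh (\<one>, c 0) (b, 0)) = H (u, 0) (0, v) + Dh (\<one>, \<one>) (A', 0)"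
  proof -
    have "((\<lambda>p. \<Sum>b\<in>Basis. (u \<bullet> b) *\<^sub>R Dh p (b, 0)) has_derivative (\<lambda>y. \<Sum>b\<in>Basis. (u \<bullet> b) *\<^sub>R H (b, 0) y)) (at (\<one>, \<one>))"
      by (intro has_derivative_sum has_derivative_scaleR_right dDh)
    then have "((\<lambda>p. Dh p (u, 0)) has_derivative (\<lambda>y. \<Sum>b\<in>Basis. (u \<bullet> b) *\<^sub>R H (b, 0) y)) (at (\<one>, \<one>))"
      by (rule has_derivative_transform_within_open[OF _ W(1,2)]) (simp add: expand)
    then have "H (u, 0) = (\<lambda>y. \<Sum>b\<in>Basis. (u \<bullet> b) *\<^sub>R H (b, 0) y)" using has_derivative_unique[OF dDh] by blast
    then show ?thesis using expand[OF W(2), of A'] c(4) Ad_one[OF u] by (simp add: sum.distrib)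
  qed
  ultimately have "((\<lambda>s. \<Sum>b\<in>Basis. (Ad (c s) u \<bullet> b) *\<^sub>R Dh (\<one>, c s) (b, 0)) has_vector_derivative H (u, 0) (0, v) + Dh (\<one>, \<one>) (A', 0)) (at 0)" by simp
  then have "((\<lambda>s. Dh (c s, \<one>) (0, u)) has_vector_derivative H (u, 0) (0, v) + Dh (\<one>, \<one>) (A', 0)) (at 0)"
    by (rule has_vector_derivative_transform_within_open[OF _ I I0]) (use eq expand cI in auto)
  then have "H (0, u) (v, 0) = H (u, 0) (0, v) + Dh (\<one>, \<one>) (A', 0)" using d(1) vector_derivative_at by metis
  \<comment> \<open>\<open>Dh\<close> is known to agree with \<open>DM\<close> only on tangent
    vectors, so this is where tangency of \<open>A'\<close> enters.\<close>
  moreover have "Dh (\<one>, \<one>) (A', 0) = A'"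
    using DM_Dh[OF W(2) _ zero_tangent[OF one_closed], of A'] DM_right_lf[OF one_closed one_closed, of A'] A' lf1 Ad_one by (simp add: A'_def)
  ultimately show ?thesis using bracket Hsym[of "(u, 0)" "(0, v)"] by (simp add: A'_def)
qed

end

section \<open>Homomorphisms onto simply connected groups\<close>

text \<open>Instantiated twice: for the model group mapping to \<open>G\<close>, and for the
  additive real line mapping onto the subgroup \<open>H\<close>. The source is a vector space as a
  set, which provides straight paths.\<close>

locale immersive_hom = embedded_lie_group G for G :: "'a::euclidean_space monoid" (structure) +
  fixes A :: "'m::euclidean_space monoid" and \<Phi> :: "'m \<Rightarrow> 'a"
  assumes A: "group A" "carrier A = UNIV" and cont_A: "\<And>g. continuous_on UNIV (\<lambda>y. g \<otimes>\<^bsub>A\<^esub> y)"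
    and hom: "\<And>x y. \<Phi> (x \<otimes>\<^bsub>A\<^esub> y) = \<Phi> x \<otimes> \<Phi> y" and range: "range \<Phi> \<subseteq> S" and smooth: "Cinf_on \<Phi> UNIV"
    and inj_D: "\<And>v. frechet_derivative \<Phi> (at \<one>\<^bsub>A\<^esub>) v = 0 \<Longrightarrow> v = 0"
    and onto_D: "T1 \<subseteq> range (frechet_derivative \<Phi> (at \<one>\<^bsub>A\<^esub>))" and conn: "connected S"
begin

lemma \<Phi>_S: "\<Phi> x \<in> S" using range by blast

lemma \<Phi>_one: "\<Phi> \<one>\<^bsub>A\<^esub> = \<one>"
proof -
  have "\<Phi> \<one>\<^bsub>A\<^esub> \<otimes> \<Phi> \<one>\<^bsub>A\<^esub> = \<Phi> \<one>\<^bsub>A\<^esub>"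
    using hom[of "\<one>\<^bsub>A\<^esub>" "\<one>\<^bsub>A\<^esub>"] group.is_monoid[OF A(1)] A(2) by (metis UNIV_I monoid.l_one)
  then show ?thesis using \<Phi>_S by (metis l_cancel_one)
qed

lemma A_simps:
  "inv\<^bsub>A\<^esub> x \<otimes>\<^bsub>A\<^esub> x = \<one>\<^bsub>A\<^esub>" "x \<otimes>\<^bsub>A\<^esub> inv\<^bsub>A\<^esub> x = \<one>\<^bsub>A\<^esub>" "x \<otimes>\<^bsub>A\<^esub> \<one>\<^bsub>A\<^esub> = x" "\<one>\<^bsub>A\<^esub> \<otimes>\<^bsub>A\<^esub> x = x"
  "x \<otimes>\<^bsub>A\<^esub> y \<otimes>\<^bsub>A\<^esub> z = x \<otimes>\<^bsub>A\<^esub> (y \<otimes>\<^bsub>A\<^esub> z)" "inv\<^bsub>A\<^esub> x \<otimes>\<^bsub>A\<^esub> (x \<otimes>\<^bsub>A\<^esub> y) = y" "x \<otimes>\<^bsub>A\<^esub> (inv\<^bsub>A\<^esub> x \<otimes>\<^bsub>A\<^esub> y) = y"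
proof -
  interpret A: group A by (rule A)
  show "inv\<^bsub>A\<^esub> x \<otimes>\<^bsub>A\<^esub> x = \<one>\<^bsub>A\<^esub>" "x \<otimes>\<^bsub>A\<^esub> inv\<^bsub>A\<^esub> x = \<one>\<^bsub>A\<^esub>" "x \<otimes>\<^bsub>A\<^esub> \<one>\<^bsub>A\<^esub> = x" "\<one>\<^bsub>A\<^esub> \<otimes>\<^bsub>A\<^esub> x = x"
    "x \<otimes>\<^bsub>A\<^esub> y \<otimes>\<^bsub>A\<^esub> z = x \<otimes>\<^bsub>A\<^esub> (y \<otimes>\<^bsub>A\<^esub> z)"
    by (simp_all add: A(2) A.m_assoc)
  show "inv\<^bsub>A\<^esub> x \<otimes>\<^bsub>A\<^esub> (x \<otimes>\<^bsub>A\<^esub> y) = y" "x \<otimes>\<^bsub>A\<^esub> (inv\<^bsub>A\<^esub> x \<otimes>\<^bsub>A\<^esub> y) = y"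
    by (simp_all add: A(2) A.m_assoc[symmetric])
qed

lemma \<Phi>_inv: "\<Phi> (inv\<^bsub>A\<^esub> x) = inv (\<Phi> x)"
  using hom[of "inv\<^bsub>A\<^esub> x" x] \<Phi>_S by (simp add: A_simps \<Phi>_one inv_equality)

lemma local_inverse:
  obtains U P h where "open U" "\<one>\<^bsub>A\<^esub> \<in> U" "open P" "\<Phi> ` U = P \<inter> S" "continuous_on P h"
    "\<And>y. y \<in> U \<Longrightarrow> h (\<Phi> y) = y" "\<And>x. x \<in> P \<inter> S \<Longrightarrow> h x \<in> U \<and> \<Phi> (h x) = x"
proof -
  obtain k where k: "submanifold k S" using submanifold_S by blast
  show ?thesis
    using immersion_local_inverse[OF k open_UNIV UNIV_I smooth range inj_D] onto_D \<Phi>_one Cinf_on_continuous that by metis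
qed

lemma open_translate:
  assumes "open P" "a \<in> S" shows "openin (top_of_set S) {b \<in> S. inv a \<otimes> b \<in> P}"
proof -
  have "continuous_on S (\<lambda>b. inv a \<otimes> b)" using smooth_on_continuous[OF smooth_left] assms(2) by simp
  then show ?thesis using continuous_openin_preimage_gen[OF _ assms(1), of S "\<lambda>b. inv a \<otimes> b"] by (simp add: vimage_def Int_def conj_commute)
qed

text \<open>Around every \<open>a\<close> in \<open>S\<close> the neighbourhood \<open>a P\<close>
  differs from \<open>a\<close> only by factors in the image. So the image and its complement are
  both open in the connected set \<open>S\<close>.\<close>

lemma surj: "range \<Phi> = S"
proof -
  obtain U P h where U: "open U" "\<one>\<^bsub>A\<^esub> \<in> U" "open P" "\<Phi> ` U = P \<inter> S" by (rule local_inverse) blast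
  have P1: "\<one> \<in> P" using U(2,4) \<Phi>_one by (metis IntD1 imageI)
  have 1: "openin (top_of_set S) (range \<Phi>)"
  proof (subst openin_subopen, intro ballI)
    fix a assume a: "a \<in> range \<Phi>"
    have "{b \<in> S. inv a \<otimes> b \<in> P} \<subseteq> range \<Phi>"
    proof safe
      fix b assume b: "b \<in> S" "inv a \<otimes> b \<in> P"
      then have "inv a \<otimes> b \<in> \<Phi> ` U" using U(4) a range by auto
      then obtain x y where "inv a \<otimes> b = \<Phi> x" "a = \<Phi> y" using a by blast
      then have "b = \<Phi> (y \<otimes>\<^bsub>A\<^esub> x)" using hom b(1) \<Phi>_S by (metis inv_closed l_one m_assoc r_inv)
      then show "b \<in> range \<Phi>" by simp
    qed
    then show "\<exists>T. openin (top_of_set S) T \<and> a \<in> T \<and> T \<subseteq> range \<Phi>"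
      using open_translate[OF U(3), of a] a range P1 by (intro exI[of _ "{b \<in> S. inv a \<otimes> b \<in> P}"]) auto
  qed
  have 2: "openin (top_of_set S) (S - range \<Phi>)"
  proof (subst openin_subopen, intro ballI)
    fix a assume a: "a \<in> S - range \<Phi>"
    have "{b \<in> S. inv a \<otimes> b \<in> P} \<inter> range \<Phi> = {}"
    proof safe
      fix y assume b: "\<Phi> y \<in> S" "inv a \<otimes> \<Phi> y \<in> P"
      then have "inv a \<otimes> \<Phi> y \<in> \<Phi> ` U" using U(4) a by auto
      then obtain x where x: "inv a \<otimes> \<Phi> y = \<Phi> x" by blast
      have "a = \<Phi> y \<otimes> inv (\<Phi> x)"
      proof -
        have "a \<otimes> \<Phi> x = \<Phi> y" using a \<Phi>_S x by (metis DiffD1 inv_closed l_one m_assoc r_inv)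
        then show ?thesis using a \<Phi>_S by (metis DiffD1 inv_solve_right')
      qed
      then have "a = \<Phi> (y \<otimes>\<^bsub>A\<^esub> inv\<^bsub>A\<^esub> x)" by (simp add: hom \<Phi>_inv)
      then show "\<Phi> y \<in> {}" using a by blast
    qed
    then show "\<exists>T. openin (top_of_set S) T \<and> a \<in> T \<and> T \<subseteq> S - range \<Phi>"
      using open_translate[OF U(3), of a] a P1 by (intro exI[of _ "{b \<in> S. inv a \<otimes> b \<in> P}"]) auto
  qed
  have "closedin (top_of_set S) (range \<Phi>)" using 2 range by (simp add: closedin_def)
  then show ?thesis using conn[unfolded connected_clopen] 1 by blast
qed

text \<open>The neighbourhood \<open>x P\<close> is evenly covered by the translates
  \<open>g U\<close> with \<open>g\<close> in the fibre over \<open>x\<close>. For a given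
  \<open>y\<close>, all the elements \<open>g\<inverse> y\<close> have the same image, so
  injectivity of \<open>\<Phi>\<close> on \<open>U\<close> makes distinct sheets disjoint.\<close>

lemma covering: "covering_space UNIV \<Phi> S"
proof
  show "continuous_on UNIV \<Phi>" by (rule Cinf_on_continuous[OF smooth])
  show "\<Phi> ` UNIV = S" by (rule surj)
next
  fix x assume x: "x \<in> S"
  obtain U P h where U: "open U" "\<one>\<^bsub>A\<^esub> \<in> U" "open P" "\<Phi> ` U = P \<inter> S" "continuous_on P h"
    "\<And>y. y \<in> U \<Longrightarrow> h (\<Phi> y) = y" "\<And>x. x \<in> P \<inter> S \<Longrightarrow> h x \<in> U \<and> \<Phi> (h x) = x" using local_inverse by metis
  have P1: "\<one> \<in> P" using U(2,4) \<Phi>_one by (metis IntD1 imageI)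
  define T where "T = {b \<in> S. inv x \<otimes> b \<in> P}"
  define B where "B g = {y. inv\<^bsub>A\<^esub> g \<otimes>\<^bsub>A\<^esub> y \<in> U}" for g
  define F where "F = {g. \<Phi> g = x}"
  have BT: "\<Phi> y \<in> T" if "g \<in> F" "y \<in> B g" for g y
  proof -
    have "\<Phi> (inv\<^bsub>A\<^esub> g \<otimes>\<^bsub>A\<^esub> y) \<in> P" using that U(4) by (auto simp: B_def)
    then show ?thesis using that(1) \<Phi>_S by (simp add: T_def F_def hom \<Phi>_inv)
  qed
  show "\<exists>T. x \<in> T \<and> openin (top_of_set S) T \<and> (\<exists>v. \<Union> v = UNIV \<inter> \<Phi> -` T \<and> (\<forall>u\<in>v. openin (top_of_set UNIV) u) \<and> pairwise disjnt v \<and> (\<forall>u\<in>v. \<exists>q. homeomorphism u T \<Phi> q))"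
  proof (intro exI[of _ T] exI[of _ "B ` F"] conjI)
    show "x \<in> T" using x P1 by (simp add: T_def)
    show "openin (top_of_set S) T" unfolding T_def by (rule open_translate[OF U(3) x])
    show "\<Union> (B ` F) = UNIV \<inter> \<Phi> -` T"
    proof (intro equalityI subsetI)
      fix y assume "y \<in> UNIV \<inter> \<Phi> -` T"
      then have "inv x \<otimes> \<Phi> y \<in> \<Phi> ` U" using U(4) x \<Phi>_S by (auto simp: T_def)
      then obtain u where u: "u \<in> U" "inv x \<otimes> \<Phi> y = \<Phi> u" by blast
      define g where "g = y \<otimes>\<^bsub>A\<^esub> inv\<^bsub>A\<^esub> u"
      have "x \<otimes> \<Phi> u = \<Phi> y" using u(2) x \<Phi>_S by (metis inv_closed l_one m_assoc r_inv)
      then have "\<Phi> g = x" unfolding g_def hom \<Phi>_inv using x \<Phi>_S by (metis inv_solve_right')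
      moreover have "inv\<^bsub>A\<^esub> g \<otimes>\<^bsub>A\<^esub> y = u"
      proof -
        interpret A: group A by (rule A)
        show ?thesis unfolding g_def by (simp add: A(2) A.inv_mult_group A.m_assoc)
      qed
      ultimately show "y \<in> \<Union> (B ` F)" using u(1) by (auto simp: B_def F_def)
    qed (use BT in auto)
    have "open (B g)" for g unfolding B_def
      using open_vimage[OF U(1) cont_A, of "inv\<^bsub>A\<^esub> g"] by (simp add: vimage_def)
    then show "\<forall>u\<in>B ` F. openin (top_of_set UNIV) u" by (auto simp: subtopology_UNIV)
    show "pairwise disjnt (B ` F)"
    proof (clarsimp simp: pairwise_def disjnt_def)
      fix g g' assume g: "g \<in> F" "g' \<in> F" "B g \<noteq> B g'"
      show "B g \<inter> B g' = {}"
      proof (rule ccontr)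
        assume "B g \<inter> B g' \<noteq> {}"
        then obtain y where y: "inv\<^bsub>A\<^esub> g \<otimes>\<^bsub>A\<^esub> y \<in> U" "inv\<^bsub>A\<^esub> g' \<otimes>\<^bsub>A\<^esub> y \<in> U" by (auto simp: B_def)
        moreover have "\<Phi> (inv\<^bsub>A\<^esub> g \<otimes>\<^bsub>A\<^esub> y) = \<Phi> (inv\<^bsub>A\<^esub> g' \<otimes>\<^bsub>A\<^esub> y)" using g by (simp add: hom \<Phi>_inv F_def)
        ultimately have "inv\<^bsub>A\<^esub> g \<otimes>\<^bsub>A\<^esub> y = inv\<^bsub>A\<^esub> g' \<otimes>\<^bsub>A\<^esub> y" using U(6) by metis
        then have "inv\<^bsub>A\<^esub> g = inv\<^bsub>A\<^esub> g'" using A A_simps by (metis)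
        then have "g = g'" using A by (metis UNIV_I group.inv_inv)
        then show False using g(3) by simp
      qed
    qed
    show "\<forall>u\<in>B ` F. \<exists>q. homeomorphism u T \<Phi> q"
    proof safe
      fix g assume g: "g \<in> F"
      have gx: "\<Phi> g = x" using g by (simp add: F_def)
      have q: "g \<otimes>\<^bsub>A\<^esub> h (inv x \<otimes> b) \<in> B g \<and> \<Phi> (g \<otimes>\<^bsub>A\<^esub> h (inv x \<otimes> b)) = b" if "b \<in> T" for b
      proof -
        have b: "inv x \<otimes> b \<in> P \<inter> S" "b \<in> S" using that x by (auto simp: T_def)
        have "x \<otimes> (inv x \<otimes> b) = b" using b(2) x by (metis inv_closed l_one m_assoc r_inv)
        then show ?thesis using U(7)[OF b(1)] by (simp add: B_def A_simps hom gx)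
      qed
      have "homeomorphism (B g) T \<Phi> (\<lambda>b. g \<otimes>\<^bsub>A\<^esub> h (inv x \<otimes> b))"
      proof
        show "continuous_on (B g) \<Phi>" using Cinf_on_continuous[OF smooth] continuous_on_subset by blast
        have "continuous_on T (\<lambda>b. inv x \<otimes> b)"
          using smooth_on_continuous[OF smooth_left[of "inv x"]] x by (auto simp: T_def elim: continuous_on_subset)
        then have "continuous_on T (\<lambda>b. h (inv x \<otimes> b))"
          by (rule continuous_on_compose2[OF U(5)]) (auto simp: T_def)
        then show "continuous_on T (\<lambda>b. g \<otimes>\<^bsub>A\<^esub> h (inv x \<otimes> b))"
          by (rule continuous_on_compose2[OF cont_A[of g]]) auto
        show "\<Phi> ` B g \<subseteq> T" using BT[OF g] by blast
        show "(\<lambda>b. g \<otimes>\<^bsub>A\<^esub> h (inv x \<otimes> b)) ` T \<subseteq> B g" using q by blast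
        show "\<Phi> (g \<otimes>\<^bsub>A\<^esub> h (inv x \<otimes> b)) = b" if "b \<in> T" for b using q that by blast
        show "g \<otimes>\<^bsub>A\<^esub> h (inv x \<otimes> \<Phi> y) = y" if "y \<in> B g" for y
        proof -
          have "inv x \<otimes> \<Phi> y = \<Phi> (inv\<^bsub>A\<^esub> g \<otimes>\<^bsub>A\<^esub> y)" by (simp add: hom \<Phi>_inv gx)
          then show ?thesis using U(6)[of "inv\<^bsub>A\<^esub> g \<otimes>\<^bsub>A\<^esub> y"] that by (simp add: B_def A_simps)
        qed
      qed
      then show "\<exists>q. homeomorphism (B g) T \<Phi> q" by blast
    qed
  qed
qed

text \<open>If \<open>a\<close> and \<open>b\<close> have the same image, the segment between them
  maps to a loop. The loop is null-homotopic, so by monodromy its lift from \<open>a\<close> ends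
  where the constant lift ends.\<close>

lemma inj_if_simply_connected:
  assumes "simply_connected S" shows "inj \<Phi>"
proof (rule injI)
  fix a b assume ab: "\<Phi> a = \<Phi> b"
  have cont: "continuous_on X \<Phi>" for X using Cinf_on_continuous[OF smooth] continuous_on_subset by blast
  define p where "p = \<Phi> \<circ> linepath a b"
  have p: "path p" "path_image p \<subseteq> S" unfolding p_def
    by (rule path_continuous_image[OF path_linepath cont]) (use range in \<open>auto simp: path_image_compose\<close>)
  have "pathstart p = \<Phi> a" "pathfinish p = \<Phi> a" using ab by (auto simp: p_def pathstart_compose pathfinish_compose)
  then have "homotopic_paths S p (linepath (\<Phi> a) (\<Phi> a))"
    using assms p unfolding simply_connected_eq_contractible_path by metis
  then have "pathfinish (linepath a b) = pathfinish (linepath a a)"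
    by (intro covering_space_monodromy[OF covering p, of "linepath (\<Phi> a) (\<Phi> a)"]) (use \<Phi>_S path_linepath[of a a] path_linepath[of "\<Phi> a" "\<Phi> a"] in \<open>auto simp: p_def linepath_refl pathstart_def linepath_0'\<close>)
  then show "a = b" by simp
qed

end

section \<open>The simply connected group with Lie algebra of \<open>N(\<kappa>)\<close>\<close>

lemma ghat_bracket_eq: "ghat_bracket k u v =
  (vec2 (k * (snd (snd u)$2 * fst (snd v) - fst (snd u) * snd (snd v)$2)) (- k * (snd (snd u)$1 * fst (snd v) - fst (snd u) * snd (snd v)$1)),
   snd (snd u)$1 * snd (snd v)$2 - snd (snd u)$2 * snd (snd v)$1, 0)"
  by (simp add: ghat_bracket_def case_prod_beta vec2_eq)

lemma has_vector_derivative_zero_const: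
  fixes f :: "real \<Rightarrow> 'a::real_normed_vector"
  assumes "\<And>t. (f has_vector_derivative 0) (at t)"
  shows "f t = f 0"
proof -
  have "(f has_derivative (\<lambda>h. 0)) (at t within UNIV)" for t using assms[of t] by (simp add: has_vector_derivative_def)
  then have "\<exists>k. \<forall>t\<in>UNIV. f t = k" by (intro has_derivative_zero_constant convex_UNIV)
  then show ?thesis by auto
qed

lemma has_vector_derivative_linear:
  "(f has_vector_derivative f') F \<Longrightarrow> bounded_linear l \<Longrightarrow> ((\<lambda>x. l (f x)) has_vector_derivative l f') F"
  using bounded_linear.has_vector_derivative by blast

text \<open>The linear differential equation \<open>d' = [u, d]\<close> is solved one component at a time, as the
  algebra is nilpotent.\<close>

lemma nilpotent_flow_zero:
  assumes d: "\<And>t. (d has_vector_derivative ghat_bracket k u (d t)) (at t)" and 0: "d 0 = 0"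
  shows "d t = 0"
proof -
  have b: "bounded_linear (\<lambda>x :: ghat. snd (snd x))" "bounded_linear (\<lambda>x :: ghat. fst (snd x))" "bounded_linear (\<lambda>x :: ghat. fst x)"
    by (intro bounded_linear_snd_comp bounded_linear_fst_comp bounded_linear_snd bounded_linear_fst)+
  have 1: "snd (snd (d t)) = 0" for t
    using has_vector_derivative_zero_const[of "\<lambda>t. snd (snd (d t))"] has_vector_derivative_linear[OF d b(1)] 0 by (simp add: ghat_bracket_eq)
  have 2: "fst (snd (d t)) = 0" for t
    using has_vector_derivative_zero_const[of "\<lambda>t. fst (snd (d t))"] has_vector_derivative_linear[OF d b(2)] 0 by (simp add: ghat_bracket_eq 1)
  have "vec2 0 0 = 0" by (simp add: vec2_eq)
  then have "fst (d t) = 0" for t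
    using has_vector_derivative_zero_const[of "\<lambda>t. fst (d t)"] has_vector_derivative_linear[OF d b(3)] 0 by (simp add: ghat_bracket_eq 1 2)
  with 1 2 show ?thesis by (simp add: prod_eq_iff)
qed

text \<open>The exponential series of \<open>t\<close> times the inner derivation by
  \<open>u\<close>. It stops at the quadratic term because a threefold bracket with \<open>u\<close>
  vanishes.\<close>

definition nilpotent_flow :: "real \<Rightarrow> ghat \<Rightarrow> real \<Rightarrow> ghat \<Rightarrow> ghat" where
  "nilpotent_flow k u t v = v + t *\<^sub>R ghat_bracket k u v + (t^2 / 2) *\<^sub>R ghat_bracket k u (ghat_bracket k u v)"

lemma nilpotent_flow_derivative:
  "((\<lambda>t. nilpotent_flow k u t v) has_vector_derivative ghat_bracket k u (nilpotent_flow k u t v)) (at t)"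
proof -
  have 1: "((\<lambda>t. nilpotent_flow k u t v) has_vector_derivative ghat_bracket k u v + t *\<^sub>R ghat_bracket k u (ghat_bracket k u v)) (at t)"
    unfolding nilpotent_flow_def by (auto intro!: derivative_eq_intros)
  have 2: "ghat_bracket k u v + t *\<^sub>R ghat_bracket k u (ghat_bracket k u v) = ghat_bracket k u (nilpotent_flow k u t v)"
    unfolding nilpotent_flow_def ghat_bracket_eq by (simp add: prod_eq_iff vec2_eq algebra_simps)
  show ?thesis using 1 unfolding 2 .
qed

context embedded_lie_group
begin

lemma lf_one: "v \<in> T1 \<Longrightarrow> lf v \<one> = v"
  using DM_left_tangent[OF one_closed] differential_cong[OF _ smooth_left[OF one_closed] one_closed, of "\<lambda>b. b"] differential_ident[OF one_closed]
  by (simp add: lf_def)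

lemma tangent_eq_lf:
  assumes "a \<in> S" "v \<in> tangent_space S a"
  obtains w where "w \<in> T1" "v = lf w a"
proof
  show w: "DM (inv a) a (0, v) \<in> T1" using DM_left_in_tangent[of "inv a" v a] assms by simp
  obtain c e where c: "0 < e" "c ` {-e<..<e} \<subseteq> S" "c 0 = a" "(c has_vector_derivative v) (at (0::real))"
    using tangent_curve[OF assms(2)] by metis
  let ?I = "{-e<..<e}"
  have I: "open ?I" "0 \<in> ?I" using c(1) by auto
  have ia: "inv a \<in> S" using assms(1) by simp
  have 1: "((\<lambda>t. inv a \<otimes> c t) has_vector_derivative DM (inv a) a (0, v)) (at 0)"
    using curve_left[OF ia c(4) I c(2)] c(3) by simp
  have "((\<lambda>t. a \<otimes> (inv a \<otimes> c t)) has_vector_derivative lf (DM (inv a) a (0, v)) a) (at 0)"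
    using curve_left[OF assms(1) 1 I] c(2,3) ia assms(1) by (auto simp: lf_def)
  moreover have "a \<otimes> (inv a \<otimes> c t) = c t" if "t \<in> ?I" for t
    using that c(2) assms(1) by (simp add: image_subset_iff m_assoc[symmetric])
  ultimately have "(c has_vector_derivative lf (DM (inv a) a (0, v)) a) (at 0)"
    using has_vector_derivative_transform_within_open[OF _ I, of "\<lambda>t. a \<otimes> (inv a \<otimes> c t)" _ c] by auto
  then show "v = lf (DM (inv a) a (0, v)) a" using c(4) vector_derivative_at by metis
qed

end

text \<open>The left Maurer-Cartan form of the model group.\<close>

definition model_mc :: "real \<Rightarrow> ghat \<Rightarrow> ghat \<Rightarrow> ghat" where
  "model_mc k u w = (fst w - (k/2 * (snd (snd u)$1 * snd (snd w)$2 + snd (snd u)$2 * snd (snd w)$1)) *\<^sub>R snd (snd u)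
     - fst (snd u) *\<^sub>R vec2 (snd (snd w)$1) (- (snd (snd w)$2)),
     fst (snd w) - k/2 * (snd (snd u)$1 * snd (snd w)$2 - snd (snd u)$2 * snd (snd w)$1), snd (snd w))"

lemma model_mc_field: "model_mc k u (model_field k w u) = w"
  by (simp add: model_mc_def model_field_def prod_eq_iff)

definition model_mult_D :: "real \<Rightarrow> ghat \<Rightarrow> ghat \<Rightarrow> ghat \<Rightarrow> ghat" where
  "model_mult_D k a b w = (fst w + (k * (snd (snd w)$1 * snd (snd b)$2 + snd (snd b)$1 * snd (snd w)$2) + k/2 * (snd (snd a)$1 * snd (snd w)$2 + snd (snd a)$2 * snd (snd w)$1)) *\<^sub>R snd (snd a)
     + fst (snd a) *\<^sub>R vec2 (snd (snd w)$1) (- (snd (snd w)$2)),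
     fst (snd w) + k/2 * (snd (snd a)$1 * snd (snd w)$2 - snd (snd a)$2 * snd (snd w)$1), snd (snd w))"

lemma model_mult_D: "((\<lambda>b. model_mult k a b) has_derivative model_mult_D k a b) (at b)"
  unfolding model_mult_def model_mult_D_def[abs_def]
  by (rule has_derivative_eq_rhs, (rule has_derivative_rules)+) (auto simp: fun_eq_iff prod_eq_iff vec2_eq algebra_simps)

lemma model_mc_left_invariant: "model_mc k (model_mult k a b) (model_mult_D k a b w) = model_mc k b w"
  unfolding model_mc_def model_mult_def model_mult_D_def prod_eq_iff vec2_eq
  by (simp add: algebra_simps)

lemma linear_model_psi: "linear (model_psi k)"
  by (rule linearI) (auto simp: model_psi_def vec2_eq algebra_simps)

lemma model_psi_involution: "k * k = 1 \<Longrightarrow> model_psi k (model_psi k u) = u"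
  by (simp add: model_psi_def prod_eq_iff vec2_eq mult.assoc[symmetric])

locale lie_realization = embedded_lie_group G for G :: "'a::euclidean_space monoid" (structure) +
  fixes \<kappa> :: real and \<psi> :: "ghat \<Rightarrow> 'a"
  assumes \<kappa>: "\<kappa> * \<kappa> = 1" and lin: "linear \<psi>" and bij: "bij_betw \<psi> UNIV T1"
    and bracket: "\<And>\<xi> \<eta>. lie_bracket G (\<psi> \<xi>) (\<psi> \<eta>) = \<psi> (ghat_bracket \<kappa> \<xi> \<eta>)"
begin

lemma \<psi>_T1[simp]: "\<psi> \<xi> \<in> T1" using bij by (auto simp: bij_betw_def)

lemma inj_\<psi>: "inj \<psi>" using bij by (auto simp: bij_betw_def)

lemma left_inverse_exists: "\<exists>f. linear f \<and> (\<forall>x. f (\<psi> x) = x)"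
  using linear_injective_left_inverse[OF lin inj_\<psi>] by (metis comp_apply id_apply)

text \<open>A left inverse of \<open>\<psi>\<close> on the whole ambient space rather than on
  \<open>T1\<close> only, so that it is a bounded linear map and commutes with
  differentiation.\<close>

definition \<Psi> :: "'a \<Rightarrow> ghat" where "\<Psi> = (SOME f. linear f \<and> (\<forall>x. f (\<psi> x) = x))"

lemma \<Psi>: "bounded_linear \<Psi>" "\<Psi> (\<psi> x) = x"
  using someI_ex[OF left_inverse_exists, folded \<Psi>_def] linear_conv_bounded_linear by blast+

lemma \<psi>_\<Psi>: "v \<in> T1 \<Longrightarrow> \<psi> (\<Psi> v) = v"
  using bij \<Psi>(2) by (metis bij_betw_imp_surj_on imageE)

lemma bl_\<psi>: "bounded_linear \<psi>" using lin linear_conv_bounded_linear by blast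

abbreviation E where "E \<xi> \<equiv> one_ps (\<psi> \<xi>)"
abbreviation L where "L \<xi> \<equiv> lf (\<psi> \<xi>)"

lemma E_S[simp]: "E \<xi> t \<in> S" and E_0[simp]: "E \<xi> 0 = \<one>" by (auto simp: one_ps)

lemma L_linear: "a \<in> S \<Longrightarrow> L (\<xi> + \<eta>) a = L \<xi> a + L \<eta> a" "a \<in> S \<Longrightarrow> L (r *\<^sub>R \<xi>) a = r *\<^sub>R L \<xi> a"
  by (simp_all add: linear_add[OF lin] linear_cmul[OF lin] lf_linear)

text \<open>Since \<open>E \<xi>\<close> is a homomorphism, the derivative at time \<open>t\<close>
  is the derivative at \<open>0\<close> for the vector
  \<open>u = Ad (E \<xi> t) (\<psi> \<eta>)\<close>, where \<open>Ad_derivative\<close> gives the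
  bracket.\<close>

lemma Ad_E_derivative:
  "((\<lambda>t. \<Psi> (Ad (E \<xi> t) (\<psi> \<eta>))) has_vector_derivative ghat_bracket \<kappa> \<xi> (\<Psi> (Ad (E \<xi> t) (\<psi> \<eta>)))) (at t)"
proof -
  define u where "u = Ad (E \<xi> t) (\<psi> \<eta>)"
  have u: "u \<in> T1" unfolding u_def by (rule Ad_T1) auto
  define A' where "A' = differential S (\<lambda>a. Ad a u) \<one> (\<psi> \<xi>)"
  have d0: "((\<lambda>s. Ad (E \<xi> s) u) has_vector_derivative A') (at 0)"
  proof -
    have "range (E \<xi>) \<subseteq> S" by auto
    from smooth_on_curve[OF smooth_Ad[OF u] one_ps(3)[OF \<psi>_T1, of \<xi> 0] open_UNIV UNIV_I this]
    show ?thesis by (simp add: A'_def lf_one)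
  qed
  \<comment> \<open>The curve stays in \<open>T1\<close>, where \<open>\<psi> \<circ> \<Psi>\<close>
    is the identity. Hence its derivative \<open>A'\<close> is fixed by this map and lies in
    \<open>T1\<close> too, as \<open>Ad_derivative\<close> requires.\<close>
  have "((\<lambda>s. \<psi> (\<Psi> (Ad (E \<xi> s) u))) has_vector_derivative \<psi> (\<Psi> A')) (at 0)"
    by (rule has_vector_derivative_linear[OF has_vector_derivative_linear[OF d0 \<Psi>(1)] bl_\<psi>])
  moreover have "\<psi> (\<Psi> (Ad (E \<xi> s) u)) = Ad (E \<xi> s) u" for s by (rule \<psi>_\<Psi>[OF Ad_T1[OF E_S u]])
  ultimately have "((\<lambda>s. Ad (E \<xi> s) u) has_vector_derivative \<psi> (\<Psi> A')) (at 0)" by simp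
  then have "\<psi> (\<Psi> A') = A'" using d0 vector_derivative_at by metis
  then have "A' \<in> T1" by (metis \<psi>_T1)
  then have "A' = lie_bracket G (\<psi> \<xi>) (\<psi> (\<Psi> u))" using Ad_derivative[OF u \<psi>_T1] \<psi>_\<Psi>[OF u] by (simp add: A'_def)
  then have "\<Psi> A' = ghat_bracket \<kappa> \<xi> (\<Psi> u)" by (simp add: bracket \<Psi>(2))
  then have "((\<lambda>s. \<Psi> (Ad (E \<xi> s) u)) has_vector_derivative ghat_bracket \<kappa> \<xi> (\<Psi> u)) (at (- t + t))"
    using has_vector_derivative_linear[OF d0 \<Psi>(1)] by simp
  then have "((\<lambda>s. \<Psi> (Ad (E \<xi> (- t + s)) u)) has_vector_derivative ghat_bracket \<kappa> \<xi> (\<Psi> u)) (at t)"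
    by (rule has_vector_derivative_shift)
  moreover have "Ad (E \<xi> (- t + s)) u = Ad (E \<xi> s) (\<psi> \<eta>)" for s
    using Ad_mult[of "E \<xi> (- t + s)" "E \<xi> t" "\<psi> \<eta>"] one_ps_add[OF \<psi>_T1, of \<xi> "- t + s" t] by (simp add: u_def)
  ultimately show ?thesis by (simp add: u_def)
qed

text \<open>Both sides solve the linear equation given by the bracket with \<open>\<xi>\<close> and
  agree at \<open>0\<close>; \<open>nilpotent_flow_zero\<close> applies to their difference.\<close>

lemma Ad_E: "Ad (E \<xi> t) (\<psi> \<eta>) = \<psi> (nilpotent_flow \<kappa> \<xi> t \<eta>)"
proof -
  define d where "d t = \<Psi> (Ad (E \<xi> t) (\<psi> \<eta>)) - nilpotent_flow \<kappa> \<xi> t \<eta>" for t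
  have "ghat_bracket \<kappa> \<xi> x - ghat_bracket \<kappa> \<xi> y = ghat_bracket \<kappa> \<xi> (x - y)" for x y
    by (simp add: ghat_bracket_eq prod_eq_iff vec2_eq algebra_simps)
  moreover have "(d has_vector_derivative ghat_bracket \<kappa> \<xi> (\<Psi> (Ad (E \<xi> t) (\<psi> \<eta>))) - ghat_bracket \<kappa> \<xi> (nilpotent_flow \<kappa> \<xi> t \<eta>)) (at t)" for t
    unfolding d_def[abs_def] by (rule has_vector_derivative_diff[OF Ad_E_derivative nilpotent_flow_derivative])
  ultimately have "(d has_vector_derivative ghat_bracket \<kappa> \<xi> (d t)) (at t)" for t
    by (simp add: d_def)
  moreover have "d 0 = 0" by (simp add: d_def Ad_one \<Psi>(2) nilpotent_flow_def)
  ultimately have "d t = 0" by (rule nilpotent_flow_zero)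
  then have "\<Psi> (Ad (E \<xi> t) (\<psi> \<eta>)) = nilpotent_flow \<kappa> \<xi> t \<eta>" by (simp add: d_def)
  then show ?thesis using \<psi>_\<Psi>[OF Ad_T1[OF E_S \<psi>_T1]] by metis
qed

lemma E_curve:
  assumes "(p has_vector_derivative p') (at t)"
  shows "((\<lambda>t. E \<eta> (p t)) has_vector_derivative L (p' *\<^sub>R \<eta>) (E \<eta> (p t))) (at t)"
  using vector_diff_chain_at[OF assms one_ps(3)[OF \<psi>_T1]] by (simp add: o_def L_linear)

lemma curve_mult_E:
  assumes "(c has_vector_derivative L \<xi> (c t)) (at t)" "(p has_vector_derivative p') (at t)" "\<And>t. c t \<in> S"
  shows "((\<lambda>t. c t \<otimes> E \<eta> (p t)) has_vector_derivative L (nilpotent_flow \<kappa> \<eta> (- p t) \<xi> + p' *\<^sub>R \<eta>) (c t \<otimes> E \<eta> (p t))) (at t)"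
proof -
  have "((\<lambda>t. c t \<otimes> E \<eta> (p t)) has_vector_derivative lf (Ad (inv (E \<eta> (p t))) (\<psi> \<xi>) + \<psi> (p' *\<^sub>R \<eta>)) (c t \<otimes> E \<eta> (p t))) (at t)"
    by (rule curve_mult_lf[OF assms(1) E_curve[OF assms(2)] \<psi>_T1 \<psi>_T1 assms(3) E_S])
  then show ?thesis by (simp add: one_ps_minus Ad_E linear_add[OF lin])
qed

abbreviation "\<sigma>1 \<equiv> (vec2 1 0, 0, 0) :: ghat"
abbreviation "\<sigma>2 \<equiv> (vec2 0 1, 0, 0) :: ghat"
abbreviation "a0 \<equiv> (0, 1, 0) :: ghat"
abbreviation "e1 \<equiv> (0, 0, vec2 1 0) :: ghat"
abbreviation "e2 \<equiv> (0, 0, vec2 0 1) :: ghat"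

text \<open>The coefficients come from canonical coordinates of the second kind of \<open>(Z, y, X)\<close> in the model group.\<close>

definition p3 :: "ghat \<Rightarrow> real" where "p3 u = fst (snd u) - \<kappa>/2 * snd (snd u)$1 * snd (snd u)$2"
definition p2 :: "ghat \<Rightarrow> real" where "p2 u = fst u$1 - \<kappa>/2 * snd (snd u)$1 * snd (snd u)$1 * snd (snd u)$2 - p3 u * snd (snd u)$1"
definition p1 :: "ghat \<Rightarrow> real" where "p1 u = fst u$2 + p3 u * snd (snd u)$2"

text \<open>The central directions come first: a velocity is conjugated only by the factors to its
  right, which keeps the logarithmic derivative short. The factor \<open>\<kappa>\<close> at
  \<open>a0\<close> reflects that \<open>model_psi\<close> rescales the coordinate \<open>y\<close>
  by \<open>\<kappa>\<close>.\<close>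

definition \<Phi> :: "ghat \<Rightarrow> 'a" where
  "\<Phi> u = E \<sigma>1 (p1 u) \<otimes> E \<sigma>2 (p2 u) \<otimes> E a0 (\<kappa> * p3 u) \<otimes> E e1 (snd (snd u)$1) \<otimes> E e2 (snd (snd u)$2)"

lemma \<Phi>_S: "\<Phi> u \<in> S" by (simp add: \<Phi>_def)

lemma \<Phi>_0: "\<Phi> 0 = \<one>" by (simp add: \<Phi>_def p1_def p2_def p3_def)

lemma \<Phi>_a0: "\<Phi> (0, y, 0) = E a0 (\<kappa> * y)" by (simp add: \<Phi>_def p1_def p2_def p3_def)

text \<open>The central computation: \<open>\<Phi>\<close> transports the Maurer-Cartan form of the
  model to that of \<open>G\<close>. Each factor contributes its own velocity, carried past the
  later factors by the polynomial flow.\<close>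

lemma \<Phi>_curve:
  assumes u: "(u has_vector_derivative w) (at t)"
  shows "((\<lambda>t. \<Phi> (u t)) has_vector_derivative L (model_psi \<kappa> (model_mc \<kappa> (u t) w)) (\<Phi> (u t))) (at t)"
proof -
  have b: "bounded_linear (\<lambda>x :: ghat. snd (snd x)$i)" "bounded_linear (\<lambda>x :: ghat. fst (snd x))" "bounded_linear (\<lambda>x :: ghat. fst x$i)" for i
    by (intro bounded_linear_snd_comp bounded_linear_fst_comp bounded_linear_snd bounded_linear_fst bounded_linear_compose[OF bounded_linear_vec_nth])+
  note d = has_vector_derivative_linear[OF u b(1)] has_vector_derivative_linear[OF u b(2)] has_vector_derivative_linear[OF u b(3)]
  note d' = d[folded has_real_derivative_iff_has_vector_derivative]
  define w1 w2 wy z1 z2 where "w1 = snd (snd w)$1" and "w2 = snd (snd w)$2" and "wy = fst (snd w)" and "z1 = fst w$1" and "z2 = fst w$2"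
  define x1 x2 y where "x1 = snd (snd (u t))$1" and "x2 = snd (snd (u t))$2" and "y = fst (snd (u t))"
  note defs = w1_def w2_def wy_def z1_def z2_def x1_def x2_def y_def
  define q3 where "q3 = wy - \<kappa>/2 * (w1 * x2 + x1 * w2)"
  define q2 where "q2 = z1 - \<kappa>/2 * (2 * x1 * w1 * x2 + x1 * x1 * w2) - (q3 * x1 + p3 (u t) * w1)"
  define q1 where "q1 = z2 + (q3 * x2 + p3 (u t) * w2)"
  have dp3: "((\<lambda>t. p3 (u t)) has_real_derivative q3) (at t)"
    unfolding p3_def by (rule DERIV_cong, (rule derivative_intros d')+) (simp add: q3_def defs algebra_simps)
  have dp2: "((\<lambda>t. p2 (u t)) has_real_derivative q2) (at t)"
    unfolding p2_def by (rule DERIV_cong, (rule derivative_intros d' dp3)+) (simp add: q2_def defs algebra_simps)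
  have dp1: "((\<lambda>t. p1 (u t)) has_real_derivative q1) (at t)"
    unfolding p1_def by (rule DERIV_cong, (rule derivative_intros d' dp3)+) (simp add: q1_def defs algebra_simps)
  have dp3': "((\<lambda>t. \<kappa> * p3 (u t)) has_real_derivative \<kappa> * q3) (at t)" by (rule DERIV_cmult[OF dp3])
  note dp = dp1[unfolded has_real_derivative_iff_has_vector_derivative] dp2[unfolded has_real_derivative_iff_has_vector_derivative]
    dp3'[unfolded has_real_derivative_iff_has_vector_derivative]
  have "((\<lambda>t. \<Phi> (u t)) has_vector_derivative
    L (nilpotent_flow \<kappa> e2 (- x2) (nilpotent_flow \<kappa> e1 (- x1) (nilpotent_flow \<kappa> a0 (- (\<kappa> * p3 (u t)))
       (nilpotent_flow \<kappa> \<sigma>2 (- p2 (u t)) (q1 *\<^sub>R \<sigma>1) + q2 *\<^sub>R \<sigma>2) + (\<kappa> * q3) *\<^sub>R a0) + w1 *\<^sub>R e1) + w2 *\<^sub>R e2) (\<Phi> (u t))) (at t)"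
    unfolding \<Phi>_def x1_def x2_def w1_def w2_def
    by (intro curve_mult_E E_curve dp d(1) m_closed E_S)
  moreover have "nilpotent_flow \<kappa> e2 (- x2) (nilpotent_flow \<kappa> e1 (- x1) (nilpotent_flow \<kappa> a0 (- (\<kappa> * p3 (u t)))
       (nilpotent_flow \<kappa> \<sigma>2 (- p2 (u t)) (q1 *\<^sub>R \<sigma>1) + q2 *\<^sub>R \<sigma>2) + (\<kappa> * q3) *\<^sub>R a0) + w1 *\<^sub>R e1) + w2 *\<^sub>R e2
     = model_psi \<kappa> (model_mc \<kappa> (u t) w)"
  proof -
    have k: "\<kappa> * (\<kappa> * r) = r" for r using \<kappa> by (simp add: mult.assoc[symmetric])
    \<comment> \<open>The two \<open>\<sigma>\<close> directions are central and \<open>a0\<close>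
      brackets to zero with them, so only the flows of \<open>e1\<close> and \<open>e2\<close>
      change anything.\<close>
    have 1: "nilpotent_flow \<kappa> \<sigma>2 r (q1 *\<^sub>R \<sigma>1) = q1 *\<^sub>R \<sigma>1" for r
      by (simp add: nilpotent_flow_def ghat_bracket_eq prod_eq_iff vec2_eq)
    have 2: "nilpotent_flow \<kappa> a0 r (q1 *\<^sub>R \<sigma>1 + q2 *\<^sub>R \<sigma>2) = q1 *\<^sub>R \<sigma>1 + q2 *\<^sub>R \<sigma>2" for r
      by (simp add: nilpotent_flow_def ghat_bracket_eq prod_eq_iff vec2_eq)
    have 3: "nilpotent_flow \<kappa> e1 (- x1) (q1 *\<^sub>R \<sigma>1 + q2 *\<^sub>R \<sigma>2 + (\<kappa> * q3) *\<^sub>R a0) = (vec2 q1 (q2 + q3 * x1), \<kappa> * q3, 0)"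
      by (simp add: nilpotent_flow_def ghat_bracket_eq prod_eq_iff vec2_eq k algebra_simps)
    have 4: "nilpotent_flow \<kappa> e2 (- x2) ((vec2 q1 (q2 + q3 * x1), \<kappa> * q3, 0) + w1 *\<^sub>R e1)
      = (vec2 (q1 - q3 * x2 - \<kappa>/2 * x2 * x2 * w1) (q2 + q3 * x1), \<kappa> * q3 + x2 * w1, vec2 w1 0)"
      by (simp add: nilpotent_flow_def ghat_bracket_eq prod_eq_iff vec2_eq k power2_eq_square algebra_simps)
    show ?thesis unfolding 1 2 3 4
      by (simp add: model_psi_def model_mc_def prod_eq_iff vec2_eq defs[symmetric])
         (simp add: q1_def q2_def q3_def p3_def defs k algebra_simps diff_divide_distrib)
  qed
  ultimately show ?thesis by simp
qed

lemma \<Phi>_Cinf: "Cinf_on \<Phi> UNIV"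
proof -
  have "smooth_on UNIV (\<lambda>u. E \<xi> (p u))" if "Cinf_on p UNIV" for \<xi> and p :: "ghat \<Rightarrow> real"
    using Cinf_compose[OF open_UNIV open_UNIV UNIV_I that one_ps_Cinf[OF \<psi>_T1]] by (rule smooth_UNIV)
  moreover have "Cinf_on p3 UNIV" unfolding p3_def[abs_def] by (intro Cinf_intros)
  moreover have "Cinf_on (\<lambda>u. \<kappa> * p3 u) UNIV" unfolding p3_def[abs_def] by (intro Cinf_intros)
  moreover have "Cinf_on p2 UNIV" unfolding p2_def[abs_def] p3_def[abs_def] by (intro Cinf_intros)
  moreover have "Cinf_on p1 UNIV" unfolding p1_def[abs_def] p3_def[abs_def] by (intro Cinf_intros)
  moreover have "Cinf_on (\<lambda>u :: ghat. snd (snd u)$i) UNIV" for i by (intro Cinf_intros)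
  ultimately have "smooth_on UNIV \<Phi>"
    unfolding \<Phi>_def[abs_def] by (intro smooth_on_mult) auto
  then show ?thesis by (simp add: smooth_on_UNIV_iff)
qed

lemma \<Phi>_derivative: "frechet_derivative \<Phi> (at x) w = L (model_psi \<kappa> (model_mc \<kappa> x w)) (\<Phi> x)"
proof -
  have "((\<lambda>t. \<Phi> (x + t *\<^sub>R w)) has_vector_derivative frechet_derivative \<Phi> (at x) w) (at 0)"
    by (rule directional_derivative_curve) (use Cinf_on_has_derivative[OF \<Phi>_Cinf, of x] in simp)
  moreover have "((\<lambda>t. x + t *\<^sub>R w) has_vector_derivative w) (at 0)" by (auto intro!: derivative_eq_intros)
  from \<Phi>_curve[OF this] have "((\<lambda>t. \<Phi> (x + t *\<^sub>R w)) has_vector_derivative L (model_psi \<kappa> (model_mc \<kappa> x w)) (\<Phi> x)) (at 0)" by simp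
  ultimately show ?thesis using vector_derivative_at by metis
qed

text \<open>Along \<open>t *\<^sub>R b\<close> both sides start at \<open>\<Phi> a\<close>. By left
  invariance of the Maurer-Cartan form they have the same time-dependent logarithmic derivative, so
  uniqueness of integral curves identifies them.\<close>

lemma \<Phi>_hom: "\<Phi> (model_mult \<kappa> a b) = \<Phi> a \<otimes> \<Phi> b"
proof -
  have l: "((\<lambda>t. t *\<^sub>R b) has_vector_derivative b) (at t)" for t by (auto intro!: derivative_eq_intros)
  have "\<Phi> (model_mult \<kappa> a (1 *\<^sub>R b)) = \<Phi> a \<otimes> \<Phi> (1 *\<^sub>R b)"
  proof (rule integral_curve_unique[where I=UNIV and ?t0.0=0 and v="\<lambda>t. \<psi> (model_psi \<kappa> (model_mc \<kappa> (t *\<^sub>R b) b))"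
        and ?c1.0="\<lambda>t. \<Phi> (model_mult \<kappa> a (t *\<^sub>R b))" and ?c2.0="\<lambda>t. \<Phi> a \<otimes> \<Phi> (t *\<^sub>R b)"])
    show "((\<lambda>t. \<Phi> (model_mult \<kappa> a (t *\<^sub>R b))) has_vector_derivative L (model_psi \<kappa> (model_mc \<kappa> (t *\<^sub>R b) b)) (\<Phi> (model_mult \<kappa> a (t *\<^sub>R b)))) (at t)" for t
    proof -
      have "((\<lambda>t. model_mult \<kappa> a (t *\<^sub>R b)) has_vector_derivative model_mult_D \<kappa> a (t *\<^sub>R b) b) (at t)"
        by (rule has_derivative_curve[of "model_mult \<kappa> a" "model_mult_D \<kappa> a (t *\<^sub>R b)" "\<lambda>t. t *\<^sub>R b" t UNIV b UNIV])
            (use model_mult_D[of \<kappa> a "t *\<^sub>R b"] l in auto)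
      from \<Phi>_curve[OF this] show ?thesis by (simp add: model_mc_left_invariant)
    qed
    show "((\<lambda>t. \<Phi> a \<otimes> \<Phi> (t *\<^sub>R b)) has_vector_derivative L (model_psi \<kappa> (model_mc \<kappa> (t *\<^sub>R b) b)) (\<Phi> a \<otimes> \<Phi> (t *\<^sub>R b))) (at t)" for t
      by (rule curve_left_lf[OF \<Phi>_S \<psi>_T1 \<Phi>_curve[OF l], of UNIV]) (auto simp: \<Phi>_S)
    have "model_mult \<kappa> a 0 = a" by (simp add: model_mult_def prod_eq_iff vec2_eq)
    then show "\<Phi> (model_mult \<kappa> a (0 *\<^sub>R b)) = \<Phi> a \<otimes> \<Phi> (0 *\<^sub>R b)" by (simp add: \<Phi>_0 \<Phi>_S)
  qed (auto simp: \<Phi>_S connected_UNIV)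
  then show ?thesis by simp
qed

end

section \<open>Connected one-dimensional subgroups\<close>

context embedded_lie_group
begin

lemma subgroup_lie:
  assumes H: "subgroup H G" "submanifold k H" shows "embedded_lie_group (G\<lparr>carrier := H\<rparr>)"
proof -
  have HS: "H \<subseteq> S" using subgroup.subset[OF H(1)] .
  have gr: "group (G\<lparr>carrier := H\<rparr>)" using subgroup.subgroup_is_group[OF H(1) is_group] .
  have "smooth_on (H \<times> H) (\<lambda>(a, b). a \<otimes> b)" by (rule smooth_on_subset[OF smooth_mult]) (use HS in auto)
  moreover have "smooth_on H (m_inv (G\<lparr>carrier := H\<rparr>))"
    by (rule smooth_on_cong[OF _ smooth_on_subset[OF smooth_inv HS]]) (simp add: m_inv_consistent[OF H(1)])
  ultimately have "lie_group (G\<lparr>carrier := H\<rparr>)" unfolding lie_group_def using gr H(2) by auto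
  then show ?thesis using gr by (simp add: embedded_lie_group_def embedded_lie_group_axioms_def)
qed

text \<open>\<open>H\<close> is a Lie group itself and so has a one-parameter subgroup with the same
  initial velocity. Viewed in \<open>G\<close>, it solves the same equation and coincides with that
  of \<open>G\<close>.\<close>

lemma subgroup_one_ps:
  assumes H: "subgroup H G" "submanifold k H" and v: "v \<in> tangent_space H \<one>"
  shows "one_ps v t \<in> H"
proof -
  have HS: "H \<subseteq> S" using subgroup.subset[OF H(1)] .
  interpret H: embedded_lie_group "G\<lparr>carrier := H\<rparr>" by (rule subgroup_lie[OF H])
  have v': "v \<in> T1" using v tangent_space_mono[OF HS] by blast
  have vH: "v \<in> H.T1" using v by simp
  have lf: "H.lf v a = lf v a" if a: "a \<in> H" for a
  proof -
    obtain c e where c: "0 < e" "c ` {-e<..<e} \<subseteq> H" "c 0 = \<one>" "(c has_vector_derivative v) (at (0::real))"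
      using tangent_spaceE[OF v] by metis
    have cS: "c ` {-e<..<e} \<subseteq> S" using c(2) HS by blast
    have aS: "a \<in> S" using a HS by blast
    have "((\<lambda>t. a \<otimes> c t) has_vector_derivative H.lf v a) (at 0)"
      using H.curve_left[of a c v 0 "{-e<..<e}"] a c by (simp add: H.lf_def)
    moreover have "((\<lambda>t. a \<otimes> c t) has_vector_derivative lf v a) (at 0)"
      using curve_left[OF aS c(4) _ _ cS] c(1,3) by (simp add: lf_def)
    ultimately show ?thesis using vector_derivative_at by metis
  qed
  have HH: "H.one_ps v t \<in> H" for t using H.one_ps(2)[OF vH] by simp
  have "H.one_ps v t = one_ps v t"
  proof (rule integral_curve_unique[where I=UNIV and ?t0.0=0 and v="\<lambda>_. v"])
    show "(H.one_ps v has_vector_derivative lf v (H.one_ps v t)) (at t)" for t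
      using H.one_ps(3)[OF vH, of t] lf[OF HH] by simp
    show "H.one_ps v 0 = one_ps v 0" using H.one_ps(1)[OF vH] one_ps(1)[OF v'] by simp
    show "range (H.one_ps v) \<subseteq> S" using HH HS by blast
    show "range (one_ps v) \<subseteq> S" using one_ps(2)[OF v'] by blast
  qed (auto simp: v' one_ps connected_UNIV)
  then show ?thesis using HH by metis
qed

text \<open>An instance of \<open>immersive_hom.surj\<close> with the real line as source: its
  derivative at \<open>0\<close> is \<open>r \<mapsto> r v\<close>, injective because
  \<open>v\<close> is not zero and onto the tangent line by \<open>v\<close>.\<close>

lemma one_parameter_subgroup_onto:
  assumes H: "subgroup H G" "submanifold k H" and conn: "connected H" and v: "tangent_space H \<one> = range (\<lambda>r. r *\<^sub>R v)" and v0: "v \<noteq> 0"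
  shows "H = range (one_ps v)"
proof -
  let ?A = "\<lparr>carrier = UNIV, mult = (+), one = 0\<rparr> :: real monoid"
  interpret H: embedded_lie_group "G\<lparr>carrier := H\<rparr>" by (rule subgroup_lie[OF H])
  have HS: "H \<subseteq> S" using subgroup.subset[OF H(1)] .
  have vH: "v \<in> tangent_space H \<one>" unfolding v by (metis rangeI scaleR_one)
  then have v': "v \<in> T1" using tangent_space_mono[OF HS] by blast
  have D: "frechet_derivative (one_ps v) (at 0) = (\<lambda>r. r *\<^sub>R v)"
    using frechet_derivative_at[OF one_ps(3)[OF v', of 0, unfolded has_vector_derivative_def]] lf_one[OF v'] one_ps(1)[OF v'] by simp
  have A: "group ?A" by (rule groupI) (auto intro: exI[of _ "- x" for x])
  interpret immersive_hom "G\<lparr>carrier := H\<rparr>" ?A "one_ps v"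
  proof (intro immersive_hom.intro immersive_hom_axioms.intro)
    show "embedded_lie_group (G\<lparr>carrier := H\<rparr>)" by (rule subgroup_lie[OF H])
    show "group ?A" by (rule A)
    show "carrier ?A = UNIV" by simp
    show "continuous_on UNIV (\<lambda>y. g \<otimes>\<^bsub>?A\<^esub> y)" for g by (auto intro!: continuous_intros)
    show "one_ps v (x \<otimes>\<^bsub>?A\<^esub> y) = one_ps v x \<otimes>\<^bsub>G\<lparr>carrier := H\<rparr>\<^esub> one_ps v y" for x y by (simp add: one_ps_add[OF v'])
    show "range (one_ps v) \<subseteq> H.S" using subgroup_one_ps[OF H vH] by auto
    show "Cinf_on (one_ps v) UNIV" by (rule one_ps_Cinf[OF v'])
    show "w = 0" if "frechet_derivative (one_ps v) (at \<one>\<^bsub>?A\<^esub>) w = 0" for w using that v0 by (simp add: D)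
    show "H.T1 \<subseteq> range (frechet_derivative (one_ps v) (at \<one>\<^bsub>?A\<^esub>))" by (simp add: D v)
    show "connected H.S" using conn by simp
  qed
  show ?thesis using surj by simp
qed

end

context lie_realization
begin

lemma \<Phi>_immersive:
  assumes "connected S" shows "immersive_hom G (model_group \<kappa>) \<Phi>"
proof (intro immersive_hom.intro immersive_hom_axioms.intro)
  show "embedded_lie_group G" by (rule embedded_lie_group_axioms)
  have mc0: "model_mc \<kappa> 0 w = w" for w by (simp add: model_mc_def prod_eq_iff)
  have D: "frechet_derivative \<Phi> (at \<one>\<^bsub>model_group \<kappa>\<^esub>) w = \<psi> (model_psi \<kappa> w)" for w
    by (simp add: \<Phi>_derivative mc0 \<Phi>_0 lf_one)
  show "group (model_group \<kappa>)" by (rule model_group_group)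
  show "carrier (model_group \<kappa>) = UNIV" by simp
  show "continuous_on UNIV (\<lambda>y. g \<otimes>\<^bsub>model_group \<kappa>\<^esub> y)" for g
    using has_derivative_continuous[OF model_mult_D[of \<kappa> g]] by (simp add: continuous_on_eq_continuous_within)
  show "\<Phi> (x \<otimes>\<^bsub>model_group \<kappa>\<^esub> y) = \<Phi> x \<otimes> \<Phi> y" for x y by (simp add: \<Phi>_hom)
  show "range \<Phi> \<subseteq> S" using \<Phi>_S by blast
  show "Cinf_on \<Phi> UNIV" by (rule \<Phi>_Cinf)
  have \<psi>0: "\<psi> x = 0 \<Longrightarrow> x = 0" for x using inj_\<psi> linear_0[OF lin] by (metis injD)
  show "w = 0" if "frechet_derivative \<Phi> (at \<one>\<^bsub>model_group \<kappa>\<^esub>) w = 0" for w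
  proof -
    have "model_psi \<kappa> w = 0" using that[unfolded D] by (rule \<psi>0)
    then show ?thesis using model_psi_involution[OF \<kappa>, of w] linear_0[OF linear_model_psi] by simp
  qed
  show "T1 \<subseteq> range (frechet_derivative \<Phi> (at \<one>\<^bsub>model_group \<kappa>\<^esub>))"
  proof
    fix v assume "v \<in> T1"
    then have "v = frechet_derivative \<Phi> (at \<one>\<^bsub>model_group \<kappa>\<^esub>) (model_psi \<kappa> (\<Psi> v))"
      by (simp only: D model_psi_involution[OF \<kappa>] \<psi>_\<Psi>)
    then show "v \<in> range (frechet_derivative \<Phi> (at \<one>\<^bsub>model_group \<kappa>\<^esub>))" by blast
  qed
  show "connected S" by fact
qed

end

section \<open>Realisations of \<open>N(\<kappa>)\<close> are isometric to the model\<close>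

locale N_realization =
  fixes \<kappa> :: real and G :: "'a::euclidean_space monoid" (structure) and \<psi> H and N :: "'n::euclidean_space set" and \<pi> g
  assumes \<kappa>': "\<kappa> \<in> {1, -1}" and N_space: "N_space \<kappa> G \<psi> H N \<pi> g"

sublocale N_realization \<subseteq> lie_realization G \<kappa> \<psi>
proof -
  have 1: "lie_group G" "linear \<psi>" "bij_betw \<psi> UNIV (tangent_space (carrier G) \<one>)"
    "\<And>\<xi> \<eta>. lie_bracket G (\<psi> \<xi>) (\<psi> \<eta>) = \<psi> (ghat_bracket \<kappa> \<xi> \<eta>)"
    using N_space by (auto simp: N_space_def)
  have "group G" "embedded_lie_group_axioms G" using 1(1) by (simp_all add: lie_group_def embedded_lie_group_axioms_def)
  then show "lie_realization G \<kappa> \<psi>"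
    using 1 \<kappa>' by (auto intro!: lie_realization.intro embedded_lie_group.intro lie_realization_axioms.intro)
qed

context N_realization
begin

lemma sc: "simply_connected S" and conn: "connected S" and H: "subgroup H G" "\<exists>k. submanifold k H" "connected H"
  and TH: "tangent_space H \<one> = \<psi> ` {(0, a, 0) | a. True}"
  and hN: "\<exists>k. submanifold k N" "smooth_on S \<pi>" "\<pi> ` S = N"
  and cosets: "\<And>a b. a \<in> S \<Longrightarrow> b \<in> S \<Longrightarrow> \<pi> a = \<pi> b \<longleftrightarrow> a <# H = b <# H"
  and T\<pi>: "\<And>a. a \<in> S \<Longrightarrow> differential S \<pi> a ` tangent_space S a = tangent_space N (\<pi> a)"
  and gN: "pseudo_riemannian_metric N g" and trans: "\<And>a. a \<in> S \<Longrightarrow> isometry N g N g (translation G \<pi> a)"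
  and g0: "\<And>\<xi> \<eta>. theta \<xi> = - \<xi> \<Longrightarrow> theta \<eta> = - \<eta> \<Longrightarrow>
    g (\<pi> \<one>) (differential S \<pi> \<one> (\<psi> \<xi>)) (differential S \<pi> \<one> (\<psi> \<eta>)) = ghat_inner \<kappa> \<xi> \<eta>"
proof -
  note N = N_space[unfolded N_space_def connected_lie_subgroup_def homogeneous_space_def]
  show sc: "simply_connected S" using N by (elim conjE)
  then show "connected S" using simply_connected_imp_connected by blast
  show "subgroup H G" using N by (elim conjE)
  show "\<exists>k. submanifold k H" using N by (elim conjE)
  show "connected H" using N by (elim conjE)
  show "tangent_space H \<one> = \<psi> ` {(0, a, 0) | a. True}" using N by (elim conjE)
  show "\<exists>k. submanifold k N" using N by (elim conjE)
  show "smooth_on S \<pi>" using N by (elim conjE)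
  show "\<pi> ` S = N" using N by (elim conjE)
  show "pseudo_riemannian_metric N g" using N by (elim conjE)
  have "\<forall>a\<in>S. \<forall>b\<in>S. \<pi> a = \<pi> b \<longleftrightarrow> a <# H = b <# H" using N by (elim conjE)
  then show "\<pi> a = \<pi> b \<longleftrightarrow> a <# H = b <# H" if "a \<in> S" "b \<in> S" for a b using that by blast
  have "\<forall>a\<in>S. differential S \<pi> a ` tangent_space S a = tangent_space N (\<pi> a)" using N by (elim conjE)
  then show "differential S \<pi> a ` tangent_space S a = tangent_space N (\<pi> a)" if "a \<in> S" for a using that by blast
  have "\<forall>a\<in>S. isometry N g N g (translation G \<pi> a)" using N by (elim conjE)
  then show "isometry N g N g (translation G \<pi> a)" if "a \<in> S" for a using that by blast
  have "\<forall>\<xi> \<eta>. theta \<xi> = - \<xi> \<and> theta \<eta> = - \<eta> \<longrightarrow>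
    g (\<pi> \<one>) (differential S \<pi> \<one> (\<psi> \<xi>)) (differential S \<pi> \<one> (\<psi> \<eta>)) = ghat_inner \<kappa> \<xi> \<eta>" using N by (elim conjE)
  then show "g (\<pi> \<one>) (differential S \<pi> \<one> (\<psi> \<xi>)) (differential S \<pi> \<one> (\<psi> \<eta>)) = ghat_inner \<kappa> \<xi> \<eta>"
    if "theta \<xi> = - \<xi>" "theta \<eta> = - \<eta>" for \<xi> \<eta> using that by blast
qed

interpretation \<Phi>: immersive_hom G "model_group \<kappa>" \<Phi> by (rule \<Phi>_immersive[OF conn])

lemma inj_\<Phi>: "inj \<Phi>" by (rule \<Phi>.inj_if_simply_connected[OF sc])
lemma surj_\<Phi>: "range \<Phi> = S" by (rule \<Phi>.surj)

lemma H_eq: "H = range (E a0)"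
proof -
  obtain k where k: "submanifold k H" using H(2) by blast
  have a: "\<psi> (0, a, 0) = a *\<^sub>R \<psi> a0" for a using linear_cmul[OF lin, of a a0] by (simp add: scaleR_Pair)
  have "\<psi> ` {(0, a, 0) | a. True} = range (\<lambda>a. \<psi> (0, a, 0))" by blast
  also have "\<dots> = range (\<lambda>r. r *\<^sub>R \<psi> a0)" by (intro image_cong refl a)
  finally have T: "tangent_space H \<one> = range (\<lambda>r. r *\<^sub>R \<psi> a0)" unfolding TH .
  have "a0 \<noteq> 0" by (simp add: zero_prod_def)
  then have "\<psi> a0 \<noteq> 0" using inj_\<psi> linear_0[OF lin] by (metis injD)
  from one_parameter_subgroup_onto[OF H(1) k H(3) T this] show ?thesis .
qed

lemma H_\<Phi>: "H = \<Phi> ` model_subgroup"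
proof -
  have "E a0 r = \<Phi> (0, \<kappa> * r, 0)" for r unfolding \<Phi>_a0 using \<kappa> by (simp add: mult.assoc[symmetric])
  moreover have "\<Phi> (0, y, 0) = E a0 (\<kappa> * y)" for y by (rule \<Phi>_a0)
  ultimately show ?thesis unfolding H_eq model_subgroup_def by (blast intro: rangeI)
qed

lemma \<pi>_H: assumes "a \<in> S" "h \<in> H" shows "\<pi> (a \<otimes> h) = \<pi> a"
proof -
  have h: "h \<in> S" using assms(2) H(1) subgroup.subset by blast
  have "a \<otimes> h \<in> a <# H" using assms by (auto simp: l_coset_def)
  then have "a <# H = (a \<otimes> h) <# H" by (rule l_repr_independence[OF _ assms(1) H(1)])
  then show ?thesis using cosets assms h by auto
qed

definition quot :: "(real^2) \<times> (real^2) \<Rightarrow> 'n" where "quot x = \<pi> (\<Phi> (fst x, 0, snd x))"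

lemma \<pi>_\<Phi>: "\<pi> (\<Phi> u) = quot (model_proj u)"
proof -
  have u: "u = model_mult \<kappa> (fst u, 0, snd (snd u)) (0, fst (snd u), 0)"
    by (simp add: model_mult_def prod_eq_iff vec2_eq)
  have "\<Phi> u = \<Phi> (fst u, 0, snd (snd u)) \<otimes> \<Phi> (0, fst (snd u), 0)" using \<Phi>_hom u by metis
  moreover have "\<Phi> (0, fst (snd u), 0) \<in> H" unfolding H_\<Phi> model_subgroup_def by blast
  ultimately show ?thesis using \<pi>_H[OF \<Phi>_S] by (simp add: quot_def model_proj_def)
qed

lemma quot_N: "quot x \<in> N" unfolding quot_def using hN(3) \<Phi>_S by blast

lemma inj_quot: "inj quot"
proof (rule injI)
  fix x x' assume eq: "quot x = quot x'"
  let ?u = "(fst x, 0, snd x)" and ?u' = "(fst x', 0, snd x')"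
  have "\<Phi> ?u <# H = \<Phi> ?u' <# H" using eq cosets \<Phi>_S by (simp add: quot_def)
  moreover have "\<Phi> ?u' \<in> \<Phi> ?u' <# H"
    using subgroup.one_closed[OF H(1)] \<Phi>_S[of ?u'] unfolding l_coset_def by (auto intro!: bexI[of _ \<one>])
  ultimately obtain h where "h \<in> H" "\<Phi> ?u' = \<Phi> ?u \<otimes> h" by (auto simp: l_coset_def)
  then obtain y where "\<Phi> ?u' = \<Phi> (model_mult \<kappa> ?u (0, y, 0))" unfolding H_\<Phi> model_subgroup_def using \<Phi>_hom by auto
  then have "?u' = model_mult \<kappa> ?u (0, y, 0)" using inj_\<Phi> by (simp add: inj_eq)
  then show "x = x'" by (simp add: model_mult_def prod_eq_iff vec2_eq)
qed

lemma range_quot: "range quot = N"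
proof -
  have "N = (\<lambda>u. \<pi> (\<Phi> u)) ` UNIV" using hN(3) surj_\<Phi> by (metis image_image)
  also have "\<dots> = quot ` range model_proj" unfolding \<pi>_\<Phi> image_image ..
  also have "range model_proj = UNIV" by (metis surjI[of model_proj "\<lambda>x. (fst x, 0, snd x)"] model_proj_def fst_conv snd_conv prod.collapse)
  finally show ?thesis by simp
qed

lemma quot_Cinf: "Cinf_on quot UNIV"
proof -
  have "Cinf_on (\<lambda>x :: (real^2) \<times> (real^2). (fst x, 0 :: real, snd x)) UNIV" by (intro Cinf_intros)
  then have "Cinf_on (\<lambda>x :: (real^2) \<times> (real^2). \<Phi> (fst x, 0, snd x)) UNIV"
    using Cinf_compose[OF open_UNIV open_UNIV UNIV_I _ \<Phi>_Cinf] by blast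
  then show ?thesis unfolding quot_def[abs_def]
    by (rule smooth_on_compose_Cinf[OF hN(2) open_UNIV]) (use \<Phi>_S in auto)
qed

lemma quot_derivative:
  "frechet_derivative quot (at (model_proj u)) (model_proj w) =
     differential S \<pi> (\<Phi> u) (L (model_psi \<kappa> (model_mc \<kappa> u w)) (\<Phi> u))"
proof -
  have l: "((\<lambda>t. u + t *\<^sub>R w) has_vector_derivative w) (at 0)" by (auto intro!: derivative_eq_intros)
  have "((\<lambda>t. \<Phi> (u + t *\<^sub>R w)) has_vector_derivative L (model_psi \<kappa> (model_mc \<kappa> u w)) (\<Phi> u)) (at 0)"
    using \<Phi>_curve[OF l] by simp
  moreover have "range (\<lambda>t. \<Phi> (u + t *\<^sub>R w)) \<subseteq> S" using \<Phi>_S by blast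
  ultimately have "((\<lambda>t. \<pi> (\<Phi> (u + t *\<^sub>R w))) has_vector_derivative differential S \<pi> (\<Phi> u) (L (model_psi \<kappa> (model_mc \<kappa> u w)) (\<Phi> u))) (at 0)"
    using smooth_on_curve[OF hN(2) _ open_UNIV UNIV_I, of "\<lambda>t. \<Phi> (u + t *\<^sub>R w)" _ 0] by simp
  moreover have "\<pi> (\<Phi> (u + t *\<^sub>R w)) = quot (model_proj u + t *\<^sub>R model_proj w)" for t
    by (simp add: \<pi>_\<Phi> model_proj_def)
  moreover have "((\<lambda>t. quot (model_proj u + t *\<^sub>R model_proj w)) has_vector_derivative frechet_derivative quot (at (model_proj u)) (model_proj w)) (at 0)"
    by (rule directional_derivative_curve) (use Cinf_on_has_derivative[OF quot_Cinf, of "model_proj u"] in simp)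
  ultimately show ?thesis using vector_derivative_at by (metis (no_types, lifting) ext)
qed

text \<open>\<open>translation\<close> works with a chosen representative of the coset. Any other
  representative differs by a right factor from \<open>H\<close>, which \<open>\<pi>\<close>
  absorbs.\<close>

lemma translation_\<pi>: assumes "a \<in> S" "b \<in> S" shows "translation G \<pi> a (\<pi> b) = \<pi> (a \<otimes> b)"
proof -
  define b' where "b' = inv_into S \<pi> (\<pi> b)"
  have b': "b' \<in> S" "\<pi> b' = \<pi> b" using assms(2) by (auto simp: b'_def inv_into_into f_inv_into_f)
  have "b' \<in> b' <# H"
    using subgroup.one_closed[OF H(1)] b'(1) unfolding l_coset_def by (auto intro!: bexI[of _ \<one>])
  then have "b' \<in> b <# H" using cosets[OF b'(1) assms(2)] b'(2) by simp
  then obtain h where h: "h \<in> H" "b' = b \<otimes> h" by (auto simp: l_coset_def)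
  have "h \<in> S" using h(1) H(1) subgroup.subset by blast
  then have "a \<otimes> b' = (a \<otimes> b) \<otimes> h" using h(2) assms by (simp add: m_assoc)
  then show ?thesis using \<pi>_H[OF _ h(1), of "a \<otimes> b"] assms by (simp add: translation_def b'_def)
qed

text \<open>Equivariance of \<open>\<pi>\<close> under left multiplication, differentiated along a
  one-parameter subgroup: tangent vectors anywhere are brought back to the base point.\<close>

lemma \<pi>_L:
  assumes "a \<in> S"
  shows "differential S \<pi> a (L \<xi> a) = differential N (translation G \<pi> a) (\<pi> \<one>) (differential S \<pi> \<one> (\<psi> \<xi>))"
proof -
  have sm: "smooth_on N (translation G \<pi> a)" using trans[OF assms] by (simp add: isometry_def)
  have 1: "(E \<xi> has_vector_derivative \<psi> \<xi>) (at 0)" using one_ps(3)[OF \<psi>_T1, of \<xi> 0] by (simp add: lf_one)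
  have rE: "range (E \<xi>) \<subseteq> S" by auto
  have "((\<lambda>t. a \<otimes> E \<xi> t) has_vector_derivative L \<xi> a) (at 0)"
    using curve_left[OF assms 1 open_UNIV UNIV_I rE] by (simp add: lf_def)
  moreover have "range (\<lambda>t. a \<otimes> E \<xi> t) \<subseteq> S" using assms by auto
  ultimately have "((\<lambda>t. \<pi> (a \<otimes> E \<xi> t)) has_vector_derivative differential S \<pi> a (L \<xi> a)) (at 0)"
    using smooth_on_curve[OF hN(2) _ open_UNIV UNIV_I, of "\<lambda>t. a \<otimes> E \<xi> t" _ 0] assms by simp
  note 2 = this
  have "((\<lambda>t. \<pi> (E \<xi> t)) has_vector_derivative differential S \<pi> \<one> (\<psi> \<xi>)) (at 0)"
    using smooth_on_curve[OF hN(2) 1 open_UNIV UNIV_I rE] by simp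
  moreover have "range (\<lambda>t. \<pi> (E \<xi> t)) \<subseteq> N" using hN(3) E_S by blast
  ultimately have "((\<lambda>t. translation G \<pi> a (\<pi> (E \<xi> t))) has_vector_derivative differential N (translation G \<pi> a) (\<pi> \<one>) (differential S \<pi> \<one> (\<psi> \<xi>))) (at 0)"
    using smooth_on_curve[OF sm _ open_UNIV UNIV_I, of "\<lambda>t. \<pi> (E \<xi> t)" _ 0] by simp
  then have "((\<lambda>t. \<pi> (a \<otimes> E \<xi> t)) has_vector_derivative differential N (translation G \<pi> a) (\<pi> \<one>) (differential S \<pi> \<one> (\<psi> \<xi>))) (at 0)"
    by (simp add: translation_\<pi>[OF assms])
  then show ?thesis using 2 vector_derivative_at by metis
qed

text \<open>The one-parameter subgroup in direction \<open>a0\<close> lies in \<open>H\<close>,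
  where \<open>\<pi>\<close> is constant, so its velocity is annihilated.\<close>

lemma \<pi>_\<psi>_horizontal: "differential S \<pi> \<one> (\<psi> \<xi>) = differential S \<pi> \<one> (\<psi> (fst \<xi>, 0, snd (snd \<xi>)))"
proof -
  have 1: "(E (0, a, 0) has_vector_derivative \<psi> (0, a, 0)) (at 0)" for a using one_ps(3)[OF \<psi>_T1, of "(0, a, 0)" 0] by (simp add: lf_one)
  have 0: "differential S \<pi> \<one> (\<psi> (0, a, 0)) = 0" for a
  proof -
    obtain k where k: "submanifold k H" using H(2) by blast
    have "\<psi> (0, a, 0) \<in> tangent_space H \<one>" unfolding TH by blast
    then have EH: "E (0, a, 0) t \<in> H" for t using subgroup_one_ps[OF H(1) k] by blast
    have "range (E (0, a, 0)) \<subseteq> S" by auto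
    from smooth_on_curve[OF hN(2) 1 open_UNIV UNIV_I this]
    have "((\<lambda>t. \<pi> (E (0, a, 0) t)) has_vector_derivative differential S \<pi> \<one> (\<psi> (0, a, 0))) (at 0)" by simp
    moreover have "\<pi> (E (0, a, 0) t) = \<pi> \<one>" for t using \<pi>_H[OF one_closed EH] by simp
    then have "((\<lambda>t. \<pi> (E (0, a, 0) t)) has_vector_derivative 0) (at 0)" by simp
    ultimately show ?thesis using vector_derivative_at by metis
  qed
  have "\<psi> \<xi> = \<psi> (0, fst (snd \<xi>), 0) + \<psi> (fst \<xi>, 0, snd (snd \<xi>))" by (simp add: linear_add[OF lin, symmetric])
  then show ?thesis using 0 linear_add[OF linear_differential[OF hN(2) one_closed]] by simp
qed

text \<open>Invariance under translations reduces both sides to the base point, where the metric is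
  the given inner product. There the two vectors are Maurer-Cartan values at the representative with
  \<open>y = 0\<close>.\<close>

lemma quot_metric:
  "g (quot x) (frechet_derivative quot (at x) v) (frechet_derivative quot (at x) w) = model_metric \<kappa> x v w"
proof -
  define u where "u = (fst x, 0 :: real, snd x)"
  have x: "x = model_proj u" by (simp add: u_def model_proj_def)
  define c where "c v = model_psi \<kappa> (model_mc \<kappa> u (fst v, 0, snd v))" for v :: "(real^2) \<times> (real^2)"
  \<comment> \<open>The metric is prescribed only on the eigenspace of \<open>theta\<close> for
    \<open>-1\<close>, so the \<open>a0\<close> component is dropped first;
    \<open>\<pi>_\<psi>_horizontal\<close> allows this.\<close>
  define c' where "c' v = (fst (c v), 0 :: real, snd (snd (c v)))" for v
  define a where "a = \<Phi> u"
  have a: "a \<in> S" by (simp add: a_def \<Phi>_S)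
  have D: "frechet_derivative quot (at x) v = differential N (translation G \<pi> a) (\<pi> \<one>) (differential S \<pi> \<one> (\<psi> (c' v)))" for v
  proof -
    have "v = model_proj (fst v, 0, snd v)" by (simp add: model_proj_def)
    then have "frechet_derivative quot (at x) v = differential S \<pi> a (L (c v) a)"
      using quot_derivative[of u "(fst v, 0, snd v)"] by (simp add: x c_def a_def)
    then show ?thesis using \<pi>_L[OF a] \<pi>_\<psi>_horizontal[of "c v"] by (simp add: c'_def)
  qed
  have qx: "quot x = translation G \<pi> a (\<pi> \<one>)" using translation_\<pi>[OF a one_closed] a by (simp add: x \<pi>_\<Phi>[symmetric] a_def)
  have tan: "differential S \<pi> \<one> (\<psi> \<xi>) \<in> tangent_space N (\<pi> \<one>)" for \<xi> using T\<pi>[OF one_closed] \<psi>_T1 by blast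
  have "\<pi> \<one> \<in> N" using hN(3) by blast
  then have "g (quot x) (frechet_derivative quot (at x) v) (frechet_derivative quot (at x) w) =
    g (\<pi> \<one>) (differential S \<pi> \<one> (\<psi> (c' v))) (differential S \<pi> \<one> (\<psi> (c' w)))"
    unfolding D qx using trans[OF a] tan unfolding isometry_def by blast
  also have "\<dots> = ghat_inner \<kappa> (c' v) (c' w)" by (rule g0) (auto simp: c'_def theta_def)
  also have "\<dots> = model_metric \<kappa> x v w"
    by (simp add: c'_def c_def ghat_inner_def model_metric inner2 model_psi_def model_mc_def u_def)
       (simp add: algebra_simps add_divide_distrib)
  finally show ?thesis .
qed

text \<open>Smoothness of the inverse is the point. Nondegeneracy of the metric makes
  \<open>quot\<close> an immersion, the submersion \<open>\<pi>\<close> makes its derivative onto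
  the tangent spaces of \<open>N\<close>, and \<open>immersion_local_inverse\<close> supplies a
  smooth local inverse.\<close>

lemma quot_isometry: "isometry UNIV (model_metric \<kappa>) N g quot"
proof -
  have bij: "bij_betw quot UNIV N" using inj_quot range_quot by (simp add: bij_betw_def)
  have D_inj: "v = 0" if "frechet_derivative quot (at x) v = 0" for x v
  proof -
    have lin: "scalar_product_on (tangent_space N (quot x)) (g (quot x))" using gN quot_N by (simp add: pseudo_riemannian_metric_def)
    have tan: "frechet_derivative quot (at x) w \<in> tangent_space N (quot x)" for w
      using differential_tangent[OF smooth_UNIV[OF quot_Cinf, of UNIV], of N w x] range_quot by (simp add: tangent_UNIV)
    have "g (quot x) 0 (frechet_derivative quot (at x) w) = 0" for w
    proof -
      have "0 \<in> tangent_space N (quot x)" using zero_tangent quot_N by blast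
      then have "g (quot x) (0 *\<^sub>R 0) (frechet_derivative quot (at x) w) = 0 * g (quot x) 0 (frechet_derivative quot (at x) w)"
        using lin tan[of w] unfolding scalar_product_on_def by blast
      then show ?thesis by simp
    qed
    then have "\<forall>w. model_metric \<kappa> x v w = 0" using quot_metric[of x v] that by simp
    moreover have "nondegenerate_on UNIV (model_metric \<kappa> x)"
      using model_metric_metric[of \<kappa>, unfolded pseudo_riemannian_metric_def scalar_product_on_def tangent_UNIV] by blast
    ultimately show ?thesis unfolding nondegenerate_on_def by blast
  qed
  have D_onto: "tangent_space N (quot x) \<subseteq> range (frechet_derivative quot (at x))" for x
  proof
    fix v assume v: "v \<in> tangent_space N (quot x)"
    define u where "u = (fst x, 0 :: real, snd x)"
    have x: "x = model_proj u" by (simp add: u_def model_proj_def)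
    have "quot x = \<pi> (\<Phi> u)" by (simp add: x \<pi>_\<Phi>)
    then obtain v' where v': "v' \<in> tangent_space S (\<Phi> u)" "v = differential S \<pi> (\<Phi> u) v'"
      using v T\<pi>[OF \<Phi>_S, of u] by auto
    obtain \<xi> where \<xi>: "v' = L \<xi> (\<Phi> u)" using tangent_eq_lf[OF \<Phi>_S v'(1)] \<psi>_\<Psi> by metis
    \<comment> \<open>\<open>model_field\<close> is a right inverse of \<open>model_mc\<close> and
      \<open>model_psi\<close> is an involution, so this vector has the logarithmic derivative
      \<open>\<xi>\<close>.\<close>
    define w where "w = model_field \<kappa> (model_psi \<kappa> \<xi>) u"
    have "frechet_derivative quot (at x) (model_proj w) = v"
      unfolding x quot_derivative w_def model_mc_field model_psi_involution[OF \<kappa>] v'(2) \<xi> ..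
    then show "v \<in> range (frechet_derivative quot (at x))" by blast
  qed
  have "smooth_on N (inv_into UNIV quot)"
    unfolding smooth_on_def
  proof
    fix z assume "z \<in> N"
    then obtain x where x: "z = quot x" using range_quot by blast
    obtain k where k: "submanifold k N" using hN(1) by blast
    have rq: "range quot \<subseteq> N" using range_quot by simp
    obtain U P h where U: "open U" "x \<in> U" "U \<subseteq> UNIV" "open P" "quot ` U = P \<inter> N" "Cinf_on h P"
      "\<And>y. y \<in> U \<Longrightarrow> h (quot y) = y" "\<And>z. z \<in> P \<inter> N \<Longrightarrow> h z \<in> U \<and> quot (h z) = z"
      by (rule immersion_local_inverse[OF k open_UNIV UNIV_I[of x] quot_Cinf rq D_inj D_onto], assumption, rule that)
    have "inv_into UNIV quot z = h z" if "z \<in> P \<inter> N" for z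
      using inv_f_f[OF inj_quot, of "h z"] U(8)[OF that] by simp
    moreover have "z \<in> P" using U(2,5) x by blast
    ultimately show "\<exists>U h. open U \<and> z \<in> U \<and> Cinf_on h U \<and> (\<forall>y\<in>U \<inter> N. inv_into UNIV quot y = h y)"
      using U(4,6) by blast
  qed
  then show ?thesis unfolding isometry_def using bij smooth_UNIV[OF quot_Cinf] quot_metric by blast
qed

end

section \<open>Isometries and point symmetries\<close>

lemma isometry_tangent:
  assumes "isometry N g M h f" "v \<in> tangent_space N x" shows "differential N f x v \<in> tangent_space M (f x)"
  using assms by (intro differential_tangent) (auto simp: isometry_def bij_betw_def)

lemma isometry_compose:
  assumes f: "isometry N g M h f" and f': "isometry M h L k f'"
  shows "isometry N g L k (\<lambda>x. f' (f x))"
proof -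
  have s: "smooth_on N f" "smooth_on M f'" "f ` N = M" "f' ` M = L" "inj_on f N" "inj_on f' M"
    using f f' by (auto simp: isometry_def bij_betw_def)
  have "bij_betw (\<lambda>x. f' (f x)) N L" using bij_betw_trans[of f N M f' L] f f' by (simp add: isometry_def o_def)
  moreover have "smooth_on N (\<lambda>x. f' (f x))" using smooth_on_compose[OF s(1) _ s(2)] s(3) by simp
  moreover have "smooth_on L (inv_into N (\<lambda>x. f' (f x)))"
  proof (rule smooth_on_cong)
    have "inv_into M f' ` L \<subseteq> M" using bij_betw_inv_into[of f' M L] f' by (simp add: isometry_def bij_betw_def)
    moreover have "smooth_on L (inv_into M f')" "smooth_on M (inv_into N f)" using f f' by (simp_all add: isometry_def)
    ultimately show "smooth_on L (\<lambda>y. inv_into N f (inv_into M f' y))" using smooth_on_compose by blast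
    show "inv_into N f (inv_into M f' y) = inv_into N (\<lambda>x. f' (f x)) y" if "y \<in> L" for y
    proof -
      have m: "inv_into M f' y \<in> f ` N" "y \<in> f' ` M" using that s(3,4) inv_into_into[of y f' M] by auto
      have "inj_on (\<lambda>x. f' (f x)) N" using comp_inj_on[OF s(5), of f'] s(3,6) by (simp add: o_def)
      then show ?thesis using m f_inv_into_f[OF m(1)] f_inv_into_f[OF m(2)] inv_into_into[OF m(1)] by (intro inv_into_f_eq[symmetric]) auto
    qed
  qed
  moreover have "k (f' (f x)) (differential N (\<lambda>x. f' (f x)) x u) (differential N (\<lambda>x. f' (f x)) x v) = g x u v"
    if x: "x \<in> N" and uv: "u \<in> tangent_space N x" "v \<in> tangent_space N x" for x u v
  proof -
    have "differential N (\<lambda>x. f' (f x)) x w = differential M f' (f x) (differential N f x w)" if "w \<in> tangent_space N x" for w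
      using differential_compose[OF s(1) _ s(2) x that] s(3) by simp
    then show ?thesis using isometry_tangent[OF f] f f' uv x s(3) unfolding isometry_def by auto
  qed
  ultimately show ?thesis unfolding isometry_def by blast
qed

lemma isometry_cong:
  assumes f: "isometry N g M h f" and eq: "\<And>x. x \<in> N \<Longrightarrow> f x = f' x"
  shows "isometry N g M h f'"
proof -
  have "inv_into N f = inv_into N f'" unfolding inv_into_def using eq by (intro ext) metis
  moreover have "bij_betw f' N M" using f eq bij_betw_cong[of N f f' M] by (auto simp: isometry_def)
  moreover have "smooth_on N f'" using smooth_on_cong[OF eq] f by (auto simp: isometry_def)
  moreover have "differential N f' x u = differential N f x u" if "x \<in> N" "u \<in> tangent_space N x" for x u
    using differential_cong[OF eq _ that] f by (simp add: isometry_def)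
  ultimately show ?thesis using f eq unfolding isometry_def by metis
qed

lemma isometry_ident: "isometry N g N g (\<lambda>x. x)"
proof -
  have "smooth_on N (inv_into N (\<lambda>x. x))"
    by (rule smooth_on_cong[of N "\<lambda>x. x"]) (auto intro!: inv_into_f_eq[symmetric] smooth_UNIV Cinf_id)
  then show ?thesis unfolding isometry_def by (auto simp: bij_betw_def differential_ident smooth_UNIV Cinf_id)
qed

lemma differential_inverse:
  assumes f: "isometry N g M h f" and y: "y \<in> M" "v \<in> tangent_space M y"
  shows "differential N f (inv_into N f y) (differential M (inv_into N f) y v) = v"
proof -
  have s: "smooth_on N f" "smooth_on M (inv_into N f)" "f ` N = M"
    using f by (auto simp: isometry_def bij_betw_def)
  have "differential M (\<lambda>y. f (inv_into N f y)) y v = differential N f (inv_into N f y) (differential M (inv_into N f) y v)"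
    by (rule differential_compose[OF s(2) _ s(1) y]) (use f bij_betw_inv_into[of f N M] in \<open>simp add: isometry_def bij_betw_def\<close>)
  moreover have "differential M (\<lambda>y. y) y v = differential M (\<lambda>y. f (inv_into N f y)) y v"
    by (rule differential_cong[OF _ smooth_UNIV[OF Cinf_id] y]) (simp add: f_inv_into_f s(3)[symmetric])
  ultimately show ?thesis using differential_ident[OF y] by simp
qed

lemma isometry_inverse:
  assumes f: "isometry N g M h f" shows "isometry M h N g (inv_into N f)"
proof -
  have s: "smooth_on N f" "smooth_on M (inv_into N f)" "bij_betw f N M" "f ` N = M"
    using f by (auto simp: isometry_def bij_betw_def)
  have b: "bij_betw (inv_into N f) M N" using s(3) by (rule bij_betw_inv_into)
  have "smooth_on N (inv_into M (inv_into N f))"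
    by (rule smooth_on_cong[OF _ s(1)]) (simp add: inv_into_inv_into_eq[OF s(3)])
  moreover have "g (inv_into N f y) (differential M (inv_into N f) y u) (differential M (inv_into N f) y v) = h y u v"
    if y: "y \<in> M" and uv: "u \<in> tangent_space M y" "v \<in> tangent_space M y" for y u v
  proof -
    have x: "inv_into N f y \<in> N" "f (inv_into N f y) = y" using y s(4) by (auto simp: inv_into_into f_inv_into_f)
    have t: "differential M (inv_into N f) y w \<in> tangent_space N (inv_into N f y)" if "w \<in> tangent_space M y" for w
      by (rule differential_tangent[OF s(2) _ that]) (use b in \<open>simp add: bij_betw_def\<close>)
    have "h (f (inv_into N f y)) (differential N f (inv_into N f y) (differential M (inv_into N f) y u)) (differential N f (inv_into N f y) (differential M (inv_into N f) y v))
      = g (inv_into N f y) (differential M (inv_into N f) y u) (differential M (inv_into N f) y v)"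
      using f x(1) t uv unfolding isometry_def by blast
    then show ?thesis using differential_inverse[OF f y] uv x(2) by simp
  qed
  ultimately show ?thesis unfolding isometry_def using b s(2) by blast
qed

section \<open>Isometry groups and conjugation by an isometry\<close>

lemma isometry_group_simps:
  "\<one>\<^bsub>isometry_group N g\<^esub> = (\<lambda>x\<in>N. x)" "carrier (isometry_group N g) = {f \<in> extensional N. isometry N g N g f}"
  by (auto simp: isometry_group_def BijGroup_def)

lemma isometry_group_mult:
  assumes "F \<in> carrier (isometry_group N g)" "F' \<in> carrier (isometry_group N g)"
  shows "F \<otimes>\<^bsub>isometry_group N g\<^esub> F' = compose N F F'"
  using assms by (auto simp: isometry_group_def BijGroup_def Bij_def isometry_def)

lemma isometry_group_subgroup: "subgroup {f \<in> extensional N. isometry N g N g f} (BijGroup N)"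
proof (rule group.subgroupI[OF group_BijGroup])
  show "{f \<in> extensional N. isometry N g N g f} \<subseteq> carrier (BijGroup N)"
    by (auto simp: BijGroup_def Bij_def isometry_def)
  have "restrict (\<lambda>x. x) N \<in> {f \<in> extensional N. isometry N g N g f}"
    by (auto intro: isometry_cong[OF isometry_ident])
  then show "{f \<in> extensional N. isometry N g N g f} \<noteq> {}" by blast
next
  fix f assume f: "f \<in> {f \<in> extensional N. isometry N g N g f}"
  then have "inv\<^bsub>BijGroup N\<^esub> f = restrict (inv_into N f) N" by (intro inv_BijGroup) (auto simp: Bij_def isometry_def)
  then show "inv\<^bsub>BijGroup N\<^esub> f \<in> {f \<in> extensional N. isometry N g N g f}"
    using isometry_cong[OF isometry_inverse, of N g N g f "restrict (inv_into N f) N"] f by auto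
next
  fix f f' assume f: "f \<in> {f \<in> extensional N. isometry N g N g f}" "f' \<in> {f \<in> extensional N. isometry N g N g f}"
  then have "f \<otimes>\<^bsub>BijGroup N\<^esub> f' = compose N f f'" by (auto simp: BijGroup_def Bij_def isometry_def)
  moreover have "isometry N g N g (compose N f f')"
    by (rule isometry_cong[OF isometry_compose[of N g N g f' N g f]]) (use f in \<open>auto simp: compose_def\<close>)
  ultimately show "f \<otimes>\<^bsub>BijGroup N\<^esub> f' \<in> {f \<in> extensional N. isometry N g N g f}" by simp
qed

lemma isometry_group_group: "group (isometry_group N g)"
  unfolding isometry_group_def by (rule subgroup.subgroup_is_group[OF isometry_group_subgroup group_BijGroup])

text \<open>The restriction to \<open>N\<close> makes the result extensional, as membership in
  \<open>isometry_group\<close> requires.\<close>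

definition conjugate :: "('m \<Rightarrow> 'n) \<Rightarrow> 'm set \<Rightarrow> 'n set \<Rightarrow> ('m \<Rightarrow> 'm) \<Rightarrow> 'n \<Rightarrow> 'n" where
  "conjugate f M N F = (\<lambda>y\<in>N. f (F (inv_into M f y)))"

lemma conjugate_isometry:
  assumes f: "isometry M h N g f" and F: "isometry M h M h F"
  shows "isometry N g N g (conjugate f M N F)" "conjugate f M N F \<in> carrier (isometry_group N g)"
proof -
  show 1: "isometry N g N g (conjugate f M N F)"
    by (rule isometry_cong[OF isometry_compose[OF isometry_compose[OF isometry_inverse[OF f] F] f]]) (simp add: conjugate_def)
  then show "conjugate f M N F \<in> carrier (isometry_group N g)" by (simp add: isometry_group_simps conjugate_def)
qed

lemma conjugate_point_symmetry:
  assumes f: "isometry M h N g f" and s: "point_symmetry M h x s" and x: "x \<in> M"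
  shows "point_symmetry N g (f x) (conjugate f M N s)"
proof -
  have iso: "isometry M h M h s" and sx: "s x = x" and ds: "\<And>v. v \<in> tangent_space M x \<Longrightarrow> differential M s x v = - v"
    using s by (auto simp: point_symmetry_def isometry_group_simps)
  have b: "bij_betw f M N" and smf: "smooth_on M f" and smi: "smooth_on N (inv_into M f)" and sms: "smooth_on M s" and sM: "s ` M = M"
    using f iso by (auto simp: isometry_def bij_betw_def)
  have fx: "f x \<in> N" "inv_into M f (f x) = x" using b x by (auto simp: bij_betw_def)
  have "conjugate f M N s (f x) = f x" using fx sx by (simp add: conjugate_def)
  moreover have "differential N (conjugate f M N s) (f x) v = - v" if v: "v \<in> tangent_space N (f x)" for v
  proof -
    define w where "w = differential N (inv_into M f) (f x) v"
    have w: "w \<in> tangent_space M x" using isometry_tangent[OF isometry_inverse[OF f] v] fx(2) by (simp add: w_def)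
    have 1: "smooth_on N (\<lambda>y. s (inv_into M f y))"
      by (rule smooth_on_compose[OF smi _ sms]) (use bij_betw_inv_into[OF b] in \<open>simp add: bij_betw_def\<close>)
    have 2: "smooth_on N (\<lambda>y. f (s (inv_into M f y)))"
      by (rule smooth_on_compose[OF 1 _ smf]) (use bij_betw_inv_into[OF b] sM in \<open>auto simp: bij_betw_def\<close>)
    have "differential N (conjugate f M N s) (f x) v = differential N (\<lambda>y. f (s (inv_into M f y))) (f x) v"
      by (rule differential_cong[OF _ 2 fx(1) v, symmetric]) (simp add: conjugate_def)
    also have "\<dots> = differential M f x (differential N (\<lambda>y. s (inv_into M f y)) (f x) v)"
      using differential_compose[OF 1 _ smf fx(1) v] bij_betw_inv_into[OF b] sM fx(2) sx by (auto simp: bij_betw_def)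
    also have "differential N (\<lambda>y. s (inv_into M f y)) (f x) v = differential M s x w"
      using differential_compose[OF smi _ sms fx(1) v] bij_betw_inv_into[OF b] fx(2) by (simp add: bij_betw_def w_def)
    also have "\<dots> = - w" by (rule ds[OF w])
    also have "differential M f x (- w) = - differential M f x w" using linear_neg[OF linear_differential[OF smf x]] .
    also have "differential M f x w = v" using differential_inverse[OF f fx(1) v] fx(2) by (simp add: w_def)
    finally show ?thesis .
  qed
  ultimately show ?thesis unfolding point_symmetry_def using conjugate_isometry[OF f iso] by blast
qed

lemma conjugate_inverse:
  assumes b: "bij_betw f M N" and s: "s \<in> extensional N" "s ` N \<subseteq> N"
  shows "conjugate f M N (conjugate (inv_into M f) N M s) = s"
proof
  fix y show "conjugate f M N (conjugate (inv_into M f) N M s) y = s y"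
  proof (cases "y \<in> N")
    case True
    have x: "inv_into M f y \<in> M" "f (inv_into M f y) = y" using b True by (auto simp: bij_betw_def inv_into_into f_inv_into_f)
    have "inv_into N (inv_into M f) (inv_into M f y) = y" using inv_into_inv_into_eq[OF b x(1)] x(2) by simp
    moreover have "f (inv_into M f (s y)) = s y" using s(2) True b by (auto simp: bij_betw_def intro!: f_inv_into_f)
    ultimately show ?thesis using True x(1) by (simp add: conjugate_def)
  next
    case False then show ?thesis using s(1) by (simp add: conjugate_def extensional_def)
  qed
qed

lemma point_symmetries_conjugate:
  assumes f: "isometry M h N g f"
  shows "{s. \<exists>y\<in>N. point_symmetry N g y s} = conjugate f M N ` {s. \<exists>x\<in>M. point_symmetry M h x s}"
proof (intro equalityI subsetI)
  fix s assume "s \<in> {s. \<exists>y\<in>N. point_symmetry N g y s}"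
  then obtain y where y: "y \<in> N" "point_symmetry N g y s" by blast
  have b: "bij_betw f M N" using f by (simp add: isometry_def)
  have s: "s \<in> extensional N" "s ` N \<subseteq> N" using y(2) by (auto simp: point_symmetry_def isometry_group_simps isometry_def bij_betw_def)
  have "point_symmetry M h (inv_into M f y) (conjugate (inv_into M f) N M s)"
    by (rule conjugate_point_symmetry[OF isometry_inverse[OF f] y(2,1)])
  moreover have "inv_into M f y \<in> M" using b y(1) by (auto simp: bij_betw_def inv_into_into)
  ultimately have "conjugate (inv_into M f) N M s \<in> {s. \<exists>x\<in>M. point_symmetry M h x s}" by blast
  then have "conjugate f M N (conjugate (inv_into M f) N M s) \<in> conjugate f M N ` {s. \<exists>x\<in>M. point_symmetry M h x s}" by (rule imageI)
  then show "s \<in> conjugate f M N ` {s. \<exists>x\<in>M. point_symmetry M h x s}" unfolding conjugate_inverse[OF b s] .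
next
  fix s assume "s \<in> conjugate f M N ` {s. \<exists>x\<in>M. point_symmetry M h x s}"
  then obtain t x where "s = conjugate f M N t" "x \<in> M" "point_symmetry M h x t" by blast
  moreover from this have "f x \<in> N" using f by (auto simp: isometry_def bij_betw_def)
  ultimately show "s \<in> {s. \<exists>y\<in>N. point_symmetry N g y s}" using conjugate_point_symmetry[OF f] by blast
qed

section \<open>Rigidity of isometries of the model\<close>

lemma derivative_along_curve:
  fixes F :: "'a::euclidean_space \<Rightarrow> 'b::real_normed_vector"
  assumes F: "Cinf_on F UNIV" and c: "(c has_vector_derivative v) (at t)" and w: "(w has_vector_derivative w') (at t)"
  shows "((\<lambda>s. frechet_derivative F (at (c s)) (w s)) has_vector_derivative
     frechet_derivative (\<lambda>y. frechet_derivative F (at y) (w t)) (at (c t)) v + frechet_derivative F (at (c t)) w') (at t)"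
proof -
  define D where "D y = frechet_derivative F (at y)" for y
  define H where "H x = frechet_derivative (\<lambda>y. D y x) (at (c t))" for x
  have lin: "linear (D y)" for y unfolding D_def using has_derivative_linear[OF Cinf_on_has_derivative[OF F]] by blast
  have dD: "((\<lambda>y. D y x) has_derivative H x) (at (c t))" for x
    unfolding H_def D_def by (rule Cinf_on_has_derivative[of _ UNIV]) (use F Cinf_on_iff in blast)+
  have expand: "D y x = (\<Sum>b\<in>Basis. (x \<bullet> b) *\<^sub>R D y b)" for y x by (rule linear_expand[OF lin])
  have dc: "((\<lambda>s. D (c s) x) has_vector_derivative H x v) (at t)" for x
    by (rule has_derivative_curve[of _ "H x" c t UNIV v UNIV]) (use dD c in auto)
  have "((\<lambda>s. \<Sum>b\<in>Basis. (w s \<bullet> b) *\<^sub>R D (c s) b) has_vector_derivative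
      (\<Sum>b\<in>Basis. (w t \<bullet> b) *\<^sub>R H b v + (w' \<bullet> b) *\<^sub>R D (c t) b)) (at t)"
    by (intro has_vector_derivative_sum has_vector_derivative_scaleR dc
        bounded_linear.has_vector_derivative[OF bounded_linear_inner_left, of _ _ "at t", folded has_real_derivative_iff_has_vector_derivative] w)
  \<comment> \<open>Linearity of \<open>H\<close> in its index, from uniqueness of derivatives: it
    collapses the basis expansion to a single second derivative.\<close>
  moreover have "H (w t) = (\<lambda>z. \<Sum>b\<in>Basis. (w t \<bullet> b) *\<^sub>R H b z)"
  proof -
    have "((\<lambda>y. \<Sum>b\<in>Basis. (w t \<bullet> b) *\<^sub>R D y b) has_derivative (\<lambda>z. \<Sum>b\<in>Basis. (w t \<bullet> b) *\<^sub>R H b z)) (at (c t))"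
      by (intro has_derivative_sum has_derivative_scaleR_right dD)
    then have "((\<lambda>y. D y (w t)) has_derivative (\<lambda>z. \<Sum>b\<in>Basis. (w t \<bullet> b) *\<^sub>R H b z)) (at (c t))"
      by (simp add: expand[symmetric])
    then show ?thesis using has_derivative_unique[OF dD] by blast
  qed
  ultimately have "((\<lambda>s. D (c s) (w s)) has_vector_derivative H (w t) v + D (c t) w') (at t)"
    by (simp add: expand[symmetric] sum.distrib)
  then show ?thesis by (simp add: D_def H_def)
qed

lemma form5_simps:
  "form5 k (a + b) c = form5 k a c + form5 k b c" "form5 k c (a + b) = form5 k c a + form5 k c b"
  "form5 k (r *\<^sub>R a) c = r * form5 k a c" "form5 k c (r *\<^sub>R a) = r * form5 k c a" "form5 k a b = form5 k b a"
  by (auto simp: form5_def case_prod_beta inner_add_left inner_add_right inner_commute algebra_simps)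

lemma form5_bilinear: "bounded_bilinear (form5 k)"
proof -
  have "bilinear (form5 k)" unfolding bilinear_def by (intro conjI allI linearI) (simp_all add: form5_simps)
  then show ?thesis using bilinear_conv_bounded_bilinear by blast
qed

text \<open>The Koszul formula for equal first arguments. By symmetry of second derivatives, the
  tangential part of a second derivative is expressed by derivatives of the induced metric
  alone.\<close>

lemma koszul:
  fixes f :: "'a::real_normed_vector \<Rightarrow> R5" and k :: real
  assumes f: "Cinf_on f UNIV"
  defines "A u v y \<equiv> form5 k (frechet_derivative f (at y) u) (frechet_derivative f (at y) v)"
  shows "form5 k (frechet_derivative (\<lambda>y. frechet_derivative f (at y) u) (at x) u) (frechet_derivative f (at x) w) =
     frechet_derivative (A u w) (at x) u - frechet_derivative (A u u) (at x) w / 2"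
proof -
  define D where "D y = frechet_derivative f (at y)" for y
  define H where "H u = frechet_derivative (\<lambda>y. D y u) (at x)" for u
  have dD: "((\<lambda>y. D y u) has_derivative H u) (at x)" for u
    unfolding H_def D_def by (rule Cinf_on_has_derivative[of _ UNIV]) (use f Cinf_on_iff in blast)+
  have sym: "H u v = H v u" for u v unfolding H_def D_def by (rule mixed_derivatives_commute[OF open_UNIV f UNIV_I])
  have dA: "frechet_derivative (A u v) (at x) z = form5 k (D x u) (H v z) + form5 k (H u z) (D x v)" for u v z
  proof -
    have "(A u v has_derivative (\<lambda>z. form5 k (D x u) (H v z) + form5 k (H u z) (D x v))) (at x)"
      unfolding A_def D_def[symmetric] by (rule bounded_bilinear.FDERIV[OF form5_bilinear dD dD])
    then show ?thesis by (simp add: frechet_derivative_at[symmetric])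
  qed
  show ?thesis unfolding D_def[symmetric] H_def[symmetric] dA
    using sym[of u w] form5_simps(5)[of k "D x u" "H u w"] form5_simps(5)[of k "D x u" "H w u"] by simp
qed

definition model_embed :: "(real^2) \<times> (real^2) \<Rightarrow> R5" where
  "model_embed x = (fst x, snd x$1 * snd x$2, vec2 (- snd x$2) (- snd x$1))"

lemma model_embed_Cinf: "Cinf_on model_embed UNIV"
  unfolding model_embed_def[abs_def] by (intro Cinf_intros)

lemma model_embed_has_derivative: "(model_embed has_derivative model_embed_deriv x) (at x)"
  unfolding model_embed_def[abs_def] model_embed_deriv_def[abs_def]
  by (rule has_derivative_eq_rhs, (rule has_derivative_rules)+) (auto simp: fun_eq_iff prod_eq_iff vec2_eq algebra_simps)

lemma model_embed_derivative: "frechet_derivative model_embed (at x) = model_embed_deriv x"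
  using frechet_derivative_at[OF model_embed_has_derivative] by simp

lemma model_embed_second_derivative:
  "frechet_derivative (\<lambda>x. model_embed_deriv x u) (at x) w = (0, snd w$1 * snd u$2 + snd w$2 * snd u$1, 0)"
proof -
  have "((\<lambda>x. model_embed_deriv x u) has_derivative (\<lambda>w. (0, snd w$1 * snd u$2 + snd w$2 * snd u$1, 0))) (at x)"
    unfolding model_embed_deriv_def[abs_def]
    by (rule has_derivative_eq_rhs, (rule has_derivative_rules)+) (auto simp: fun_eq_iff prod_eq_iff vec2_eq algebra_simps)
  then show ?thesis by (simp add: frechet_derivative_at[symmetric])
qed

lemma inj_model_embed: "inj model_embed"
  by (rule injI) (auto simp: model_embed_def prod_eq_iff vec2_eq)

text \<open>Found by requiring the acceleration in five-space to be normal, that is, a multiple of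
  \<open>(k *\<^sub>R X, 1, 0)\<close>. With \<open>X\<close> affine in \<open>t\<close>, the middle
  coordinate \<open>X1 X2\<close> has constant second derivative \<open>2 v1 v2\<close>, so the
  second derivative of \<open>Z\<close> is \<open>2 k v1 v2\<close> times \<open>X\<close>;
  integrating twice gives the cubic.\<close>

definition model_geodesic :: "real \<Rightarrow> (real^2) \<times> (real^2) \<Rightarrow> (real^2) \<times> (real^2) \<Rightarrow> real \<Rightarrow> (real^2) \<times> (real^2)" where
  "model_geodesic k x v t = (fst x + t *\<^sub>R fst v + (2 * k * snd v$1 * snd v$2) *\<^sub>R ((t^2/2) *\<^sub>R snd x + (t^3/6) *\<^sub>R snd v), snd x + t *\<^sub>R snd v)"

lemma model_geodesic_through: "\<exists>v. model_geodesic k x v 1 = y"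
proof -
  let ?w = "snd y - snd x"
  show ?thesis
    by (rule exI[of _ "(fst y - fst x - (2 * k * ?w$1 * ?w$2) *\<^sub>R ((1/2) *\<^sub>R snd x + (1/6) *\<^sub>R ?w), ?w)"])
       (simp add: model_geodesic_def prod_eq_iff)
qed

lemma second_derivative_determines:
  fixes c b :: "real \<Rightarrow> 'a::real_normed_vector"
  assumes "\<And>t. (c has_vector_derivative c' t) (at t)" "\<And>t. (b has_vector_derivative b' t) (at t)"
    "\<And>t. (c' has_vector_derivative a t) (at t)" "\<And>t. (b' has_vector_derivative a t) (at t)" "c 0 = b 0" "c' 0 = b' 0"
  shows "c t = b t"
proof -
  have "((\<lambda>t. c' t - b' t) has_vector_derivative 0) (at t)" for t using has_vector_derivative_diff[OF assms(3,4)] by simp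
  then have 1: "c' t = b' t" for t using has_vector_derivative_zero_const[of "\<lambda>t. c' t - b' t" t] assms(6) by simp
  have "((\<lambda>t. c t - b t) has_vector_derivative 0) (at t)" for t using has_vector_derivative_diff[OF assms(1,2)] 1 by simp
  then show ?thesis using has_vector_derivative_zero_const[of "\<lambda>t. c t - b t" t] assms(5) by simp
qed

text \<open>Testing against the two tangent vectors with \<open>X\<close> component zero kills the
  last component of \<open>a\<close>; the other two then tie the first component to the middle
  one.\<close>

lemma normal_to_model:
  assumes k: "k * k = 1" and a: "\<And>z. form5 k a (model_embed_deriv x z) = 0"
  shows "snd (snd a) = 0" "fst a = (k * fst (snd a)) *\<^sub>R snd x"
proof -
  have 1: "form5 k a (model_embed_deriv x (vec2 1 0, 0)) = 0" "form5 k a (model_embed_deriv x (vec2 0 1, 0)) = 0"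
    "form5 k a (model_embed_deriv x (0, vec2 1 0)) = 0" "form5 k a (model_embed_deriv x (0, vec2 0 1)) = 0" using a by blast+
  show q: "snd (snd a) = 0" using 1(1,2) by (simp add: form5_def case_prod_beta model_embed_deriv_def inner2 vec2_eq)
  show "fst a = (k * fst (snd a)) *\<^sub>R snd x" using 1(3,4) q
    by (simp add: form5_def case_prod_beta model_embed_deriv_def inner2 vec2_eq algebra_simps)
qed

text \<open>For a geodesic \<open>\<gamma>\<close> through \<open>x\<close>, both \<open>model_embed \<circ> F \<circ> \<gamma>\<close> and \<open>model_embed \<circ> \<gamma>\<close>
  have acceleration normal to the submanifold. This forces the last two coordinates to be affine, which determines the
  middle coordinate, which in turn determines the acceleration of the first two.\<close>

lemma model_rigidity:
  assumes k: "k * k = 1" and F: "isometry UNIV (model_metric k) UNIV (model_metric k) F"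
    and Fx: "F x = x" and dF: "\<And>v. frechet_derivative F (at x) v = v"
  shows "F y = y"
proof -
  have FC: "Cinf_on F UNIV" using F by (simp add: isometry_def smooth_on_UNIV_iff)
  have met: "model_metric k (F z) (frechet_derivative F (at z) u) (frechet_derivative F (at z) v) = model_metric k z u v" for z u v
    using F unfolding isometry_def tangent_UNIV by blast
  have Fd: "(F has_derivative frechet_derivative F (at z)) (at z)" for z using Cinf_on_has_derivative[OF FC] by simp
  define f where "f z = model_embed (F z)" for z
  have fC: "Cinf_on f UNIV" unfolding f_def[abs_def] by (rule Cinf_compose[OF open_UNIV open_UNIV UNIV_I FC model_embed_Cinf])
  have Df: "frechet_derivative f (at z) u = model_embed_deriv (F z) (frechet_derivative F (at z) u)" for z u
    using frechet_derivative_at[OF diff_chain_at[OF Fd model_embed_has_derivative]] by (metis (no_types, lifting) f_def comp_def ext)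
  have A: "form5 k (frechet_derivative f (at z) u) (frechet_derivative f (at z) v) =
     form5 k (frechet_derivative model_embed (at z) u) (frechet_derivative model_embed (at z) v)" for z u v
    unfolding Df model_embed_derivative using met by (simp add: model_metric_def)
  have second: "form5 k (frechet_derivative (\<lambda>y. frechet_derivative f (at y) u) (at z) u) (frechet_derivative f (at z) w) =
     form5 k (frechet_derivative (\<lambda>y. frechet_derivative model_embed (at y) u) (at z) u) (frechet_derivative model_embed (at z) w)" for z u w
    unfolding koszul[OF fC] koszul[OF model_embed_Cinf] A ..
  \<comment> \<open>The acceleration of \<open>f \<circ> \<gamma>\<close> has to be orthogonal to
    every tangent vector at the image point, not just to those known to come from \<open>F\<close>;
    an isometry has injective, hence surjective, derivative.\<close>
  have onto: "\<exists>w. u = frechet_derivative F (at z) w" for z u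
  proof -
    have lin: "linear (frechet_derivative F (at z))" using has_derivative_linear[OF Fd] .
    have "w = 0" if w: "frechet_derivative F (at z) w = 0" for w
    proof -
      have "model_metric k z w v = 0" for v using met[of z w v] w by (simp add: model_metric)
      moreover have "nondegenerate_on UNIV (model_metric k z)"
        using model_metric_metric[of k, unfolded pseudo_riemannian_metric_def scalar_product_on_def tangent_UNIV] by blast
      ultimately show ?thesis unfolding nondegenerate_on_def by blast
    qed
    then have "inj (frechet_derivative F (at z))" using linear_injective_0[OF lin] by blast
    then have "surj (frechet_derivative F (at z))" using linear_injective_imp_surjective[OF lin] by auto
    then show ?thesis by (metis surjD)
  qed
  obtain v where v: "model_geodesic k x v 1 = y" using model_geodesic_through by blast
  define \<gamma> where "\<gamma> = model_geodesic k x v"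
  define \<gamma>' where "\<gamma>' t = (fst v + (2 * k * snd v$1 * snd v$2) *\<^sub>R (t *\<^sub>R snd x + (t^2/2) *\<^sub>R snd v), snd v)" for t
  define \<gamma>'' where "\<gamma>'' t = ((2 * k * snd v$1 * snd v$2) *\<^sub>R (snd x + t *\<^sub>R snd v), 0 :: real^2)" for t
  have d1: "(\<gamma> has_vector_derivative \<gamma>' t) (at t)" for t
    unfolding \<gamma>_def model_geodesic_def[abs_def] \<gamma>'_def
    by (rule has_vector_derivative_eq_rhs, rule has_vector_derivative_Pair) (auto intro!: derivative_eq_intros simp: power2_eq_square)
  have d2: "(\<gamma>' has_vector_derivative \<gamma>'' t) (at t)" for t
    unfolding \<gamma>'_def[abs_def] \<gamma>''_def
    by (rule has_vector_derivative_eq_rhs, rule has_vector_derivative_Pair) (auto intro!: derivative_eq_intros)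
  define c' where "c' h t = frechet_derivative h (at (\<gamma> t)) (\<gamma>' t)" for h :: "(real^2) \<times> (real^2) \<Rightarrow> R5" and t
  define a where "a h t = frechet_derivative (\<lambda>y. frechet_derivative h (at y) (\<gamma>' t)) (at (\<gamma> t)) (\<gamma>' t) + frechet_derivative h (at (\<gamma> t)) (\<gamma>'' t)" for h :: "(real^2) \<times> (real^2) \<Rightarrow> R5" and t
  have dc: "((\<lambda>t. h (\<gamma> t)) has_vector_derivative c' h t) (at t)" "(c' h has_vector_derivative a h t) (at t)" if h: "Cinf_on h UNIV" for h t
  proof -
    show "((\<lambda>t. h (\<gamma> t)) has_vector_derivative c' h t) (at t)" unfolding c'_def
      by (rule has_derivative_curve[of h _ \<gamma> t UNIV _ UNIV]) (use Cinf_on_has_derivative[OF h] d1 in auto)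
    show "(c' h has_vector_derivative a h t) (at t)" unfolding c'_def[abs_def] a_def by (rule derivative_along_curve[OF h d1 d2])
  qed
  have normal_e: "form5 k (a model_embed t) (model_embed_deriv (\<gamma> t) w) = 0" for t w
  proof -
    have "a model_embed t = (0, 2 * snd v$1 * snd v$2, 0) + model_embed_deriv (\<gamma> t) (\<gamma>'' t)"
      unfolding a_def model_embed_derivative model_embed_second_derivative by (simp add: \<gamma>'_def)
    then show ?thesis unfolding \<gamma>''_def \<gamma>_def
      by (simp add: form5_def case_prod_beta model_embed_deriv_def model_geodesic_def inner2 algebra_simps)
  qed
  have normal_f: "form5 k (a f t) (model_embed_deriv (F (\<gamma> t)) w) = 0" for t w
  proof -
    obtain w' where w': "w = frechet_derivative F (at (\<gamma> t)) w'" using onto by blast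
    have "form5 k (a f t) (frechet_derivative f (at (\<gamma> t)) w') = form5 k (a model_embed t) (frechet_derivative model_embed (at (\<gamma> t)) w')"
      unfolding a_def form5_simps(1) second A ..
    then show ?thesis using normal_e by (simp add: w' Df model_embed_derivative)
  qed
  define b where "b h t = h (\<gamma> t)" for h :: "(real^2) \<times> (real^2) \<Rightarrow> R5" and t
  have db: "(b h has_vector_derivative c' h t) (at t)" if "Cinf_on h UNIV" for h t
    unfolding b_def[abs_def] by (rule dc(1)[OF that])
  have \<gamma>0: "\<gamma> 0 = x" by (simp add: \<gamma>_def model_geodesic_def)
  have init: "b f 0 = b model_embed 0" "c' f 0 = c' model_embed 0"
    by (simp_all add: b_def c'_def \<gamma>0 f_def Fx dF Df model_embed_derivative)
  have bl: "bounded_linear (\<lambda>x :: R5. snd (snd x))" "bounded_linear (\<lambda>x :: R5. fst (snd x))" "bounded_linear (\<lambda>x :: R5. fst x)"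
    by (intro bounded_linear_snd_comp bounded_linear_fst_comp bounded_linear_snd bounded_linear_fst)+
  note nf = normal_to_model[OF k normal_f] and ne = normal_to_model[OF k normal_e]
  have q: "snd (snd (b f t)) = snd (snd (b model_embed t))" for t
  proof (rule second_derivative_determines)
    show "((\<lambda>t. snd (snd (c' f t))) has_vector_derivative 0) (at t)" "((\<lambda>t. snd (snd (c' model_embed t))) has_vector_derivative 0) (at t)" for t
      using has_vector_derivative_linear[OF dc(2)[OF fC] bl(1), of t] has_vector_derivative_linear[OF dc(2)[OF model_embed_Cinf] bl(1), of t] nf(1) ne(1) by simp_all
  qed (use init has_vector_derivative_linear[OF db[OF fC] bl(1)] has_vector_derivative_linear[OF db[OF model_embed_Cinf] bl(1)] in auto)
  have X: "snd (F (\<gamma> t)) = snd (\<gamma> t)" for t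
    using q[of t] by (simp add: b_def f_def model_embed_def vec2_eq)
  have m: "fst (snd (b f t)) = fst (snd (b model_embed t))" for t by (simp add: b_def f_def model_embed_def X)
  \<comment> \<open>The middle coordinate is the product of the two \<open>X\<close> coordinates,
    which already agree at all times. Hence its derivatives agree as well, and they fix the
    acceleration of the first component through the normal direction.\<close>
  have m': "fst (snd (c' f t)) = fst (snd (c' model_embed t))" for t
    using has_vector_derivative_linear[OF db[OF fC] bl(2), of t] has_vector_derivative_linear[OF db[OF model_embed_Cinf] bl(2), of t] vector_derivative_at unfolding m by metis
  have m'': "fst (snd (a f t)) = fst (snd (a model_embed t))" for t
    using has_vector_derivative_linear[OF dc(2)[OF fC] bl(2), of t] has_vector_derivative_linear[OF dc(2)[OF model_embed_Cinf] bl(2), of t] vector_derivative_at unfolding m' by metis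
  have p: "fst (b f t) = fst (b model_embed t)" for t
  proof (rule second_derivative_determines)
    show "((\<lambda>t. fst (c' f t)) has_vector_derivative fst (a f t)) (at t)" "((\<lambda>t. fst (c' model_embed t)) has_vector_derivative fst (a f t)) (at t)" for t
      using has_vector_derivative_linear[OF dc(2)[OF fC] bl(3), of t] has_vector_derivative_linear[OF dc(2)[OF model_embed_Cinf] bl(3), of t] nf(2)[of t] ne(2)[of t] m'' X by simp_all
  qed (use init has_vector_derivative_linear[OF db[OF fC] bl(3)] has_vector_derivative_linear[OF db[OF model_embed_Cinf] bl(3)] in auto)
  have "fst (F (\<gamma> 1)) = fst (\<gamma> 1)" using p[of 1] by (simp add: b_def f_def model_embed_def)
  then have "F (\<gamma> 1) = \<gamma> 1" using X[of 1] by (simp add: prod_eq_iff)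
  then show ?thesis using v by (simp add: \<gamma>_def)
qed

section \<open>Groups generated by products of two reflections\<close>

text \<open>In the coordinates \<open>(Z, y, X)\<close> the group automorphism integrating
  \<open>theta\<close> is given by the same formula.\<close>

definition model_theta :: "ghat \<Rightarrow> ghat" where "model_theta u = (- fst u, fst (snd u), - snd (snd u))"

text \<open>The reflections at \<open>v\<close> and at \<open>0\<close> compose to the translation
  by \<open>v\<close> times \<open>model_theta\<close> of the inverse of \<open>v\<close>. For
  vanishing \<open>y\<close> coordinate this is the square of \<open>v\<close>, so horizontal
  elements need square roots.\<close>

lemma model_mult_horizontal: "\<exists>u. fst (snd u) = 0 \<and> model_mult k u u = (Z, 0, X)"
proof -
  \<comment> \<open>Squaring doubles \<open>X\<close> and adds \<open>2 * k * ?X$1 * ?X$2\<close>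
    times \<open>?X\<close> to twice the first component; the subtracted cubic term cancels
    this.\<close>
  let ?X = "(1/2) *\<^sub>R X"
  have "model_mult k ((1/2) *\<^sub>R Z - (k * (?X$1 * ?X$2)) *\<^sub>R ?X, 0, ?X) ((1/2) *\<^sub>R Z - (k * (?X$1 * ?X$2)) *\<^sub>R ?X, 0, ?X) = (Z, 0, X)"
    unfolding model_mult_def prod_eq_iff vec2_eq by (simp add: algebra_simps)
  then show ?thesis by (metis fst_conv snd_conv)
qed

text \<open>Horizontal elements do not form a subgroup: the product of two with independent
  \<open>X\<close> parts acquires a \<open>y\<close> coordinate, and a third one cancels the
  rest.\<close>

lemma model_mult_vertical:
  assumes "k * k = 1"
  shows "\<exists>a b c. fst (snd a) = 0 \<and> fst (snd b) = 0 \<and> fst (snd c) = 0 \<and> model_mult k (model_mult k a b) c = (0, y, 0)"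
proof -
  \<comment> \<open>The product of elements with \<open>X\<close> parts \<open>(1, 0)\<close> and
    \<open>(0, ?s)\<close> has \<open>y\<close> coordinate \<open>k/2 * ?s\<close>, which equals
    \<open>y\<close> because \<open>k * k = 1\<close>.\<close>
  let ?s = "2 * k * y"
  define w where "w = model_mult k (0, 0, vec2 1 0) (0, 0, vec2 0 ?s)"
  have w: "w = (vec2 y 0, y, vec2 1 ?s)"
    using assms by (simp add: w_def model_mult_def prod_eq_iff vec2_eq mult.assoc[symmetric])
  have "\<exists>Z. model_mult k w (Z, 0, vec2 (-1) (- ?s)) = (0, y, 0)"
  proof -
    have "model_mult k w (- (fst w + (k * ((-1) * (- ?s)) + k/2 * (1 * (- ?s) + ?s * (-1))) *\<^sub>R vec2 1 ?s + y *\<^sub>R vec2 (-1) ?s), 0, vec2 (-1) (- ?s)) = (0, y, 0)"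
      by (simp add: w model_mult_def prod_eq_iff vec2_eq)
    then show ?thesis by blast
  qed
  then show ?thesis unfolding w_def by (metis fst_conv snd_conv)
qed

lemma model_mult_decompose: "u = model_mult k (0, fst (snd u), 0) (fst u - fst (snd u) *\<^sub>R vec2 (snd (snd u)$1) (- (snd (snd u)$2)), 0, snd (snd u))"
  by (simp add: model_mult_def prod_eq_iff vec2_eq)

lemma model_theta_inverse: "model_theta (model_inv k u) = u" if "fst (snd u) = 0"
  using that by (simp add: model_theta_def model_inv_def prod_eq_iff)

text \<open>Used for the isometry group of \<open>N\<close> and for the bijections of five-space:
  \<open>h\<close> is the action of the model group, and \<open>r\<close> is the reflection at the
  base point, acting on it through \<open>model_theta\<close>.\<close>

locale model_reflections = I: group I for I :: "'b monoid" (structure) +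
  fixes k :: real and h :: "ghat \<Rightarrow> 'b" and r :: 'b
  assumes k: "k * k = 1" and h: "\<And>a. h a \<in> carrier I" "\<And>a b. h (model_mult k a b) = h a \<otimes> h b"
    and r: "r \<in> carrier I" "r \<otimes> r = \<one>" "\<And>a. r \<otimes> h a = h (model_theta a) \<otimes> r"
begin

definition refls where "refls = {h a \<otimes> r \<otimes> h (model_inv k a) | a. True}"

lemma h_0: "h 0 = \<one>"
proof -
  have "model_mult k 0 0 = 0" by (simp add: model_mult_def prod_eq_iff vec2_eq)
  then have "h 0 \<otimes> h 0 = h 0" using h(2)[of 0 0] by simp
  then show ?thesis using h(1) by (metis I.l_cancel_one)
qed

lemma h_inv: "inv (h a) = h (model_inv k a)"
proof -
  have "model_mult k (model_inv k a) a = 0" by (simp add: model_mult_def model_inv_def prod_eq_iff vec2_eq algebra_simps)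
  then have "h (model_inv k a) \<otimes> h a = \<one>" using h(2) h_0 by metis
  then show ?thesis using h(1) by (simp add: I.inv_equality)
qed

lemma subgroup_h: "subgroup (range h) I"
proof (rule I.subgroupI)
  show "range h \<subseteq> carrier I" using h(1) by blast
  show "inv x \<in> range h" if "x \<in> range h" for x using that h_inv by blast
  show "x \<otimes> y \<in> range h" if "x \<in> range h" "y \<in> range h" for x y using that h(2)[symmetric] by blast
qed simp

text \<open>The first \<open>r\<close> slides to the right at the price of
  \<open>model_theta\<close> and cancels against the second, so a product of two reflections lies in
  the image of \<open>h\<close>.\<close>

lemma refl_product:
  "(h a \<otimes> r \<otimes> h (model_inv k a)) \<otimes> (h b \<otimes> r \<otimes> h (model_inv k b)) =
     h (model_mult k a (model_mult k (model_theta (model_mult k (model_inv k a) b)) (model_inv k b)))"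
proof -
  have "(h a \<otimes> r \<otimes> h (model_inv k a)) \<otimes> (h b \<otimes> r \<otimes> h (model_inv k b))
    = h a \<otimes> (r \<otimes> h (model_mult k (model_inv k a) b)) \<otimes> (r \<otimes> h (model_inv k b))"
    using h(1) r(1) by (simp add: h(2) I.m_assoc)
  also have "\<dots> = h a \<otimes> h (model_theta (model_mult k (model_inv k a) b)) \<otimes> (r \<otimes> r) \<otimes> h (model_inv k b)"
    unfolding r(3) using h(1) r(1) by (simp add: I.m_assoc r(3))
  finally show ?thesis using r(2) h(1) by (simp add: h(2) I.m_assoc)
qed

theorem generate_refls: "generate I {s \<otimes> t | s t. s \<in> refls \<and> t \<in> refls} = range h"
proof
  have "{s \<otimes> t | s t. s \<in> refls \<and> t \<in> refls} \<subseteq> range h" unfolding refls_def using refl_product by auto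
  then show "generate I {s \<otimes> t | s t. s \<in> refls \<and> t \<in> refls} \<subseteq> range h"
    by (rule I.generate_subgroup_incl[OF _ subgroup_h])
next
  let ?T = "generate I {s \<otimes> t | s t. s \<in> refls \<and> t \<in> refls}"
  \<comment> \<open>With \<open>v\<close> a square root of \<open>u\<close>, the reflections at
    \<open>v\<close> and at \<open>0\<close> multiply to \<open>h u\<close>.\<close>
  have hor: "h u \<in> ?T" if u0: "fst (snd u) = 0" for u
  proof -
    have "(fst u, 0, snd (snd u)) = u" using u0 by (simp add: prod_eq_iff)
    then obtain v where v: "fst (snd v) = 0" "model_mult k v v = u" using model_mult_horizontal[of k "fst u" "snd (snd u)"] by metis
    have "(h v \<otimes> r \<otimes> h (model_inv k v)) \<otimes> (h 0 \<otimes> r \<otimes> h (model_inv k 0)) = h u"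
    proof -
      have 0: "model_inv k 0 = 0" "\<And>a. model_mult k a 0 = a" by (auto simp: model_inv_def model_mult_def prod_eq_iff vec2_eq)
      show ?thesis using refl_product[of v 0] by (simp add: 0 model_theta_inverse[OF v(1)] v(2))
    qed
    moreover have "h a \<otimes> r \<otimes> h (model_inv k a) \<in> refls" for a unfolding refls_def by blast
    ultimately have "h u \<in> {s \<otimes> t | s t. s \<in> refls \<and> t \<in> refls}" by (metis (mono_tags, lifting) CollectI)
    then show ?thesis by (rule generate.incl)
  qed
  have vert: "h (0, y, 0) \<in> ?T" for y
  proof -
    obtain a b c where abc: "fst (snd a) = 0" "fst (snd b) = 0" "fst (snd c) = 0" "model_mult k (model_mult k a b) c = (0, y, 0)"
      using model_mult_vertical[OF k] by metis
    have "h (0, y, 0) = h a \<otimes> h b \<otimes> h c" unfolding abc(4)[symmetric] h(2) ..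
    then show ?thesis using generate.eng[OF generate.eng[OF hor[OF abc(1)] hor[OF abc(2)]] hor[OF abc(3)]] by simp
  qed
  show "range h \<subseteq> ?T"
  proof
    fix x assume "x \<in> range h"
    then obtain u where "x = h u" by blast
    then have "x = h (0, fst (snd u), 0) \<otimes> h (fst u - fst (snd u) *\<^sub>R vec2 (snd (snd u)$1) (- (snd (snd u)$2)), 0, snd (snd u))"
      using arg_cong[OF model_mult_decompose[of u k], of h] unfolding h(2) by simp
    moreover have "h (Z, 0, X) \<in> ?T" for Z X by (rule hor) simp
    ultimately show "x \<in> ?T" using generate.eng[OF vert] by simp
  qed
qed

end

lemma topological_group_isomorphic_via:
  assumes A: "\<And>a b. h1 (mu a b) = h1 a \<otimes>\<^bsub>A\<^esub> h1 b" "homeomorphism UNIV (carrier A) h1 g1"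
    and B: "\<And>a b. h2 (mu a b) = h2 a \<otimes>\<^bsub>B\<^esub> h2 b" "homeomorphism UNIV (carrier B) h2 g2"
  shows "topological_group_isomorphic A B"
proof -
  have hm: "homeomorphism (carrier A) (carrier B) (h2 \<circ> g1) (h1 \<circ> g2)"
    by (rule homeomorphism_compose[OF homeomorphism_symD[OF A(2)] B(2)])
  have g1: "h1 (g1 x) = x" if "x \<in> carrier A" for x using A(2) that by (simp add: homeomorphism_def)
  have g1': "g1 (h1 a) = a" for a using A(2) by (simp add: homeomorphism_def)
  have "(h2 \<circ> g1) (x \<otimes>\<^bsub>A\<^esub> y) = (h2 \<circ> g1) x \<otimes>\<^bsub>B\<^esub> (h2 \<circ> g1) y" if "x \<in> carrier A" "y \<in> carrier A" for x y
    using A(1)[of "g1 x" "g1 y"] g1[OF that(1)] g1[OF that(2)] by (metis B(1) comp_apply g1')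
  moreover have "bij_betw (h2 \<circ> g1) (carrier A) (carrier B)"
    by (rule bij_betwI[where g="h1 \<circ> g2"]) (use hm in \<open>auto simp: homeomorphism_def\<close>)
  ultimately have "h2 \<circ> g1 \<in> iso A B" unfolding iso_def hom_def bij_betw_def by auto
  then show ?thesis unfolding topological_group_isomorphic_def using hm by blast
qed

section \<open>The transvection group of the model\<close>

lemma model_translation_comp: "model_translation k a (model_translation k b x) = model_translation k (model_mult k a b) x"
  unfolding model_translation_def model_mult_def prod_eq_iff vec2_eq by (simp add: algebra_simps)

lemma model_translation_neg: "- model_translation k a x = model_translation k (model_theta a) (- x)"
  unfolding model_translation_def model_theta_def prod_eq_iff vec2_eq by (simp add: algebra_simps)

lemma model_neg_isometry: "isometry UNIV (model_metric k) UNIV (model_metric k) uminus"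
proof -
  have d: "frechet_derivative uminus (at x) = (uminus :: (real^2)\<times>(real^2) \<Rightarrow> _)" for x
    using frechet_derivative_at[OF has_derivative_minus[OF has_derivative_ident]] by metis
  have s: "smooth_on UNIV (uminus :: (real^2)\<times>(real^2) \<Rightarrow> _)" by (rule smooth_UNIV) (intro Cinf_intros)
  have i: "inv_into UNIV (uminus :: (real^2)\<times>(real^2) \<Rightarrow> _) = uminus" by (rule inv_equality) auto
  have "bij (uminus :: (real^2)\<times>(real^2) \<Rightarrow> _)" by (rule bij_uminus)
  then show ?thesis unfolding isometry_def i d using s by (simp add: model_metric algebra_simps)
qed

definition model_symmetry :: "real \<Rightarrow> ghat \<Rightarrow> (real^2)\<times>(real^2) \<Rightarrow> (real^2)\<times>(real^2)" where
  "model_symmetry k a y = model_translation k a (- model_translation k (model_inv k a) y)"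

lemma model_symmetry_isometry: "isometry UNIV (model_metric k) UNIV (model_metric k) (model_symmetry k a)"
  unfolding model_symmetry_def[abs_def]
  by (rule isometry_compose[OF isometry_compose[OF model_translation_isometry model_neg_isometry] model_translation_isometry])

lemma model_symmetry_involution: "model_symmetry k a (model_symmetry k a y) = y"
  by (simp add: model_symmetry_def model_translation_inv)

text \<open>At this point the derivatives of the two translations are inverse to each other, so only
  the sign of the inner reflection survives.\<close>

lemma model_symmetry_fixes: "model_symmetry k a (model_proj a) = model_proj a"
  and model_symmetry_derivative: "frechet_derivative (model_symmetry k a) (at (model_proj a)) v = - v"
proof -
  have 0: "model_translation k a 0 = model_proj a" "model_translation k (model_inv k a) (model_proj a) = 0"
    by (simp_all add: model_translation_def model_proj_def model_inv_def prod_eq_iff vec2_eq algebra_simps)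
  show "model_symmetry k a (model_proj a) = model_proj a" by (simp add: model_symmetry_def 0)
  define D where "D b x = frechet_derivative (model_translation k b) (at x)" for b x
  have dt: "(model_translation k b has_derivative D b x) (at x)" for b x
    unfolding D_def using model_translation_deriv frechet_derivative_works differentiable_def by blast
  have lin: "linear (D b x)" for b x using has_derivative_linear[OF dt] .
  have d1: "((\<lambda>y. - model_translation k (model_inv k a) y) has_derivative (\<lambda>v. - D (model_inv k a) (model_proj a) v)) (at (model_proj a))"
    by (rule has_derivative_minus[OF dt])
  have "(model_translation k a has_derivative D a 0) (at (- model_translation k (model_inv k a) (model_proj a)))"
    using dt[of a 0] by (simp add: 0)
  from diff_chain_at[OF d1 this]
  have "(model_symmetry k a has_derivative (\<lambda>v. D a 0 (- D (model_inv k a) (model_proj a) v))) (at (model_proj a))"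
    by (simp add: model_symmetry_def[abs_def] o_def)
  moreover have "D a 0 (D (model_inv k a) (model_proj a) v) = v" for v
  proof -
    have "(model_translation k a has_derivative D a 0) (at (model_translation k (model_inv k a) (model_proj a)))"
      using dt[of a 0] by (simp add: 0)
    from diff_chain_at[OF dt this]
    have "((\<lambda>x. x) has_derivative D a 0 \<circ> D (model_inv k a) (model_proj a)) (at (model_proj a))"
      by (simp add: o_def model_translation_inv)
    then show ?thesis using has_derivative_unique[OF _ has_derivative_ident] by (metis comp_apply)
  qed
  ultimately have "(model_symmetry k a has_derivative uminus) (at (model_proj a))"
    by (simp add: linear_neg[OF lin])
  then show "frechet_derivative (model_symmetry k a) (at (model_proj a)) v = - v"
    by (simp add: frechet_derivative_at[symmetric])
qed

text \<open>Composing a point symmetry with the explicit one at the same point gives an isometry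
  fixing the point with identity derivative, which is trivial by
  \<open>model_rigidity\<close>.\<close>

lemma model_point_symmetries:
  assumes k: "k * k = 1"
  shows "{s. \<exists>x\<in>UNIV. point_symmetry UNIV (model_metric k) x s} = range (model_symmetry k)"
proof (intro equalityI subsetI)
  fix s assume "s \<in> {s. \<exists>x\<in>UNIV. point_symmetry UNIV (model_metric k) x s}"
  then obtain x where s: "isometry UNIV (model_metric k) UNIV (model_metric k) s" "s x = x" "\<And>v. frechet_derivative s (at x) v = - v"
    by (auto simp: point_symmetry_def isometry_group_simps tangent_UNIV)
  define a where "a = (fst x, 0 :: real, snd x)"
  have x: "x = model_proj a" by (simp add: a_def model_proj_def)
  have iso: "isometry UNIV (model_metric k) UNIV (model_metric k) (\<lambda>y. model_symmetry k a (s y))"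
    by (rule isometry_compose[OF s(1) model_symmetry_isometry])
  have "frechet_derivative (\<lambda>y. model_symmetry k a (s y)) (at x) v = v" for v
  proof -
    have "frechet_derivative (\<lambda>y. model_symmetry k a (s y)) (at x) v = frechet_derivative (model_symmetry k a) (at (s x)) (frechet_derivative s (at x) v)"
      using differential_compose[of UNIV s UNIV "model_symmetry k a" x v] s(1) model_symmetry_isometry by (simp add: isometry_def tangent_UNIV)
    then show ?thesis using s(2,3) model_symmetry_derivative[of k a] by (simp add: x)
  qed
  then have "model_symmetry k a (s y) = y" for y
    using model_rigidity[OF k iso, of x y] s(2) model_symmetry_fixes[of k a] by (simp add: x)
  then have "s = model_symmetry k a" using model_symmetry_involution by (metis ext)
  then show "s \<in> range (model_symmetry k)" by blast
next
  fix s assume "s \<in> range (model_symmetry k)"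
  then obtain a where "s = model_symmetry k a" by blast
  moreover have "point_symmetry UNIV (model_metric k) (model_proj a) (model_symmetry k a)"
    unfolding point_symmetry_def isometry_group_simps extensional_UNIV
    using model_symmetry_isometry model_symmetry_fixes model_symmetry_derivative by blast
  ultimately show "s \<in> {s. \<exists>x\<in>UNIV. point_symmetry UNIV (model_metric k) x s}" by blast
qed

lemma transvection_group_model:
  fixes f :: "(real^2)\<times>(real^2) \<Rightarrow> 'n::euclidean_space"
  assumes k: "k * k = 1" and f: "isometry UNIV (model_metric k) N g f"
  defines "h \<equiv> \<lambda>a. conjugate f UNIV N (model_translation k a)"
  shows "carrier (transvection_group N g) = range h"
    and "h (model_mult k a b) = h a \<otimes>\<^bsub>transvection_group N g\<^esub> h b"
proof -
  let ?I = "isometry_group N g"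
  have b: "bij_betw f UNIV N" using f by (simp add: isometry_def)
  have fN: "f x \<in> N" "inv_into UNIV f (f x) = x" for x using b by (auto simp: bij_betw_def)
  define C where "C = conjugate f UNIV N"
  have C: "C F \<in> carrier ?I" if "isometry UNIV (model_metric k) UNIV (model_metric k) F" for F
    unfolding C_def by (rule conjugate_isometry(2)[OF f that])
  have C_mult: "C F \<otimes>\<^bsub>?I\<^esub> C F' = C (\<lambda>x. F (F' x))"
    if "isometry UNIV (model_metric k) UNIV (model_metric k) F" "isometry UNIV (model_metric k) UNIV (model_metric k) F'" for F F'
    unfolding isometry_group_mult[OF C[OF that(1)] C[OF that(2)]] by (intro ext) (simp add: C_def conjugate_def compose_def fN)
  have hC: "h a = C (model_translation k a)" for a by (simp add: h_def C_def)
  have hI: "h a \<in> carrier ?I" for a unfolding hC by (rule C[OF model_translation_isometry])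
  have hm: "h (model_mult k a b) = h a \<otimes>\<^bsub>?I\<^esub> h b" for a b
    unfolding hC C_mult[OF model_translation_isometry model_translation_isometry] model_translation_comp ..
  interpret model_reflections ?I k h "C uminus"
  proof (intro model_reflections.intro model_reflections_axioms.intro)
    show "group ?I" by (rule isometry_group_group)
    show "C uminus \<in> carrier ?I" by (rule C[OF model_neg_isometry])
    show "C uminus \<otimes>\<^bsub>?I\<^esub> C uminus = \<one>\<^bsub>?I\<^esub>"
      unfolding C_mult[OF model_neg_isometry model_neg_isometry] isometry_group_simps using b
      by (auto simp: C_def conjugate_def bij_betw_def f_inv_into_f)
    show "C uminus \<otimes>\<^bsub>?I\<^esub> h a = h (model_theta a) \<otimes>\<^bsub>?I\<^esub> C uminus" for a
      unfolding hC C_mult[OF model_neg_isometry model_translation_isometry] C_mult[OF model_translation_isometry model_neg_isometry] model_translation_neg ..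
  qed (use k hI hm in auto)
  have sym: "C (model_symmetry k a) = h a \<otimes>\<^bsub>?I\<^esub> C uminus \<otimes>\<^bsub>?I\<^esub> h (model_inv k a)" for a
    unfolding hC C_mult[OF model_translation_isometry model_neg_isometry]
      C_mult[OF isometry_compose[OF model_neg_isometry model_translation_isometry] model_translation_isometry] model_symmetry_def[abs_def] ..
  have "refls = C ` range (model_symmetry k)" unfolding refls_def image_image sym by blast
  then have refls: "refls = {s. \<exists>y\<in>N. point_symmetry N g y s}"
    unfolding point_symmetries_conjugate[OF f] model_point_symmetries[OF k] C_def .
  have "{s \<otimes>\<^bsub>?I\<^esub> t | s t. (\<exists>x\<in>N. point_symmetry N g x s) \<and> (\<exists>y\<in>N. point_symmetry N g y t)} = {s \<otimes>\<^bsub>?I\<^esub> t | s t. s \<in> refls \<and> t \<in> refls}"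
    unfolding refls by simp
  then show "carrier (transvection_group N g) = range h"
    unfolding transvection_group_def using generate_refls by simp
  show "h (model_mult k a b) = h a \<otimes>\<^bsub>transvection_group N g\<^esub> h b" using hm by (simp add: transvection_group_def)
qed

lemma transvection_group_homeomorphism:
  fixes f :: "(real^2)\<times>(real^2) \<Rightarrow> 'n::euclidean_space"
  assumes k: "k * k = 1" and f: "isometry UNIV (model_metric k) N g f"
  defines "h \<equiv> \<lambda>a. conjugate f UNIV N (model_translation k a)"
  shows "\<exists>h'. homeomorphism UNIV (range h) h h'"
proof -
  have b: "bij_betw f UNIV N" using f by (simp add: isometry_def)
  have fN: "f x \<in> N" "inv_into UNIV f (f x) = x" for x using b by (auto simp: bij_betw_def)
  have cf: "continuous_on UNIV f" "continuous_on N (inv_into UNIV f)" using f smooth_on_continuous by (auto simp: isometry_def)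
  define e where "e x F = inv_into UNIV f (F (f x))" for x and F :: "'n \<Rightarrow> 'n"
  have eh: "e x (h a) = model_translation k a x" for x a by (simp add: e_def h_def conjugate_def fN)
  \<comment> \<open>In the topology of pointwise convergence only evaluations are at hand, and two
    suffice: the image of \<open>0\<close> shows \<open>Z\<close> and \<open>X\<close>, and the
    first coordinate of the image of \<open>(0, vec2 1 0)\<close> exceeds that of \<open>Z\<close>
    by \<open>y\<close> plus a term known from \<open>X\<close>.\<close>
  define h' where "h' F = (fst (e 0 F), fst (e (0, vec2 1 0) F)$1 - fst (e 0 F)$1 - k/2 * snd (e 0 F)$2 * snd (e 0 F)$1, snd (e 0 F))" for F
  have h'h: "h' (h a) = a" for a unfolding h'_def eh by (simp add: model_translation_def prod_eq_iff vec2_eq)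
  have ce: "continuous_on (range h) (e x)" for x
    unfolding e_def
  proof (rule continuous_on_compose2[OF cf(2)])
    show "continuous_on (range h) (\<lambda>F. F (f x))" by (rule continuous_on_subset[OF continuous_on_product_coordinates]) simp
    show "(\<lambda>F. F (f x)) ` range h \<subseteq> N" by (auto simp: h_def conjugate_def fN)
  qed
  have "homeomorphism UNIV (range h) h h'"
  proof
    show "continuous_on UNIV h"
    proof (rule continuous_on_coordinatewise_then_product)
      fix y show "continuous_on UNIV (\<lambda>a. h a y)"
      proof (cases "y \<in> N")
        case True
        have "continuous_on UNIV (\<lambda>a. model_translation k a (inv_into UNIV f y))"
          by (rule Cinf_on_continuous) (unfold model_translation_def, intro Cinf_intros)
        then have "continuous_on UNIV (\<lambda>a. f (model_translation k a (inv_into UNIV f y)))"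
          by (rule continuous_on_compose2[OF cf(1)]) simp
        then show ?thesis using True by (simp add: h_def conjugate_def)
      next
        case False then show ?thesis by (simp add: h_def conjugate_def)
      qed
    qed
    show "continuous_on (range h) h'" unfolding h'_def
      by (intro continuous_on_Pair continuous_on_diff continuous_on_mult continuous_on_fst continuous_on_snd continuous_on_component continuous_on_const ce)
  qed (use h'h in auto)
  then show ?thesis by blast
qed

section \<open>The submanifold \<open>M\<close> and its reflections\<close>

lemma vec2_collapse[simp]: "vec2 (x$1) (x$2) = x" by (simp add: vec2_eq)

lemma form5_eq: "form5 k u v = - (fst u$1 * snd (snd v)$1 + fst u$2 * snd (snd v)$2 + (fst v$1 * snd (snd u)$1 + fst v$2 * snd (snd u)$2)) - k * fst (snd u) * fst (snd v)"
  by (simp add: form5_def case_prod_beta inner2 algebra_simps)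

lemma M5_model_embed: "M5 = range model_embed"
proof (intro equalityI subsetI)
  fix w assume "w \<in> M5"
  then obtain p q where w: "w = (p, q$1 * q$2, q)" by (auto simp: M5_def)
  have "w = model_embed (p, vec2 (- q$2) (- q$1))" by (simp add: w model_embed_def prod_eq_iff vec2_eq)
  then show "w \<in> range model_embed" by blast
qed (auto simp: M5_def model_embed_def)

text \<open>Ignores the middle coordinate and is therefore defined on all of five-space: one global
  smooth extension of the inverse parametrisation.\<close>

definition model_embed_inv :: "R5 \<Rightarrow> (real^2)\<times>(real^2)" where
  "model_embed_inv w = (fst w, vec2 (- snd (snd w)$2) (- snd (snd w)$1))"

lemma model_embed_inv: "model_embed_inv (model_embed x) = x"
  by (simp add: model_embed_inv_def model_embed_def prod_eq_iff vec2_eq)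

lemma model_embed_inv_M5: "m \<in> M5 \<Longrightarrow> model_embed (model_embed_inv m) = m"
  unfolding M5_model_embed by (auto simp: model_embed_inv)

lemma model_embed_inv_Cinf: "Cinf_on model_embed_inv UNIV"
  unfolding model_embed_inv_def[abs_def] by (intro Cinf_intros)

lemma model_embed_isometry: "isometry UNIV (model_metric k) M5 (\<lambda>_. form5 k) model_embed"
proof -
  have "inv_into UNIV model_embed z = model_embed_inv z" if "z \<in> M5" for z
    using that unfolding M5_model_embed by (auto simp: inv_f_f[OF inj_model_embed] model_embed_inv)
  then have "smooth_on M5 (inv_into UNIV model_embed)"
    by (intro smooth_on_cong[OF _ smooth_UNIV[OF model_embed_inv_Cinf]]) simp
  then show ?thesis unfolding isometry_def model_embed_derivative
    using inj_model_embed M5_model_embed smooth_UNIV[OF model_embed_Cinf] by (simp add: bij_betw_def model_metric_def)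
qed

text \<open>A curve in \<open>M5\<close> is the image of a smooth curve of parameters under
  \<open>model_embed\<close>, because \<open>model_embed_inv\<close> is smooth on the whole space;
  differentiating this factorisation gives the nontrivial inclusion.\<close>

lemma tangent_M5: "tangent_space M5 (model_embed x) = range (model_embed_deriv x)"
proof (intro equalityI subsetI)
  fix v assume v: "v \<in> tangent_space M5 (model_embed x)"
  obtain c e where c: "0 < e" "Cinf_on c {-e<..<e}" "c ` {-e<..<e} \<subseteq> M5" "c 0 = model_embed x" "(c has_vector_derivative v) (at (0::real))"
    using tangent_spaceE[OF v] by metis
  have I: "open {-e<..<e}" "0 \<in> {-e<..<e}" using c(1) by auto
  obtain D where D: "(model_embed_inv has_derivative D) (at (model_embed x))"
    using Cinf_on_has_derivative[OF model_embed_inv_Cinf] by blast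
  have "((\<lambda>t. model_embed_inv (c t)) has_vector_derivative D v) (at 0)"
    by (rule has_derivative_curve[of _ D c 0 UNIV v UNIV]) (use D c(4,5) in auto)
  then have "((\<lambda>t. model_embed (model_embed_inv (c t))) has_vector_derivative model_embed_deriv x (D v)) (at 0)"
    by (intro has_derivative_curve[of model_embed "model_embed_deriv x" "\<lambda>t. model_embed_inv (c t)" 0 UNIV "D v" UNIV])
      (use model_embed_has_derivative[of x] c(4) in \<open>auto simp: model_embed_inv\<close>)
  then have "(c has_vector_derivative model_embed_deriv x (D v)) (at 0)"
    by (rule has_vector_derivative_transform_within_open[OF _ I]) (use c(3) model_embed_inv_M5 in blast)
  then show "v \<in> range (model_embed_deriv x)" using c(5) vector_derivative_at by blast
next
  fix v assume "v \<in> range (model_embed_deriv x)"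
  then obtain u where u: "v = model_embed_deriv x u" by blast
  have "differential UNIV model_embed x u \<in> tangent_space M5 (model_embed x)"
    by (rule isometry_tangent[OF model_embed_isometry]) (simp add: tangent_UNIV)
  then show "v \<in> tangent_space M5 (model_embed x)" by (simp add: u model_embed_derivative)
qed

text \<open>\<open>M5\<close> is a graph over the coordinates \<open>(p, q)\<close>, flattened
  globally by a shear of the middle coordinate.\<close>

lemma submanifold_M5: "\<exists>k. submanifold k M5"
proof -
  define \<phi> where "\<phi> w = (fst w, fst (snd w) - snd (snd w)$1 * snd (snd w)$2, snd (snd w))" for w :: R5
  define \<psi> where "\<psi> w = (fst w, fst (snd w) + snd (snd w)$1 * snd (snd w)$2, snd (snd w))" for w :: R5
  define L where "L = {w :: R5. fst (snd w) = 0}"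
  have 1: "\<psi> (\<phi> w) = w" "\<phi> (\<psi> w) = w" for w by (simp_all add: \<phi>_def \<psi>_def)
  have c: "Cinf_on \<phi> UNIV" "Cinf_on \<psi> UNIV" unfolding \<phi>_def[abs_def] \<psi>_def[abs_def] by (intro Cinf_intros)+
  have h: "homeomorphism UNIV UNIV \<phi> \<psi>"
    using Cinf_on_continuous[OF c(1)] Cinf_on_continuous[OF c(2)] 1 by (intro homeomorphismI) auto
  have L: "subspace L" unfolding L_def subspace_def by auto
  have M: "M5 = {w. \<phi> w \<in> L}" unfolding M5_def \<phi>_def L_def by auto
  have "\<phi> ` (UNIV \<inter> M5) = UNIV \<inter> L"
  proof (intro equalityI subsetI)
    fix w assume "w \<in> UNIV \<inter> L"
    then have "\<psi> w \<in> UNIV \<inter> M5" "w = \<phi> (\<psi> w)" using 1 by (simp_all add: M)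
    then show "w \<in> \<phi> ` (UNIV \<inter> M5)" by blast
  qed (auto simp: M)
  then have "submanifold (dim L) M5" unfolding submanifold_def using h c L by blast
  then show ?thesis ..
qed

lemma form5_scalar_product: assumes "k * k = 1" shows "scalar_product_on UNIV (form5 k)"
proof -
  have "u = 0" if u: "\<forall>v. form5 k u v = 0" for u
  proof -
    have k0: "k \<noteq> 0" using assms by auto
    have "form5 k u (vec2 1 0, 0, 0) = 0" "form5 k u (vec2 0 1, 0, 0) = 0" "form5 k u (0, 1, 0) = 0"
      "form5 k u (0, 0, vec2 1 0) = 0" "form5 k u (0, 0, vec2 0 1) = 0" using u by blast+
    then show ?thesis using k0 by (simp add: form5_eq prod_eq_iff vec2_eq)
  qed
  then show ?thesis unfolding scalar_product_on_def nondegenerate_on_def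
    by (intro conjI ballI allI impI form5_simps) auto
qed

lemma nondegenerate_M5: "nondegenerate_on (tangent_space M5 (model_embed x)) (form5 k)"
  unfolding nondegenerate_on_def tangent_M5
proof (intro ballI impI)
  fix u assume "u \<in> range (model_embed_deriv x)" and 0: "\<forall>v\<in>range (model_embed_deriv x). form5 k u v = 0"
  then obtain w where w: "u = model_embed_deriv x w" by blast
  have "model_metric k x w v = 0" for v using 0 unfolding w model_metric_def by blast
  moreover have "nondegenerate_on UNIV (model_metric k x)"
    using model_metric_metric[of k, unfolded pseudo_riemannian_metric_def scalar_product_on_def tangent_UNIV] by blast
  ultimately have "w = 0" unfolding nondegenerate_on_def by blast
  then show "u = 0" by (simp add: w model_embed_deriv_def prod_eq_iff vec2_eq)
qed

definition model_normal :: "real \<Rightarrow> (real^2)\<times>(real^2) \<Rightarrow> R5" where "model_normal k x = (k *\<^sub>R snd x, 1, 0)"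

text \<open>The bracketed functional is the coefficient along \<open>model_normal\<close> in the
  splitting into tangent and normal part: it is \<open>0\<close> on tangent vectors and
  \<open>1\<close> on the normal vector.\<close>

definition refl5 :: "real \<Rightarrow> (real^2)\<times>(real^2) \<Rightarrow> R5 \<Rightarrow> R5" where
  "refl5 k x w = model_embed x - (w - model_embed x) +
     (2 * (fst (snd (w - model_embed x)) + snd x \<bullet> snd (snd (w - model_embed x)))) *\<^sub>R model_normal k x"

lemma normal_space_M5:
  assumes "k * k = 1"
  shows "normal_space (form5 k) M5 (model_embed x) = {model_embed x + r *\<^sub>R model_normal k x | r. True}"
proof -
  have eq: "(\<forall>v\<in>tangent_space M5 (model_embed x). form5 k n v = 0) \<longleftrightarrow> (\<exists>r. n = r *\<^sub>R model_normal k x)" for n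
  proof
    assume "\<forall>v\<in>tangent_space M5 (model_embed x). form5 k n v = 0"
    then have "form5 k n (model_embed_deriv x z) = 0" for z unfolding tangent_M5 by blast
    from normal_to_model[OF assms this] have "n = fst (snd n) *\<^sub>R model_normal k x"
      by (simp add: model_normal_def prod_eq_iff mult.commute)
    then show "\<exists>r. n = r *\<^sub>R model_normal k x" by blast
  next
    assume "\<exists>r. n = r *\<^sub>R model_normal k x"
    then show "\<forall>v\<in>tangent_space M5 (model_embed x). form5 k n v = 0"
      unfolding tangent_M5 by (auto simp: form5_eq model_normal_def model_embed_deriv_def algebra_simps)
  qed
  show ?thesis unfolding normal_space_def eq by blast
qed

text \<open>The definition uses \<open>THE\<close>, so uniqueness matters: an affine map is
  determined by its linear part on the tangent space together with its values on the normal line, as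
  these span five-space.\<close>

lemma extrinsic_reflection_M5:
  assumes k: "k * k = 1"
  shows "extrinsic_reflection (form5 k) M5 (model_embed x) = refl5 k x"
  unfolding extrinsic_reflection_def
proof (rule the_equality)
  let ?A = "\<lambda>v. - v + (2 * (fst (snd v) + snd x \<bullet> snd (snd v))) *\<^sub>R model_normal k x"
  have lin: "linear ?A" by (rule linearI) (simp_all add: prod_eq_iff inner_add_right algebra_simps)
  have "refl5 k x = (\<lambda>w. ?A w + (model_embed x - ?A (model_embed x)))"
    unfolding refl5_def by (intro ext) (simp add: prod_eq_iff vec2_eq inner_diff_right inner_add_right algebra_simps)
  moreover have "\<forall>v\<in>tangent_space M5 (model_embed x). ?A v = - v"
    unfolding tangent_M5 by (auto simp: model_embed_deriv_def inner2 prod_eq_iff)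
  moreover have "\<forall>w\<in>normal_space (form5 k) M5 (model_embed x). refl5 k x w = w"
    unfolding normal_space_M5[OF k] by (auto simp: refl5_def model_normal_def prod_eq_iff vec2_eq inner2 algebra_simps)
  ultimately show "(\<exists>A b. linear A \<and> refl5 k x = (\<lambda>w. A w + b) \<and> (\<forall>v\<in>tangent_space M5 (model_embed x). A v = - v)) \<and>
    (\<forall>w\<in>normal_space (form5 k) M5 (model_embed x). refl5 k x w = w)"
    using lin by (intro conjI exI[of _ ?A] exI[of _ "model_embed x - ?A (model_embed x)"])
next
  fix s assume s: "(\<exists>A b. linear A \<and> s = (\<lambda>w. A w + b) \<and> (\<forall>v\<in>tangent_space M5 (model_embed x). A v = - v)) \<and>
    (\<forall>w\<in>normal_space (form5 k) M5 (model_embed x). s w = w)"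
  then obtain A b where A: "linear A" "s = (\<lambda>w. A w + b)" "\<And>v. v \<in> tangent_space M5 (model_embed x) \<Longrightarrow> A v = - v" by blast
  have n: "A (model_embed x + r *\<^sub>R model_normal k x) + b = model_embed x + r *\<^sub>R model_normal k x" for r
  proof -
    have "model_embed x + r *\<^sub>R model_normal k x \<in> normal_space (form5 k) M5 (model_embed x)"
      unfolding normal_space_M5[OF k] by blast
    then have "s (model_embed x + r *\<^sub>R model_normal k x) = model_embed x + r *\<^sub>R model_normal k x" using s by blast
    then show ?thesis unfolding A(2) .
  qed
  have m: "A (model_embed x) + b = model_embed x" using n[of 0] by simp
  have "(A (model_embed x) + b) + A (model_normal k x) = model_embed x + model_normal k x"
    using n[of 1] by (simp add: linear_add[OF A(1)] ac_simps)
  then have \<nu>: "A (model_normal k x) = model_normal k x" by (simp add: m)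
  show "s = refl5 k x"
  proof
    fix w
    define v where "v = w - model_embed x"
    define c where "c = fst (snd v) + snd x \<bullet> snd (snd v)"
    \<comment> \<open>Subtracting the normal component leaves a tangent vector; its parameters are
      read off from the first and last components.\<close>
    have "v - c *\<^sub>R model_normal k x = model_embed_deriv x (fst v - (c * k) *\<^sub>R snd x, vec2 (- snd (snd v)$2) (- snd (snd v)$1))"
      by (simp add: model_embed_deriv_def model_normal_def prod_eq_iff vec2_eq c_def inner2)
    then have "A (v - c *\<^sub>R model_normal k x) = - (v - c *\<^sub>R model_normal k x)" by (intro A(3)) (simp add: tangent_M5)
    then have "A v - c *\<^sub>R model_normal k x = - v + c *\<^sub>R model_normal k x"
      by (simp add: linear_diff[OF A(1)] linear_cmul[OF A(1)] \<nu>)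
    then have "A v = - v + (c + c) *\<^sub>R model_normal k x" by (simp only: scaleR_left_distrib diff_eq_eq add.assoc)
    then have "A v = - v + (2 * c) *\<^sub>R model_normal k x" by simp
    moreover have "s w = A v + model_embed x" using m by (simp add: A(2) v_def linear_diff[OF A(1)] algebra_simps)
    ultimately show "s w = refl5 k x w" by (simp add: refl5_def v_def c_def)
  qed
qed

section \<open>The extrinsic transvection group\<close>

definition trans5 :: "real \<Rightarrow> ghat \<Rightarrow> R5 \<Rightarrow> R5" where
  "trans5 k u = transvection5 k (snd (snd u)) (fst u) (fst (snd u))"

text \<open>The extrinsic reflection at \<open>0\<close>, where the normal line is the middle
  axis.\<close>

definition neg5 :: "R5 \<Rightarrow> R5" where "neg5 w = (- fst w, fst (snd w), - snd (snd w))"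

lemma trans5_comp: "trans5 k a (trans5 k b w) = trans5 k (model_mult k a b) w"
  unfolding trans5_def by (simp add: transvection5_comp)

lemma trans5_0: "trans5 k 0 w = w"
  by (simp add: trans5_def transvection5_eq prod_eq_iff vec2_eq)

lemma model_mult_inv: "model_mult k a (model_inv k a) = 0" "model_mult k (model_inv k a) a = 0"
  by (auto simp: model_mult_def model_inv_def prod_eq_iff vec2_eq algebra_simps)

lemma trans5_inv: "trans5 k a (trans5 k (model_inv k a) w) = w" "trans5 k (model_inv k a) (trans5 k a w) = w"
  by (simp_all add: trans5_comp model_mult_inv trans5_0)

lemma bij_trans5: "bij (trans5 k a)"
  by (rule bij_betwI[where g="trans5 k (model_inv k a)"]) (auto simp: trans5_inv)

lemma trans5_neg5: "neg5 (trans5 k a w) = trans5 k (model_theta a) (neg5 w)"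
  by (simp add: trans5_def neg5_def model_theta_def transvection5_eq prod_eq_iff vec2_eq inner2 algebra_simps)

lemma trans5_model_embed: "trans5 k a (model_embed x) = model_embed (model_translation k a x)"
  by (simp add: trans5_def model_embed_def model_translation_def transvection5_eq prod_eq_iff vec2_eq inner2 algebra_simps)

lemma neg5_model_embed: "neg5 (model_embed x) = model_embed (- x)"
  by (simp add: neg5_def model_embed_def prod_eq_iff vec2_eq)

text \<open>Transvections carry the reflection at \<open>0\<close> to the reflection at the image
  point. This holds as an identity of polynomials on all of five-space, not only on
  \<open>M5\<close>.\<close>

lemma refl5_trans5:
  assumes "k * k = 1" shows "trans5 k a (neg5 (trans5 k (model_inv k a) w)) = refl5 k (model_proj a) w"
proof -
  have kk: "k * (k * z) = z" for z using assms by (simp add: mult.assoc[symmetric])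
  show ?thesis
    by (simp add: trans5_def neg5_def model_inv_def refl5_def model_proj_def model_embed_def model_normal_def
        transvection5_eq prod_eq_iff vec2_eq inner2 algebra_simps kk)
qed

lemma refl5_M5: assumes "k * k = 1" shows "refl5 k x ` M5 = M5"
proof -
  define a where "a = (fst x, 0 :: real, snd x)"
  have x: "x = model_proj a" by (simp add: a_def model_proj_def)
  have sub: "refl5 k x m \<in> M5" if "m \<in> M5" for m
  proof -
    obtain y where "m = model_embed y" using \<open>m \<in> M5\<close> M5_model_embed by blast
    then show ?thesis unfolding x refl5_trans5[OF assms, symmetric] by (simp add: trans5_model_embed neg5_model_embed M5_model_embed)
  qed
  have "refl5 k x (refl5 k x m) = m" for m
    unfolding x refl5_trans5[OF assms, symmetric] by (simp add: trans5_inv neg5_def)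
  then show ?thesis using sub by (intro equalityI subsetI) (auto, metis image_eqI)
qed

lemma extrinsic_symmetric_M5: assumes "k * k = 1" shows "extrinsic_symmetric (form5 k) M5"
  unfolding extrinsic_symmetric_def
proof (intro conjI ballI)
  fix m assume "m \<in> M5"
  then obtain x where m: "m = model_embed x" using M5_model_embed by blast
  show "nondegenerate_on (tangent_space M5 m) (form5 k)" unfolding m by (rule nondegenerate_M5)
  show "extrinsic_reflection (form5 k) M5 m ` M5 = M5" unfolding m extrinsic_reflection_M5[OF assms] by (rule refl5_M5[OF assms])
qed (rule form5_scalar_product[OF assms] submanifold_M5)+

lemma BijGroup_UNIV: "carrier (BijGroup UNIV) = {f. bij f}" "\<one>\<^bsub>BijGroup UNIV\<^esub> = (\<lambda>x. x)"
  by (auto simp: BijGroup_def Bij_def)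

lemma BijGroup_UNIV_mult: "bij f \<Longrightarrow> bij f' \<Longrightarrow> f \<otimes>\<^bsub>BijGroup UNIV\<^esub> f' = f \<circ> f'"
  by (auto simp: BijGroup_def Bij_def compose_def)

lemma bij_neg5: "bij neg5" by (rule bij_betwI[where g=neg5]) (auto simp: neg5_def)

lemma extrinsic_transvections:
  assumes k: "k * k = 1"
  shows "carrier (extrinsic_transvection_group (form5 k) M5) = range (trans5 k)"
    and "subgroup (range (trans5 k)) (BijGroup UNIV)"
proof -
  interpret model_reflections "BijGroup UNIV" k "trans5 k" neg5
  proof (intro model_reflections.intro model_reflections_axioms.intro)
    show "group (BijGroup (UNIV :: R5 set))" by (rule group_BijGroup)
    show "trans5 k a \<in> carrier (BijGroup UNIV)" for a by (simp add: BijGroup_UNIV bij_trans5)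
    show "trans5 k (model_mult k a b) = trans5 k a \<otimes>\<^bsub>BijGroup UNIV\<^esub> trans5 k b" for a b
      by (simp add: BijGroup_UNIV_mult bij_trans5 fun_eq_iff trans5_comp)
    show "neg5 \<in> carrier (BijGroup UNIV)" by (simp add: BijGroup_UNIV bij_neg5)
    show "neg5 \<otimes>\<^bsub>BijGroup UNIV\<^esub> neg5 = \<one>\<^bsub>BijGroup UNIV\<^esub>"
      unfolding BijGroup_UNIV_mult[OF bij_neg5 bij_neg5] BijGroup_UNIV by (auto simp: neg5_def)
    show "neg5 \<otimes>\<^bsub>BijGroup UNIV\<^esub> trans5 k a = trans5 k (model_theta a) \<otimes>\<^bsub>BijGroup UNIV\<^esub> neg5" for a
      unfolding BijGroup_UNIV_mult[OF bij_neg5 bij_trans5] BijGroup_UNIV_mult[OF bij_trans5 bij_neg5] by (auto simp: trans5_neg5)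
  qed (rule k)
  have m: "trans5 k a \<otimes>\<^bsub>BijGroup UNIV\<^esub> neg5 \<otimes>\<^bsub>BijGroup UNIV\<^esub> trans5 k (model_inv k a) = refl5 k (model_proj a)" for a
    using bij_trans5 bij_neg5 refl5_trans5[OF k] by (simp add: BijGroup_UNIV_mult bij_comp fun_eq_iff)
  have refls: "refls = range (refl5 k)"
  proof -
    have "range model_proj = UNIV" by (metis surjI[of model_proj "\<lambda>x. (fst x, 0, snd x)"] model_proj_def fst_conv snd_conv prod.collapse)
    then have "range (refl5 k) = range (\<lambda>a. refl5 k (model_proj a))" by (metis image_image)
    then show ?thesis unfolding refls_def m by blast
  qed
  have refl_bij: "bij (refl5 k x)" for x
  proof -
    have "refl5 k x = trans5 k (fst x, 0, snd x) \<circ> neg5 \<circ> trans5 k (model_inv k (fst x, 0, snd x))"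
      using refl5_trans5[OF k, of "(fst x, 0, snd x)"] by (simp add: model_proj_def fun_eq_iff)
    then show ?thesis by (simp add: bij_comp bij_trans5 bij_neg5)
  qed
  have "{extrinsic_reflection (form5 k) M5 x \<circ> extrinsic_reflection (form5 k) M5 y | x y. x \<in> M5 \<and> y \<in> M5} = {s \<circ> t | s t. s \<in> refls \<and> t \<in> refls}"
    unfolding refls M5_model_embed extrinsic_reflection_M5[OF k, unfolded M5_model_embed, symmetric] by blast
  also have "\<dots> = {s \<otimes>\<^bsub>BijGroup UNIV\<^esub> t | s t. s \<in> refls \<and> t \<in> refls}"
    unfolding refls using BijGroup_UNIV_mult[OF refl_bij refl_bij] by (metis (no_types, opaque_lifting) rangeE)
  finally show "carrier (extrinsic_transvection_group (form5 k) M5) = range (trans5 k)"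
    unfolding extrinsic_transvection_group_def using generate_refls by simp
  show "subgroup (range (trans5 k)) (BijGroup UNIV)" by (rule subgroup_h)
qed

lemma trans5_homeomorphism: "\<exists>h'. homeomorphism UNIV (range (trans5 k)) (trans5 k) h'"
proof -
  \<comment> \<open>The image of \<open>0\<close> shows \<open>Z\<close> and, in its last component,
    the swapped and negated \<open>X\<close>. The first coordinate of the image of
    \<open>(0, 0, vec2 0 1)\<close> then reveals \<open>- y\<close> up to known terms.\<close>
  define h' where "h' F = (fst (F 0), - (fst (F (0, 0, vec2 0 1))$1 + k/2 * snd (snd (F 0))$1 * snd (snd (F 0))$2 - fst (F 0)$1), vec2 (- snd (snd (F 0))$2) (- snd (snd (F 0))$1))" for F :: "R5 \<Rightarrow> R5"
  have h'h: "h' (trans5 k a) = a" for a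
    by (simp add: h'_def trans5_def transvection5_eq prod_eq_iff vec2_eq inner2)
  have ev: "continuous_on (range (trans5 k)) (\<lambda>F. F w)" for w
    by (rule continuous_on_subset[OF continuous_on_product_coordinates]) simp
  have "homeomorphism UNIV (range (trans5 k)) (trans5 k) h'"
  proof
    show "continuous_on UNIV (trans5 k)"
    proof (rule continuous_on_coordinatewise_then_product)
      show "continuous_on UNIV (\<lambda>a. trans5 k a w)" for w
        by (rule Cinf_on_continuous) (unfold trans5_def transvection5_eq inner2, intro Cinf_intros)
    qed
    show "continuous_on (range (trans5 k)) h'" unfolding h'_def vec2_def
      by (intro continuous_on_Pair continuous_on_add continuous_on_minus continuous_on_scaleR continuous_on_diff continuous_on_mult continuous_on_fst continuous_on_snd continuous_on_component continuous_on_const ev)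
  qed (use h'h in auto)
  then show ?thesis by blast
qed

section \<open>Semidirect products\<close>

text \<open>Conjugation has to be examined for \<open>Q\<close> only, as \<open>A\<close> normalises
  itself and every element is a product of an element of \<open>A\<close> and one of
  \<open>Q\<close>.\<close>

lemma internal_semidirectI:
  fixes G :: "'a monoid" (structure)
  assumes grp: "group G" and A: "subgroup A G" and Q: "subgroup Q G"
    and conj: "\<And>q a. q \<in> Q \<Longrightarrow> a \<in> A \<Longrightarrow> \<exists>b\<in>A. q \<otimes> a = b \<otimes> q"
    and triv: "A \<inter> Q \<subseteq> {\<one>}" and G: "carrier G \<subseteq> A <#> Q"
  shows "internal_semidirect G A Q"
proof -
  interpret group G by (rule grp)
  have AG: "A \<subseteq> carrier G" and QG: "Q \<subseteq> carrier G" using A Q subgroup.subset by blast+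
  have "x \<otimes> h \<otimes> inv x \<in> A" if x: "x \<in> carrier G" and h: "h \<in> A" for x h
  proof -
    obtain a q where aq: "a \<in> A" "q \<in> Q" "x = a \<otimes> q" using G x unfolding set_mult_def by blast
    obtain b where b: "b \<in> A" "q \<otimes> h = b \<otimes> q" using conj[OF aq(2) h] by blast
    have c: "a \<in> carrier G" "q \<in> carrier G" "b \<in> carrier G" "h \<in> carrier G" using aq b h AG QG by blast+
    have "x \<otimes> h \<otimes> inv x = a \<otimes> (q \<otimes> h) \<otimes> inv q \<otimes> inv a" using c by (simp add: aq(3) inv_mult_group m_assoc)
    also have "\<dots> = a \<otimes> b \<otimes> inv a" unfolding b(2) using c by (simp add: m_assoc)
    finally show ?thesis using aq(1) b(1) A by (simp add: subgroup.m_closed subgroup.m_inv_closed)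
  qed
  then have "A \<lhd> G" using A by (simp add: normal_inv_iff)
  moreover have "A \<inter> Q = {\<one>}" using triv subgroup.one_closed[OF A] subgroup.one_closed[OF Q] by blast
  moreover have "A <#> Q \<subseteq> carrier G" using AG QG by (rule set_mult_closed)
  ultimately show ?thesis unfolding internal_semidirect_def using Q G by blast
qed

lemma (in group) subgroup_set_mult_conj:
  assumes A: "subgroup A G" and Q: "subgroup Q G"
    and conj: "\<And>q a. q \<in> Q \<Longrightarrow> a \<in> A \<Longrightarrow> \<exists>b\<in>A. q \<otimes> a = b \<otimes> q"
  shows "subgroup (A <#> Q) G"
proof (rule subgroupI)
  have AG: "A \<subseteq> carrier G" and QG: "Q \<subseteq> carrier G" using A Q subgroup.subset by blast+
  show "A <#> Q \<subseteq> carrier G" using AG QG by (rule set_mult_closed)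
  show "A <#> Q \<noteq> {}" using subgroup.one_closed[OF A] subgroup.one_closed[OF Q] unfolding set_mult_def by blast
  show "inv x \<in> A <#> Q" if x: "x \<in> A <#> Q" for x
  proof -
    obtain a q where aq: "a \<in> A" "q \<in> Q" "x = a \<otimes> q" using x unfolding set_mult_def by blast
    have i: "inv q \<in> Q" "inv a \<in> A" using aq A Q by (simp_all add: subgroup.m_inv_closed)
    obtain b where b: "b \<in> A" "inv q \<otimes> inv a = b \<otimes> inv q" using conj[OF i] by blast
    have "inv x = inv q \<otimes> inv a" using aq AG QG by (simp add: inv_mult_group subsetD)
    then show ?thesis unfolding b(2) set_mult_def using b(1) i(1) by blast
  qed
  show "x \<otimes> y \<in> A <#> Q" if xy: "x \<in> A <#> Q" "y \<in> A <#> Q" for x y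
  proof -
    obtain a q where aq: "a \<in> A" "q \<in> Q" "x = a \<otimes> q" using xy(1) unfolding set_mult_def by blast
    obtain a' q' where aq': "a' \<in> A" "q' \<in> Q" "y = a' \<otimes> q'" using xy(2) unfolding set_mult_def by blast
    obtain b where b: "b \<in> A" "q \<otimes> a' = b \<otimes> q" using conj[OF aq(2) aq'(1)] by blast
    have c: "a \<in> carrier G" "q \<in> carrier G" "b \<in> carrier G" "a' \<in> carrier G" "q' \<in> carrier G" using aq aq' b AG QG by blast+
    have "x \<otimes> y = a \<otimes> (q \<otimes> a') \<otimes> q'" using c by (simp add: aq(3) aq'(3) m_assoc)
    also have "\<dots> = (a \<otimes> b) \<otimes> (q \<otimes> q')" unfolding b(2) using c by (simp add: m_assoc)
    finally show ?thesis unfolding set_mult_def using aq aq' b A Q by (auto intro: subgroup.m_closed)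
  qed
qed

section \<open>Affine isometries preserving \<open>M\<close>\<close>

lemma linear_isometries_compose: "A \<in> linear_isometries \<beta> \<Longrightarrow> B \<in> linear_isometries \<beta> \<Longrightarrow> A \<circ> B \<in> linear_isometries \<beta>"
  by (auto simp: linear_isometries_def linear_compose bij_comp)

lemma linear_isometries_inverse: assumes "A \<in> linear_isometries \<beta>" shows "inv_into UNIV A \<in> linear_isometries \<beta>"
proof -
  have A: "linear A" "bij A" "\<And>u v. \<beta> (A u) (A v) = \<beta> u v" using assms by (auto simp: linear_isometries_def)
  have s: "A (inv_into UNIV A x) = x" for x using A(2) by (simp add: bij_is_surj surj_f_inv_f)
  have i: "inv_into UNIV A x = y" if "A y = x" for x y
    by (rule inv_into_f_eq[OF bij_is_inj[OF A(2)] UNIV_I that])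
  have "linear (inv_into UNIV A)"
    by (rule linearI; rule i) (simp_all add: linear_add[OF A(1)] linear_cmul[OF A(1)] s)
  moreover have "\<beta> (inv_into UNIV A u) (inv_into UNIV A v) = \<beta> u v" for u v using A(3)[of "inv_into UNIV A u" "inv_into UNIV A v"] s by simp
  ultimately show ?thesis using A(2) by (simp add: linear_isometries_def bij_imp_bij_inv)
qed

lemma affine_isometryI: "A \<in> linear_isometries \<beta> \<Longrightarrow> (\<lambda>w. A w + b) \<in> carrier (affine_isometry_group \<beta>)"
  unfolding affine_isometry_group_def by auto

lemma affine_isometries_bij: "F \<in> carrier (affine_isometry_group \<beta>) \<Longrightarrow> bij F"
proof -
  assume "F \<in> carrier (affine_isometry_group \<beta>)"
  then obtain A b where F: "F = (\<lambda>w. A w + b)" "A \<in> linear_isometries \<beta>" by (auto simp: affine_isometry_group_def)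
  have "F = (\<lambda>w. w + b) \<circ> A" by (auto simp: F)
  moreover have "bij (\<lambda>w. w + b)" by (rule bij_betwI[where g="\<lambda>w. w - b"]) auto
  ultimately show ?thesis using F(2) by (auto simp: linear_isometries_def bij_comp)
qed

lemma subgroup_affine: "subgroup (carrier (affine_isometry_group \<beta>)) (BijGroup UNIV)"
proof (rule group.subgroupI[OF group_BijGroup])
  show "carrier (affine_isometry_group \<beta>) \<subseteq> carrier (BijGroup UNIV)" using affine_isometries_bij by (auto simp: BijGroup_UNIV)
  have "(\<lambda>w. (\<lambda>w. w) w + 0) \<in> carrier (affine_isometry_group \<beta>)"
    unfolding affine_isometry_group_def by (auto simp: linear_isometries_def linear_id[unfolded id_def] bij_id[unfolded id_def] intro!: exI[of _ "\<lambda>w. w"] exI[of _ 0])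
  then show "carrier (affine_isometry_group \<beta>) \<noteq> {}" by blast
next
  fix F assume F: "F \<in> carrier (affine_isometry_group \<beta>)"
  then obtain A b where A: "F = (\<lambda>w. A w + b)" "A \<in> linear_isometries \<beta>" by (auto simp: affine_isometry_group_def)
  have "bij A" using A(2) by (simp add: linear_isometries_def)
  have "linear (inv_into UNIV A)" using linear_isometries_inverse[OF A(2)] by (simp add: linear_isometries_def)
  then have inv: "inv_into UNIV F w = inv_into UNIV A w + (- inv_into UNIV A b)" for w
    using affine_isometries_bij[OF F] \<open>bij A\<close>
    by (intro inv_into_f_eq) (auto simp: A(1) bij_is_inj linear_diff[symmetric] bij_is_surj surj_f_inv_f)
  have "inv\<^bsub>BijGroup UNIV\<^esub> F = inv_into UNIV F"
    using inv_BijGroup[of F UNIV] affine_isometries_bij[OF F] by (auto simp: Bij_def)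
  also have "\<dots> = (\<lambda>w. inv_into UNIV A w + (- inv_into UNIV A b))" using inv by blast
  finally have e: "inv\<^bsub>BijGroup UNIV\<^esub> F = (\<lambda>w. inv_into UNIV A w + (- inv_into UNIV A b))" .
  show "inv\<^bsub>BijGroup UNIV\<^esub> F \<in> carrier (affine_isometry_group \<beta>)"
    unfolding e by (rule affine_isometryI[OF linear_isometries_inverse[OF A(2)]])
next
  fix F F' assume F: "F \<in> carrier (affine_isometry_group \<beta>)" "F' \<in> carrier (affine_isometry_group \<beta>)"
  then obtain A b A' b' where A: "F = (\<lambda>w. A w + b)" "A \<in> linear_isometries \<beta>" "F' = (\<lambda>w. A' w + b')" "A' \<in> linear_isometries \<beta>"
    by (auto simp: affine_isometry_group_def)
  have "linear A" using A(2) by (simp add: linear_isometries_def)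
  then have e: "F \<otimes>\<^bsub>BijGroup UNIV\<^esub> F' = (\<lambda>w. (A \<circ> A') w + (A b' + b))"
    unfolding BijGroup_UNIV_mult[OF F[THEN affine_isometries_bij]] by (auto simp: A(1,3) linear_add add.assoc)
  show "F \<otimes>\<^bsub>BijGroup UNIV\<^esub> F' \<in> carrier (affine_isometry_group \<beta>)"
    unfolding e by (rule affine_isometryI[OF linear_isometries_compose[OF A(2,4)]])
qed

lemma subgroup_extrinsic: "subgroup (carrier (extrinsic_isometry_group \<beta> M)) (BijGroup UNIV)"
proof (rule group.subgroupI[OF group_BijGroup])
  let ?E = "extrinsic_isometry_group \<beta> M"
  have E: "carrier ?E = {F \<in> carrier (affine_isometry_group \<beta>). F ` M = M}" by (simp add: extrinsic_isometry_group_def)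
  show "carrier ?E \<subseteq> carrier (BijGroup UNIV)" unfolding E using subgroup.subset[OF subgroup_affine] by blast
  have "(\<lambda>w. w) \<in> carrier ?E" unfolding E using subgroup.one_closed[OF subgroup_affine] by (simp add: BijGroup_UNIV)
  then show "carrier ?E \<noteq> {}" by blast
  show "inv\<^bsub>BijGroup UNIV\<^esub> F \<in> carrier ?E" if F: "F \<in> carrier ?E" for F
  proof -
    have b: "bij F" "F ` M = M" using F affine_isometries_bij by (auto simp: E)
    have "inv\<^bsub>BijGroup UNIV\<^esub> F = inv_into UNIV F" using inv_BijGroup[of F UNIV] b by (auto simp: Bij_def)
    moreover have "inv_into UNIV F ` M = M" using b by (metis bij_is_inj image_inv_f_f)
    ultimately show ?thesis using F subgroup.m_inv_closed[OF subgroup_affine, of F] unfolding E by simp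
  qed
  show "F \<otimes>\<^bsub>BijGroup UNIV\<^esub> F' \<in> carrier ?E" if F: "F \<in> carrier ?E" "F' \<in> carrier ?E" for F F'
  proof -
    have b: "bij F" "bij F'" using F affine_isometries_bij by (auto simp: E)
    have "(F \<circ> F') ` M = M" using F unfolding image_comp[symmetric] E by simp
    then show ?thesis using F subgroup.m_closed[OF subgroup_affine, of F _ F'] unfolding E by (simp add: BijGroup_UNIV_mult[OF b])
  qed
qed

section \<open>Generators of \<open>O(1,1)\<close> and of the group of order two\<close>

definition diag5 :: "real \<Rightarrow> R5 \<Rightarrow> R5" where
  "diag5 s w = (vec2 (fst w$1 / s) (s * fst w$2), fst (snd w), vec2 (s * snd (snd w)$1) (snd (snd w)$2 / s))"

definition swap5 :: "R5 \<Rightarrow> R5" where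
  "swap5 w = (vec2 (fst w$2) (fst w$1), fst (snd w), vec2 (snd (snd w)$2) (snd (snd w)$1))"

lemma Z2_gen_eq: "Z2_gen w = (vec2 (fst w$1) (- fst w$2), - fst (snd w), vec2 (snd (snd w)$1) (- snd (snd w)$2))"
  by (cases w) (simp add: Z2_gen_def vec2_eq)

lemma matrix_inv_eqI:
  fixes A B :: "real^'n^'n" assumes "A ** B = mat 1" shows "matrix_inv A = B"
proof -
  have BA: "B ** A = mat 1" using assms matrix_left_right_inverse by blast
  then have "A ** matrix_inv A = mat 1 \<and> matrix_inv A ** A = mat 1"
    unfolding matrix_inv_def using assms by (intro someI[where P="\<lambda>A'. A ** A' = mat 1 \<and> A' ** A = mat 1"]) blast
  then show ?thesis using BA by (metis matrix_mul_assoc matrix_mul_lid matrix_mul_rid)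
qed

text \<open>Preserving \<open>q1 q2\<close> means permuting the two null axes with reciprocal
  scalings. \<open>diag5 s\<close> is such a scaling, with the dual action on \<open>p\<close>, and
  \<open>swap5\<close> exchanges the axes.\<close>

lemma O11_diag_image: "O11_diag ` O11 = {diag5 s | s. s \<noteq> 0} \<union> {diag5 s \<circ> swap5 | s. s \<noteq> 0}"
proof -
  have mv: "(S *v q)$1 = S$1$1 * q$1 + S$1$2 * q$2" "(S *v q)$2 = S$2$1 * q$1 + S$2$2 * q$2" for S :: "real^2^2" and q
    by (simp_all add: matrix_vector_mult_def sum_2)
  have O11: "S \<in> O11 \<longleftrightarrow> S$1$1 * S$2$1 = 0 \<and> S$1$2 * S$2$2 = 0 \<and> S$1$1 * S$2$2 + S$1$2 * S$2$1 = 1" for S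
  proof
    assume "S \<in> O11"
    then have e: "(S *v q)$1 * (S *v q)$2 = q$1 * q$2" for q by (simp add: O11_def)
    show "S$1$1 * S$2$1 = 0 \<and> S$1$2 * S$2$2 = 0 \<and> S$1$1 * S$2$2 + S$1$2 * S$2$1 = 1"
      \<comment> \<open>The two null vectors give the vanishing products, and their sum gives the
        mixed coefficient.\<close>
      using e[of "vec2 1 0"] e[of "vec2 0 1"] e[of "vec2 1 1"] unfolding mv by (auto simp: algebra_simps)
  next
    assume a: "S$1$1 * S$2$1 = 0 \<and> S$1$2 * S$2$2 = 0 \<and> S$1$1 * S$2$2 + S$1$2 * S$2$1 = 1"
    have "(S *v q)$1 * (S *v q)$2 = (S$1$1 * S$2$1) * (q$1 * q$1) + (S$1$2 * S$2$2) * (q$2 * q$2) + (S$1$1 * S$2$2 + S$1$2 * S$2$1) * (q$1 * q$2)" for q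
      unfolding mv by (simp add: algebra_simps)
    then show "S \<in> O11" using a by (simp add: O11_def)
  qed
  have inv: "matrix_inv S = (\<chi> i j. if i = 1 then (if j = 1 then S$2$2 else S$1$2) else (if j = 1 then S$2$1 else S$1$1))" if "S \<in> O11" for S
    using that unfolding O11 by (intro matrix_inv_eqI) (auto simp: matrix_matrix_mult_def mat_def vec_eq_iff forall_2 sum_2 algebra_simps)
  have diag: "O11_diag S w = (vec2 (S$2$2 * fst w$1 + S$2$1 * fst w$2) (S$1$2 * fst w$1 + S$1$1 * fst w$2), fst (snd w),
     vec2 (S$1$1 * snd (snd w)$1 + S$1$2 * snd (snd w)$2) (S$2$1 * snd (snd w)$1 + S$2$2 * snd (snd w)$2))" if "S \<in> O11" for S w
    by (cases w) (simp add: O11_diag_def inv[OF that] vec2_eq mv transpose_def)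
  show ?thesis
  proof (intro equalityI subsetI)
    fix F assume "F \<in> O11_diag ` O11"
    then obtain S where S: "S \<in> O11" "F = O11_diag S" by blast
    note e = S(1)[unfolded O11]
    show "F \<in> {diag5 s | s. s \<noteq> 0} \<union> {diag5 s \<circ> swap5 | s. s \<noteq> 0}"
    proof (cases "S$1$1 = 0")
      case False
      then have "S$2$1 = 0" "S$2$2 = 1 / S$1$1" "S$1$2 = 0" using e by (auto simp: field_simps)
      then have "F = diag5 (S$1$1)" unfolding S(2) by (auto simp: fun_eq_iff diag[OF S(1)] diag5_def)
      then show ?thesis using False by blast
    next
      case True
      then have S12: "S$1$2 * S$2$1 = 1" using e by simp
      then have "S$1$2 \<noteq> 0" by auto
      then have "S$2$1 = 1 / S$1$2" "S$2$2 = 0" using e S12 by (simp_all add: eq_divide_eq mult.commute)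
      then have "F = diag5 (S$1$2) \<circ> swap5" unfolding S(2) using True by (auto simp: fun_eq_iff diag[OF S(1)] diag5_def swap5_def)
      then show ?thesis using \<open>S$1$2 \<noteq> 0\<close> by blast
    qed
  next
    fix F assume "F \<in> {diag5 s | s. s \<noteq> 0} \<union> {diag5 s \<circ> swap5 | s. s \<noteq> 0}"
    then obtain s where s: "s \<noteq> 0" "F = diag5 s \<or> F = diag5 s \<circ> swap5" by blast
    let ?S1 = "vector [vector [s, 0], vector [0, 1 / s]] :: real^2^2" and ?S2 = "vector [vector [0, s], vector [1 / s, 0]] :: real^2^2"
    have S: "?S1 \<in> O11" "?S2 \<in> O11" unfolding O11 using s(1) by simp_all
    have "O11_diag ?S1 = diag5 s" "O11_diag ?S2 = diag5 s \<circ> swap5"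
      by (auto simp: fun_eq_iff diag[OF S(1)] diag[OF S(2)] diag5_def swap5_def)
    then show "F \<in> O11_diag ` O11" using s(2) S by (metis image_eqI)
  qed
qed

lemma diag5_comp: "diag5 s (diag5 t w) = diag5 (s * t) w"
  and swap5_swap5: "swap5 (swap5 w) = w" and swap5_diag5: "swap5 (diag5 s w) = diag5 (1 / s) (swap5 w)"
  and diag5_1: "diag5 1 w = w" and Z2_Z2: "Z2_gen (Z2_gen w) = w"
  and Z2_diag5: "Z2_gen (diag5 s w) = diag5 s (Z2_gen w)" and Z2_swap5: "Z2_gen (swap5 w) = diag5 (-1) (swap5 (Z2_gen w))"
  by (auto simp: diag5_def swap5_def Z2_gen_eq prod_eq_iff vec2_eq)

lemma diag5_inverse: "s \<noteq> 0 \<Longrightarrow> diag5 s (diag5 (1 / s) w) = w" "s \<noteq> 0 \<Longrightarrow> diag5 (1 / s) (diag5 s w) = w"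
  by (simp_all add: diag5_comp diag5_1)

lemma linear5: "linear (diag5 s)" "linear swap5" "linear Z2_gen"
  by (rule linearI; simp add: diag5_def swap5_def Z2_gen_eq prod_eq_iff vec2_eq algebra_simps add_divide_distrib)+

lemma linear_isometries5:
  "s \<noteq> 0 \<Longrightarrow> diag5 s \<in> linear_isometries (form5 k)" "swap5 \<in> linear_isometries (form5 k)" "Z2_gen \<in> linear_isometries (form5 k)"
proof -
  have b: "s \<noteq> 0 \<Longrightarrow> bij (diag5 s)" "bij swap5" "bij Z2_gen"
    by (rule bij_betwI[where g="diag5 (1 / s)"] bij_betwI[where g=swap5] bij_betwI[where g=Z2_gen]; simp add: diag5_inverse swap5_swap5 Z2_Z2)+
  show "s \<noteq> 0 \<Longrightarrow> diag5 s \<in> linear_isometries (form5 k)" "swap5 \<in> linear_isometries (form5 k)" "Z2_gen \<in> linear_isometries (form5 k)"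
    unfolding linear_isometries_def using b linear5 by (simp_all add: form5_eq diag5_def swap5_def Z2_gen_eq)
qed

lemma M5_preserved: "s \<noteq> 0 \<Longrightarrow> m \<in> M5 \<Longrightarrow> diag5 s m \<in> M5" "m \<in> M5 \<Longrightarrow> swap5 m \<in> M5" "m \<in> M5 \<Longrightarrow> Z2_gen m \<in> M5" "m \<in> M5 \<Longrightarrow> trans5 k a m \<in> M5"
proof -
  have M: "w \<in> M5 \<longleftrightarrow> fst (snd w) = snd (snd w)$1 * snd (snd w)$2" for w by (cases w) (auto simp: M5_def)
  show "s \<noteq> 0 \<Longrightarrow> m \<in> M5 \<Longrightarrow> diag5 s m \<in> M5" "m \<in> M5 \<Longrightarrow> swap5 m \<in> M5" "m \<in> M5 \<Longrightarrow> Z2_gen m \<in> M5"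
    by (simp_all add: M diag5_def swap5_def Z2_gen_eq)
  show "m \<in> M5 \<Longrightarrow> trans5 k a m \<in> M5" unfolding M5_model_embed by (auto simp: trans5_model_embed)
qed

lemma trans5_affine: assumes k: "k * k = 1" shows "trans5 k a \<in> carrier (affine_isometry_group (form5 k))"
proof -
  define A where "A w = trans5 k a w - trans5 k a 0" for w
  have A: "A w = ((k * fst (snd w) - k/2 * (snd (snd a) \<bullet> snd (snd w))) *\<^sub>R snd (snd a) + fst (snd a) *\<^sub>R vec2 (- (snd (snd w) $ 2)) (snd (snd w) $ 1) + fst w,
      fst (snd w) - snd (snd a) \<bullet> snd (snd w), snd (snd w))" for w
    by (simp add: A_def trans5_def transvection5_eq prod_eq_iff vec2_eq)
  have kk: "k * (k * z) = z" for z using k by (simp add: mult.assoc[symmetric])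
  have "linear A" by (rule linearI) (simp_all add: A prod_eq_iff vec2_eq inner2 algebra_simps)
  moreover have "bij A"
    by (rule bij_betwI[where g="\<lambda>w. trans5 k (model_inv k a) (w + trans5 k a 0)"]) (auto simp: A_def trans5_inv)
  moreover have "form5 k (A u) (A v) = form5 k u v" for u v
    unfolding form5_eq A by (simp add: inner2 algebra_simps kk)
  ultimately have "A \<in> linear_isometries (form5 k)" by (simp add: linear_isometries_def)
  moreover have "trans5 k a = (\<lambda>w. A w + trans5 k a 0)" by (auto simp: A_def)
  ultimately show ?thesis using affine_isometryI by metis
qed

text \<open>These maps normalise the transvections, acting on the parameters. The sign of
  \<open>y\<close> changes exactly for the two maps with determinant \<open>-1\<close> on the
  coordinates \<open>q\<close>, because \<open>y\<close> parametrises a skew matrix.\<close>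

lemma trans5_conj:
  "s \<noteq> 0 \<Longrightarrow> diag5 s (trans5 k (Z, y, X) w) = trans5 k (vec2 (Z$1 / s) (s * Z$2), y, vec2 (X$1 / s) (s * X$2)) (diag5 s w)"
  "swap5 (trans5 k (Z, y, X) w) = trans5 k (vec2 (Z$2) (Z$1), - y, vec2 (X$2) (X$1)) (swap5 w)"
  "Z2_gen (trans5 k (Z, y, X) w) = trans5 k (vec2 (Z$1) (- Z$2), - y, vec2 (- X$1) (X$2)) (Z2_gen w)"
  by (simp_all add: trans5_def transvection5_eq diag5_def swap5_def Z2_gen_eq prod_eq_iff vec2_eq inner2)
     (simp_all add: field_simps)

text \<open>\<open>nz\<close> says that \<open>A\<close> does not exchange the two null axes.
  Preservation of \<open>M5\<close> becomes a polynomial identity for the \<open>q\<close>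
  coordinates, which forces \<open>A\<close> to scale them; the isometry condition then determines
  the \<open>p\<close> coordinates up to one parameter.\<close>

lemma linear_stabilizer_diag:
  assumes A: "linear A" and iso: "\<And>u v. form5 k (A u) (A v) = form5 k u v" and M: "\<And>m. m \<in> M5 \<Longrightarrow> A m \<in> M5"
    and n: "A (0, 1, 0) = (0, 1, 0)" and T: "\<And>p q. fst (snd (A (p, 0, q))) = 0"
    and nz: "snd (snd (A (0, 0, vec2 1 0)))$1 \<noteq> 0"
  shows "\<exists>s y. s \<noteq> 0 \<and> A = trans5 k (0, y, 0) \<circ> diag5 s"
proof -
  define a1 a2 b1 b2 where "a1 = A (vec2 1 0, 0, 0)" and "a2 = A (vec2 0 1, 0, 0)" and "b1 = A (0, 0, vec2 1 0)" and "b2 = A (0, 0, vec2 0 1)"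
  have lin: "A w = fst w$1 *\<^sub>R a1 + fst w$2 *\<^sub>R a2 + fst (snd w) *\<^sub>R (0, 1, 0) + snd (snd w)$1 *\<^sub>R b1 + snd (snd w)$2 *\<^sub>R b2" for w
  proof -
    have "w = fst w$1 *\<^sub>R (vec2 1 0, 0, 0) + fst w$2 *\<^sub>R (vec2 0 1, 0, 0) + fst (snd w) *\<^sub>R (0, 1, 0) + snd (snd w)$1 *\<^sub>R (0, 0, vec2 1 0) + snd (snd w)$2 *\<^sub>R (0, 0, vec2 0 1)"
      by (simp add: prod_eq_iff vec2_eq)
    then have "A w = A (fst w$1 *\<^sub>R (vec2 1 0, 0, 0) + fst w$2 *\<^sub>R (vec2 0 1, 0, 0) + fst (snd w) *\<^sub>R (0, 1, 0) + snd (snd w)$1 *\<^sub>R (0, 0, vec2 1 0) + snd (snd w)$2 *\<^sub>R (0, 0, vec2 0 1))" by simp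
    then show ?thesis unfolding linear_add[OF A] linear_cmul[OF A] n a1_def a2_def b1_def b2_def .
  qed
  have x0: "fst (snd a1) = 0" "fst (snd a2) = 0" "fst (snd b1) = 0" "fst (snd b2) = 0"
    using T[of "vec2 1 0" 0] T[of "vec2 0 1" 0] T[of 0 "vec2 1 0"] T[of 0 "vec2 0 1"] by (simp_all add: a1_def a2_def b1_def b2_def)
  \<comment> \<open>The equation of \<open>M5\<close> for the image of
    \<open>(p, q$1 * q$2, q)\<close>: by \<open>x0\<close> and \<open>n\<close> the middle
    coordinate is unchanged, and the two factors are the \<open>q\<close> coordinates of the
    image.\<close>
  have poly: "(p$1 * snd (snd a1)$1 + p$2 * snd (snd a2)$1 + q$1 * snd (snd b1)$1 + q$2 * snd (snd b2)$1) *
      (p$1 * snd (snd a1)$2 + p$2 * snd (snd a2)$2 + q$1 * snd (snd b1)$2 + q$2 * snd (snd b2)$2) = q$1 * q$2" for p q :: "real^2"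
  proof -
    have "A (p, q$1 * q$2, q) \<in> M5" by (rule M) (auto simp: M5_def)
    then have "fst (snd (A (p, q$1 * q$2, q))) = snd (snd (A (p, q$1 * q$2, q)))$1 * snd (snd (A (p, q$1 * q$2, q)))$2" by (auto simp: M5_def)
    from this[symmetric] show ?thesis unfolding lin by (simp add: x0)
  qed
  have nz': "snd (snd b1)$1 \<noteq> 0" using nz by (simp add: b1_def)
  define s where "s = snd (snd b1)$1"
  have s: "s \<noteq> 0" using nz' by (simp add: s_def)
  have b12: "snd (snd b1)$2 = 0" using poly[of "vec2 1 0" 0] poly[of "vec2 0 1" 0] poly[of 0 "vec2 1 0"] nz' by simp
  have b22: "s * snd (snd b2)$2 = 1" and b21: "snd (snd b2)$1 = 0"
  proof -
    have e: "snd (snd b2)$1 * snd (snd b2)$2 = 0" "(s + snd (snd b2)$1) * snd (snd b2)$2 = 1"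
      using poly[of 0 "vec2 0 1"] poly[of 0 "vec2 1 1"] b12 by (simp_all add: s_def)
    show "s * snd (snd b2)$2 = 1" using e by (auto simp: algebra_simps)
    then show "snd (snd b2)$1 = 0" using e(1) by auto
  qed
  have b22': "snd (snd b2)$2 = 1 / s" using b22 s by (simp add: field_simps)
  \<comment> \<open>The hypotheses are \<open>poly\<close> on a \<open>p\<close> axis vector alone
    and with each of the two \<open>q\<close> axis vectors added; their differences kill first one
    coordinate and then the other.\<close>
  have a_0: "snd (snd a)$1 = 0 \<and> snd (snd a)$2 = 0"
    if "snd (snd a)$1 * snd (snd a)$2 = 0" "(snd (snd a)$1 + s) * snd (snd a)$2 = 0" "snd (snd a)$1 * (snd (snd a)$2 + 1 / s) = 0" for a :: R5
    using that s by (auto simp: algebra_simps)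
  have a1q: "snd (snd a1)$1 = 0 \<and> snd (snd a1)$2 = 0"
    using poly[of "vec2 1 0" 0] poly[of "vec2 1 0" "vec2 1 0"] poly[of "vec2 1 0" "vec2 0 1"]
    by (intro a_0) (simp_all add: b12 b21 b22' s_def[symmetric])
  have a2q: "snd (snd a2)$1 = 0 \<and> snd (snd a2)$2 = 0"
    using poly[of "vec2 0 1" 0] poly[of "vec2 0 1" "vec2 1 0"] poly[of "vec2 0 1" "vec2 0 1"]
    by (intro a_0) (simp_all add: b12 b21 b22' s_def[symmetric])
  have i: "form5 k a1 b1 = -1" "form5 k a1 b2 = 0" "form5 k a2 b1 = 0" "form5 k a2 b2 = -1"
    "form5 k b1 b1 = 0" "form5 k b1 b2 = 0" "form5 k b2 b2 = 0"
    unfolding a1_def a2_def b1_def b2_def iso by (simp_all add: form5_eq)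
  note qs = b12 b21 b22' a1q[THEN conjunct1] a1q[THEN conjunct2] a2q[THEN conjunct1] a2q[THEN conjunct2] s_def[symmetric] x0
  \<comment> \<open>Orthogonality of \<open>b1\<close> and \<open>b2\<close> leaves
    \<open>fst b2$1\<close> free. It becomes the parameter \<open>y\<close> of a transvection fixing
    \<open>0\<close>.\<close>
  have p: "fst a1$1 = 1 / s" "fst a1$2 = 0" "fst a2$1 = 0" "fst a2$2 = s" "fst b1$1 = 0" "fst b2$2 = 0" "fst b1$2 = - (s * s * fst b2$1)"
    using i s unfolding form5_eq by (simp_all add: qs field_simps)
  have "A w = trans5 k (0, - (s * fst b2$1), 0) (diag5 s w)" for w
    unfolding lin trans5_def transvection5_eq diag5_def prod_eq_iff vec2_eq using s by (simp add: qs p)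
  then have "A = trans5 k (0, - (s * fst b2$1), 0) \<circ> diag5 s" by (auto simp: fun_eq_iff)
  then show ?thesis using s by blast
qed

section \<open>The group of extrinsic isometries\<close>

lemma extrinsic_isometryI:
  assumes "F \<in> carrier (affine_isometry_group \<beta>)" "\<And>m. m \<in> M \<Longrightarrow> F m \<in> M" "\<And>m. m \<in> M \<Longrightarrow> \<exists>m'\<in>M. F m' = m"
  shows "F \<in> carrier (extrinsic_isometry_group \<beta> M)"
proof -
  have "F ` M = M" using assms(2,3) by blast
  then show ?thesis using assms(1) by (simp add: extrinsic_isometry_group_def)
qed

lemma linear_affine: "A \<in> linear_isometries \<beta> \<Longrightarrow> A \<in> carrier (affine_isometry_group \<beta>)"
  using affine_isometryI[of A \<beta> 0] by simp

lemma diag5_E: "s \<noteq> 0 \<Longrightarrow> diag5 s \<in> carrier (extrinsic_isometry_group (form5 k) M5)"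
  by (rule extrinsic_isometryI[OF linear_affine[OF linear_isometries5(1)] M5_preserved(1)])
    (auto intro!: bexI[of _ "diag5 (1 / s) m" for m] M5_preserved(1) simp: diag5_inverse)

lemma swap5_E: "swap5 \<in> carrier (extrinsic_isometry_group (form5 k) M5)"
  by (rule extrinsic_isometryI[OF linear_affine[OF linear_isometries5(2)] M5_preserved(2)])
    (use M5_preserved(2) swap5_swap5 in blast)+

lemma Z2_E: "Z2_gen \<in> carrier (extrinsic_isometry_group (form5 k) M5)"
  by (rule extrinsic_isometryI[OF linear_affine[OF linear_isometries5(3)] M5_preserved(3)])
    (use M5_preserved(3) Z2_Z2 in blast)+

lemma trans5_E: "k * k = 1 \<Longrightarrow> trans5 k a \<in> carrier (extrinsic_isometry_group (form5 k) M5)"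
  by (rule extrinsic_isometryI[OF trans5_affine M5_preserved(4)])
    (use M5_preserved(4) trans5_inv in blast)+

lemma E_mult:
  assumes "F \<in> carrier (extrinsic_isometry_group \<beta> M)" "F' \<in> carrier (extrinsic_isometry_group \<beta> M)"
  shows "F \<otimes>\<^bsub>extrinsic_isometry_group \<beta> M\<^esub> F' = F \<circ> F'"
proof -
  have "bij F" "bij F'" using assms subgroup.subset[OF subgroup_extrinsic] by (auto simp: BijGroup_UNIV)
  then show ?thesis by (simp add: extrinsic_isometry_group_def BijGroup_UNIV_mult)
qed

lemma E_group: "group (extrinsic_isometry_group \<beta> M)"
  using subgroup.subgroup_is_group[OF subgroup_extrinsic group_BijGroup, of \<beta> M] by (simp add: extrinsic_isometry_group_def)

lemma E_one: "\<one>\<^bsub>extrinsic_isometry_group \<beta> M\<^esub> = (\<lambda>x. x)"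
  by (simp add: extrinsic_isometry_group_def BijGroup_UNIV)

lemma E_comp:
  assumes "F \<in> carrier (extrinsic_isometry_group \<beta> M)" "F' \<in> carrier (extrinsic_isometry_group \<beta> M)"
  shows "F \<circ> F' \<in> carrier (extrinsic_isometry_group \<beta> M)"
  using group.is_monoid[OF E_group] assms E_mult[OF assms] monoid.m_closed by metis

lemma E_inv:
  assumes "F \<in> carrier (extrinsic_isometry_group \<beta> M)" "F' \<in> carrier (extrinsic_isometry_group \<beta> M)" "F' \<circ> F = (\<lambda>x. x)"
  shows "inv\<^bsub>extrinsic_isometry_group \<beta> M\<^esub> F = F'"
  by (rule group.inv_equality[OF E_group _ assms(1,2)]) (simp add: E_mult assms E_one)

text \<open>The tangent space at \<open>0\<close> is the hyperplane where the middle coordinate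
  vanishes, and it is spanned by lines contained in \<open>M5\<close>. On the image of such a line
  the middle coordinate is linear in \<open>t\<close>, whereas the equation of \<open>M5\<close>
  makes it quadratic, so it vanishes.\<close>

lemma linear_tangent_preserved:
  assumes A: "linear A" and M: "\<And>m. m \<in> M5 \<Longrightarrow> A m \<in> M5"
  shows "fst (snd (A (p, 0, q))) = 0"
proof -
  have M5: "w \<in> M5 \<longleftrightarrow> fst (snd w) = snd (snd w)$1 * snd (snd w)$2" for w by (cases w) (auto simp: M5_def)
  have 0: "fst (snd (A (p, 0, q))) = 0" if "q$1 * q$2 = 0" for p q
  proof -
    have "fst (snd (A (t *\<^sub>R (p, 0, q)))) = snd (snd (A (t *\<^sub>R (p, 0, q))))$1 * snd (snd (A (t *\<^sub>R (p, 0, q))))$2" for t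
    proof -
      have "t *\<^sub>R (p, 0, q) \<in> M5" unfolding M5 using that by auto
      from M[OF this] show ?thesis unfolding M5 .
    qed
    then have e: "t * fst (snd (A (p, 0, q))) = (t * t) * (snd (snd (A (p, 0, q)))$1 * snd (snd (A (p, 0, q)))$2)" for t
      unfolding linear_cmul[OF A] by (simp add: algebra_simps)
    show ?thesis using e[of 1] e[of 2] by simp
  qed
  have "(p, 0::real, q) = (p, 0, vec2 (q$1) 0) + (0, 0, vec2 0 (q$2))" by (simp add: vec2_eq)
  then have "A (p, 0, q) = A (p, 0, vec2 (q$1) 0) + A (0, 0, vec2 0 (q$2))"
    using linear_add[OF A, of "(p, 0, vec2 (q$1) 0)" "(0, 0, vec2 0 (q$2))"] by (simp only:)
  moreover have "fst (snd (A (p, 0, vec2 (q$1) 0))) = 0" "fst (snd (A (0, 0, vec2 0 (q$2)))) = 0" by (rule 0, simp)+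
  ultimately show ?thesis by simp
qed

text \<open>A linear isometry preserving \<open>M\<close> preserves the tangent space at \<open>0\<close> and hence, up to sign, the
  normal vector.\<close>

lemma linear_normal_preserved:
  assumes k: "k * k = 1" and A: "A \<in> linear_isometries (form5 k)" and M: "A ` M5 = M5"
  shows "A (0, 1, 0) = (0, 1, 0) \<or> A (0, 1, 0) = (0, -1, 0)"
proof -
  define n where "n = A (0, 1, 0)"
  have A': "linear A" "bij A" "\<And>u v. form5 k (A u) (A v) = form5 k u v" using A by (auto simp: linear_isometries_def)
  define B where "B = inv_into UNIV A"
  have B: "linear B" using linear_isometries_inverse[OF A] by (simp add: linear_isometries_def B_def)
  have AB: "A (B x) = x" for x using A'(2) by (simp add: B_def bij_is_surj surj_f_inv_f)
  have "B m \<in> M5" if "m \<in> M5" for m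
  proof -
    have "m \<in> A ` M5" using that unfolding M .
    then obtain m' where "m' \<in> M5" "m = A m'" by (elim imageE)
    then show ?thesis by (simp add: B_def bij_is_inj[OF A'(2)])
  qed
  then have Bx: "fst (snd (B (p, 0, q))) = 0" for p q using linear_tangent_preserved[OF B] by blast
  have "form5 k n (p, 0, q) = 0" for p q
  proof -
    have "form5 k n (p, 0, q) = form5 k (0, 1, 0) (B (p, 0, q))" unfolding n_def A'(3)[symmetric, of "(0, 1, 0)"] AB ..
    then show ?thesis using Bx by (simp add: form5_eq)
  qed
  from this[of "vec2 1 0" 0] this[of "vec2 0 1" 0] this[of 0 "vec2 1 0"] this[of 0 "vec2 0 1"]
  have "n = (0, fst (snd n), 0)" by (simp add: form5_eq prod_eq_iff vec2_eq)
  then obtain c where n: "n = (0, c, 0)" by blast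
  \<comment> \<open>The normal vector keeps its square \<open>- k\<close>, which is not zero, so the
    factor \<open>c\<close> is a sign.\<close>
  have "form5 k n n = - k" unfolding n_def A'(3) by (simp add: form5_eq)
  then have "k * (c * c) = k * 1" unfolding n by (simp add: form5_eq mult.assoc)
  then have "c * c = 1" using k by (metis mult_cancel_left mult_zero_left zero_neq_one)
  then have "c = 1 \<or> c = -1" by (simp add: square_eq_1_iff)
  then show ?thesis using n unfolding n_def by blast
qed

text \<open>The four cases record whether \<open>A\<close> exchanges the null axes and whether it
  reverses the normal vector. Composing with \<open>swap5\<close> or \<open>Z2_gen\<close> reduces
  each of them to \<open>linear_stabilizer_diag\<close>.\<close>

lemma E_fixing_0:
  assumes k: "k * k = 1" and A: "A \<in> linear_isometries (form5 k)" and M: "A ` M5 = M5"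
  shows "\<exists>y s. s \<noteq> 0 \<and> (A = trans5 k (0, y, 0) \<circ> diag5 s \<or> A = trans5 k (0, y, 0) \<circ> (diag5 s \<circ> swap5) \<or>
     A = trans5 k (0, y, 0) \<circ> (diag5 s \<circ> Z2_gen) \<or> A = trans5 k (0, y, 0) \<circ> ((diag5 s \<circ> swap5) \<circ> Z2_gen))"
proof -
  have *: "\<exists>y s. s \<noteq> 0 \<and> (A = trans5 k (0, y, 0) \<circ> diag5 s \<or> A = trans5 k (0, y, 0) \<circ> (diag5 s \<circ> swap5))"
    if A: "A \<in> linear_isometries (form5 k)" and M: "A ` M5 = M5" and n: "A (0, 1, 0) = (0, 1, 0)" for A
  proof -
    have A': "linear A" "\<And>u v. form5 k (A u) (A v) = form5 k u v" using A by (auto simp: linear_isometries_def)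
    have MA: "A m \<in> M5" if "m \<in> M5" for m using M that by blast
    show ?thesis
    proof (cases "snd (snd (A (0, 0, vec2 1 0)))$1 = 0")
      case False
      then show ?thesis using linear_stabilizer_diag[OF A'(1,2) MA n linear_tangent_preserved[OF A'(1) MA]] by blast
    next
      case True
      \<comment> \<open>Otherwise the image of the point \<open>(0, 1, vec2 1 1)\<close> of
        \<open>M5\<close> would have middle coordinate \<open>1\<close> and first \<open>q\<close>
        coordinate \<open>0\<close>, contradicting the equation of \<open>M5\<close>.\<close>
      have b2: "snd (snd (A (0, 0, vec2 0 1)))$1 \<noteq> 0"
      proof
        assume 0: "snd (snd (A (0, 0, vec2 0 1)))$1 = 0"
        have "A (0, 1, vec2 1 1) = A (0, 1, 0) + A (0, 0, vec2 1 0) + A (0, 0, vec2 0 1)"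
          unfolding linear_add[OF A'(1), symmetric] by (rule arg_cong[where f=A]) (simp add: vec2_eq)
        moreover have "A (0, 1, vec2 1 1) \<in> M5" by (rule MA) (auto simp: M5_def intro!: exI[of _ "vec2 1 1"])
        then have "fst (snd (A (0, 1, vec2 1 1))) = snd (snd (A (0, 1, vec2 1 1)))$1 * snd (snd (A (0, 1, vec2 1 1)))$2" by (auto simp: M5_def)
        ultimately show False
          using True 0 n linear_tangent_preserved[OF A'(1) MA, of 0 "vec2 1 0"] linear_tangent_preserved[OF A'(1) MA, of 0 "vec2 0 1"] by simp
      qed
      define C where "C = A \<circ> swap5"
      have C: "C \<in> linear_isometries (form5 k)" unfolding C_def by (rule linear_isometries_compose[OF A linear_isometries5(2)])
      have C': "linear C" "\<And>u v. form5 k (C u) (C v) = form5 k u v" using C by (auto simp: linear_isometries_def)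
      have MC: "C m \<in> M5" if "m \<in> M5" for m using MA M5_preserved(2) that by (simp add: C_def)
      have z: "vec2 0 0 = 0" by (simp add: vec2_eq)
      have "C (0, 1, 0) = (0, 1, 0)" "snd (snd (C (0, 0, vec2 1 0)))$1 \<noteq> 0" using n b2 by (simp_all add: C_def swap5_def z)
      from linear_stabilizer_diag[OF C'(1,2) MC this(1) linear_tangent_preserved[OF C'(1) MC] this(2)]
      obtain s y where s: "s \<noteq> 0" "C = trans5 k (0, y, 0) \<circ> diag5 s" by blast
      have "A w = C (swap5 w)" for w by (simp add: C_def swap5_swap5)
      then have "A = trans5 k (0, y, 0) \<circ> (diag5 s \<circ> swap5)" unfolding s(2) by (auto simp: fun_eq_iff)
      then show ?thesis using s(1) by blast
    qed
  qed
  from linear_normal_preserved[OF k A M] show ?thesis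
  proof
    assume "A (0, 1, 0) = (0, 1, 0)"
    from *[OF A M this] show ?thesis by blast
  next
    assume n: "A (0, 1, 0) = (0, -1, 0)"
    have lin: "linear A" using A by (simp add: linear_isometries_def)
    have Z2M: "Z2_gen ` M5 = M5"
    proof (intro equalityI subsetI)
      fix m assume "m \<in> M5"
      then show "m \<in> Z2_gen ` M5" by (intro image_eqI[where x = "Z2_gen m"] M5_preserved(3)) (simp_all add: Z2_Z2)
    qed (use M5_preserved(3) in blast)
    have z: "vec2 0 0 = 0" by (simp add: vec2_eq)
    have "(A \<circ> Z2_gen) (0, 1, 0) = (0, 1, 0)" using linear_neg[OF lin, of "(0, 1, 0)"] n by (simp add: Z2_gen_eq z)
    moreover have "(A \<circ> Z2_gen) ` M5 = M5" unfolding image_comp[symmetric] Z2M M ..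
    ultimately obtain y s where s: "s \<noteq> 0" "A \<circ> Z2_gen = trans5 k (0, y, 0) \<circ> diag5 s \<or> A \<circ> Z2_gen = trans5 k (0, y, 0) \<circ> (diag5 s \<circ> swap5)"
      using *[OF linear_isometries_compose[OF A linear_isometries5(3)]] by blast
    have A2: "A = (A \<circ> Z2_gen) \<circ> Z2_gen" by (auto simp: fun_eq_iff Z2_Z2)
    from s(2) have "A = trans5 k (0, y, 0) \<circ> (diag5 s \<circ> Z2_gen) \<or> A = trans5 k (0, y, 0) \<circ> ((diag5 s \<circ> swap5) \<circ> Z2_gen)"
    proof
      assume "A \<circ> Z2_gen = trans5 k (0, y, 0) \<circ> diag5 s"
      from trans[OF A2[unfolded this] comp_assoc] show ?thesis ..
    next
      assume "A \<circ> Z2_gen = trans5 k (0, y, 0) \<circ> (diag5 s \<circ> swap5)"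
      from trans[OF A2[unfolded this] comp_assoc] show ?thesis ..
    qed
    then show ?thesis using s(1) by blast
  qed
qed

locale extrinsic_group =
  fixes k :: real and E :: "(R5 \<Rightarrow> R5) monoid" (structure) and K Z A
  assumes k: "k * k = 1"
  defines "E \<equiv> extrinsic_isometry_group (form5 k) M5" and "K \<equiv> O11_diag ` O11" and "Z \<equiv> generate E {Z2_gen}" and "A \<equiv> range (trans5 k)"
begin

sublocale group E unfolding E_def by (rule E_group)

lemma K: "K = {diag5 s | s. s \<noteq> 0} \<union> {diag5 s \<circ> swap5 | s. s \<noteq> 0}"
  unfolding K_def by (rule O11_diag_image)

lemma K_diag: "s \<noteq> 0 \<Longrightarrow> diag5 s \<in> K" and K_swap: "s \<noteq> 0 \<Longrightarrow> diag5 s \<circ> swap5 \<in> K"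
  unfolding K by blast+

lemma mult: "F \<in> carrier E \<Longrightarrow> F' \<in> carrier E \<Longrightarrow> F \<otimes> F' = F \<circ> F'"
  unfolding E_def by (rule E_mult)

lemma KE: "K \<subseteq> carrier E"
  unfolding K E_def using diag5_E E_comp[OF diag5_E swap5_E] by blast

lemma Z2E: "Z2_gen \<in> carrier E" unfolding E_def by (rule Z2_E)

lemma AE: "A \<subseteq> carrier E" unfolding A_def E_def using trans5_E[OF k] by blast

lemma one: "\<one> = (\<lambda>x. x)" unfolding E_def by (rule E_one)

lemma Z: "Z = {\<one>, Z2_gen}"
proof
  have "Z2_gen \<otimes> Z2_gen = \<one>" unfolding mult[OF Z2E Z2E] one by (auto simp: Z2_Z2)
  then have i: "Z2_gen \<otimes> Z2_gen = \<one>" "inv Z2_gen = Z2_gen" using Z2E inv_equality by auto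
  have "subgroup {\<one>, Z2_gen} E" by (rule subgroupI) (use Z2E i in auto)
  then show "Z \<subseteq> {\<one>, Z2_gen}" unfolding Z_def by (rule generate_subgroup_incl[rotated]) simp
  show "{\<one>, Z2_gen} \<subseteq> Z" unfolding Z_def by (auto intro: generate.one generate.incl)
qed

lemma subgroup_Z: "subgroup Z E" unfolding Z_def by (rule generate_is_subgroup) (use Z2E in simp)

lemma Z2_ne: "Z2_gen \<noteq> \<one>"
proof
  assume "Z2_gen = \<one>"
  then have "Z2_gen (0, 1, 0) = (0, 1, 0)" unfolding one by (rule fun_cong)
  then show False by (simp add: Z2_gen_eq)
qed

lemma card_Z: "card Z = 2" unfolding Z using Z2_ne by (simp add: eq_commute)

lemma K_cases: assumes "F \<in> K" obtains s where "s \<noteq> 0" "F = diag5 s" | s where "s \<noteq> 0" "F = diag5 s \<circ> swap5"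
  using assms unfolding K by (elim UnE CollectE exE conjE) (rule that; assumption)+

lemma subgroup_K: "subgroup K E"
proof (rule subgroupI[OF KE])
  have "diag5 1 \<in> K" unfolding K by (intro UnI1 CollectI exI[of _ 1]) simp
  then show "K \<noteq> {}" by blast
  show "inv F \<in> K" if F: "F \<in> K" for F
    using F
  proof (cases rule: K_cases)
    case (1 s)
    have "inv F = diag5 (1 / s)" unfolding E_def
      by (rule E_inv) (use 1 in \<open>auto simp: diag5_E diag5_inverse\<close>)
    then show ?thesis using 1(1) K_diag by simp
  next
    case (2 s)
    have "inv F = diag5 s \<circ> swap5" unfolding E_def
    proof (rule E_inv)
      show "diag5 s \<circ> swap5 \<in> carrier (extrinsic_isometry_group (form5 k) M5)" "F \<in> carrier (extrinsic_isometry_group (form5 k) M5)"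
        using E_comp[OF diag5_E[OF 2(1)] swap5_E] 2(2) by simp_all
      show "(diag5 s \<circ> swap5) \<circ> F = (\<lambda>x. x)"
        using 2 by (simp add: fun_eq_iff swap5_diag5 diag5_inverse swap5_swap5)
    qed
    then show ?thesis using K_swap[OF 2(1)] by (simp only:)
  qed
  show "F \<otimes> F' \<in> K" if F: "F \<in> K" "F' \<in> K" for F F'
  proof -
    have m: "F \<otimes> F' = F \<circ> F'" using F KE mult by blast
    show ?thesis unfolding m
    proof (rule K_cases[OF F(1)]; rule K_cases[OF F(2)])
      fix s t assume st: "s \<noteq> (0::real)" "F = diag5 s" "t \<noteq> (0::real)" "F' = diag5 t"
      then have "F \<circ> F' = diag5 (s * t)" unfolding st(2,4) by (auto simp: fun_eq_iff diag5_comp)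
      then show "F \<circ> F' \<in> K" using K_diag[of "s * t"] st by simp
    next
      fix s t assume st: "s \<noteq> (0::real)" "F = diag5 s" "t \<noteq> (0::real)" "F' = diag5 t \<circ> swap5"
      then have "F \<circ> F' = diag5 (s * t) \<circ> swap5" unfolding st(2,4) by (auto simp: fun_eq_iff diag5_comp)
      then show "F \<circ> F' \<in> K" using K_swap[of "s * t"] st by simp
    next
      fix s t assume st: "s \<noteq> (0::real)" "F = diag5 s \<circ> swap5" "t \<noteq> (0::real)" "F' = diag5 t"
      then have "F \<circ> F' = diag5 (s * (1 / t)) \<circ> swap5" unfolding st(2,4) by (auto simp: fun_eq_iff diag5_comp swap5_diag5)
      then show "F \<circ> F' \<in> K" using K_swap[of "s * (1 / t)"] st by simp
    next
      fix s t assume st: "s \<noteq> (0::real)" "F = diag5 s \<circ> swap5" "t \<noteq> (0::real)" "F' = diag5 t \<circ> swap5"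
      then have "F \<circ> F' = diag5 (s * (1 / t))" unfolding st(2,4) by (auto simp: fun_eq_iff diag5_comp swap5_diag5 swap5_swap5)
      then show "F \<circ> F' \<in> K" using K_diag[of "s * (1 / t)"] st by simp
    qed
  qed
qed

lemma subgroup_A: "subgroup A E"
proof -
  have "subgroup A (BijGroup UNIV)" unfolding A_def by (rule extrinsic_transvections(2)[OF k])
  moreover have "A \<subseteq> carrier (extrinsic_isometry_group (form5 k) M5)" using AE E_def by simp
  ultimately have "subgroup A (BijGroup UNIV\<lparr>carrier := carrier (extrinsic_isometry_group (form5 k) M5)\<rparr>)"
    by (intro group.subgroup_incl[OF group_BijGroup _ subgroup_extrinsic])
  then show ?thesis unfolding E_def extrinsic_isometry_group_def by simp
qed

lemma conj_K: assumes "z \<in> Z" "F \<in> K" shows "\<exists>F'\<in>K. z \<otimes> F = F' \<otimes> z"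
proof -
  have "z = \<one> \<or> z = Z2_gen" using assms(1) Z by blast
  then show ?thesis
  proof
    assume z: "z = \<one>"
    have "F \<in> carrier E" using assms(2) KE by blast
    then show ?thesis using assms(2) by (intro bexI[of _ F]) (simp_all add: z)
  next
    assume z: "z = Z2_gen"
    show ?thesis using assms(2)
    proof (cases rule: K_cases)
      case (1 s)
      have "Z2_gen \<circ> F = F \<circ> Z2_gen" by (auto simp: fun_eq_iff 1 Z2_diag5)
      then show ?thesis using assms(2) KE Z2E unfolding z by (intro bexI[of _ F]) (simp_all add: mult subsetD)
    next
      case (2 s)
      \<comment> \<open>Moving \<open>Z2_gen\<close> past \<open>swap5\<close> costs a factor
        \<open>diag5 (-1)\<close>, which stays in \<open>K\<close>: \<open>K\<close> is normalised
        by \<open>Z2_gen\<close> without being centralised.\<close>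
      have "Z2_gen \<circ> F = (diag5 (s * -1) \<circ> swap5) \<circ> Z2_gen" by (auto simp: fun_eq_iff 2 Z2_diag5 Z2_swap5 diag5_comp)
      moreover have K': "diag5 (s * -1) \<circ> swap5 \<in> K" using K_swap[of "s * -1"] 2 by simp
      ultimately show ?thesis using assms(2) KE Z2E unfolding z by (intro bexI[of _ "diag5 (s * -1) \<circ> swap5"]) (simp_all add: mult subsetD)
    qed
  qed
qed

lemma subgroup_KZ: "subgroup (K <#> Z) E"
  by (rule subgroup_set_mult_conj[OF subgroup_K subgroup_Z conj_K])

lemma conj_diag: "s \<noteq> 0 \<Longrightarrow> a \<in> A \<Longrightarrow> \<exists>b\<in>A. diag5 s \<circ> a = b \<circ> diag5 s"
  and conj_swap: "a \<in> A \<Longrightarrow> \<exists>b\<in>A. swap5 \<circ> a = b \<circ> swap5"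
  and conj_Z2: "a \<in> A \<Longrightarrow> \<exists>b\<in>A. Z2_gen \<circ> a = b \<circ> Z2_gen"
proof -
  have a: "\<exists>Z y X. a = trans5 k (Z, y, X)" if "a \<in> A" for a using that unfolding A_def by (metis prod.collapse rangeE)
  show "\<exists>b\<in>A. diag5 s \<circ> a = b \<circ> diag5 s" if s: "s \<noteq> 0" and aA: "a \<in> A"
  proof -
    obtain Z y X where e: "a = trans5 k (Z, y, X)" using a[OF aA] by blast
    have "diag5 s \<circ> a = trans5 k (vec2 (Z$1 / s) (s * Z$2), y, vec2 (X$1 / s) (s * X$2)) \<circ> diag5 s"
      unfolding e by (rule ext) (simp only: comp_apply trans5_conj(1)[OF s])
    then show ?thesis unfolding A_def by blast
  qed
  show "\<exists>b\<in>A. swap5 \<circ> a = b \<circ> swap5" if aA: "a \<in> A"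
  proof -
    obtain Z y X where e: "a = trans5 k (Z, y, X)" using a[OF aA] by blast
    have "swap5 \<circ> a = trans5 k (vec2 (Z$2) (Z$1), - y, vec2 (X$2) (X$1)) \<circ> swap5"
      unfolding e by (rule ext) (simp only: comp_apply trans5_conj(2))
    then show ?thesis unfolding A_def by blast
  qed
  show "\<exists>b\<in>A. Z2_gen \<circ> a = b \<circ> Z2_gen" if aA: "a \<in> A"
  proof -
    obtain Z y X where e: "a = trans5 k (Z, y, X)" using a[OF aA] by blast
    have "Z2_gen \<circ> a = trans5 k (vec2 (Z$1) (- Z$2), - y, vec2 (- X$1) (X$2)) \<circ> Z2_gen"
      unfolding e by (rule ext) (simp only: comp_apply trans5_conj(3))
    then show ?thesis unfolding A_def by blast
  qed
qed

lemma conj_A: assumes "q \<in> K <#> Z" "a \<in> A" shows "\<exists>b\<in>A. q \<otimes> a = b \<otimes> q"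
proof -
  obtain F z where Fz: "F \<in> K" "z \<in> Z" "q = F \<otimes> z" using assms(1) unfolding set_mult_def by blast
  have cl: "F \<in> carrier E" "z \<in> carrier E" using Fz KE subgroup.subset[OF subgroup_Z] by blast+
  have z: "\<exists>b\<in>A. z \<circ> a = b \<circ> z" if "a \<in> A" for a
    using Fz(2) conj_Z2[OF that] that unfolding Z one by (auto simp: comp_def)
  have F: "\<exists>b\<in>A. F \<circ> a = b \<circ> F" if aA: "a \<in> A" for a
    using Fz(1)
  proof (cases rule: K_cases)
    case (1 s) then show ?thesis using conj_diag aA by blast
  next
    case (2 s)
    obtain b where b: "b \<in> A" "swap5 \<circ> a = b \<circ> swap5" using conj_swap[OF aA] by blast
    obtain c where c: "c \<in> A" "diag5 s \<circ> b = c \<circ> diag5 s" using conj_diag[OF 2(1) b(1)] by blast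
    have "F \<circ> a = c \<circ> F" unfolding 2(2) by (metis b(2) c(2) comp_assoc)
    then show ?thesis using c(1) by blast
  qed
  obtain b where b: "b \<in> A" "z \<circ> a = b \<circ> z" using z[OF assms(2)] by blast
  obtain c where c: "c \<in> A" "F \<circ> b = c \<circ> F" using F[OF b(1)] by blast
  have "(F \<circ> z) \<circ> a = c \<circ> (F \<circ> z)" by (metis b(2) c(2) comp_assoc)
  moreover have "a \<in> carrier E" "c \<in> carrier E" using AE assms(2) c(1) by blast+
  ultimately have "q \<otimes> a = c \<otimes> q" using cl by (simp add: Fz(3) mult[symmetric])
  then show ?thesis using c(1) by blast
qed

text \<open>Elements of \<open>K <#> Z\<close> fix \<open>0\<close> and preserve the plane
  \<open>p = 0\<close>, \<open>x = 0\<close>. A transvection fixing \<open>0\<close> has vanishing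
  \<open>X\<close> and \<open>Z\<close>, and then moves \<open>(0, 0, vec2 1 0)\<close> out of this
  plane unless \<open>y = 0\<close>.\<close>

lemma A_Q: "A \<inter> (K <#> Z) \<subseteq> {\<one>}"
proof
  fix F assume F: "F \<in> A \<inter> (K <#> Z)"
  have Kp: "fst (F (0, 0, q)) = 0 \<and> fst (snd (F (0, 0, q))) = 0 \<and> F 0 = 0" if "F \<in> K" for F q
    using that by (cases rule: K_cases) (auto simp: diag5_def swap5_def vec2_eq prod_eq_iff)
  have Zp: "\<exists>q'. z (0, 0, q) = (0, 0, q')" "z 0 = 0" if "z \<in> Z" for z q
    using that unfolding Z one by (auto simp: Z2_gen_eq vec2_eq prod_eq_iff)
  obtain G z where Gz: "G \<in> K" "z \<in> Z" "F = G \<otimes> z" using F unfolding set_mult_def by blast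
  have "F = G \<circ> z" using Gz KE subgroup.subset[OF subgroup_Z] mult by blast
  then have 1: "F 0 = 0" "fst (F (0, 0, q)) = 0" for q using Kp[OF Gz(1)] Zp[OF Gz(2)] by (auto, metis)
  obtain a where a: "F = trans5 k a" using F unfolding A_def by blast
  have "fst a = 0" "snd (snd a) = 0" using 1(1) by (auto simp: a trans5_def transvection5_eq prod_eq_iff vec2_eq)
  moreover have "fst (snd a) = 0" using 1(2)[of "vec2 1 0"] calculation by (auto simp: a trans5_def transvection5_eq prod_eq_iff vec2_eq)
  ultimately have "a = 0" by (simp add: prod_eq_iff)
  then show "F \<in> {\<one>}" by (auto simp: a one trans5_0)
qed

lemma K_Z: "K \<inter> Z \<subseteq> {\<one>}"
proof -
  have "fst (snd (F (0, 1, 0))) = 1" if "F \<in> K" for F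
    using that by (cases rule: K_cases) (auto simp: diag5_def swap5_def)
  then have "Z2_gen \<notin> K" by (force simp: Z2_gen_eq)
  then show ?thesis unfolding Z by blast
qed

text \<open>The stabiliser of \<open>0\<close> still contains the transvections with parameters
  \<open>(0, y, 0)\<close>. They are merged with the transvection that moves \<open>0\<close> to
  \<open>F 0\<close>, leaving a factor in \<open>K <#> Z\<close>.\<close>

lemma E_decompose: "carrier E \<subseteq> A <#> (K <#> Z)"
proof
  fix F assume F: "F \<in> carrier E"
  then have "F ` M5 = M5" by (simp add: E_def extrinsic_isometry_group_def)
  moreover have "(0::R5) \<in> M5" by (auto simp: M5_def zero_prod_def intro!: exI[of _ 0])
  ultimately have "F 0 \<in> M5" by blast
  then obtain x where x: "F 0 = model_embed x" using M5_model_embed by blast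
  define a where "a = (fst x, 0 :: real, snd x)"
  have a0: "trans5 k a 0 = F 0" by (simp add: x a_def trans5_def transvection5_eq model_embed_def prod_eq_iff vec2_eq)
  define B where "B = trans5 k (model_inv k a) \<circ> F"
  have BE: "B \<in> carrier (extrinsic_isometry_group (form5 k) M5)"
    unfolding B_def using E_comp[OF trans5_E[OF k]] F unfolding E_def by blast
  have B0: "B 0 = 0" unfolding B_def using a0 trans5_inv(2) by (metis comp_apply)
  obtain C b where C: "B = (\<lambda>w. C w + b)" "C \<in> linear_isometries (form5 k)"
    using BE unfolding extrinsic_isometry_group_def affine_isometry_group_def by auto
  have "C 0 = 0" using C(2) linear_0 by (auto simp: linear_isometries_def)
  then have "B = C" using B0 C(1) by auto
  then have "B \<in> linear_isometries (form5 k)" "B ` M5 = M5" using C(2) BE by (auto simp: extrinsic_isometry_group_def)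
  from E_fixing_0[OF k this] obtain y s where s: "s \<noteq> 0" and
    B: "B = trans5 k (0, y, 0) \<circ> diag5 s \<or> B = trans5 k (0, y, 0) \<circ> (diag5 s \<circ> swap5) \<or>
     B = trans5 k (0, y, 0) \<circ> (diag5 s \<circ> Z2_gen) \<or> B = trans5 k (0, y, 0) \<circ> ((diag5 s \<circ> swap5) \<circ> Z2_gen)" by blast
  have KZ: "G \<in> K <#> Z" "G \<circ> Z2_gen \<in> K <#> Z" if "G \<in> K" for G
  proof -
    have G: "G \<in> carrier E" using that KE by blast
    then have "G = G \<otimes> \<one>" "G \<circ> Z2_gen = G \<otimes> Z2_gen" using mult[OF G Z2E] by simp_all
    then show "G \<in> K <#> Z" "G \<circ> Z2_gen \<in> K <#> Z" using that unfolding set_mult_def Z by blast+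
  qed
  obtain q where q: "q \<in> K <#> Z" "B = trans5 k (0, y, 0) \<circ> q"
    using B KZ K_diag[OF s] K_swap[OF s] by metis
  have "F = trans5 k a \<circ> B" by (auto simp: fun_eq_iff B_def trans5_inv)
  then have "F = trans5 k (model_mult k a (0, y, 0)) \<circ> q" by (auto simp: fun_eq_iff q(2) trans5_comp)
  moreover have "q \<in> carrier E" using q(1) subgroup.subset[OF subgroup_KZ] by blast
  moreover have tA: "trans5 k (model_mult k a (0, y, 0)) \<in> A" unfolding A_def by blast
  ultimately have "F = trans5 k (model_mult k a (0, y, 0)) \<otimes> q" using mult[OF subsetD[OF AE tA]] by simp
  then show "F \<in> A <#> (K <#> Z)" unfolding set_mult_def[of E A] using q(1) tA by blast
qed

lemma semidirect: "internal_semidirect E A (K <#> Z)"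
  by (rule internal_semidirectI[OF is_group subgroup_A subgroup_KZ conj_A A_Q E_decompose])

lemma semidirect_KZ: "internal_semidirect (E\<lparr>carrier := K <#> Z\<rparr>) K Z"
proof (rule internal_semidirectI)
  have KZ: "K \<subseteq> K <#> Z" "Z \<subseteq> K <#> Z"
  proof -
    have "F = F \<otimes> \<one>" if "F \<in> K" for F using subsetD[OF KE that] by simp
    then show "K \<subseteq> K <#> Z" using subgroup.one_closed[OF subgroup_Z] by (intro subsetI) (metis (no_types, lifting) UN_I insertI1 set_mult_def)
    have "F = \<one> \<otimes> F" if "F \<in> Z" for F using that subgroup.mem_carrier[OF subgroup_Z] by simp
    then show "Z \<subseteq> K <#> Z" using subgroup.one_closed[OF subgroup_K] by (intro subsetI) (metis (no_types, lifting) UN_I insertI1 set_mult_def)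
  qed
  show "group (E\<lparr>carrier := K <#> Z\<rparr>)" by (rule subgroup.subgroup_is_group[OF subgroup_KZ is_group])
  show "subgroup K (E\<lparr>carrier := K <#> Z\<rparr>)" by (rule subgroup_incl[OF subgroup_K subgroup_KZ KZ(1)])
  show "subgroup Z (E\<lparr>carrier := K <#> Z\<rparr>)" by (rule subgroup_incl[OF subgroup_Z subgroup_KZ KZ(2)])
  show "\<exists>b\<in>K. q \<otimes>\<^bsub>E\<lparr>carrier := K <#> Z\<rparr>\<^esub> a = b \<otimes>\<^bsub>E\<lparr>carrier := K <#> Z\<rparr>\<^esub> q" if "q \<in> Z" "a \<in> K" for q a
    using conj_K[OF that] by simp
  show "K \<inter> Z \<subseteq> {\<one>\<^bsub>E\<lparr>carrier := K <#> Z\<rparr>\<^esub>}" using K_Z by simp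
  show "carrier (E\<lparr>carrier := K <#> Z\<rparr>) \<subseteq> K <#>\<^bsub>E\<lparr>carrier := K <#> Z\<rparr>\<^esub> Z" by (simp add: set_mult_def)
qed

end

section \<open>Orientation\<close>

lemma exhaust_5: fixes x :: 5 shows "x = 1 \<or> x = 2 \<or> x = 3 \<or> x = 4 \<or> x = 5"
proof (induct x)
  case (of_int z)
  then have "0 \<le> z" "z < 5" by simp_all
  then have "z = 0 \<or> z = 1 \<or> z = 2 \<or> z = 3 \<or> z = 4" by arith
  then show ?case by auto
qed

lemma UNIV_5: "UNIV = {1, 2, 3, 4, 5 :: 5}" using exhaust_5 by auto

lemma forall_5: "(\<forall>i::5. P i) \<longleftrightarrow> P 1 \<and> P 2 \<and> P 3 \<and> P 4 \<and> P 5" by (metis exhaust_5)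

lemma vector_5:
  "(vector [a, b, c, d, e] :: real^5)$1 = a" "(vector [a, b, c, d, e] :: real^5)$2 = b" "(vector [a, b, c, d, e] :: real^5)$3 = c"
  "(vector [a, b, c, d, e] :: real^5)$4 = d" "(vector [a, b, c, d, e] :: real^5)$5 = e"
  unfolding vector_def by simp_all

lemma coords5_eq: "coords5 w = vector [fst w$1, fst w$2, fst (snd w), snd (snd w)$1, snd (snd w)$2]"
  by (cases w) (simp add: coords5_def)

lemma coords5_inv: "inv_into UNIV coords5 v = (vec2 (v$1) (v$2), v$3, vec2 (v$4) (v$5))"
proof (rule inv_into_f_eq)
  show "inj coords5"
  proof (rule injI)
    fix u v assume "coords5 u = coords5 v"
    then have "coords5 u $ i = coords5 v $ i" for i by simp
    from this[of 1] this[of 2] this[of 3] this[of 4] this[of 5] show "u = v"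
      by (cases u; cases v) (simp add: coords5_eq vector_5 vec2_eq)
  qed
  show "coords5 (vec2 (v$1) (v$2), v$3, vec2 (v$4) (v$5)) = v"
    by (simp add: coords5_eq vec_eq_iff forall_5 vector_5)
qed simp

text \<open>The scaling on \<open>p\<close> is dual to that on \<open>q\<close>, so the diagonal
  entries \<open>1/s, s, 1, s, 1/s\<close> cancel in pairs.\<close>

lemma det_diag5: "s \<noteq> 0 \<Longrightarrow> det (matrix (coords5 \<circ> diag5 s \<circ> inv_into UNIV coords5)) = 1"
proof -
  assume s: "s \<noteq> 0"
  let ?A = "matrix (coords5 \<circ> diag5 s \<circ> inv_into UNIV coords5)"
  have A: "?A$i$j = (if i = j then (if i = 1 \<or> i = 5 then 1 / s else if i = 3 then 1 else s) else 0)" for i j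
  proof -
    have "\<forall>i j. ?A$i$j = (if i = j then (if i = 1 \<or> i = 5 then 1 / s else if i = 3 then 1 else s) else 0)"
      unfolding forall_5 by (simp add: matrix_def coords5_inv diag5_def coords5_eq vector_5 axis_def)
    then show ?thesis by blast
  qed
  have "det ?A = (\<Prod>i\<in>UNIV. ?A$i$i)" by (rule det_diagonal) (simp add: A)
  also have "\<dots> = 1" unfolding A UNIV_5 using s by simp
  finally show ?thesis .
qed

text \<open>\<open>swap5\<close> exchanges two coordinates in \<open>p\<close> and two in
  \<open>q\<close>, an even permutation.\<close>

lemma det_swap5: "det (matrix (coords5 \<circ> swap5 \<circ> inv_into UNIV coords5)) = 1"
proof -
  let ?p = "Transposition.transpose (1::5) 2 \<circ> Transposition.transpose 4 5"
  have p: "?p permutes UNIV" by (intro permutes_compose permutes_swap_id) auto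
  have "matrix (coords5 \<circ> swap5 \<circ> inv_into UNIV coords5) = (\<chi> i. (mat 1 :: real^5^5) $ ?p i)"
    by (simp add: vec_eq_iff forall_5 matrix_def coords5_inv swap5_def coords5_eq vector_5 axis_def mat_def Transposition.transpose_def)
  moreover have "sign ?p = 1" by (subst sign_compose) (auto simp: permutation_swap_id sign_swap_id)
  ultimately show ?thesis using det_permute_rows[OF p, of "mat 1 :: real^5^5"] by simp
qed

lemma O11_SO5: "O11_diag ` O11 \<subseteq> SO5 k"
proof
  fix F assume "F \<in> O11_diag ` O11"
  then consider (1) s where "s \<noteq> 0" "F = diag5 s" | (2) s where "s \<noteq> 0" "F = diag5 s \<circ> swap5" unfolding O11_diag_image by blast
  then show "F \<in> SO5 k"
  proof cases
    case 1 then show ?thesis by (simp add: SO5_def linear_isometries5 det_diag5)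
  next
    case 2
    let ?f = "coords5 \<circ> swap5 \<circ> inv_into UNIV coords5" and ?g = "coords5 \<circ> diag5 s \<circ> inv_into UNIV coords5"
    have lin: "linear ?f" "linear ?g"
      by (rule linearI; simp add: coords5_inv swap5_def diag5_def coords5_eq vec_eq_iff forall_5 vector_5 algebra_simps add_divide_distrib)+
    have "inv_into UNIV coords5 (coords5 w) = w" for w by (cases w) (simp add: coords5_inv coords5_eq vector_5 vec2_eq)
    then have "coords5 \<circ> F \<circ> inv_into UNIV coords5 = ?g \<circ> ?f" by (auto simp: fun_eq_iff 2)
    then have "det (matrix (coords5 \<circ> F \<circ> inv_into UNIV coords5)) = 1"
      using matrix_compose[OF lin] det_diag5[OF 2(1)] det_swap5 by (simp add: det_mul)
    then show ?thesis using linear_isometries_compose[OF linear_isometries5(1,2)] 2 by (simp add: SO5_def)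
  qed
qed

theorem corollary4p19:
  fixes \<kappa> :: real
  assumes "\<kappa> \<in> {1, -1}"
  shows
    "extrinsic_symmetric (form5 \<kappa>) M5 \<and>
     (\<forall>(G :: 'a::euclidean_space monoid) \<psi> H (N :: 'n::euclidean_space set) \<pi> g.
        N_space \<kappa> G \<psi> H N \<pi> g \<longrightarrow>
          (\<exists>f. isometry N g M5 (\<lambda>_. form5 \<kappa>) f) \<and>
          topological_group_isomorphic
            (extrinsic_transvection_group (form5 \<kappa>) M5) (transvection_group N g)) \<and>
     (let T = extrinsic_transvection_group (form5 \<kappa>) M5;
          E = extrinsic_isometry_group (form5 \<kappa>) M5;
          K = O11_diag ` O11;
          Z = generate E {Z2_gen}
      in subgroup (carrier T) (affine_isometry_group (form5 \<kappa>)) \<and>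
         carrier T = {transvection5 \<kappa> X Z y | X Z y. True} \<and>
         K \<subseteq> SO5 \<kappa> \<and> Z2_gen \<in> linear_isometries (form5 \<kappa>) \<and> card Z = 2 \<and>
         internal_semidirect E (carrier T) (K <#>\<^bsub>E\<^esub> Z) \<and>
         internal_semidirect (E\<lparr>carrier := K <#>\<^bsub>E\<^esub> Z\<rparr>) K Z)"
proof (intro conjI allI impI)
  have k: "\<kappa> * \<kappa> = 1" using assms by auto
  show "extrinsic_symmetric (form5 \<kappa>) M5" by (rule extrinsic_symmetric_M5[OF k])
  note T = extrinsic_transvections(1)[OF k]
  {
    fix G :: "'a monoid" and \<psi> H and N :: "'n set" and \<pi> g
    assume N: "N_space \<kappa> G \<psi> H N \<pi> g"
    obtain f where f: "isometry UNIV (model_metric \<kappa>) N g f"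
      using N_realization.quot_isometry[OF N_realization.intro[OF assms N]] by blast
    show "\<exists>f. isometry N g M5 (\<lambda>_. form5 \<kappa>) f"
      using isometry_compose[OF isometry_inverse[OF f] model_embed_isometry] by blast
    \<comment> \<open>Both transvection groups are parametrised homeomorphically by the model group,
      through \<open>trans5\<close> and through conjugated translations; the isomorphism passes from
      one parametrisation to the other.\<close>
    obtain g1 where g1: "homeomorphism UNIV (carrier (extrinsic_transvection_group (form5 \<kappa>) M5)) (trans5 \<kappa>) g1"
      using trans5_homeomorphism[of \<kappa>] unfolding T ..
    define h where "h = (\<lambda>a. conjugate f UNIV N (model_translation \<kappa> a))"
    obtain g2 where g2: "homeomorphism UNIV (carrier (transvection_group N g)) h g2"
      using transvection_group_homeomorphism[OF k f] transvection_group_model(1)[OF k f] unfolding h_def by metis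
    have m: "trans5 \<kappa> (model_mult \<kappa> a b) = trans5 \<kappa> a \<otimes>\<^bsub>extrinsic_transvection_group (form5 \<kappa>) M5\<^esub> trans5 \<kappa> b" for a b
      using BijGroup_UNIV_mult[OF bij_trans5 bij_trans5] by (simp add: extrinsic_transvection_group_def fun_eq_iff trans5_comp)
    show "topological_group_isomorphic (extrinsic_transvection_group (form5 \<kappa>) M5) (transvection_group N g)"
      by (rule topological_group_isomorphic_via[OF m g1 _ g2]) (simp add: h_def transvection_group_model(2)[OF k f])
  }
  interpret X: extrinsic_group \<kappa> "extrinsic_isometry_group (form5 \<kappa>) M5" "O11_diag ` O11" "generate (extrinsic_isometry_group (form5 \<kappa>) M5) {Z2_gen}" "range (trans5 \<kappa>)"
    by (rule extrinsic_group.intro[OF k])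
  have "subgroup (range (trans5 \<kappa>)) (BijGroup UNIV\<lparr>carrier := carrier (affine_isometry_group (form5 \<kappa>))\<rparr>)"
    by (rule group.subgroup_incl[OF group_BijGroup extrinsic_transvections(2)[OF k] subgroup_affine]) (use trans5_affine[OF k] in blast)
  then have aff: "subgroup (range (trans5 \<kappa>)) (affine_isometry_group (form5 \<kappa>))" by (simp add: affine_isometry_group_def)
  have "range (trans5 \<kappa>) = {transvection5 \<kappa> X Z y | X Z y. True}"
  proof (intro equalityI subsetI)
    fix F assume "F \<in> {transvection5 \<kappa> X Z y | X Z y. True}"
    then obtain X Z y where "F = transvection5 \<kappa> X Z y" by blast
    then have "F = trans5 \<kappa> (Z, y, X)" by (simp add: trans5_def)
    then show "F \<in> range (trans5 \<kappa>)" by blast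
  qed (auto simp: trans5_def)
  then show "let T = extrinsic_transvection_group (form5 \<kappa>) M5;
          E = extrinsic_isometry_group (form5 \<kappa>) M5;
          K = O11_diag ` O11;
          Z = generate E {Z2_gen}
      in subgroup (carrier T) (affine_isometry_group (form5 \<kappa>)) \<and>
         carrier T = {transvection5 \<kappa> X Z y | X Z y. True} \<and>
         K \<subseteq> SO5 \<kappa> \<and> Z2_gen \<in> linear_isometries (form5 \<kappa>) \<and> card Z = 2 \<and>
         internal_semidirect E (carrier T) (K <#>\<^bsub>E\<^esub> Z) \<and>
         internal_semidirect (E\<lparr>carrier := K <#>\<^bsub>E\<^esub> Z\<rparr>) K Z"
    unfolding Let_def T using aff O11_SO5 linear_isometries5(3) X.card_Z X.semidirect X.semidirect_KZ by blast
qed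

end
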